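(* Let $n$ be a positive integer, $B$ an $n$-element set, and $H\subset\mathrm{Perm}(B)$ a permutation group. Assume that $(n,H)$ enjoys one of the following properties: (i) $n=2^m+1\ge 9$ and $H$ contains a subgroup isomorphic to $\mathrm{PSL}_2(\mathbf{F}_{2^m})$; (ii) for some positive integer $k$ we have $n=2^{2(2k+1)}+1$ and $H$ contains a subgroup isomorphic to the Suzuki group $\mathbf{Sz}(2^{2k+1})$. Then the $H$-module $Q_B$ is very simple.
   Context: $\mathrm{Perm}(B)$ is the group of permutations of $B$. $\mathbf{F}_2^B$ is the space of maps $h:B\to\mathbf{F}_2$, with $s\in\mathrm{Perm}(B)$ acting by $(sh)(b)=h(s^{-1}(b))$; $(\mathbf{F}_2^B)^0=\{h\in\mathbf{F}_2^B\mid\sum_{b\in B}h(b)=0\}$. For $\#(B)$ odd (as is the case here) $Q_B:=(\mathbf{F}_2^B)^0$, an $\mathbf{F}_2$-vector space of dimension $n-1$ with the induced action of any subgroup of $\mathrm{Perm}(B)$. $\mathbf{Sz}(q)$, for $q=2^{2k+1}$ with $k\geq 1$, is the Suzuki simple group ${}^2B_2(q)$, of order $(q^2+1)q^2(q-1)$. Definition (very simple). Let $V$ be a vector space over a field $\mathbf{F}$, $G$ a group and $\rho:G\to \mathrm{Aut}_{\mathbf{F}}(V)$ a linear representation. The $G$-module $V$ is very simple if: whenever $R\subset\mathrm{End}_{\mathbf{F}}(V)$ is an $\mathbf{F}$-subalgebra containing the identity operator $\mathrm{Id}$ such that $\rho(\sigma)R\rho(\sigma)^{-1}\subset R$ for all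 $\sigma\in G$, then either $R=\mathbf{F}\cdot\mathrm{Id}$ or $R=\mathrm{End}_{\mathbf{F}}(V)$. *)

theory Defs
  imports
    "HOL-Library.Z2"
    "HOL-Algebra.Algebra"
    "HOL-Algebra.Algebraic_Closure_Type"
    "Jordan_Normal_Form.Determinant"
begin

section \<open>Linear representations and very simple modules\<close>

text \<open>
  Operators on \<open>V\<close> are represented by functions that are extensional on the carrier of
  \<open>V\<close>, so that equality of operators is equality of functions.
\<close>

definition End_algebra :: "('a, 'c) ring_scheme \<Rightarrow> ('a, 'v, 'd) module_scheme \<Rightarrow> ('a, 'v \<Rightarrow> 'v) module"
  where "End_algebra F V =
    \<lparr>carrier = {f \<in> carrier V \<rightarrow>\<^sub>E carrier V.
        (\<forall>x\<in>carrier V. \<forall>y\<in>carrier V. f (x \<oplus>\<^bsub>V\<^esub> y) = f x \<oplus>\<^bsub>V\<^esub> f y) \<and>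
        (\<forall>a\<in>carrier F. \<forall>x\<in>carrier V. f (a \<odot>\<^bsub>V\<^esub> x) = a \<odot>\<^bsub>V\<^esub> f x)},
     monoid.mult = compose (carrier V),
     one = (\<lambda>x\<in>carrier V. x),
     ring.zero = (\<lambda>x\<in>carrier V. \<zero>\<^bsub>V\<^esub>),
     add = (\<lambda>f g. \<lambda>x\<in>carrier V. f x \<oplus>\<^bsub>V\<^esub> g x),
     module.smult = (\<lambda>a f. \<lambda>x\<in>carrier V. a \<odot>\<^bsub>V\<^esub> f x)\<rparr>"

abbreviation Aut_group :: "('a, 'c) ring_scheme \<Rightarrow> ('a, 'v, 'd) module_scheme \<Rightarrow> ('v \<Rightarrow> 'v) monoid"
  where "Aut_group F V \<equiv> units_of (End_algebra F V)"

text \<open>Since a \<open>subring\<close> contains \<open>\<one>\<close>, these are the subalgebras containing the identity operator.\<close>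

definition unital_subalgebra ::
  "('v \<Rightarrow> 'v) set \<Rightarrow> ('a, 'c) ring_scheme \<Rightarrow> ('a, 'v, 'd) module_scheme \<Rightarrow> bool"
  where "unital_subalgebra A F V \<longleftrightarrow>
    subring A (End_algebra F V) \<and>
    (\<forall>a\<in>carrier F. \<forall>u\<in>A. a \<odot>\<^bsub>End_algebra F V\<^esub> u \<in> A)"

locale linear_representation =
  field F + module F V + group G
  for F :: "('a, 'c) ring_scheme" and V :: "('a, 'v, 'd) module_scheme"
    and G :: "('g, 'e) monoid_scheme" and \<rho> :: "'g \<Rightarrow> 'v \<Rightarrow> 'v" +
  assumes rep_hom: "\<rho> \<in> hom G (Aut_group F V)"

locale very_simple_module = linear_representation F V G \<rho>
  for F :: "('a, 'c) ring_scheme" and V :: "('a, 'v, 'd) module_scheme"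
    and G :: "('g, 'e) monoid_scheme" and \<rho> :: "'g \<Rightarrow> 'v \<Rightarrow> 'v" +
  assumes very_simple:
    "\<lbrakk>unital_subalgebra A F V;
      \<And>\<sigma> u. \<lbrakk>\<sigma> \<in> carrier G; u \<in> A\<rbrakk> \<Longrightarrow>
        \<rho> \<sigma> \<otimes>\<^bsub>End_algebra F V\<^esub> u \<otimes>\<^bsub>End_algebra F V\<^esub> inv\<^bsub>End_algebra F V\<^esub> (\<rho> \<sigma>) \<in> A\<rbrakk>
     \<Longrightarrow> A = {a \<odot>\<^bsub>End_algebra F V\<^esub> \<one>\<^bsub>End_algebra F V\<^esub> | a. a \<in> carrier F} \<or>
         A = carrier (End_algebra F V)"


section \<open>The permutation module\<close>

abbreviation F2 :: "bit ring"
  where "F2 \<equiv> ring_of_type_algebra"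

text \<open>
  The module of functions of sum zero, which is the heart of the permutation module when
  \<open>card B\<close> is odd. The fields \<open>mult\<close> and \<open>one\<close> of the record play no role in a module.
\<close>

definition Q_module :: "'b set \<Rightarrow> (bit, 'b \<Rightarrow> bit) module"
  where "Q_module B =
    \<lparr>carrier = {h \<in> B \<rightarrow>\<^sub>E UNIV. (\<Sum>b\<in>B. h b) = 0},
     monoid.mult = undefined,
     one = undefined,
     ring.zero = (\<lambda>b\<in>B. 0),
     add = (\<lambda>g h. \<lambda>b\<in>B. g b + h b),
     module.smult = (\<lambda>a h. \<lambda>b\<in>B. a * h b)\<rparr>"

definition Q_action :: "'b set \<Rightarrow> ('b \<Rightarrow> 'b) \<Rightarrow> ('b \<Rightarrow> bit) \<Rightarrow> ('b \<Rightarrow> bit)"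
  where "Q_action B s =
    (\<lambda>h\<in>carrier (Q_module B). \<lambda>b\<in>B. h ((inv\<^bsub>BijGroup B\<^esub> s) b))"


section \<open>The groups\<close>

definition contains_copy :: "('g, 'c) monoid_scheme \<Rightarrow> ('h, 'd) monoid_scheme \<Rightarrow> bool"
  where "contains_copy G K \<longleftrightarrow> (\<exists>S. subgroup S G \<and> G\<lparr>carrier := S\<rparr> \<cong> K)"

text \<open>
  For \<open>q\<close> a power of 2 with positive exponent, the field with \<open>q\<close> elements inside an
  algebraic closure of the field with 2 elements.
\<close>

definition GF :: "nat \<Rightarrow> bit alg_closure set"
  where "GF q = {x. x ^ q = x}"

definition GL :: "nat \<Rightarrow> 'a :: field mat monoid"
  where "GL n = units_of (ring_mat TYPE('a) n ())"

definition SL2 :: "'a :: field set \<Rightarrow> 'a mat monoid"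
  where "SL2 K = (GL 2)\<lparr>carrier := {A \<in> carrier_mat 2 2. elements_mat A \<subseteq> K \<and> det A = 1}\<rparr>"

definition group_center :: "('g, 'c) monoid_scheme \<Rightarrow> 'g set"
  where "group_center G = {z \<in> carrier G. \<forall>x\<in>carrier G. z \<otimes>\<^bsub>G\<^esub> x = x \<otimes>\<^bsub>G\<^esub> z}"

definition PSL2 :: "'a :: field set \<Rightarrow> 'a mat set monoid"
  where "PSL2 K = SL2 K Mod group_center (SL2 K)"

text \<open>
  Suzuki's group in its standard four-dimensional matrix realization (Huppert and Blackburn,
  Finite Groups III, Chapter XI, Section 3). For \<open>q = 2 ^ (2 * k + 1)\<close>, the map
  \<open>\<theta> x = x ^ 2 ^ (k + 1)\<close> is the automorphism of the field with \<open>q\<close> elements whose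
  square is the Frobenius map \<open>x \<mapsto> x ^ 2\<close>. The group is generated by
  the lower unitriangular matrices \<open>Sz_S k a b\<close> (a Sylow 2-subgroup of order \<open>q ^ 2\<close>),
  the diagonal matrices \<open>Sz_M k l\<close> (a torus of order \<open>q - 1\<close>), and the involution \<open>Sz_T\<close>.
\<close>

definition Sz_S :: "nat \<Rightarrow> 'a :: field \<Rightarrow> 'a \<Rightarrow> 'a mat"
  where "Sz_S k a b = (let \<theta> = (\<lambda>x. x ^ 2 ^ (k + 1)) in
    mat_of_rows_list 4
      [[1, 0, 0, 0],
       [a, 1, 0, 0],
       [b, \<theta> a, 1, 0],
       [a ^ 2 * \<theta> a + a * b + \<theta> b, a * \<theta> a + b, a, 1]])"

definition Sz_M :: "nat \<Rightarrow> 'a :: field \<Rightarrow> 'a mat"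
  where "Sz_M k l =
    mat_of_rows_list 4
      [[l ^ (1 + 2 ^ k), 0, 0, 0],
       [0, l ^ 2 ^ k, 0, 0],
       [0, 0, inverse l ^ 2 ^ k, 0],
       [0, 0, 0, inverse l ^ (1 + 2 ^ k)]]"

definition Sz_T :: "'a :: field mat"
  where "Sz_T =
    mat_of_rows_list 4
      [[0, 0, 0, 1],
       [0, 0, 1, 0],
       [0, 1, 0, 0],
       [1, 0, 0, 0]]"

text \<open>\<open>Suzuki k\<close> is the group \<open>Sz(q)\<close> for \<open>q = 2 ^ (2 * k + 1)\<close>.\<close>

definition Suzuki :: "nat \<Rightarrow> bit alg_closure mat monoid"
  where "Suzuki k = (let K = GF (2 ^ (2 * k + 1)) in
    subgroup_generated (GL 4)
      ({Sz_S k a b | a b. a \<in> K \<and> b \<in> K} \<union> {Sz_M k l | l. l \<in> K - {0}} \<union> {Sz_T}))"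

end

(*
Both groups have the form G = P T \<union> P w T P, where P is a 2-group, T normalizes P, no
nontrivial element of T commutes with a nontrivial element of P, and w inverts T. Comparing how a
proper subgroup M of index at most |P| + 1 and its conjugates meet the conjugates of an involution
with how they meet the elements of P T outside P shows that M is conjugate to P T. Hence a
nontrivial action on |P| + 1 points is the standard one: P fixes one point and is regular on the
others, so P fixes only one nonzero vector v0 of Q_B.

Let R be a subalgebra normalized by G and C its commutant. A nonzero P-stable subspace contains
v0, and if it is T-stable and larger than {0, v0} it contains the whole second layer S2 of the
P-socle, because S2 modulo v0 is dual to P modulo its Frattini subgroup, on which T acts
irreducibly. Clifford theory makes W = R v0 a simple R-module. If R and C both moved v0, each v in
S2 would be c_v v0 with c_v in C; then c_v v = v + v0, which is impossible for three elements of
S2 independent modulo v0. So one of R and C is scalar, and if C is, then Q_B is a simple R-module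
and R is everything by Jacobson density.
*)
theory Submission imports Defs "HOL-Library.Function_Algebras"
begin

text \<open>The hypothesis supplies only an abstract copy of the group among the permutations of B,
  so neither transitivity nor the shape of a point stabilizer is known in advance; both have to come
  out of the bound |P| + 1 on the index. Over the field with two elements, parity does the work of
  dimension: a 2-group acting on a finite set has as many fixed points as the set has elements,
  modulo 2. This yields fixed vectors in P-stable subspaces and in their quotients by v0. It also
  yields a P-stable simple submodule, because the number of submodules isomorphic to a given simple
  one is odd. The relation c_v v = v + v0 arises because conjugation by P can change c_v on R v0
  only to c_v + 1, and c_v^2 + c_v is the same for both. Polarization turns it into c_u c_v + c_v
  c_u = 1, which is additive in u and so fails once a third independent element exists. This is
  where the factor 8 between P and its Frattini subgroup comes from, and hence one reason for fields
  with at least eight elements.\<close>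

section \<open>Parity of fixed points under 2-groups\<close>

lemma even_card_involution:
  assumes "finite \<Omega>" "\<And>x. x \<in> \<Omega> \<Longrightarrow> f x \<in> \<Omega>" "\<And>x. x \<in> \<Omega> \<Longrightarrow> f (f x) = x" "\<And>x. x \<in> \<Omega> \<Longrightarrow> f x \<noteq> x"
  shows "even (card \<Omega>)"
  using assms
proof (induction \<Omega> rule: finite_psubset_induct)
  case (psubset \<Omega>)
  show ?case
  proof (cases "\<Omega> = {}")
    case False
    then obtain x where x: "x \<in> \<Omega>" by blast
    define Y where "Y = \<Omega> - {x, f x}"
    have "Y \<subset> \<Omega>" using x by (auto simp: Y_def)
    moreover have "f y \<in> Y" if "y \<in> Y" for y
    proof -
      have "f y \<noteq> x" using that psubset.prems x by (force simp: Y_def)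
      moreover have "f y \<noteq> f x" using that psubset.prems(2) x unfolding Y_def by (metis DiffD1 DiffD2 insertI1)
      ultimately show ?thesis using that psubset.prems by (auto simp: Y_def)
    qed
    ultimately have "even (card Y)"
      using psubset.prems by (intro psubset.IH) (auto simp: Y_def)
    moreover have "card \<Omega> = card Y + card {x, f x}"
      unfolding Y_def using x psubset.prems psubset.hyps
      by (subst card_Diff_subset) (auto intro!: le_add_diff_inverse2[symmetric] card_mono)
    moreover have "card {x, f x} = 2" using psubset.prems(3)[OF x] by auto
    ultimately show ?thesis by simp
  qed simp
qed

text \<open>Orbit lengths divide \<open>2 ^ k\<close>, so every orbit with more than one point is
  even and only the fixed points affect the parity. The action is a plain function obeying the
  action laws on \<open>\<Omega>\<close> alone, so that vectors, cosets and submodules can all serve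
  as points.\<close>

lemma (in group) even_card_iff_fixed:
  fixes a :: "'a \<Rightarrow> 'x \<Rightarrow> 'x"
  assumes ord: "Coset.order G = 2 ^ k" and \<Omega>: "finite \<Omega>"
    and closed: "\<And>g x. g \<in> carrier G \<Longrightarrow> x \<in> \<Omega> \<Longrightarrow> a g x \<in> \<Omega>"
    and one: "\<And>x. x \<in> \<Omega> \<Longrightarrow> a \<one> x = x"
    and mult: "\<And>g h x. g \<in> carrier G \<Longrightarrow> h \<in> carrier G \<Longrightarrow> x \<in> \<Omega> \<Longrightarrow> a (g \<otimes> h) x = a g (a h x)"
  shows "even (card \<Omega>) \<longleftrightarrow> even (card {x \<in> \<Omega>. \<forall>g\<in>carrier G. a g x = x})"
proof -
  \<comment> \<open>\<open>Bij\<close> admits only functions that are extensional on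
    \<open>\<Omega>\<close>, hence the restriction.\<close>
  define \<phi> where "\<phi> = (\<lambda>g. restrict (a g) \<Omega>)"
  have bij: "\<phi> g \<in> Bij \<Omega>" if g: "g \<in> carrier G" for g
  proof -
    have "bij_betw (a g) \<Omega> \<Omega>"
      by (rule bij_betw_byWitness[where f' = "a (inv g)"])
         (use g closed in \<open>auto simp: mult[symmetric] one\<close>)
    then show ?thesis by (simp add: Bij_def \<phi>_def bij_betw_restrict_eq)
  qed
  interpret group_action G \<Omega> \<phi>
  proof (intro group_action.intro group_hom.intro group_hom_axioms.intro is_group group_BijGroup)
    show "\<phi> \<in> hom G (BijGroup \<Omega>)"
      using bij closed mult by (auto simp: BijGroup_def \<phi>_def compose_def fun_eq_iff hom_def)
  qed
  have fin: "finite (orbits G \<Omega> \<phi>)" using \<Omega> by (simp add: orbits_def)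
  have orb_sub: "Ob \<subseteq> \<Omega>" if "Ob \<in> orbits G \<Omega> \<phi>" for Ob
    using that closed by (auto simp: orbits_def orbit_def \<phi>_def)
  define F where "F = {x \<in> \<Omega>. \<forall>g\<in>carrier G. a g x = x}"
  define Os where "Os = {Ob \<in> orbits G \<Omega> \<phi>. card Ob \<noteq> 1}"
  have self: "x \<in> orbit G \<phi> x" if "x \<in> \<Omega>" for x
    using orbit_refl that by auto
  have F_iff: "x \<in> F \<longleftrightarrow> card (orbit G \<phi> x) = 1" if x: "x \<in> \<Omega>" for x
  proof
    assume "x \<in> F"
    then have "orbit G \<phi> x = {x}" using x by (force simp: orbit_def F_def \<phi>_def)
    then show "card (orbit G \<phi> x) = 1" by simp
  next
    assume "card (orbit G \<phi> x) = 1"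
    then have "orbit G \<phi> x = {x}" using self[OF x] by (metis card_1_singletonE singletonD)
    moreover have "a g x \<in> orbit G \<phi> x" if "g \<in> carrier G" for g
      using that x by (force simp: orbit_def \<phi>_def)
    ultimately show "x \<in> F" using x by (auto simp: F_def)
  qed
  have part: "orbit G \<phi> x = Ob" if "x \<in> Ob" "Ob \<in> orbits G \<Omega> \<phi>" for x Ob
  proof -
    obtain y where y: "y \<in> \<Omega>" "Ob = orbit G \<phi> y" using \<open>Ob \<in> _\<close> by (auto simp: orbits_def)
    have x: "x \<in> \<Omega>" using that orb_sub by blast
    have "orbit G \<phi> x \<in> orbits G \<Omega> \<phi>" using x by (auto simp: orbits_def)
    moreover have "\<exists>!b. b \<in> orbits G \<Omega> \<phi> \<and> x \<in> b"
      using orbit_partition x unfolding partition_def by blast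
    ultimately show ?thesis using self[OF x] that by blast
  qed
  have "\<Omega> = F \<union> \<Union>Os"
    using F_iff self orb_sub unfolding Os_def F_def by (fastforce simp: orbits_def)
  moreover have "F \<inter> \<Union>Os = {}"
  proof -
    have False if "x \<in> F" "x \<in> Ob" "Ob \<in> Os" for x Ob
      using F_iff[of x] part[of x Ob] that by (auto simp: Os_def F_def)
    then show ?thesis by blast
  qed
  ultimately have "card \<Omega> = card F + card (\<Union>Os)"
    using \<Omega> by (metis card_Un_disjoint finite_Un)
  moreover have "card (\<Union>Os) = (\<Sum>Ob\<in>Os. card Ob)"
  proof (rule card_Union_disjoint)
    show "pairwise disjnt Os"
      using part unfolding pairwise_def disjnt_def Os_def by (metis (lifting) disjoint_iff mem_Collect_eq)
    show "\<And>A. A \<in> Os \<Longrightarrow> finite A"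
      using finite_subset[OF orb_sub \<Omega>] by (simp add: Os_def)
  qed
  moreover have "even (\<Sum>Ob\<in>Os. card Ob)"
  proof (rule dvd_sum)
    fix Ob assume Ob: "Ob \<in> Os"
    then obtain y where y: "y \<in> \<Omega>" "Ob = orbit G \<phi> y" by (auto simp: orbits_def Os_def)
    have "card Ob dvd 2 ^ k"
      using orbit_stabilizer_theorem[OF y(1)] y(2) ord by (metis dvd_triv_left)
    then obtain j where "card Ob = 2 ^ j" by (auto simp: divides_primepow_nat)
    moreover from this have "j \<noteq> 0" using Ob by (auto simp: Os_def intro: ccontr)
    ultimately show "2 dvd card Ob" by simp
  qed
  ultimately show ?thesis unfolding F_def by simp
qed

lemma (in group) even_card_iff_fixed_subgroup:
  fixes a :: "'a \<Rightarrow> 'x \<Rightarrow> 'x"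
  assumes "subgroup P G" "card P = 2 ^ k" and \<Omega>: "finite \<Omega>"
    and closed: "\<And>g x. g \<in> P \<Longrightarrow> x \<in> \<Omega> \<Longrightarrow> a g x \<in> \<Omega>"
    and one: "\<And>x. x \<in> \<Omega> \<Longrightarrow> a \<one> x = x"
    and mult: "\<And>g h x. g \<in> P \<Longrightarrow> h \<in> P \<Longrightarrow> x \<in> \<Omega> \<Longrightarrow> a (g \<otimes> h) x = a g (a h x)"
  shows "even (card \<Omega>) \<longleftrightarrow> even (card {x \<in> \<Omega>. \<forall>g\<in>P. a g x = x})"
  using group.even_card_iff_fixed[OF subgroup_imp_group[OF assms(1)], of k \<Omega> a] assms
  by (simp add: Coset.order_def)

section \<open>Modules over the field with two elements\<close>

text \<open>With scalars 0 and 1 only, a finite set closed under addition is already a vector space.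
  The identity x + x = 0 is imposed on the whole type, so that cancellation needs no membership
  conditions.\<close>

locale char2_space =
  fixes V :: "'v :: ab_group_add set"
  assumes fin: "finite V" and zero_in [simp]: "0 \<in> V"
    and add_in [simp]: "\<And>x y. x \<in> V \<Longrightarrow> y \<in> V \<Longrightarrow> x + y \<in> V"
    and char2 [simp]: "\<And>x :: 'v. x + x = 0"
begin

lemma cancel2 [simp]: "x + (x + y) = (y :: 'v)"
  by (metis add.assoc add_0 char2)

lemma add_eq_0_iff2: "x + y = 0 \<longleftrightarrow> x = (y :: 'v)"
  by (metis add_0_right cancel2)

definition subsp :: "'v set \<Rightarrow> bool"
  where "subsp U \<longleftrightarrow> U \<subseteq> V \<and> 0 \<in> U \<and> (\<forall>x\<in>U. \<forall>y\<in>U. x + y \<in> U)"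

text \<open>Nothing is asked of \<open>f\<close> outside \<open>V\<close>; operators are therefore
  compared pointwise on \<open>V\<close> instead of by equality of functions.\<close>

definition endo :: "('v \<Rightarrow> 'v) \<Rightarrow> bool"
  where "endo f \<longleftrightarrow> (\<forall>x\<in>V. f x \<in> V) \<and> (\<forall>x\<in>V. \<forall>y\<in>V. f (x + y) = f x + f y)"

lemma endo_0: "endo f \<Longrightarrow> f 0 = 0"
  by (metis endo_def add_0_right cancel2 zero_in)

lemma endo_in: "endo f \<Longrightarrow> x \<in> V \<Longrightarrow> f x \<in> V"
  by (simp add: endo_def)

lemma endo_add: "endo f \<Longrightarrow> x \<in> V \<Longrightarrow> y \<in> V \<Longrightarrow> f (x + y) = f x + f y"
  by (simp add: endo_def)

lemma subsp_in: "subsp U \<Longrightarrow> x \<in> U \<Longrightarrow> x \<in> V"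
  by (auto simp: subsp_def)

lemma subsp_0: "subsp U \<Longrightarrow> 0 \<in> U"
  by (auto simp: subsp_def)

lemma subsp_add: "subsp U \<Longrightarrow> x \<in> U \<Longrightarrow> y \<in> U \<Longrightarrow> x + y \<in> U"
  by (auto simp: subsp_def)

lemma subsp_fin: "subsp U \<Longrightarrow> finite U"
  using fin finite_subset by (auto simp: subsp_def)

lemma subsp_sum: "subsp U \<Longrightarrow> (\<And>i. i \<in> I \<Longrightarrow> f i \<in> U) \<Longrightarrow> sum f I \<in> U"
  by (induction I rule: infinite_finite_induct) (auto simp: subsp_0 subsp_add)

lemma endo_sum: "endo h \<Longrightarrow> (\<And>i. i \<in> I \<Longrightarrow> f i \<in> V) \<Longrightarrow> h (sum f I) = (\<Sum>i\<in>I. h (f i))"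
proof (induction I rule: infinite_finite_induct)
  case (insert x F)
  moreover have "sum f F \<in> V" using insert.prems by (intro subsp_sum) (auto simp: subsp_def)
  ultimately show ?case by (simp add: endo_add)
qed (auto simp: endo_0)

lemma subsp_V: "subsp V" by (simp add: subsp_def)

lemma subsp_zero: "subsp {0}" by (simp add: subsp_def)

definition setsum :: "'v set \<Rightarrow> 'v set \<Rightarrow> 'v set"
  where "setsum A B = {x + y |x y. x \<in> A \<and> y \<in> B}"

lemma subsp_setsum: "subsp A \<Longrightarrow> subsp B \<Longrightarrow> subsp (setsum A B)"
proof -
  assume AB: "subsp A" "subsp B"
  show ?thesis
    unfolding subsp_def
  proof (intro conjI ballI subsetI)
    fix u v assume "u \<in> setsum A B" "v \<in> setsum A B"
    then obtain a b a' b' where *: "u = a + b" "v = a' + b'" "a \<in> A" "a' \<in> A" "b \<in> B" "b' \<in> B"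
      unfolding setsum_def by blast
    have "u + v = (a + a') + (b + b')" using * by (simp add: algebra_simps)
    moreover have "a + a' \<in> A" "b + b' \<in> B" using * AB subsp_add by blast+
    ultimately show "u + v \<in> setsum A B" unfolding setsum_def by blast
  next
    fix u assume "u \<in> setsum A B"
    then obtain a b where "u = a + b" "a \<in> A" "b \<in> B" unfolding setsum_def by blast
    then show "u \<in> V" using AB subsp_in by simp
  next
    have "0 + 0 \<in> setsum A B" using AB subsp_0 unfolding setsum_def by blast
    then show "0 \<in> setsum A B" by simp
  qed
qed

lemma setsum_upper:
  assumes "subsp A" "subsp B"
  shows "A \<subseteq> setsum A B" "B \<subseteq> setsum A B"
proof -
  have "x + 0 \<in> setsum A B" if "x \<in> A" for x
    using assms that subsp_0 unfolding setsum_def by blast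
  then show "A \<subseteq> setsum A B" by auto
  have "0 + x \<in> setsum A B" if "x \<in> B" for x
    using assms that subsp_0 unfolding setsum_def by blast
  then show "B \<subseteq> setsum A B" by auto
qed

lemma setsum_least: "subsp C \<Longrightarrow> A \<subseteq> C \<Longrightarrow> B \<subseteq> C \<Longrightarrow> setsum A B \<subseteq> C"
  unfolding setsum_def using subsp_add by blast

text \<open>Take a maximal subspace of \<open>U\<close> with the property: a vector of
  \<open>U\<close> outside it could still be adjoined. This is induction along a basis without
  choosing one.\<close>

lemma subsp_extend_induct:
  assumes U: "subsp U" and base: "P {0}"
    and step: "\<And>W y. subsp W \<Longrightarrow> y \<in> V \<Longrightarrow> y \<notin> W \<Longrightarrow> P W \<Longrightarrow> P (setsum W {0, y})"
  shows "P U"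
proof -
  define \<W> where "\<W> = {W. subsp W \<and> W \<subseteq> U \<and> P W}"
  have "finite \<W>" using subsp_fin[OF U] by (auto simp: \<W>_def)
  moreover have "{0} \<in> \<W>" using base U by (auto simp: \<W>_def subsp_zero subsp_def)
  ultimately obtain W where W: "W \<in> \<W>" "\<And>W'. W' \<in> \<W> \<Longrightarrow> W \<subseteq> W' \<Longrightarrow> W = W'"
    by (metis finite_has_maximal empty_iff)
  show ?thesis
  proof (cases "W = U")
    case False
    then obtain y where y: "y \<in> U" "y \<notin> W" using W by (auto simp: \<W>_def)
    have s: "subsp {0, y}" using y U by (auto simp: subsp_def)
    have WU: "subsp W" "W \<subseteq> U" "P W" using W by (auto simp: \<W>_def)
    have "setsum W {0, y} \<subseteq> U" using setsum_least[OF U WU(2), of "{0, y}"] y subsp_0[OF U] by simp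
    then have "setsum W {0, y} \<in> \<W>"
      using WU y s step[of W y] U by (simp add: \<W>_def subsp_setsum subsp_in)
    moreover have "W \<subseteq> setsum W {0, y}" "y \<in> setsum W {0, y}"
      using setsum_upper[OF WU(1) s] by blast+
    ultimately show ?thesis using W(2) y by blast
  qed (use W in \<open>auto simp: \<W>_def\<close>)
qed

lemma even_card_subsp:
  assumes "subsp U" "x \<in> U" "x \<noteq> 0"
  shows "even (card U)"
  using assms by (intro even_card_involution[where f = "\<lambda>u. x + u"]) (auto simp: subsp_fin subsp_add)

end

section \<open>Modules over a unital algebra of operators\<close>

locale char2_algebra = char2_space V for V :: "'v :: ab_group_add set" +
  fixes R :: "('v \<Rightarrow> 'v) set"
  assumes R_endo: "\<And>r. r \<in> R \<Longrightarrow> endo r"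
    and R_id: "(\<lambda>x. x) \<in> R"
    and R_add: "\<And>r s. r \<in> R \<Longrightarrow> s \<in> R \<Longrightarrow> (\<lambda>x. r x + s x) \<in> R"
    and R_comp: "\<And>r s. r \<in> R \<Longrightarrow> s \<in> R \<Longrightarrow> (\<lambda>x. r (s x)) \<in> R"
begin

definition rsub :: "'v set \<Rightarrow> bool"
  where "rsub U \<longleftrightarrow> subsp U \<and> (\<forall>r\<in>R. \<forall>x\<in>U. r x \<in> U)"

definition rsimple :: "'v set \<Rightarrow> bool"
  where "rsimple S \<longleftrightarrow> rsub S \<and> S \<noteq> {0} \<and> (\<forall>U. rsub U \<longrightarrow> U \<subseteq> S \<longrightarrow> U = {0} \<or> U = S)"

definition rhom :: "'v set \<Rightarrow> ('v \<Rightarrow> 'v) \<Rightarrow> bool"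
  where "rhom S f \<longleftrightarrow> (\<forall>x\<in>S. f x \<in> V) \<and> (\<forall>x\<in>S. \<forall>y\<in>S. f (x + y) = f x + f y)
    \<and> (\<forall>r\<in>R. \<forall>x\<in>S. f (r x) = r (f x))"

definition riso :: "'v set \<Rightarrow> 'v set \<Rightarrow> bool"
  where "riso S S' \<longleftrightarrow> (\<exists>f. rhom S f \<and> bij_betw f S S')"

definition commutant :: "('v \<Rightarrow> 'v) set"
  where "commutant = {c. endo c \<and> (\<forall>r\<in>R. \<forall>x\<in>V. c (r x) = r (c x))}"

definition cyc :: "'v \<Rightarrow> 'v set"
  where "cyc x = (\<lambda>r. r x) ` R"

lemma R_0: "r \<in> R \<Longrightarrow> r 0 = 0"
  using R_endo endo_0 by blast

lemma zero_R: "(\<lambda>x. 0) \<in> R"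
  using R_add[OF R_id R_id] by simp

lemma rsub_subsp: "rsub U \<Longrightarrow> subsp U"
  by (simp add: rsub_def)

lemma rsub_act: "rsub U \<Longrightarrow> r \<in> R \<Longrightarrow> x \<in> U \<Longrightarrow> r x \<in> U"
  by (simp add: rsub_def)

lemma rsub_0 [simp]: "rsub {0}"
  by (simp add: rsub_def subsp_zero R_0)

lemma rsub_V: "rsub V"
  using R_endo by (auto simp: rsub_def subsp_V endo_in)

lemma rsub_cyc: "x \<in> V \<Longrightarrow> rsub (cyc x)"
  unfolding rsub_def subsp_def cyc_def
  using zero_R R_comp R_add R_endo by (auto simp: endo_in image_iff)

lemma cyc_self: "x \<in> cyc x"
  unfolding cyc_def using R_id by (force simp: image_iff)

lemma cyc_least: "rsub U \<Longrightarrow> x \<in> U \<Longrightarrow> cyc x \<subseteq> U"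
  by (auto simp: cyc_def rsub_act)

lemma rsub_setsum: "rsub A \<Longrightarrow> rsub B \<Longrightarrow> rsub (setsum A B)"
proof -
  assume AB: "rsub A" "rsub B"
  have "r (a + b) \<in> setsum A B" if "r \<in> R" "a \<in> A" "b \<in> B" for r a b
  proof -
    have "r (a + b) = r a + r b" using that AB R_endo by (meson endo_add rsub_subsp subsp_in)
    then show ?thesis using that AB unfolding setsum_def rsub_def by blast
  qed
  then have "\<forall>r\<in>R. \<forall>x\<in>setsum A B. r x \<in> setsum A B" unfolding setsum_def by blast
  then show ?thesis using AB by (simp add: rsub_def subsp_setsum)
qed

lemma rsub_Int: "rsub A \<Longrightarrow> rsub B \<Longrightarrow> rsub (A \<inter> B)"
  by (auto simp: rsub_def subsp_def)

lemma rsimple_cases: "rsimple S \<Longrightarrow> rsub U \<Longrightarrow> U \<subseteq> S \<Longrightarrow> U = {0} \<or> U = S"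
  by (simp add: rsimple_def)

lemma rsimple_ne: "rsimple S \<Longrightarrow> S \<noteq> {0}"
  by (simp add: rsimple_def)

lemma rsimple_rsub: "rsimple S \<Longrightarrow> rsub S" by (simp add: rsimple_def)

lemma ex_rsimple:
  assumes "rsub U" "U \<noteq> {0}"
  obtains S where "rsimple S" "S \<subseteq> U"
proof -
  define \<W> where "\<W> = {W. rsub W \<and> W \<subseteq> U \<and> W \<noteq> {0}}"
  have "finite \<W>" using subsp_fin[OF rsub_subsp[OF assms(1)]] by (auto simp: \<W>_def)
  moreover have "U \<in> \<W>" using assms by (auto simp: \<W>_def)
  ultimately obtain W where "W \<in> \<W>" "\<And>W'. W' \<in> \<W> \<Longrightarrow> W' \<subseteq> W \<Longrightarrow> W = W'"
    by (metis finite_has_minimal empty_iff)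
  then show ?thesis by (intro that[of W]) (auto simp: \<W>_def rsimple_def)
qed

lemma rsimple_Int: "rsimple S \<Longrightarrow> rsub U \<Longrightarrow> S \<subseteq> U \<or> S \<inter> U = {0}"
  using rsub_Int[of S U] unfolding rsimple_def by blast

lemma rhom_0: "rsub S \<Longrightarrow> rhom S f \<Longrightarrow> f 0 = 0"
  unfolding rhom_def by (metis add_0 add_cancel_right_left rsub_subsp subsp_0)

lemma rsub_ker: "rsub S \<Longrightarrow> rhom S f \<Longrightarrow> rsub {x \<in> S. f x = 0}"
proof -
  assume *: "rsub S" "rhom S f"
  then have "f 0 = 0" by (rule rhom_0)
  with * show ?thesis
    by (auto simp: rsub_def subsp_def rhom_def R_0)
qed

lemma rsub_image: "rsub S \<Longrightarrow> rhom S f \<Longrightarrow> rsub (f ` S)"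
proof -
  assume *: "rsub S" "rhom S f"
  have "f 0 = 0" using * by (rule rhom_0)
  moreover have "f x + f y \<in> f ` S" if "x \<in> S" "y \<in> S" for x y
    using * that unfolding rhom_def by (metis image_eqI rsub_subsp subsp_add)
  moreover have "r (f x) \<in> f ` S" if "x \<in> S" "r \<in> R" for x r
    using * that unfolding rhom_def by (metis image_eqI rsub_act)
  ultimately show ?thesis using * unfolding rsub_def subsp_def
    by (auto simp: image_iff rhom_def) 
qed

lemma rhom_simple_cases:
  assumes "rsimple S" "rhom S f"
  shows "(\<forall>x\<in>S. f x = 0) \<or> inj_on f S"
proof -
  have S: "rsub S" using assms(1) by (simp add: rsimple_def)
  have "rsub {x \<in> S. f x = 0}" using rsub_ker[OF S assms(2)] .
  then have "{x \<in> S. f x = 0} = {0} \<or> {x \<in> S. f x = 0} = S"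
    using assms(1) unfolding rsimple_def by blast
  then show ?thesis
  proof
    assume ker: "{x \<in> S. f x = 0} = {0}"
    have "inj_on f S"
    proof (rule inj_onI)
      fix x y assume xy: "x \<in> S" "y \<in> S" "f x = f y"
      then have "f (x + y) = 0" "x + y \<in> S"
        using assms(2) S by (auto simp: rhom_def rsub_def subsp_add)
      then have "x + y = 0" using ker by blast
      then show "x = y" by (simp add: add_eq_0_iff2)
    qed
    then show ?thesis by blast
  qed blast
qed

lemma riso_refl: "rsub S \<Longrightarrow> riso S S"
  unfolding riso_def rhom_def using subsp_in[OF rsub_subsp] by (intro exI[of _ id]) auto

lemma riso_sym:
  assumes S: "rsub S" and iso: "riso S S'"
  shows "riso S' S"
proof -
  obtain f where f: "rhom S f" "bij_betw f S S'" using iso by (auto simp: riso_def)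
  define g where "g = inv_into S f"
  have g: "bij_betw g S' S" unfolding g_def using f(2) by (rule bij_betw_inv_into)
  have fg: "f (g y) = y" if "y \<in> S'" for y
    using that f(2) unfolding g_def by (meson bij_betw_inv_into_right)
  have gf: "g (f x) = x" if "x \<in> S" for x
    using that f(2) unfolding g_def by (meson bij_betw_inv_into_left)
  have gS: "g y \<in> S" if "y \<in> S'" for y using g that by (auto simp: bij_betw_def)
  have "g (x + y) = g x + g y" if "x \<in> S'" "y \<in> S'" for x y
    using gf[of "g x + g y"] that gS fg f(1) S by (simp add: rhom_def subsp_add rsub_def)
  moreover have "g (r y) = r (g y)" if "r \<in> R" "y \<in> S'" for r y
    using gf[of "r (g y)"] that gS fg f(1) S by (simp add: rhom_def rsub_def)
  moreover have "g y \<in> V" if "y \<in> S'" for y using gS[OF that] S rsub_subsp subsp_in by blast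
  ultimately show ?thesis unfolding riso_def rhom_def using g by blast
qed

lemma riso_trans:
  assumes "riso S S'" "riso S' S''"
  shows "riso S S''"
proof -
  obtain f where f: "rhom S f" "bij_betw f S S'" using assms by (auto simp: riso_def)
  obtain g where g: "rhom S' g" "bij_betw g S' S''" using assms by (auto simp: riso_def)
  have "rhom S (g \<circ> f)"
    using f g bij_betwE[OF f(2)] by (simp add: rhom_def)
  then show ?thesis using bij_betw_trans[OF f(2) g(2)] unfolding riso_def by blast
qed

lemma rsimple_image:
  assumes S: "rsimple S" and f: "rhom S f" and inj: "inj_on f S"
  shows "rsimple (f ` S)" "riso S (f ` S)"
proof -
  have Ssub: "rsub S" using S by (simp add: rsimple_def)
  show "riso S (f ` S)" using f inj by (auto simp: riso_def bij_betw_def)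
  have "rsub (f ` S)" using rsub_image[OF Ssub f] .
  moreover have "f ` S \<noteq> {0}"
  proof
    assume "f ` S = {0}"
    then have "f x = f 0" if "x \<in> S" for x
      using that rhom_0[OF Ssub f] by (metis image_eqI singletonD)
    then have "S \<subseteq> {0}" using inj subsp_0[OF rsub_subsp[OF Ssub]]
      unfolding inj_on_def by blast
    then show False using S by (auto simp: rsimple_def rsub_def subsp_def)
  qed
  moreover have "U = {0} \<or> U = f ` S" if U: "rsub U" "U \<subseteq> f ` S" for U
  proof -
    define W where "W = {x \<in> S. f x \<in> U}"
    have "rsub W" using U Ssub f rhom_0[OF Ssub f] unfolding W_def
      by (auto simp: rsub_def subsp_def rhom_def)
    then have "W = {0} \<or> W = S" using S unfolding rsimple_def W_def by blast
    moreover have "U = f ` W" using U unfolding W_def by auto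
    ultimately show ?thesis using rhom_0[OF Ssub f] by auto
  qed
  ultimately show "rsimple (f ` S)" by (simp add: rsimple_def)
qed

text \<open>Unless \<open>A\<close> lies in \<open>M\<close>, the sum of \<open>A\<close> and
  \<open>M\<close> is direct. The A-component of the elements of \<open>S\<close> is then a
  homomorphism to \<open>A\<close> with kernel S \<inter> M, so it is zero or an
  isomorphism.\<close>

lemma rsimple_in_setsum:
  assumes S: "rsimple S" and A: "rsimple A" and M: "rsub M" and sub: "S \<subseteq> setsum A M"
  shows "S \<subseteq> M \<or> riso S A"
proof (rule disjCI)
  assume not: "\<not> riso S A"
  show "S \<subseteq> M"
  proof (rule ccontr)
    assume nS: "\<not> S \<subseteq> M"
    then have SM: "S \<inter> M = {0}" using rsimple_Int[OF S M] by blast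
    have Asub: "rsub A" and Ssub: "rsub S" using A S by (auto simp: rsimple_def)
    have "\<not> A \<subseteq> M"
    proof
      assume "A \<subseteq> M"
      then have "setsum A M \<subseteq> M" using M by (intro setsum_least) (auto simp: rsub_def)
      then show False using sub nS by blast
    qed
    then have AM: "A \<inter> M = {0}" using rsimple_Int[OF A M] by blast
    have uniq: "a = a'" if "a \<in> A" "a' \<in> A" "x + a \<in> M" "x + a' \<in> M" for x a a'
    proof -
      have "(x + a) + (x + a') \<in> M" using that M by (auto simp: rsub_def subsp_def)
      moreover have "(x + a) + (x + a') = a + a'"
        by (metis add.assoc add.commute cancel2)
      moreover have "a + a' \<in> A" using that Asub by (auto simp: rsub_def subsp_def)
      ultimately have "a + a' = 0" using AM by auto
      then show ?thesis by (simp add: add_eq_0_iff2)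
    qed
    have "\<exists>a\<in>A. x + a \<in> M" if xS: "x \<in> S" for x
    proof -
      obtain a m where am: "x = a + m" "a \<in> A" "m \<in> M" using subsetD[OF sub xS] unfolding setsum_def by blast
      then have "x + a = m" by (metis add.commute cancel2)
      then show ?thesis using am by blast
    qed
    then have "\<exists>f. \<forall>x\<in>S. f x \<in> A \<and> x + f x \<in> M" by (intro bchoice) blast
    then obtain f where f: "\<And>x. x \<in> S \<Longrightarrow> f x \<in> A" "\<And>x. x \<in> S \<Longrightarrow> x + f x \<in> M"
      by blast
    have hom: "rhom S f"
      unfolding rhom_def
    proof (intro conjI ballI)
      fix x assume "x \<in> S" then show "f x \<in> V" using f Asub rsub_subsp subsp_in by blast
    next
      fix x y assume xy: "x \<in> S" "y \<in> S"
      have "x + y + (f x + f y) = (x + f x) + (y + f y)" by (simp add: algebra_simps)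
      moreover have "(x + f x) + (y + f y) \<in> M"
        using subsp_add[OF rsub_subsp[OF M] f(2)[OF xy(1)] f(2)[OF xy(2)]] .
      ultimately have "x + y + (f x + f y) \<in> M" by (simp only:)
      then show "f (x + y) = f x + f y"
        using xy f Asub Ssub
        by (intro uniq[of _ _ "x + y"]) (auto simp: rsub_def subsp_add)
    next
      fix r x assume rx: "r \<in> R" "x \<in> S"
      have "x \<in> V" "f x \<in> V" using rx f Asub Ssub rsub_subsp subsp_in by blast+
      then have "r x + r (f x) = r (x + f x)" using rx R_endo by (simp add: endo_add)
      then have "r x + r (f x) \<in> M" using rx f M by (simp add: rsub_def)
      then show "f (r x) = r (f x)"
        using rx f Asub Ssub by (intro uniq[of _ _ "r x"]) (auto simp: rsub_def)
    qed
    have "inj_on f S"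
      using rhom_simple_cases[OF S hom]
    proof
      assume "\<forall>x\<in>S. f x = 0"
      then have "S \<subseteq> M" using f by force
      then show ?thesis using nS by blast
    qed
    then have im: "rsimple (f ` S)" "riso S (f ` S)" using rsimple_image[OF S hom] by auto
    have "f ` S \<subseteq> A" using f(1) by blast
    then have "f ` S = A"
      using rsimple_cases[OF A rsimple_rsub[OF im(1)]] rsimple_ne[OF im(1)] by simp
    then show False using not im(2) by simp
  qed
qed

text \<open>Defining the sum of a family as an intersection gives its universal property at once and
  makes the sum of the empty family {0}.\<close>

definition sumset :: "'v set set \<Rightarrow> 'v set"
  where "sumset \<S> = \<Inter>{U. rsub U \<and> \<Union>\<S> \<subseteq> U}"

lemma sumset_upper: "S \<in> \<S> \<Longrightarrow> S \<subseteq> sumset \<S>"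
  unfolding sumset_def by blast

lemma sumset_least: "rsub U \<Longrightarrow> (\<And>S. S \<in> \<S> \<Longrightarrow> S \<subseteq> U) \<Longrightarrow> sumset \<S> \<subseteq> U"
  unfolding sumset_def by blast

lemma rsub_sumset:
  assumes "\<And>S. S \<in> \<S> \<Longrightarrow> rsub S"
  shows "rsub (sumset \<S>)"
proof -
  have "V \<in> {U. rsub U \<and> \<Union>\<S> \<subseteq> U}" using rsub_V assms subsp_in[OF rsub_subsp] by blast
  then have V: "sumset \<S> \<subseteq> V" unfolding sumset_def by (rule Inter_lower)
  have *: "0 \<in> U" "x \<in> U \<Longrightarrow> y \<in> U \<Longrightarrow> x + y \<in> U" "r \<in> R \<Longrightarrow> x \<in> U \<Longrightarrow> r x \<in> U"
    if "rsub U" for U r x y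
    using that by (auto simp: rsub_def subsp_def)
  show ?thesis unfolding rsub_def[of "sumset \<S>"] subsp_def
  proof (intro conjI ballI V)
    show "0 \<in> sumset \<S>" unfolding sumset_def using *(1) by blast
  next
    fix x y assume "x \<in> sumset \<S>" "y \<in> sumset \<S>"
    then show "x + y \<in> sumset \<S>" unfolding sumset_def using *(2) by simp
  next
    fix r x assume "r \<in> R" "x \<in> sumset \<S>"
    then show "r x \<in> sumset \<S>" unfolding sumset_def using *(3) by simp
  qed
qed

lemma sumset_empty: "sumset {} = {0}"
  using sumset_least[of "{0}" "{}"] subsp_0[OF rsub_subsp[OF rsub_sumset[of "{}"]]] by auto

lemma sumset_insert:
  assumes "rsub S" "\<And>S. S \<in> \<S> \<Longrightarrow> rsub S"
  shows "sumset (insert S \<S>) = setsum S (sumset \<S>)"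
proof (rule antisym)
  have r: "rsub (sumset \<S>)" using rsub_sumset assms by blast
  have sub: "subsp S" "subsp (sumset \<S>)" using assms(1) r by (auto simp: rsub_def)
  show "sumset (insert S \<S>) \<subseteq> setsum S (sumset \<S>)"
    using setsum_upper[OF sub] rsub_setsum[OF assms(1) r] sumset_upper
    by (intro sumset_least) blast+
  show "setsum S (sumset \<S>) \<subseteq> sumset (insert S \<S>)"
  proof (rule setsum_least)
    have r': "rsub (sumset (insert S \<S>))" using rsub_sumset assms by blast
    then show "subsp (sumset (insert S \<S>))" by (simp add: rsub_def)
    show "S \<subseteq> sumset (insert S \<S>)" by (simp add: sumset_upper)
    show "sumset \<S> \<subseteq> sumset (insert S \<S>)" using r' sumset_upper by (intro sumset_least) blast+
  qed
qed

text \<open>The summands are peeled off one at a time. This is what later keeps homogeneous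
  components of different types apart.\<close>

lemma rsimple_in_sumset:
  assumes "finite \<S>" "\<And>A. A \<in> \<S> \<Longrightarrow> rsimple A" "rsimple S" "S \<subseteq> sumset \<S>"
  shows "\<exists>A\<in>\<S>. riso S A"
  using assms
proof (induction \<S> rule: finite_induct)
  case empty
  then have "S = {0}" by (auto simp: sumset_empty rsimple_def rsub_def subsp_def)
  then show ?case using empty by (simp add: rsimple_def)
next
  case (insert A \<S>)
  have sub: "rsub B" if "B \<in> insert A \<S>" for B using insert.prems that rsimple_rsub by blast
  have "S \<subseteq> setsum A (sumset \<S>)"
    using insert.prems(3) sub by (simp add: sumset_insert)
  then have "S \<subseteq> sumset \<S> \<or> riso S A"
    using insert.prems sub by (intro rsimple_in_setsum rsub_sumset) auto
  then show ?case using insert by auto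
qed

lemma finite_rsubs: "finite {U. rsub U}"
  by (rule finite_subset[of _ "Pow V"]) (use fin in \<open>auto simp: rsub_def subsp_def\<close>)

text \<open>Jacobson density for a commutant acting by 0 and 1: annihilators separate a subspace
  from every vector outside it, so values of an operator in \<open>R\<close> can be prescribed one
  basis vector after another.\<close>

lemma density:
  assumes V: "rsimple V"
    and C: "\<And>c. c \<in> commutant \<Longrightarrow> (\<forall>x\<in>V. c x = 0) \<or> (\<forall>x\<in>V. c x = x)"
    and f: "endo f"
  shows "\<exists>r\<in>R. \<forall>x\<in>V. r x = f x"
proof -
  define Ann where "Ann U = {r \<in> R. \<forall>u\<in>U. r u = 0}" for U :: "'v set"
  \<comment> \<open>\<open>P U\<close> says that a vector killed by everything that kills
    \<open>U\<close> lies in \<open>U\<close>.\<close>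
  define P where "P U \<longleftrightarrow> (\<forall>x\<in>V - U. \<exists>r\<in>Ann U. r x \<noteq> 0)" for U :: "'v set"
  have AnnR: "r \<in> R" if "r \<in> Ann U" for r U using that by (simp add: Ann_def)
  \<comment> \<open>\<open>Ann U\<close> is a left ideal, so its values at y form a submodule; by
    \<open>P U\<close> it is nonzero, hence all of \<open>V\<close>.\<close>
  have all: "(\<lambda>r. r y) ` Ann U = V" if U: "subsp U" "P U" "y \<in> V" "y \<notin> U" for U y
  proof -
    have *: "(\<lambda>x. r x + s x) \<in> Ann U" "(\<lambda>x. t (r x)) \<in> Ann U"
      if "r \<in> Ann U" "s \<in> Ann U" "t \<in> R" for r s t
      using that R_add R_comp R_0 by (auto simp: Ann_def)
    have "rsub ((\<lambda>r. r y) ` Ann U)"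
      unfolding rsub_def subsp_def
    proof (intro conjI ballI subsetI)
      fix x assume "x \<in> (\<lambda>r. r y) ` Ann U"
      then show "x \<in> V" using \<open>y \<in> V\<close> R_endo by (auto simp: Ann_def endo_in)
    next
      show "0 \<in> (\<lambda>r. r y) ` Ann U" using zero_R by (auto simp: Ann_def image_iff)
    next
      fix u v assume "u \<in> (\<lambda>r. r y) ` Ann U" "v \<in> (\<lambda>r. r y) ` Ann U"
      then show "u + v \<in> (\<lambda>r. r y) ` Ann U" using *(1) R_id by fastforce
    next
      fix t u assume "t \<in> R" "u \<in> (\<lambda>r. r y) ` Ann U"
      then show "t u \<in> (\<lambda>r. r y) ` Ann U" using *(2) by fastforce
    qed
    moreover have "(\<lambda>r. r y) ` Ann U \<noteq> {0}" using U unfolding P_def by fastforce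
    ultimately show ?thesis using V unfolding rsimple_def
      by (metis rsub_subsp subsp_def)
  qed
  have P0: "P {0}" using R_id by (force simp: P_def Ann_def R_0)
  have Pstep: "P (setsum W {0, y})" if W: "subsp W" "y \<in> V" "y \<notin> W" "P W" for W y
  proof -
    have s: "subsp {0, y}" using W by (auto simp: subsp_def)
    show ?thesis
    proof (rule ccontr)
      assume "\<not> P (setsum W {0, y})"
      then obtain x where x: "x \<in> V" "x \<notin> setsum W {0, y}"
          "\<And>r. r \<in> Ann (setsum W {0, y}) \<Longrightarrow> r x = 0" unfolding P_def by blast
      have key: "r x = 0" if "r \<in> Ann W" "r y = 0" for r
      proof (rule x(3))
        have "r (u + v) = 0" if "u \<in> W" "v \<in> {0, y}" for u v
        proof -
          have "u \<in> V" "v \<in> V" using \<open>u \<in> W\<close> \<open>v \<in> {0, y}\<close> subsp_in[OF W(1)] W(2) by auto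
          then have "r (u + v) = r u + r v"
            using R_endo[OF AnnR[OF \<open>r \<in> Ann W\<close>]] by (simp add: endo_add)
          moreover have "r 0 = 0" using \<open>r \<in> Ann W\<close> R_0 by (simp add: Ann_def)
          ultimately show ?thesis using that \<open>r \<in> Ann W\<close> \<open>r y = 0\<close> by (auto simp: Ann_def)
        qed
        then show "r \<in> Ann (setsum W {0, y})"
          using \<open>r \<in> Ann W\<close> unfolding Ann_def setsum_def by blast
      qed
      have eq: "r x = s x" if "r \<in> Ann W" "s \<in> Ann W" "r y = s y" for r s
      proof -
        have "(\<lambda>x. r x + s x) \<in> Ann W" using that R_add by (auto simp: Ann_def)
        from key[OF this] show ?thesis using that by (simp add: add_eq_0_iff2)
      qed
      have "\<forall>v\<in>V. \<exists>r\<in>Ann W. r y = v" using all[OF W(1,4,2,3)] by force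
      then obtain h where h: "\<And>v. v \<in> V \<Longrightarrow> h v \<in> Ann W" "\<And>v. v \<in> V \<Longrightarrow> h v y = v" by metis
      \<comment> \<open>The assignment of r x to r y, for r in \<open>Ann W\<close>, is well defined
        by \<open>eq\<close> and defined on all of \<open>V\<close> by \<open>all\<close>. It
        commutes with \<open>R\<close>, so it is 0 or the identity, which puts x or x + y into
        W.\<close>
      define c where "c v = h v x" for v
      have c_eq: "c (r y) = r x" if "r \<in> Ann W" for r
      proof -
        have ry: "r y \<in> V" using that W R_endo by (auto simp: Ann_def endo_in)
        show ?thesis unfolding c_def using eq[OF h(1)[OF ry] that h(2)[OF ry]] .
      qed
      have "c \<in> commutant"
        unfolding commutant_def endo_def
      proof (intro CollectI conjI ballI)
        fix v assume "v \<in> V"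
        then show "c v \<in> V" unfolding c_def using h(1) x(1) R_endo by (auto simp: Ann_def endo_in)
      next
        fix u v assume uv: "u \<in> V" "v \<in> V"
        have "(\<lambda>x. h u x + h v x) \<in> Ann W" using h uv R_add by (auto simp: Ann_def)
        from c_eq[OF this] show "c (u + v) = c u + c v" using h uv by (simp add: c_def)
      next
        fix t v assume tv: "t \<in> R" "v \<in> V"
        have "(\<lambda>x. t (h v x)) \<in> Ann W" using h tv R_comp R_0 by (auto simp: Ann_def)
        from c_eq[OF this] show "c (t v) = t (c v)" using h tv by (simp add: c_def)
      qed
      from C[OF this] show False
      proof
        assume "\<forall>x\<in>V. c x = 0"
        then have "r x = 0" if "r \<in> Ann W" for r
          using that c_eq[OF that] W R_endo[OF AnnR[OF that]] by (metis endo_in)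
        then have "x \<in> W" using \<open>P W\<close> x(1) unfolding P_def by blast
        then show False using x(2) setsum_upper[OF W(1) s] by blast
      next
        assume "\<forall>x\<in>V. c x = x"
        then have "r (x + y) = 0" if "r \<in> Ann W" for r
          using that c_eq[OF that] W R_endo[OF AnnR[OF that]] x(1) by (simp add: endo_add endo_in)
        then have "x + y \<in> W" using \<open>P W\<close> x(1) W unfolding P_def by (metis DiffI add_in)
        then have "(x + y) + y \<in> setsum W {0, y}" unfolding setsum_def by blast
        then show False using x(2) by (simp add: add.assoc)
      qed
    qed
  qed
  have P: "P U" if "subsp U" for U
    using that P0 Pstep by (rule subsp_extend_induct)
  define Q where "Q U \<longleftrightarrow> (\<exists>r\<in>R. \<forall>x\<in>U. r x = f x)" for U :: "'v set"
  have Q0: "Q {0}" using zero_R endo_0[OF f] by (force simp: Q_def)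
  have step: "Q (setsum W {0, y})" if W: "subsp W" "y \<in> V" "y \<notin> W" "Q W" for W y
  proof -
    obtain r where r: "r \<in> R" "\<forall>x\<in>W. r x = f x" using \<open>Q W\<close> by (auto simp: Q_def)
    have "r y + f y \<in> V" using W r f R_endo by (auto simp: endo_in)
    \<comment> \<open>An operator that is already right on W is corrected at y by one that vanishes
      on W.\<close>
    then obtain s where s: "s \<in> Ann W" "s y = r y + f y"
      using all[OF W(1) P[OF W(1)] W(2,3)] by (metis imageE)
    have "(\<lambda>x. r x + s x) \<in> R" using r s R_add AnnR by blast
    moreover have "r (u + v) + s (u + v) = f (u + v)" if "u \<in> W" "v \<in> {0, y}" for u v
    proof -
      have V: "u \<in> V" "v \<in> V" using that W by (auto dest: subsp_in)
      have 0: "r 0 = 0" "s 0 = 0" "f 0 = 0" using r s R_0 AnnR f endo_0 by blast+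
      have "r (u + v) + s (u + v) = (r u + s u) + (r v + s v)"
        using V r s R_endo AnnR by (simp add: endo_add algebra_simps)
      also have "r u + s u = f u" using that r s by (simp add: Ann_def)
      also have "r v + s v = f v" using that s 0 by auto
      finally show ?thesis using V f by (simp add: endo_add)
    qed
    ultimately show ?thesis unfolding Q_def setsum_def
      by (intro bexI[of _ "\<lambda>x. r x + s x"]) blast+
  qed
  have "Q V" using subsp_V Q0 step by (rule subsp_extend_induct)
  then show ?thesis by (simp add: Q_def)
qed

end

section \<open>Representations whose unipotent subgroup fixes a single line\<close>

text \<open>\<open>fixed\<close> makes the line of \<open>v0\<close> the whole space of P-fixed
  vectors. \<open>Frattini\<close> says that T acts irreducibly on the quotient of \<open>P\<close>
  by \<open>\<Phi>\<close>. The factor 8 leaves room in \<open>S2\<close> for three vectors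
  independent modulo \<open>v0\<close>.\<close>

locale char2_rep = group G + char2_space V
  for G (structure) and V :: "'v :: ab_group_add set" +
  fixes \<rho> :: "'a \<Rightarrow> 'v \<Rightarrow> 'v" and P T \<Phi> :: "'a set" and v0 :: 'v and k :: nat
  assumes act_in: "\<And>g x. g \<in> carrier G \<Longrightarrow> x \<in> V \<Longrightarrow> \<rho> g x \<in> V"
    and act_add: "\<And>g x y. g \<in> carrier G \<Longrightarrow> x \<in> V \<Longrightarrow> y \<in> V \<Longrightarrow> \<rho> g (x + y) = \<rho> g x + \<rho> g y"
    and act_one: "\<And>x. x \<in> V \<Longrightarrow> \<rho> \<one> x = x"
    and act_mult: "\<And>g h x. g \<in> carrier G \<Longrightarrow> h \<in> carrier G \<Longrightarrow> x \<in> V \<Longrightarrow> \<rho> (g \<otimes> h) x = \<rho> g (\<rho> h x)"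
    and P: "subgroup P G" and card_P: "card P = 2 ^ k"
    and T: "subgroup T G" and T_norm: "\<And>t s. t \<in> T \<Longrightarrow> s \<in> P \<Longrightarrow> t \<otimes> s \<otimes> inv t \<in> P"
    and v0: "v0 \<in> V" "v0 \<noteq> 0"
    and v0_fixed: "\<And>s. s \<in> P \<union> T \<Longrightarrow> \<rho> s v0 = v0"
    and fixed: "\<And>x. x \<in> V \<Longrightarrow> (\<And>s. s \<in> P \<Longrightarrow> \<rho> s x = x) \<Longrightarrow> x \<in> {0, v0}"
    and nontrivial: "\<not> V \<subseteq> {0, v0}"
    and Frattini: "\<And>Q. subgroup Q G \<Longrightarrow> Q \<subseteq> P \<Longrightarrow> Q \<noteq> P \<Longrightarrow> (\<And>s. s \<in> P \<Longrightarrow> s \<otimes> s \<in> Q) \<Longrightarrow>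
      (\<And>t s. t \<in> T \<Longrightarrow> s \<in> Q \<Longrightarrow> t \<otimes> s \<otimes> inv t \<in> Q) \<Longrightarrow> Q = \<Phi>"
    and card_Phi: "card \<Phi> > 0" "8 * card \<Phi> \<le> card P"
begin

lemma P_in: "s \<in> P \<Longrightarrow> s \<in> carrier G"
  using subgroup.subset[OF P] by blast

lemma T_in: "s \<in> T \<Longrightarrow> s \<in> carrier G"
  using subgroup.subset[OF T] by blast

lemma act_inv [simp]:
  assumes "g \<in> carrier G" "x \<in> V"
  shows "\<rho> g (\<rho> (inv g) x) = x" "\<rho> (inv g) (\<rho> g x) = x"
  using assms by (simp_all add: act_mult[symmetric] act_one)

lemma act_0: "g \<in> carrier G \<Longrightarrow> \<rho> g 0 = 0"
  using act_add[of g 0 0] by simp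

lemma endo_act: "g \<in> carrier G \<Longrightarrow> endo (\<rho> g)"
  by (simp add: endo_def act_in act_add)

lemma subsp_image:
  assumes U: "subsp U" and g: "g \<in> carrier G"
  shows "subsp (\<rho> g ` U)"
  unfolding subsp_def
proof (intro conjI ballI)
  show "\<rho> g ` U \<subseteq> V" using subsp_in[OF U] act_in[OF g] by blast
  show "0 \<in> \<rho> g ` U" using subsp_0[OF U] act_0[OF g] by (metis imageI)
  fix x y assume "x \<in> \<rho> g ` U" "y \<in> \<rho> g ` U"
  then obtain a b where "a \<in> U" "b \<in> U" "x = \<rho> g a" "y = \<rho> g b" by blast
  then show "x + y \<in> \<rho> g ` U"
    using act_add[OF g] subsp_in[OF U] subsp_add[OF U] by (metis imageI)
qed

lemma image_image_inv:
  assumes "U \<subseteq> V" "g \<in> carrier G"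
  shows "\<rho> g ` \<rho> (inv g) ` U = U" "\<rho> (inv g) ` \<rho> g ` U = U"
proof -
  have "\<rho> g (\<rho> (inv g) x) = x" "\<rho> (inv g) (\<rho> g x) = x" if "x \<in> U" for x
    using assms that by auto
  then show "\<rho> g ` \<rho> (inv g) ` U = U" "\<rho> (inv g) ` \<rho> g ` U = U"
    unfolding image_image by auto
qed

text \<open>A nonzero subspace has even size, so \<open>P\<close> fixes an even number of its
  vectors; 0 is one of them, and any other must be \<open>v0\<close>.\<close>

lemma v0_in_subsp:
  assumes U: "subsp U" "U \<noteq> {0}" and stable: "\<And>s x. s \<in> P \<Longrightarrow> x \<in> U \<Longrightarrow> \<rho> s x \<in> U"
  shows "v0 \<in> U"
proof -
  have UV: "x \<in> V" if "x \<in> U" for x using subsp_in U that by blast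
  obtain u where u: "u \<in> U" "u \<noteq> 0" using U subsp_0[OF U(1)] by blast
  define F where "F = {x \<in> U. \<forall>s\<in>P. \<rho> s x = x}"
  have "even (card U) \<longleftrightarrow> even (card F)"
    unfolding F_def using stable UV
    by (intro even_card_iff_fixed_subgroup[OF P card_P subsp_fin[OF U(1)]]) (auto simp: act_one act_mult P_in)
  moreover have "even (card U)" using even_card_subsp[OF U(1) u] .
  moreover have 0: "0 \<in> F" using subsp_0[OF U(1)] act_0 P_in by (simp add: F_def)
  ultimately have "F \<noteq> {0}" by auto
  then obtain x where x: "x \<in> F" "x \<noteq> 0" using 0 by blast
  then have "x \<in> {0, v0}" using UV by (intro fixed) (auto simp: F_def)
  then show ?thesis using x by (simp add: F_def)
qed

text \<open>The preimage in \<open>V\<close> of the P-fixed vectors of the quotient by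
  \<open>v0\<close>.\<close>

definition S2 :: "'v set"
  where "S2 = {x \<in> V. \<forall>s\<in>P. \<rho> s x \<in> {x, x + v0}}"

lemma S2_act: "s \<in> P \<Longrightarrow> x \<in> S2 \<Longrightarrow> \<rho> s x \<in> {x, x + v0}"
  by (simp add: S2_def)

lemma subsp_S2: "subsp S2"
proof -
  have "\<rho> s (x + y) \<in> {x + y, x + y + v0}" if "x \<in> S2" "y \<in> S2" "s \<in> P" for x y s
  proof -
    have "\<rho> s (x + y) = \<rho> s x + \<rho> s y" using that P_in by (simp add: S2_def act_add)
    then show ?thesis using S2_act[OF that(3,1)] S2_act[OF that(3,2)] by (auto simp: ac_simps)
  qed
  moreover have "0 \<in> S2" using act_0 P_in by (simp add: S2_def)
  ultimately show ?thesis unfolding subsp_def by (auto simp: S2_def)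
qed

lemma S2_T:
  assumes t: "t \<in> T" and x: "x \<in> S2"
  shows "\<rho> t x \<in> S2"
proof -
  have tG: "t \<in> carrier G" using T_in t .
  have xV: "x \<in> V" using x by (simp add: S2_def)
  have "\<rho> s (\<rho> t x) \<in> {\<rho> t x, \<rho> t x + v0}" if s: "s \<in> P" for s
  proof -
    have sG: "s \<in> carrier G" using P_in s .
    have "inv t \<otimes> s \<otimes> inv (inv t) \<in> P" using T_norm[OF subgroup.m_inv_closed[OF T t] s] .
    then have "inv t \<otimes> s \<otimes> t \<in> P" using tG by simp
    then have "\<rho> (inv t \<otimes> s \<otimes> t) x \<in> {x, x + v0}" using x by (simp add: S2_def)
    then have "\<rho> t (\<rho> (inv t \<otimes> s \<otimes> t) x) \<in> {\<rho> t x, \<rho> t x + v0}"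
      using act_add[OF tG xV v0(1)] v0_fixed[of t] t by auto
    moreover have "\<rho> t (\<rho> (inv t \<otimes> s \<otimes> t) x) = \<rho> s (\<rho> t x)"
      using tG sG xV by (simp add: act_mult act_in)
    ultimately show ?thesis by simp
  qed
  then show ?thesis using act_in[OF tG xV] by (simp add: S2_def)
qed

text \<open>The parity argument of \<open>v0_in_subsp\<close> is repeated in the quotient of
  \<open>U\<close> by \<open>v0\<close>: a P-fixed coset other than that of 0 consists of elements
  of \<open>S2\<close>.\<close>

lemma meets_S2:
  assumes U: "subsp U" and stable: "\<And>s x. s \<in> P \<Longrightarrow> x \<in> U \<Longrightarrow> \<rho> s x \<in> U" and big: "\<not> U \<subseteq> {0, v0}"
  shows "v0 \<in> U" "\<not> U \<inter> S2 \<subseteq> {0, v0}"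
proof -
  show v0U: "v0 \<in> U" using big by (intro v0_in_subsp[OF U _ stable]) auto
  have UV: "x \<in> V" if "x \<in> U" for x using subsp_in U that by blast
  obtain u where u: "u \<in> U" "u \<notin> {0, v0}" using big by blast
  \<comment> \<open>\<open>pr x\<close> is the coset of x modulo \<open>v0\<close>, with
    \<open>P\<close> acting by images of sets.\<close>
  define pr where "pr x = {x, x + v0}" for x
  have pr_eq: "pr x = pr y \<longleftrightarrow> x = y \<or> x = y + v0" for x y
    by (auto simp: pr_def doubleton_eq_iff add.assoc)
  define Xs where "Xs = pr ` U"
  define F where "F = {A \<in> Xs. \<forall>s\<in>P. \<rho> s ` A = A}"
  have finXs: "finite Xs" using subsp_fin[OF U] by (simp add: Xs_def)
  have "even (card Xs)"
  \<comment> \<open>Translation by u moves every coset because u lies outside {0, v0}.\<close>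
  proof (rule even_card_involution[OF finXs, of "\<lambda>A. (\<lambda>x. x + u) ` A"])
    have im: "(\<lambda>x. x + u) ` pr x = pr (x + u)" for x by (auto simp: pr_def ac_simps)
    fix A assume "A \<in> Xs"
    then obtain x where x: "x \<in> U" "A = pr x" by (auto simp: Xs_def)
    show "(\<lambda>x. x + u) ` A \<in> Xs" using x u im subsp_add[OF U] by (auto simp: Xs_def)
    show "(\<lambda>x. x + u) ` (\<lambda>x. x + u) ` A = A" using x im by (simp add: add.assoc)
    show "(\<lambda>x. x + u) ` A \<noteq> A" using x im u pr_eq by auto
  qed
  moreover have "even (card Xs) \<longleftrightarrow> even (card F)"
    unfolding F_def
  proof (rule even_card_iff_fixed_subgroup[OF P card_P finXs])
    fix A assume "A \<in> Xs"
    then obtain x where x: "x \<in> U" "A = pr x" by (auto simp: Xs_def)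
    have xV: "x \<in> V" "x + v0 \<in> V" using UV x v0 by auto
    show "\<rho> \<one> ` A = A" using x xV by (simp add: pr_def act_one)
    show "\<rho> s ` A \<in> Xs" if s: "s \<in> P" for s
    proof -
      have "\<rho> s ` A = pr (\<rho> s x)" using x s xV v0 P_in v0_fixed[of s] by (simp add: pr_def act_add)
      then show ?thesis using stable[OF s x(1)] by (simp add: Xs_def)
    qed
    show "\<rho> (s \<otimes> t) ` A = \<rho> s ` \<rho> t ` A" if "s \<in> P" "t \<in> P" for s t
      using that x xV P_in by (simp add: pr_def act_mult)
  qed
  moreover have 0: "pr 0 \<in> F" using subsp_0[OF U] act_0 P_in v0_fixed by (auto simp: F_def Xs_def pr_def)
  ultimately have "F \<noteq> {pr 0}" by auto
  then obtain A where A: "A \<in> F" "A \<noteq> pr 0" using 0 by blast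
  then obtain x where x: "x \<in> U" "A = pr x" by (auto simp: F_def Xs_def)
  have "\<rho> s x \<in> pr x" if "s \<in> P" for s using A x that by (auto simp: F_def pr_def)
  then have "x \<in> U \<inter> S2" using x UV by (simp add: S2_def pr_def)
  moreover have "x \<notin> {0, v0}" using A x pr_eq by auto
  ultimately show "\<not> U \<inter> S2 \<subseteq> {0, v0}" by blast
qed

text \<open>Orthogonality for the pairing of \<open>U \<inter> S2\<close> with \<open>P\<close> given by \<open>\<rho> s u = u + \<langle>u, s\<rangle> v0\<close>.\<close>

lemma card_S2_Int:
  assumes U: "subsp U" and stable: "\<And>s x. s \<in> P \<union> T \<Longrightarrow> x \<in> U \<Longrightarrow> \<rho> s x \<in> U" and big: "\<not> U \<subseteq> {0, v0}"
  shows "card (U \<inter> S2) * card \<Phi> = 2 * card P"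
proof -
  define Y where "Y = U \<inter> S2"
  have finP: "finite P" using card_P by (metis card.infinite power_eq_0_iff zero_neq_numeral)
  have m: "v0 \<in> U" "\<not> Y \<subseteq> {0, v0}" using meets_S2[OF U _ big] stable by (auto simp: Y_def)
  have Y: "subsp Y" using U subsp_S2 by (auto simp: Y_def subsp_def)
  have v0S: "v0 \<in> S2" using v0 v0_fixed by (simp add: S2_def)
  have v0Y: "v0 \<in> Y" using m v0S by (simp add: Y_def)
  have YV: "u \<in> V" if "u \<in> Y" for u using subsp_in Y that by blast
  have Y2: "u \<in> S2" if "u \<in> Y" for u using that by (simp add: Y_def)
  \<comment> \<open>\<open>sg u s\<close> is -1 to the power of the pairing of u and s. Integer
    values are used so that character sums can vanish by cancellation.\<close>
  define sg :: "'v \<Rightarrow> 'a \<Rightarrow> int" where "sg u s = (if \<rho> s u = u then 1 else -1)" for u s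
  define K where "K = {s \<in> P. \<forall>u\<in>Y. \<rho> s u = u}"
  have ne: "u + v0 \<noteq> u" for u using v0 by simp
  have move: "\<rho> s u = u + v0" if "\<rho> s u \<noteq> u" "s \<in> P" "u \<in> Y" for s u
    using S2_act[OF that(2) Y2[OF that(3)]] that(1) by simp
  have sg_mult: "sg u (s \<otimes> t) = sg u s * sg u t" if u: "u \<in> Y" and st: "s \<in> P" "t \<in> P" for u s t
  proof -
    have eq: "\<rho> (s \<otimes> t) u = \<rho> s (\<rho> t u)" using YV[OF u] st P_in by (simp add: act_mult)
    have sv: "\<rho> s (u + v0) = \<rho> s u + v0"
      using YV[OF u] st P_in v0 v0_fixed[of s] by (simp add: act_add)
    show ?thesis
    proof (cases "\<rho> t u = u")
      case False
      then have tu: "\<rho> t u = u + v0" using move st u by blast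
      have "\<rho> (s \<otimes> t) u = u \<longleftrightarrow> \<rho> s u \<noteq> u"
      proof (cases "\<rho> s u = u")
        case True
        then show ?thesis using eq tu sv ne by simp
      next
        case False
        then have "\<rho> s u = u + v0" using move st u by blast
        then show ?thesis using eq tu sv ne by (simp add: add.assoc)
      qed
      then show ?thesis using False by (auto simp: sg_def)
    qed (simp add: sg_def eq)
  qed
  have sg_add: "sg (u + u') s = sg u s * sg u' s" if u: "u \<in> Y" "u' \<in> Y" and s: "s \<in> P" for u u' s
  proof -
    have eq: "\<rho> s (u + u') = \<rho> s u + \<rho> s u'" using YV u s P_in by (simp add: act_add)
    show ?thesis
    proof (cases "\<rho> s u = u"; cases "\<rho> s u' = u'")
      assume n: "\<rho> s u = u" "\<rho> s u' \<noteq> u'"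
      then show ?thesis using eq move[OF n(2) s u(2)] ne by (simp add: sg_def)
    next
      assume n: "\<rho> s u \<noteq> u" "\<rho> s u' = u'"
      then have "\<rho> s (u + u') = (u + u') + v0" using eq move[OF n(1) s u(1)] by (simp add: ac_simps)
      then show ?thesis using n ne by (simp add: sg_def)
    next
      assume n: "\<rho> s u \<noteq> u" "\<rho> s u' \<noteq> u'"
      have "\<rho> s (u + u') = (u + u') + (v0 + v0)"
        using eq move[OF n(1) s u(1)] move[OF n(2) s u(2)] by (simp only: ac_simps)
      then show ?thesis using n by (simp add: sg_def)
    qed (simp add: sg_def eq)
  qed
  have row: "(\<Sum>s\<in>P. sg u s) = (if u \<in> {0, v0} then int (card P) else 0)" if u: "u \<in> Y" for u
  proof (cases "u \<in> {0, v0}")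
    case True
    then have "sg u s = 1" if "s \<in> P" for s using that act_0 P_in v0_fixed[of s] by (auto simp: sg_def)
    then show ?thesis using True by simp
  next
    case False
    then obtain s0 where s0: "s0 \<in> P" "\<rho> s0 u \<noteq> u" using fixed YV[OF u] by blast
    \<comment> \<open>Shifting by an element that moves u negates every term, so the sum equals its
      own negative.\<close>
    have "(\<Sum>s\<in>P. sg u s) = (\<Sum>s\<in>P. sg u (s0 \<otimes> s))"
    proof (rule sum.reindex_bij_witness[of _ "\<lambda>s. s0 \<otimes> s" "\<lambda>s. inv s0 \<otimes> s"])
      fix s assume s: "s \<in> P"
      show "s0 \<otimes> (inv s0 \<otimes> s) = s" "inv s0 \<otimes> (s0 \<otimes> s) = s"
        using s s0 P_in by (simp_all add: m_assoc[symmetric])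
      show "inv s0 \<otimes> s \<in> P" "s0 \<otimes> s \<in> P"
        using s s0 P by (simp_all add: subgroup.m_closed subgroup.m_inv_closed)
    qed (use s0 P_in in \<open>simp add: m_assoc[symmetric]\<close>)
    also have "\<dots> = (\<Sum>s\<in>P. - sg u s)" using sg_mult[OF u s0(1)] s0 by (intro sum.cong) (auto simp: sg_def)
    finally show ?thesis using False by (simp add: sum_negf)
  qed
  have col: "(\<Sum>u\<in>Y. sg u s) = (if s \<in> K then int (card Y) else 0)" if s: "s \<in> P" for s
  proof (cases "s \<in> K")
    case True
    then show ?thesis by (simp add: sg_def K_def)
  next
    case False
    then obtain u0 where u0: "u0 \<in> Y" "\<rho> s u0 \<noteq> u0" using s by (auto simp: K_def)
    have "(\<Sum>u\<in>Y. sg u s) = (\<Sum>u\<in>Y. sg (u0 + u) s)"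
      by (rule sum.reindex_bij_witness[of _ "\<lambda>u. u0 + u" "\<lambda>u. u0 + u"]) (use subsp_add[OF Y u0(1)] in auto)
    also have "\<dots> = (\<Sum>u\<in>Y. - sg u s)" using sg_add[OF u0(1) _ s] u0 by (intro sum.cong) (auto simp: sg_def)
    finally show ?thesis using False by (simp add: sum_negf)
  qed
  \<comment> \<open>Summing \<open>sg\<close> over Y and \<open>P\<close> in both orders: rows
    contribute only for u in {0, v0}, columns only for s in the kernel K.\<close>
  have "int (2 * card P) = (\<Sum>u\<in>Y. if u \<in> {0, v0} then int (card P) else 0)"
  proof -
    have "(\<Sum>u\<in>Y. if u \<in> {0, v0} then int (card P) else 0) = (\<Sum>u\<in>Y \<inter> {0, v0}. int (card P))"
      using subsp_fin[OF Y] by (subst sum.inter_restrict) auto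
    also have "Y \<inter> {0, v0} = {0, v0}" using subsp_0[OF Y] v0Y by blast
    finally show ?thesis using v0 by simp
  qed
  also have "\<dots> = (\<Sum>u\<in>Y. \<Sum>s\<in>P. sg u s)" using row by (intro sum.cong) auto
  also have "\<dots> = (\<Sum>s\<in>P. \<Sum>u\<in>Y. sg u s)" by (rule sum.swap)
  also have "\<dots> = (\<Sum>s\<in>P. if s \<in> K then int (card Y) else 0)" using col by (intro sum.cong) auto
  also have "\<dots> = (\<Sum>s\<in>P \<inter> K. int (card Y))" using finP by (subst sum.inter_restrict) auto
  also have "P \<inter> K = K" by (auto simp: K_def)
  finally have cnt: "card Y * card K = 2 * card P"
    by (metis mult.commute of_nat_eq_iff of_nat_mult sum_constant)
  \<comment> \<open>The kernel contains all squares because \<open>sg\<close> takes the values 1 and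
    -1, is T-invariant because Y is, and is proper because \<open>P\<close> moves some vector of
    Y.\<close>
  have "K = \<Phi>"
  proof (rule Frattini)
    show "subgroup K G"
    proof (rule subgroupI)
      show "K \<subseteq> carrier G" using P_in by (auto simp: K_def)
      show "K \<noteq> {}" using subgroup.one_closed[OF P] act_one YV by (auto simp: K_def)
      show "inv a \<in> K" if a: "a \<in> K" for a
      proof -
        have aP: "a \<in> P" using a by (simp add: K_def)
        have "\<rho> (inv a) u = u" if "u \<in> Y" for u
          using act_inv(2)[OF P_in[OF aP] YV[OF that]] a that by (simp add: K_def)
        then show ?thesis using subgroup.m_inv_closed[OF P aP] by (simp add: K_def)
      qed
      show "a \<otimes> b \<in> K" if "a \<in> K" "b \<in> K" for a b
        using that YV P_in subgroup.m_closed[OF P] by (simp add: K_def act_mult)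
    qed
    show "K \<subseteq> P" by (auto simp: K_def)
    show "K \<noteq> P"
    proof
      assume KP: "K = P"
      obtain u where u: "u \<in> Y" "u \<notin> {0, v0}" using m(2) by blast
      have "\<rho> s u = u" if "s \<in> P" for s using that KP u(1) by (auto simp: K_def)
      then show False using fixed[OF YV[OF u(1)]] u(2) by blast
    qed
    show "s \<otimes> s \<in> K" if s: "s \<in> P" for s
    proof -
      have "\<rho> (s \<otimes> s) u = u" if u: "u \<in> Y" for u
      proof -
        have "sg u (s \<otimes> s) = 1" using sg_mult[OF u s s] by (simp add: sg_def)
        then show ?thesis by (simp add: sg_def split: if_splits)
      qed
      then show ?thesis using subgroup.m_closed[OF P s s] by (simp add: K_def)
    qed
    show "t \<otimes> s \<otimes> inv t \<in> K" if t: "t \<in> T" and s: "s \<in> K" for t s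
    proof -
      have sP: "s \<in> P" using s by (simp add: K_def)
      have G: "t \<in> carrier G" "s \<in> carrier G" "inv t \<in> T"
        using T_in t P_in sP subgroup.m_inv_closed[OF T] by auto
      have "\<rho> (t \<otimes> s \<otimes> inv t) u = u" if u: "u \<in> Y" for u
      proof -
        have "\<rho> (inv t) u \<in> Y" using u stable G S2_T by (simp add: Y_def)
        then have "\<rho> s (\<rho> (inv t) u) = \<rho> (inv t) u" using s by (simp add: K_def)
        then show ?thesis using G YV[OF u] by (simp add: act_mult act_in)
      qed
      then show ?thesis using T_norm[OF t sP] by (simp add: K_def)
    qed
  qed
  then show ?thesis using cnt by (simp add: Y_def)
qed

lemma card_S2: "card S2 * card \<Phi> = 2 * card P"
proof -
  have "V \<inter> S2 = S2" by (auto simp: S2_def)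
  moreover have "\<rho> s x \<in> V" if "s \<in> P \<union> T" "x \<in> V" for s x using that act_in P_in T_in by blast
  ultimately show ?thesis using card_S2_Int[OF subsp_V _ nontrivial] by simp
qed

lemma card_S2_ge: "16 \<le> card S2"
proof -
  have "16 * card \<Phi> \<le> card S2 * card \<Phi>" using card_S2 card_Phi(2) by simp
  then show ?thesis using card_Phi(1) by simp
qed

text \<open>By \<open>card_S2_Int\<close> the size of the intersection with \<open>S2\<close>
  depends only on \<open>P\<close> and \<open>\<Phi>\<close>, so it is the same for \<open>U\<close>
  as for the whole space.\<close>

lemma socle:
  assumes "subsp U" "\<And>s x. s \<in> P \<union> T \<Longrightarrow> x \<in> U \<Longrightarrow> \<rho> s x \<in> U" "\<not> U \<subseteq> {0, v0}"
  shows "S2 \<subseteq> U"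
proof -
  have "card (U \<inter> S2) * card \<Phi> = card S2 * card \<Phi>" using card_S2_Int[OF assms] card_S2 by simp
  then have "card (U \<inter> S2) = card S2" using card_Phi(1) by simp
  then have "U \<inter> S2 = S2" using subsp_fin[OF subsp_S2] by (intro card_subset_eq) auto
  then show ?thesis by blast
qed

end

section \<open>Clifford theory for a normalized algebra\<close>

text \<open>\<open>Z\<close> detects nontrivial subgroups of \<open>P\<close>, and
  \<open>normal_cases\<close> extends this to normal subgroups of \<open>G\<close>; both serve to
  control how \<open>P\<close> permutes homogeneous components. \<open>moved\<close>,
  \<open>span\<close> and \<open>scalar\<close> are what is kept of the permutation module: the
  orbit of \<open>v0\<close> is nontrivial, spans \<open>V\<close>, and has its lines preserved only
  by scalars.\<close>

locale clifford_setting = char2_rep G V \<rho> P T \<Phi> v0 k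
  for G (structure) and V :: "'v :: ab_group_add set" and \<rho> :: "'a \<Rightarrow> 'v \<Rightarrow> 'v" and P T \<Phi> v0 k +
  fixes Z :: "'a set"
  assumes Z_central: "\<And>z s. z \<in> Z \<Longrightarrow> s \<in> P \<Longrightarrow> z \<otimes> s = s \<otimes> z"
    and small: "\<And>Q. subgroup Q G \<Longrightarrow> Q \<subseteq> P \<Longrightarrow> Q \<inter> Z = {\<one>} \<Longrightarrow> Q = {\<one>}"
    and normal_cases: "\<And>N. N \<lhd> G \<Longrightarrow> N \<inter> Z = {\<one>} \<or> P \<subseteq> N"
    and moved: "\<exists>g\<in>carrier G. \<rho> g v0 \<noteq> v0"
    and span: "\<And>U. subsp U \<Longrightarrow> (\<And>g. g \<in> carrier G \<Longrightarrow> \<rho> g v0 \<in> U) \<Longrightarrow> U = V"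
    and scalar: "\<And>f. endo f \<Longrightarrow> (\<And>g. g \<in> carrier G \<Longrightarrow> f (\<rho> g v0) \<in> {0, \<rho> g v0}) \<Longrightarrow>
      (\<forall>x\<in>V. f x = 0) \<or> (\<forall>x\<in>V. f x = x)"

text \<open>A conjugate of r is matched with a member of \<open>R\<close> on \<open>V\<close> only,
  since members of \<open>R\<close> are unconstrained outside \<open>V\<close>.\<close>

locale stable_algebra = clifford_setting G V \<rho> P T \<Phi> v0 k Z + char2_algebra V R
  for G (structure) and V :: "'v :: ab_group_add set" and \<rho> P T \<Phi> v0 k Z and R :: "('v \<Rightarrow> 'v) set" +
  assumes stable: "\<And>g r. g \<in> carrier G \<Longrightarrow> r \<in> R \<Longrightarrow> \<exists>r'\<in>R. \<forall>x\<in>V. r' x = \<rho> g (r (\<rho> (inv g) x))"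
begin

lemma stable':
  assumes "g \<in> carrier G" "r \<in> R"
  obtains r' where "r' \<in> R" "\<And>x. x \<in> V \<Longrightarrow> r' (\<rho> g x) = \<rho> g (r x)"
proof -
  obtain r' where r': "r' \<in> R" "\<forall>x\<in>V. r' x = \<rho> g (r (\<rho> (inv g) x))" using stable[OF assms] by blast
  then have "r' (\<rho> g x) = \<rho> g (r x)" if "x \<in> V" for x using that assms by (simp add: act_in)
  then show ?thesis using that r' by blast
qed

text \<open>If \<open>R\<close> preserves the line of \<open>v0\<close>, conjugation shows that it
  preserves the line of every translate, and \<open>scalar\<close> applies. Otherwise
  \<open>cyc v0\<close> is stable under \<open>P\<close> and \<open>T\<close>, which fix
  \<open>v0\<close> and normalize \<open>R\<close>, and \<open>socle\<close> applies.\<close>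

lemma scalar_or_socle:
  "(\<forall>r\<in>R. (\<forall>x\<in>V. r x = 0) \<or> (\<forall>x\<in>V. r x = x)) \<or> S2 \<subseteq> cyc v0"
proof (cases "cyc v0 \<subseteq> {0, v0}")
  case True
  have "(\<forall>x\<in>V. r x = 0) \<or> (\<forall>x\<in>V. r x = x)" if r: "r \<in> R" for r
  proof (rule scalar)
    show "endo r" using r R_endo by blast
    fix g assume g: "g \<in> carrier G"
    then obtain r' where r': "r' \<in> R" "\<And>x. x \<in> V \<Longrightarrow> r' (\<rho> (inv g) x) = \<rho> (inv g) (r x)"
      using stable'[OF inv_closed[OF g] r] by blast
    have "r' v0 = \<rho> (inv g) (r (\<rho> g v0))" using r'(2)[of "\<rho> g v0"] g v0 by (simp add: act_in)
    then have "\<rho> g (r' v0) = r (\<rho> g v0)" using g v0 r R_endo by (simp add: act_in endo_in)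
    moreover have "r' v0 \<in> {0, v0}" using True r' by (auto simp: cyc_def)
    ultimately show "r (\<rho> g v0) \<in> {0, \<rho> g v0}" using act_0[OF g] by auto
  qed
  then show ?thesis by blast
next
  case False
  have sub: "subsp (cyc v0)" using rsub_cyc[OF v0(1)] by (rule rsub_subsp)
  have "\<rho> s x \<in> cyc v0" if s: "s \<in> P \<union> T" and x: "x \<in> cyc v0" for s x
  proof -
    obtain r where r: "r \<in> R" "x = r v0" using x by (auto simp: cyc_def)
    have sG: "s \<in> carrier G" using s P_in T_in by blast
    obtain r' where "r' \<in> R" "\<And>x. x \<in> V \<Longrightarrow> r' (\<rho> s x) = \<rho> s (r x)" using stable'[OF sG r(1)] by blast
    then show ?thesis using r v0_fixed[OF s] v0 by (metis cyc_def imageI)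
  qed
  then show ?thesis using socle[OF sub] False by blast
qed

text \<open>If r' is r conjugated by the inverse of g, then r (g u) = g (r' u) on
  \<open>V\<close>.\<close>

lemma rsub_act_image:
  assumes U: "rsub U" and g: "g \<in> carrier G"
  shows "rsub (\<rho> g ` U)"
  unfolding rsub_def
proof (intro conjI ballI)
  show "subsp (\<rho> g ` U)" using subsp_image[OF rsub_subsp[OF U] g] .
  fix r x assume r: "r \<in> R" and "x \<in> \<rho> g ` U"
  then obtain u where u: "u \<in> U" "x = \<rho> g u" by blast
  have uV: "u \<in> V" using u U rsub_subsp subsp_in by blast
  obtain r' where r': "r' \<in> R" "\<And>x. x \<in> V \<Longrightarrow> r' (\<rho> (inv g) x) = \<rho> (inv g) (r x)"
    using stable'[OF inv_closed[OF g] r] by blast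
  have "r' u = \<rho> (inv g) (r x)" using r'(2)[of x] g u uV by (simp add: act_in)
  then have "\<rho> g (r' u) = r x" using g u uV r R_endo by (simp add: act_in endo_in)
  moreover have "r' u \<in> U" using rsub_act[OF U r'(1) u(1)] .
  ultimately show "r x \<in> \<rho> g ` U" by (metis imageI)
qed

lemma rsub_V': "rsub U \<Longrightarrow> U \<subseteq> V"
  using rsub_subsp by (auto simp: subsp_def)

lemma rsimple_act_image:
  assumes S: "rsimple S" and g: "g \<in> carrier G"
  shows "rsimple (\<rho> g ` S)"
proof -
  have Ssub: "rsub S" using S by (rule rsimple_rsub)
  have "\<rho> g ` S \<noteq> {0}"
  proof
    assume "\<rho> g ` S = {0}"
    then have "\<rho> (inv g) ` \<rho> g ` S = {0}" using act_0 g by simp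
    then show False using image_image_inv(2)[OF rsub_V'[OF Ssub] g] rsimple_ne[OF S] by simp
  qed
  moreover have "U = {0} \<or> U = \<rho> g ` S" if U: "rsub U" "U \<subseteq> \<rho> g ` S" for U
  proof -
    have "rsub (\<rho> (inv g) ` U)" using rsub_act_image U g by simp
    moreover have "\<rho> (inv g) ` U \<subseteq> S"
      using image_mono[OF U(2), of "\<rho> (inv g)"] image_image_inv(2)[OF rsub_V'[OF Ssub] g] by simp
    ultimately have "\<rho> (inv g) ` U = {0} \<or> \<rho> (inv g) ` U = S" using rsimple_cases[OF S] by blast
    moreover have "\<rho> g ` \<rho> (inv g) ` U = U" using image_image_inv(1)[OF rsub_V'[OF U(1)] g] .
    ultimately show ?thesis using act_0[OF g] by (metis image_empty image_insert)
  qed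
  ultimately show ?thesis using rsub_act_image[OF Ssub g] by (simp add: rsimple_def)
qed

text \<open>The map \<open>\<rho> g\<close> is linear over \<open>R\<close> only up to conjugation
  of the operators; in the conjugate of f by g this twist occurs twice and cancels.\<close>

lemma riso_act_image:
  assumes S: "rsub S" and iso: "riso S S'" and g: "g \<in> carrier G"
  shows "riso (\<rho> g ` S) (\<rho> g ` S')"
proof -
  obtain f where f: "rhom S f" "bij_betw f S S'" using iso by (auto simp: riso_def)
  have SV: "x \<in> V" if "x \<in> S" for x using that rsub_V'[OF S] by blast
  have fV: "f x \<in> V" if "x \<in> S" for x using that f(1) by (simp add: rhom_def)
  define h where "h = (\<lambda>x. \<rho> g (f (\<rho> (inv g) x)))"
  have h: "h (\<rho> g x) = \<rho> g (f x)" if "x \<in> S" for x using that SV g by (simp add: h_def)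
  have inj: "x = y" if "\<rho> g x = \<rho> g y" "x \<in> V" "y \<in> V" for x y
    using that g by (metis act_inv(2))
  have "bij_betw h (\<rho> g ` S) (\<rho> g ` S')"
  proof (rule bij_betw_imageI)
    show "inj_on h (\<rho> g ` S)"
    proof (rule inj_onI)
      fix x y assume "x \<in> \<rho> g ` S" "y \<in> \<rho> g ` S" and e: "h x = h y"
      then obtain a b where ab: "a \<in> S" "b \<in> S" "x = \<rho> g a" "y = \<rho> g b" by blast
      then have "f a = f b" using e h fV inj by metis
      then have "a = b" using ab f(2) by (meson bij_betw_def inj_onD)
      then show "x = y" using ab by simp
    qed
    have "h ` \<rho> g ` S = \<rho> g ` f ` S" unfolding image_image using h by (intro image_cong) auto
    then show "h ` \<rho> g ` S = \<rho> g ` S'" using f(2) by (simp add: bij_betw_def)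
  qed
  moreover have "rhom (\<rho> g ` S) h"
    unfolding rhom_def
  proof (intro conjI ballI)
    fix x assume "x \<in> \<rho> g ` S"
    then show "h x \<in> V" using h fV act_in[OF g] by auto
  next
    fix x y assume "x \<in> \<rho> g ` S" "y \<in> \<rho> g ` S"
    then obtain a b where ab: "a \<in> S" "b \<in> S" "x = \<rho> g a" "y = \<rho> g b" by blast
    then have "x + y = \<rho> g (a + b)" using SV act_add[OF g] by simp
    moreover have "a + b \<in> S" using ab S rsub_subsp subsp_add by blast
    moreover have "f (a + b) = f a + f b" using ab f(1) by (simp add: rhom_def)
    ultimately show "h (x + y) = h x + h y" using ab h fV act_add[OF g] by simp
  next
    fix r x assume r: "r \<in> R" and "x \<in> \<rho> g ` S"
    then obtain a where a: "a \<in> S" "x = \<rho> g a" by blast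
    obtain r' where r': "r' \<in> R" "\<And>x. x \<in> V \<Longrightarrow> r' (\<rho> (inv g) x) = \<rho> (inv g) (r x)"
      using stable'[OF inv_closed[OF g] r] by blast
    have *: "r (\<rho> g y) = \<rho> g (r' y)" if "y \<in> V" for y
    proof -
      have "r' y = \<rho> (inv g) (r (\<rho> g y))" using r'(2)[of "\<rho> g y"] g that by (simp add: act_in)
      then show ?thesis using g that r R_endo by (simp add: act_in endo_in)
    qed
    have "r' a \<in> S" using rsub_act[OF S r'(1) a(1)] .
    then have "h (r x) = \<rho> g (f (r' a))" using a * SV h by simp
    also have "f (r' a) = r' (f a)" using a f(1) r'(1) by (simp add: rhom_def)
    also have "\<rho> g (r' (f a)) = r (h x)" using * a fV h by simp
    finally show "h (r x) = r (h x)" .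
  qed
  ultimately show ?thesis unfolding riso_def by blast
qed

text \<open>A class of isomorphic simple submodules stands for the homogeneous component that is its
  \<open>sumset\<close>; \<open>G\<close> permutes these classes.\<close>

definition cls :: "'v set \<Rightarrow> 'v set set"
  where "cls S = {S'. rsimple S' \<and> riso S S'}"

definition rclasses :: "'v set set set"
  where "rclasses = cls ` {S. rsimple S}"

definition cact :: "'a \<Rightarrow> 'v set set \<Rightarrow> 'v set set"
  where "cact g x = (\<lambda>S. \<rho> g ` S) ` x"

lemma cls_self: "rsimple S \<Longrightarrow> S \<in> cls S"
  by (simp add: cls_def riso_refl rsimple_rsub)

lemma cls_eq: "rsimple S \<Longrightarrow> S' \<in> cls S \<Longrightarrow> cls S' = cls S"
proof -
  assume S: "rsimple S" "S' \<in> cls S"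
  then have 1: "riso S S'" "rsimple S'" by (auto simp: cls_def)
  then have "riso S' S" using riso_sym[OF rsimple_rsub[OF S(1)]] by blast
  then show ?thesis using 1 riso_trans unfolding cls_def by blast
qed

lemma class_simple: "x \<in> rclasses \<Longrightarrow> S \<in> x \<Longrightarrow> rsimple S"
  by (auto simp: rclasses_def cls_def)

lemma class_eq_cls: "x \<in> rclasses \<Longrightarrow> S \<in> x \<Longrightarrow> x = cls S"
  using cls_eq by (auto simp: rclasses_def)

lemma class_finite: "x \<in> rclasses \<Longrightarrow> finite x"
proof -
  assume "x \<in> rclasses"
  then have "x \<subseteq> {U. rsub U}" using class_simple rsimple_rsub by blast
  then show ?thesis using finite_rsubs finite_subset by blast
qed

lemma class_ne: "x \<in> rclasses \<Longrightarrow> \<exists>S. S \<in> x"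
  using cls_self by (auto simp: rclasses_def)

lemma cact_cls:
  assumes S: "rsimple S" and g: "g \<in> carrier G"
  shows "cact g (cls S) = cls (\<rho> g ` S)"
proof -
  have sub: "cact h (cls A) \<subseteq> cls (\<rho> h ` A)" if "rsimple A" "h \<in> carrier G" for A h
    using that rsimple_act_image riso_act_image rsimple_rsub by (auto simp: cact_def cls_def)
  have "S' \<in> cact g (cls S)" if S': "S' \<in> cls (\<rho> g ` S)" for S'
  proof -
    have "\<rho> (inv g) ` S' \<in> cls (\<rho> (inv g) ` \<rho> g ` S)"
      using sub[OF rsimple_act_image[OF S g] inv_closed[OF g]] S' by (auto simp: cact_def)
    moreover have "\<rho> (inv g) ` \<rho> g ` S = S"
      using image_image_inv(2)[OF rsub_V'[OF rsimple_rsub[OF S]] g] .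
    moreover have "\<rho> g ` \<rho> (inv g) ` S' = S'"
      using S' by (intro image_image_inv(1)[OF rsub_V' g]) (auto simp: cls_def rsimple_rsub)
    ultimately show ?thesis unfolding cact_def by (metis imageI)
  qed
  then show ?thesis using sub[OF S g] by blast
qed

lemma cact_in: "g \<in> carrier G \<Longrightarrow> x \<in> rclasses \<Longrightarrow> cact g x \<in> rclasses"
  using cact_cls rsimple_act_image by (auto simp: rclasses_def)

lemma cact_mult:
  assumes "g \<in> carrier G" "h \<in> carrier G" "x \<in> rclasses"
  shows "cact (g \<otimes> h) x = cact g (cact h x)"
proof -
  have "\<rho> (g \<otimes> h) ` S = \<rho> g ` \<rho> h ` S" if "S \<in> x" for S
  proof -
    have "y \<in> V" if "y \<in> S" for y
      using that \<open>S \<in> x\<close> class_simple[OF assms(3)] rsimple_rsub rsub_V' by blast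
    then show ?thesis unfolding image_image using assms by (intro image_cong) (auto simp: act_mult)
  qed
  then show ?thesis unfolding cact_def image_image[of "\<lambda>S. \<rho> g ` S"] by (rule image_cong[OF refl])
qed

lemma cact_one: "x \<in> rclasses \<Longrightarrow> cact \<one> x = x"
proof -
  assume x: "x \<in> rclasses"
  have "\<rho> \<one> ` S = S" if "S \<in> x" for S
  proof -
    have "y \<in> V" if "y \<in> S" for y
      using that \<open>S \<in> x\<close> class_simple[OF x] rsimple_rsub rsub_V' by blast
    then show ?thesis by (simp add: act_one)
  qed
  then show ?thesis by (simp add: cact_def)
qed

lemma cact_inv:
  assumes "g \<in> carrier G" "x \<in> rclasses"
  shows "cact (inv g) (cact g x) = x" "cact g (cact (inv g) x) = x"
  using assms by (simp_all add: cact_mult[symmetric] cact_one)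

lemma sumset_act:
  assumes \<S>: "\<And>S. S \<in> \<S> \<Longrightarrow> rsub S" and g: "g \<in> carrier G" and u: "u \<in> sumset \<S>"
  shows "\<rho> g u \<in> sumset ((\<lambda>S. \<rho> g ` S) ` \<S>)"
proof -
  let ?A = "sumset ((\<lambda>S. \<rho> g ` S) ` \<S>)"
  have A: "rsub ?A" using \<S> rsub_act_image[OF _ g] by (intro rsub_sumset) auto
  have "sumset \<S> \<subseteq> \<rho> (inv g) ` ?A"
  proof (rule sumset_least)
    show "rsub (\<rho> (inv g) ` ?A)" using rsub_act_image[OF A] g by simp
    fix S assume S: "S \<in> \<S>"
    then have "\<rho> g ` S \<subseteq> ?A" by (intro sumset_upper) auto
    then have "\<rho> (inv g) ` \<rho> g ` S \<subseteq> \<rho> (inv g) ` ?A" by blast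
    then show "S \<subseteq> \<rho> (inv g) ` ?A" using image_image_inv(2)[OF rsub_V'[OF \<S>[OF S]] g] by simp
  qed
  then obtain a where a: "a \<in> ?A" "u = \<rho> (inv g) a" using u by blast
  then show ?thesis using rsub_V'[OF A] g by (metis act_inv(1) subsetD)
qed

text \<open>The intersection of the two sums is a nonzero submodule, and a simple submodule of it is
  isomorphic to a member of each family. This is the independence of homogeneous components.\<close>

lemma common_class:
  assumes "finite \<A>" "\<And>S. S \<in> \<A> \<Longrightarrow> rsimple S" "finite \<B>" "\<And>S. S \<in> \<B> \<Longrightarrow> rsimple S"
    and u: "u \<in> sumset \<A>" "u \<in> sumset \<B>" "u \<noteq> 0"
  obtains A B where "A \<in> \<A>" "B \<in> \<B>" "cls A = cls B"
proof -
  have "rsub (sumset \<A> \<inter> sumset \<B>)"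
    using assms rsimple_rsub by (intro rsub_Int rsub_sumset) blast+
  moreover have "sumset \<A> \<inter> sumset \<B> \<noteq> {0}" using u by blast
  ultimately obtain S where S: "rsimple S" "S \<subseteq> sumset \<A> \<inter> sumset \<B>" by (rule ex_rsimple)
  obtain A where A: "A \<in> \<A>" "riso S A" using rsimple_in_sumset[OF assms(1,2) S(1)] S(2) by auto
  obtain B where B: "B \<in> \<B>" "riso S B" using rsimple_in_sumset[OF assms(3,4) S(1)] S(2) by auto
  have "A \<in> cls S" "B \<in> cls S" using A B assms by (auto simp: cls_def)
  then have "cls A = cls B" using cls_eq[OF S(1)] by simp
  then show ?thesis using that A B by blast
qed

text \<open>Left multiplication by an element of \<open>P\<close> permutes the summands, so the
  trace of u over \<open>P\<close> is a fixed vector.\<close>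

lemma sum_fixed:
  assumes u: "u \<in> V"
  shows "(\<Sum>s\<in>P. \<rho> s u) \<in> {0, v0}"
proof (rule fixed)
  show "(\<Sum>s\<in>P. \<rho> s u) \<in> V" using u act_in P_in by (intro subsp_sum[OF subsp_V]) auto
  fix t assume t: "t \<in> P"
  have "\<rho> t (\<Sum>s\<in>P. \<rho> s u) = (\<Sum>s\<in>P. \<rho> t (\<rho> s u))"
    using u act_in P_in t by (intro endo_sum endo_act) auto
  also have "\<dots> = (\<Sum>s\<in>P. \<rho> (t \<otimes> s) u)" using u P_in t by (simp add: act_mult)
  also have "\<dots> = (\<Sum>s\<in>P. \<rho> s u)"
  proof (rule sum.reindex_bij_witness[of _ "\<lambda>s. inv t \<otimes> s" "\<lambda>s. t \<otimes> s"])
    fix s assume s: "s \<in> P"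
    show "inv t \<otimes> (t \<otimes> s) = s" using s t P_in by (simp add: m_assoc[symmetric])
    show "t \<otimes> (inv t \<otimes> s) = s" using s t P_in by (simp add: m_assoc[symmetric])
    show "t \<otimes> s \<in> P" "inv t \<otimes> s \<in> P"
      using s t P subgroup.m_closed subgroup.m_inv_closed by metis+
  qed simp
  finally show "\<rho> t (\<Sum>s\<in>P. \<rho> s u) = (\<Sum>s\<in>P. \<rho> s u)" .
qed

text \<open>Otherwise \<open>P\<close> would permute the homogeneous components regularly; they would then be
  lines, and the sum of their nonzero vectors would be fixed by \<open>G\<close>.\<close>

lemma ex_fixed_class: "\<exists>x\<in>rclasses. \<forall>s\<in>P. cact s x = x"
proof (rule ccontr)
  assume none: "\<not> (\<exists>x\<in>rclasses. \<forall>s\<in>P. cact s x = x)"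
  have finP: "finite P" using card_P by (metis card.infinite power_eq_0_iff zero_neq_numeral)
  have V0: "V \<noteq> {0}" using v0 by blast
  obtain S0 where S0: "rsimple S0" using ex_rsimple[OF rsub_V V0] by blast
  define x where "x = cls S0"
  have x: "x \<in> rclasses" using S0 by (auto simp: x_def rclasses_def)
  define orb where "orb y = (\<Union>s\<in>P. cact s y)" for y
  have orb: "finite (orb y)" "\<And>S. S \<in> orb y \<Longrightarrow> rsimple S" if "y \<in> rclasses" for y
    using that finP cact_in class_finite class_simple P_in unfolding orb_def by blast+
  \<comment> \<open>The sum of a P-orbit of classes is a nonzero P-stable subspace.\<close>
  have v0_orb: "v0 \<in> sumset (orb y)" if y: "y \<in> rclasses" for y
  proof (rule v0_in_subsp)
    have r: "rsub (sumset (orb y))" using orb(2)[OF y] rsimple_rsub by (intro rsub_sumset) blast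
    then show "subsp (sumset (orb y))" by (rule rsub_subsp)
    obtain S where S: "S \<in> y" using class_ne[OF y] by blast
    then have "S \<in> cact \<one> y" using cact_one[OF y] by simp
    then have "S \<in> orb y" using subgroup.one_closed[OF P] unfolding orb_def by blast
    then show "sumset (orb y) \<noteq> {0}"
      using sumset_upper[of S "orb y"] rsimple_ne[OF class_simple[OF y S]]
        subsp_0[OF rsub_subsp[OF rsimple_rsub[OF class_simple[OF y S]]]] by blast
    fix t u assume t: "t \<in> P" and u: "u \<in> sumset (orb y)"
    have "(\<lambda>S. \<rho> t ` S) ` orb y = (\<Union>s\<in>P. cact (t \<otimes> s) y)"
      using t P_in y by (auto simp: orb_def cact_mult) (auto simp: cact_def)
    also have "\<dots> \<subseteq> orb y" using t subgroup.m_closed[OF P] unfolding orb_def by blast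
    finally have sub: "(\<lambda>S. \<rho> t ` S) ` orb y \<subseteq> orb y" .
    have "\<rho> t u \<in> sumset ((\<lambda>S. \<rho> t ` S) ` orb y)"
      using orb(2)[OF y] rsimple_rsub by (intro sumset_act[OF _ P_in[OF t] u]) blast
    moreover have "sumset ((\<lambda>S. \<rho> t ` S) ` orb y) \<subseteq> sumset (orb y)"
      using sub sumset_upper by (intro sumset_least[OF r]) blast
    ultimately show "\<rho> t u \<in> sumset (orb y)" by blast
  qed
  \<comment> \<open>Both orbit sums contain \<open>v0\<close>, so the two orbits share a class;
    hence there is only one orbit.\<close>
  have trans: "\<exists>s\<in>P. cact s x = y" if y: "y \<in> rclasses" for y
  proof -
    obtain A B where AB: "A \<in> orb x" "B \<in> orb y" "cls A = cls B"
      using common_class[OF orb[OF x] orb[OF y] v0_orb[OF x] v0_orb[OF y] v0(2)] .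
    obtain s t where st: "s \<in> P" "t \<in> P" "A \<in> cact s x" "B \<in> cact t y"
      using AB unfolding orb_def by blast
    have "cact s x = cact t y"
      using class_eq_cls[OF cact_in[OF P_in[OF st(1)] x] st(3)]
        class_eq_cls[OF cact_in[OF P_in[OF st(2)] y] st(4)] AB(3) by simp
    then have "cact (inv t) (cact s x) = y" using cact_inv P_in[OF st(2)] y by simp
    then have "cact (inv t \<otimes> s) x = y" using P_in st x by (simp add: cact_mult)
    moreover have "inv t \<otimes> s \<in> P" using st P by (simp add: subgroup.m_closed subgroup.m_inv_closed)
    ultimately show ?thesis by blast
  qed
  \<comment> \<open>The kernel of the action of \<open>G\<close> on the classes. It cannot contain
    \<open>P\<close>, which fixes no class, so it meets \<open>Z\<close> trivially.\<close>
  define N where "N = {g \<in> carrier G. \<forall>y\<in>rclasses. cact g y = y}"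
  have N: "subgroup N G"
  proof (rule subgroupI)
    show "N \<subseteq> carrier G" by (auto simp: N_def)
    show "N \<noteq> {}" using cact_one by (auto simp: N_def)
    show "inv a \<in> N" if "a \<in> N" for a
    proof -
      have "cact (inv a) y = y" if "y \<in> rclasses" for y
        using cact_inv(1)[of a y] \<open>a \<in> N\<close> that by (simp add: N_def)
      then show ?thesis using that by (simp add: N_def)
    qed
    show "a \<otimes> b \<in> N" if "a \<in> N" "b \<in> N" for a b
      using that by (simp add: N_def cact_mult)
  qed
  have "N \<lhd> G"
    unfolding normal_inv_iff
  proof (intro conjI N ballI)
    fix g h assume g: "g \<in> carrier G" and h: "h \<in> N"
    have hG: "h \<in> carrier G" using h by (simp add: N_def)
    have "cact (g \<otimes> h \<otimes> inv g) y = y" if y: "y \<in> rclasses" for y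
    proof -
      have "cact (g \<otimes> h \<otimes> inv g) y = cact g (cact h (cact (inv g) y))"
        using g hG y by (simp add: cact_mult cact_in)
      also have "cact h (cact (inv g) y) = cact (inv g) y" using h cact_in g y by (simp add: N_def)
      finally show ?thesis using cact_inv g y by simp
    qed
    then show "g \<otimes> h \<otimes> inv g \<in> N" using g hG by (simp add: N_def)
  qed
  then have "N \<inter> Z = {\<one>} \<or> P \<subseteq> N" by (rule normal_cases)
  moreover have "\<not> P \<subseteq> N" using none x by (auto simp: N_def)
  ultimately have NZ: "N \<inter> Z = {\<one>}" by blast
  \<comment> \<open>By transitivity an element of \<open>Z\<close> that fixes x fixes every class.
    The stabilizer of x in \<open>P\<close> therefore meets \<open>Z\<close> trivially and is
    trivial itself: \<open>P\<close> acts regularly on the classes.\<close>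
  define Q where "Q = {s \<in> P. cact s x = x}"
  have Q: "subgroup Q G"
  proof (rule subgroupI)
    show "Q \<subseteq> carrier G" using P_in by (auto simp: Q_def)
    show "Q \<noteq> {}" using cact_one[OF x] subgroup.one_closed[OF P] by (auto simp: Q_def)
    show "inv a \<in> Q" if "a \<in> Q" for a
      using cact_inv(1)[of a x] that x P_in subgroup.m_inv_closed[OF P] by (simp add: Q_def)
    show "a \<otimes> b \<in> Q" if "a \<in> Q" "b \<in> Q" for a b
      using that x P_in subgroup.m_closed[OF P] by (simp add: Q_def cact_mult)
  qed
  have "z \<in> N" if z: "z \<in> Q \<inter> Z" for z
  proof -
    have zP: "z \<in> P" "cact z x = x" using z by (auto simp: Q_def)
    have "cact z y = y" if y: "y \<in> rclasses" for y
    proof -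
      obtain s where s: "s \<in> P" "y = cact s x" using trans[OF y] by blast
      have "cact z (cact s x) = cact (z \<otimes> s) x" using zP s P_in x by (simp add: cact_mult)
      also have "\<dots> = cact (s \<otimes> z) x" using Z_central z s by simp
      also have "\<dots> = cact s x" using zP s P_in x by (simp add: cact_mult)
      finally show ?thesis using s by simp
    qed
    then show ?thesis using zP P_in by (simp add: N_def)
  qed
  then have "Q \<inter> Z = {\<one>}" using NZ subgroup.one_closed[OF Q] by blast
  then have Q1: "Q = {\<one>}" using small[OF Q] by (auto simp: Q_def)
  have inj: "inj_on (\<lambda>s. cact s x) P"
  proof (rule inj_onI)
    fix s t assume st: "s \<in> P" "t \<in> P" "cact s x = cact t x"
    have "cact (inv t \<otimes> s) x = x" using st P_in x cact_inv by (simp add: cact_mult)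
    then have "inv t \<otimes> s \<in> Q" using st P by (simp add: Q_def subgroup.m_closed subgroup.m_inv_closed)
    then have "inv t \<otimes> s = \<one>" using Q1 by simp
    then show "s = t" using st P_in by (metis inv_solve_left' r_one one_closed inv_closed inv_inv l_one m_closed inv_equality inv_comm)
  qed
  have bij: "bij_betw (\<lambda>s. cact s x) P rclasses"
    using inj trans cact_in[OF P_in x] by (auto simp: bij_betw_def)
  have comp_sub: "sumset y \<subseteq> V" if "y \<in> rclasses" for y
    using that class_simple rsimple_rsub by (intro sumset_least rsub_V rsub_V') blast
  have comp_rsub: "rsub (sumset y)" if "y \<in> rclasses" for y
    using that class_simple rsimple_rsub by (intro rsub_sumset) blast
  have comp_act: "\<rho> g u \<in> sumset (cact g y)" if "g \<in> carrier G" "y \<in> rclasses" "u \<in> sumset y" for g y u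
    unfolding cact_def using that class_simple rsimple_rsub by (intro sumset_act) blast+
  \<comment> \<open>If the trace vanished, u would be the sum of its translates in the other
    components, against independence.\<close>
  have sum_x: "(\<Sum>s\<in>P. \<rho> s u) = v0" if u: "u \<in> sumset x" "u \<noteq> 0" for u
  proof (rule ccontr)
    assume neq: "(\<Sum>s\<in>P. \<rho> s u) \<noteq> v0"
    have uV: "u \<in> V" using u comp_sub[OF x] by blast
    have "(\<Sum>s\<in>P. \<rho> s u) = 0" using sum_fixed[OF uV] neq by simp
    moreover have "(\<Sum>s\<in>P. \<rho> s u) = u + (\<Sum>s\<in>P - {\<one>}. \<rho> s u)"
      using sum.remove[OF finP subgroup.one_closed[OF P], of "\<lambda>s. \<rho> s u"] act_one[OF uV] by simp
    ultimately have eq: "u = (\<Sum>s\<in>P - {\<one>}. \<rho> s u)" by (simp add: add_eq_0_iff2)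
    define \<B> where "\<B> = (\<Union>s\<in>P - {\<one>}. cact s x)"
    have B: "finite \<B>" "\<And>S. S \<in> \<B> \<Longrightarrow> rsimple S"
      using finP cact_in x class_finite class_simple P_in unfolding \<B>_def by blast+
    have rB: "rsub (sumset \<B>)" using B(2) rsimple_rsub by (intro rsub_sumset) blast
    have "\<rho> s u \<in> sumset \<B>" if "s \<in> P - {\<one>}" for s
    proof -
      have "\<rho> s u \<in> sumset (cact s x)" using comp_act that P_in x u by blast
      moreover have "sumset (cact s x) \<subseteq> sumset \<B>"
      proof (rule sumset_least[OF rB])
        fix S assume "S \<in> cact s x"
        then have "S \<in> \<B>" using that unfolding \<B>_def by blast
        then show "S \<subseteq> sumset \<B>" by (rule sumset_upper)
      qed
      ultimately show ?thesis by blast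
    qed
    then have "u \<in> sumset \<B>" using eq subsp_sum[OF rsub_subsp[OF rB]] by metis
    then obtain A B where AB: "A \<in> x" "B \<in> \<B>" "cls A = cls B"
      using common_class[OF class_finite[OF x] class_simple[OF x] B u(1) _ u(2)] by blast
    obtain s where s: "s \<in> P" "s \<noteq> \<one>" "B \<in> cact s x" using AB unfolding \<B>_def by blast
    have "x = cact s x" using AB class_eq_cls[OF x] class_eq_cls[OF cact_in[OF P_in[OF s(1)] x] s(3)] by simp
    then have "s \<in> Q" using s by (simp add: Q_def)
    then show False using Q1 s by simp
  qed
  \<comment> \<open>For distinct nonzero u and u' the sum u + u' is nonzero, and its trace would be
    both \<open>v0\<close> and v0 + v0 = 0.\<close>
  have uniq_x: "u = u'" if u: "u \<in> sumset x" "u \<noteq> 0" "u' \<in> sumset x" "u' \<noteq> 0" for u u'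
  proof (rule ccontr)
    assume neq: "u \<noteq> u'"
    then have ne: "u + u' \<noteq> 0" by (simp add: add_eq_0_iff2)
    have in': "u + u' \<in> sumset x" using u subsp_add[OF rsub_subsp[OF comp_rsub[OF x]]] by blast
    have "v0 = (\<Sum>s\<in>P. \<rho> s (u + u'))" using sum_x[OF in' ne] by simp
    also have "\<dots> = (\<Sum>s\<in>P. \<rho> s u + \<rho> s u')"
      using u comp_sub[OF x] act_add P_in by (intro sum.cong) (auto simp: subset_iff)
    also have "\<dots> = v0 + v0" using u sum_x by (simp add: sum.distrib)
    finally show False using v0 by simp
  qed
  have uniq: "u = u'" if y: "y \<in> rclasses" and u: "u \<in> sumset y" "u \<noteq> 0" "u' \<in> sumset y" "u' \<noteq> 0" for y u u'
  proof -
    obtain s where s: "s \<in> P" "y = cact s x" using trans[OF y] by blast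
    have sG: "inv s \<in> carrier G" "s \<in> carrier G" using s P_in by auto
    have x': "cact (inv s) y = x" using s sG cact_inv x by simp
    have V': "u \<in> V" "u' \<in> V" using u comp_sub[OF y] by blast+
    have "\<rho> (inv s) u \<in> sumset x" "\<rho> (inv s) u' \<in> sumset x"
      using comp_act[OF sG(1) y] u x' by auto
    moreover have "\<rho> (inv s) u \<noteq> 0" "\<rho> (inv s) u' \<noteq> 0"
      using act_inv(1)[OF sG(2)] V' u act_0[OF sG(2)] by metis+
    ultimately have "\<rho> (inv s) u = \<rho> (inv s) u'" using uniq_x by blast
    then show ?thesis using act_inv(1)[OF sG(2)] V' by metis
  qed
  have nz: "\<exists>u. u \<in> sumset y \<and> u \<noteq> 0" if y: "y \<in> rclasses" for y
  proof -
    obtain S where S: "S \<in> y" using class_ne[OF y] by blast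
    have "rsimple S" using class_simple[OF y S] .
    then obtain u where "u \<in> S" "u \<noteq> 0"
      using rsimple_ne subsp_0[OF rsub_subsp[OF rsimple_rsub]] by blast
    then show ?thesis using sumset_upper[OF S] by blast
  qed
  then obtain e where e: "\<And>y. y \<in> rclasses \<Longrightarrow> e y \<in> sumset y" "\<And>y. y \<in> rclasses \<Longrightarrow> e y \<noteq> 0" by metis
  have eV: "e y \<in> V" if "y \<in> rclasses" for y using e(1)[OF that] comp_sub[OF that] by blast
  \<comment> \<open>Each component contains a single nonzero vector, so \<open>G\<close> permutes
    these vectors as it permutes the classes.\<close>
  have e_act: "\<rho> g (e y) = e (cact g y)" if g: "g \<in> carrier G" and y: "y \<in> rclasses" for g y
  proof (rule uniq[OF cact_in[OF g y]])
    show "\<rho> g (e y) \<in> sumset (cact g y)" using comp_act[OF g y e(1)[OF y]] .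
    show "\<rho> g (e y) \<noteq> 0" using act_inv(2)[OF g eV[OF y]] act_0[OF inv_closed[OF g]] e(2)[OF y] by metis
  qed (use e cact_in[OF g y] in auto)
  \<comment> \<open>By regularity the translates of \<open>e x\<close> run once through all
    components; their sum is visibly invariant under \<open>G\<close>.\<close>
  have v0_sum: "v0 = (\<Sum>y\<in>rclasses. e y)"
  proof -
    have "v0 = (\<Sum>s\<in>P. \<rho> s (e x))" using sum_x e x by simp
    also have "\<dots> = (\<Sum>s\<in>P. e (cact s x))" using e_act P_in x by simp
    also have "\<dots> = (\<Sum>y\<in>rclasses. e y)" using sum.reindex_bij_betw[OF bij] .
    finally show ?thesis .
  qed
  have "\<rho> g v0 = v0" if g: "g \<in> carrier G" for g
  proof -
    have "\<rho> g v0 = (\<Sum>y\<in>rclasses. \<rho> g (e y))"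
      unfolding v0_sum using eV by (intro endo_sum endo_act g)
    also have "\<dots> = (\<Sum>y\<in>rclasses. e (cact g y))" using e_act g by simp
    also have "\<dots> = (\<Sum>y\<in>rclasses. e y)"
      by (rule sum.reindex_bij_witness[of _ "cact (inv g)" "cact g"]) (use g cact_inv cact_in in auto)
    finally show ?thesis using v0_sum by simp
  qed
  then show False using moved by blast
qed

end

section \<open>Counting the copies of a simple module\<close>

context char2_algebra
begin

text \<open>Homomorphisms from \<open>S\<close> to \<open>V\<close> come in pairs f, f + id, so the
  nonzero ones are odd in number. Each of them is an isomorphism onto a submodule of the class, and
  all submodules of the class are reached equally often; their number therefore divides an odd
  number.\<close>

lemma odd_card_class:
  assumes S: "rsimple S"
  shows "odd (card {S'. rsimple S' \<and> riso S S'})"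
proof -
  let ?x = "{S'. rsimple S' \<and> riso S S'}"
  have Ssub: "rsub S" using S by (rule rsimple_rsub)
  have SV: "S \<subseteq> V" using Ssub by (auto simp: rsub_def subsp_def)
  \<comment> \<open>Extensional functions, so that the homomorphisms form a finite set.\<close>
  define \<H> where "\<H> = {f \<in> S \<rightarrow>\<^sub>E V. rhom S f}"
  define zr where "zr = (\<lambda>x\<in>S. 0 :: 'v)"
  define Fib where "Fib S' = {f \<in> \<H>. bij_betw f S S'}" for S'
  have finS: "finite S" using SV fin finite_subset by blast
  have fH: "finite \<H>" 
    unfolding \<H>_def using finite_PiE[OF finS, of "\<lambda>_. V"] fin by simp
  have Scl: "x + y \<in> S" "r \<in> R \<Longrightarrow> r x \<in> S" if "x \<in> S" "y \<in> S" for r x y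
    using that(1) subsp_add[OF rsub_subsp[OF Ssub] that] rsub_act[OF Ssub] by simp_all
  have zr: "zr \<in> \<H>" using R_0 Scl unfolding \<H>_def zr_def rhom_def by simp
  have add_closed: "(\<lambda>x\<in>S. f x + x) \<in> \<H>" if f: "f \<in> \<H>" for f
  proof -
    have "f (x + y) + (x + y) = (f x + x) + (f y + y)" if "x \<in> S" "y \<in> S" for x y
      using f that by (simp add: \<H>_def rhom_def algebra_simps)
    moreover have "f (r x) + r x = r (f x + x)" if "x \<in> S" "r \<in> R" for x r
    proof -
      have "f x \<in> V" "x \<in> V" using f that SV by (auto simp: \<H>_def rhom_def)
      then have "r (f x + x) = r (f x) + r x" using R_endo[OF that(2)] by (simp add: endo_add)
      then show ?thesis using f that by (simp add: \<H>_def rhom_def)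
    qed
    moreover have "f x + x \<in> V" if "x \<in> S" for x using f that SV by (auto simp: \<H>_def rhom_def)
    moreover have "x + y \<in> S" if "x \<in> S" "y \<in> S" for x y using subsp_add[OF rsub_subsp[OF Ssub] that] .
    moreover have "r x \<in> S" if "r \<in> R" "x \<in> S" for r x using rsub_act[OF Ssub that] .
    ultimately show ?thesis unfolding \<H>_def rhom_def by simp
  qed
  obtain u where u: "u \<in> S" "u \<noteq> 0" using rsimple_ne[OF S] subsp_0[OF rsub_subsp[OF Ssub]] by blast
  have "even (card \<H>)"
  proof (rule even_card_involution[of _ "\<lambda>f. \<lambda>x\<in>S. f x + x"])
    show "finite \<H>" by (rule fH)
    fix f assume f: "f \<in> \<H>"
    show "(\<lambda>x\<in>S. f x + x) \<in> \<H>" using add_closed[OF f] .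
    show "(\<lambda>x\<in>S. (\<lambda>x\<in>S. f x + x) x + x) = f"
    proof
      fix x show "(\<lambda>x\<in>S. (\<lambda>x\<in>S. f x + x) x + x) x = f x"
      proof (cases "x \<in> S")
        case False
        then show ?thesis using f PiE_arb[of f S "\<lambda>_. V" x] by (simp add: \<H>_def)
      qed (simp add: add.assoc)
    qed
    show "(\<lambda>x\<in>S. f x + x) \<noteq> f"
    proof
      assume "(\<lambda>x\<in>S. f x + x) = f"
      from fun_cong[OF this, of u] show False using u by simp
    qed
  qed
  moreover have "card \<H> = card (\<H> - {zr}) + 1" using zr fH by (metis card.remove add.commute plus_1_eq_Suc)
  ultimately have odd: "odd (card (\<H> - {zr}))" by simp
  have "\<H> - {zr} = (\<Union>S'\<in>?x. Fib S')"
  proof (rule equalityI; rule subsetI)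
    fix f assume f: "f \<in> \<H> - {zr}"
    then have hom: "rhom S f" by (simp add: \<H>_def)
    have "\<not> (\<forall>x\<in>S. f x = 0)"
    proof
      assume "\<forall>x\<in>S. f x = 0"
      then have "f = zr" using f zr by (intro PiE_ext[of f S "\<lambda>_. V" zr]) (auto simp: \<H>_def zr_def)
      then show False using f by simp
    qed
    then have inj: "inj_on f S" using rhom_simple_cases[OF S hom] by blast
    then show "f \<in> (\<Union>S'\<in>?x. Fib S')" using f rsimple_image[OF S hom inj]
      by (auto simp: Fib_def bij_betw_def)
  next
    fix f assume "f \<in> (\<Union>S'\<in>?x. Fib S')"
    then obtain S' where S': "rsimple S'" "f \<in> \<H>" "bij_betw f S S'" by (auto simp: Fib_def)
    have "f \<noteq> zr"
    proof
      assume "f = zr"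
      then have "f u = f 0" "0 \<in> S" using u subsp_0[OF rsub_subsp[OF Ssub]] by (auto simp: zr_def)
      then show False using S'(3) u by (metis bij_betw_def inj_onD)
    qed
    then show "f \<in> \<H> - {zr}" using S' by simp
  qed
  moreover have "card (\<Union>S'\<in>?x. Fib S') = (\<Sum>S'\<in>?x. card (Fib S'))"
  proof (rule card_UN_disjoint)
    show "finite ?x" by (rule finite_subset[OF _ finite_rsubs]) (auto simp: rsimple_rsub)
    show "\<forall>i\<in>?x. finite (Fib i)" using fH by (simp add: Fib_def)
    show "\<forall>i\<in>?x. \<forall>j\<in>?x. i \<noteq> j \<longrightarrow> Fib i \<inter> Fib j = {}" by (auto simp: Fib_def bij_betw_def)
  qed
  \<comment> \<open>Composing with an isomorphism from S to S', and with one back, gives both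
    inequalities.\<close>
  moreover have "card (Fib S') = card (Fib S)" if S': "S' \<in> ?x" for S'
  proof -
    obtain h where h: "rhom S h" "bij_betw h S S'" using S' by (auto simp: riso_def)
    have "riso S' S" using riso_sym[OF Ssub] S' by blast
    then obtain h' where h': "rhom S' h'" "bij_betw h' S' S" by (auto simp: riso_def)
    have S'V: "S' \<subseteq> V" using S' rsimple_rsub by (auto simp: rsub_def subsp_def)
    have comp: "card (Fib A) \<le> card (Fib B)"
      if A: "A \<subseteq> V" and B: "B \<subseteq> V" and g: "rhom A g" "bij_betw g A B" for A B g
    proof (rule card_inj_on_le[of "\<lambda>f. \<lambda>x\<in>S. g (f x)"])
      show "finite (Fib B)" using fH by (simp add: Fib_def)
      show "inj_on (\<lambda>f. \<lambda>x\<in>S. g (f x)) (Fib A)"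
      proof (rule inj_onI)
        fix f f' assume ff: "f \<in> Fib A" "f' \<in> Fib A" and eq: "(\<lambda>x\<in>S. g (f x)) = (\<lambda>x\<in>S. g (f' x))"
        have "f x = f' x" if "x \<in> S" for x
        proof -
          have "g (f x) = g (f' x)" using fun_cong[OF eq, of x] that by simp
          moreover have "f x \<in> A" "f' x \<in> A" using ff that by (auto simp: Fib_def bij_betw_def)
          ultimately show ?thesis using g(2) by (meson bij_betw_def inj_onD)
        qed
        then show "f = f'" using ff by (auto simp: Fib_def \<H>_def intro: PiE_ext)
      qed
      show "(\<lambda>f. \<lambda>x\<in>S. g (f x)) ` Fib A \<subseteq> Fib B"
      proof (intro image_subsetI)
        fix f assume f: "f \<in> Fib A"
        have fA: "f x \<in> A" if "x \<in> S" for x using f that by (auto simp: Fib_def bij_betw_def)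
        have "bij_betw (\<lambda>x\<in>S. g (f x)) S B"
          using bij_betw_trans[of f S A g B] f g(2) by (simp add: Fib_def o_def bij_betw_restrict_eq)
        moreover have "rhom S (\<lambda>x\<in>S. g (f x))"
        proof -
          have "rhom S f" using f by (simp add: Fib_def \<H>_def)
          then show ?thesis using g(1) fA Scl unfolding rhom_def by simp
        qed
        ultimately show "(\<lambda>x\<in>S. g (f x)) \<in> Fib B"
          by (auto simp: Fib_def \<H>_def rhom_def)
      qed
    qed
    show ?thesis using comp[OF SV S'V h] comp[OF S'V SV h'] by simp
  qed
  ultimately have "card (\<H> - {zr}) = card ?x * card (Fib S)" by simp
  then show ?thesis using odd by simp
qed

end

section \<open>The cyclic module of the fixed vector and the commutant\<close>

context stable_algebra
begin

text \<open>\<open>P\<close> acts on the members of a P-fixed class, and their number is odd, so it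
  stabilizes one of them. That member is P-stable and nonzero, so it contains \<open>v0\<close>, and
  being simple it is generated by \<open>v0\<close>.\<close>

lemma rsimple_cyc: "rsimple (cyc v0)"
proof -
  obtain x where x: "x \<in> rclasses" "\<And>s. s \<in> P \<Longrightarrow> cact s x = x" using ex_fixed_class by blast
  obtain S0 where S0: "S0 \<in> x" using class_ne[OF x(1)] by blast
  have "odd (card x)"
    using odd_card_class[OF class_simple[OF x(1) S0]] class_eq_cls[OF x(1) S0] by (simp add: cls_def)
  moreover have "even (card x) \<longleftrightarrow> even (card {S \<in> x. \<forall>s\<in>P. \<rho> s ` S = S})"
  proof (rule even_card_iff_fixed_subgroup[OF P card_P class_finite[OF x(1)]])
    have xV: "y \<in> V" if "S \<in> x" "y \<in> S" for S y
      using that class_simple[OF x(1)] rsimple_rsub rsub_V' by blast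
    show "\<rho> s ` S \<in> x" if "s \<in> P" "S \<in> x" for s S
      using x(2)[OF that(1)] that(2) unfolding cact_def by blast
    show "\<rho> \<one> ` S = S" if "S \<in> x" for S using xV[OF that] by (simp add: act_one)
    show "\<rho> (s \<otimes> t) ` S = \<rho> s ` \<rho> t ` S" if "s \<in> P" "t \<in> P" "S \<in> x" for s t S
      unfolding image_image using xV[OF that(3)] that P_in by (intro image_cong) (auto simp: act_mult)
  qed
  ultimately have "{S \<in> x. \<forall>s\<in>P. \<rho> s ` S = S} \<noteq> {}" by (metis card.empty even_zero)
  then obtain S where S: "S \<in> x" "\<And>s. s \<in> P \<Longrightarrow> \<rho> s ` S = S" by blast
  have simple: "rsimple S" using class_simple[OF x(1) S(1)] .
  have "v0 \<in> S"
    using S(2) rsimple_ne[OF simple] by (intro v0_in_subsp rsub_subsp rsimple_rsub simple) blast+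
  then have "cyc v0 = S"
    using cyc_least[OF rsimple_rsub[OF simple]] rsimple_cases[OF simple rsub_cyc[OF v0(1)]] cyc_self[of v0] v0
    by blast
  then show ?thesis using simple by simp
qed

text \<open>A conjugate of c commutes with r because c commutes with r conjugated by the inverse
  element. The point is to have \<open>scalar_or_socle\<close> for the commutant as well.\<close>

lemma commutant_algebra: "stable_algebra G V \<rho> P T \<Phi> v0 k Z commutant"
proof unfold_locales
  show "endo r" if "r \<in> commutant" for r using that by (simp add: commutant_def)
  show "(\<lambda>x. x) \<in> commutant" by (simp add: commutant_def endo_def)
  show "(\<lambda>x. r x + s x) \<in> commutant" if "r \<in> commutant" "s \<in> commutant" for r s
    using that R_endo by (auto simp: commutant_def endo_def algebra_simps)
  show "(\<lambda>x. r (s x)) \<in> commutant" if "r \<in> commutant" "s \<in> commutant" for r s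
    using that by (auto simp: commutant_def endo_def)
  fix g c assume g: "g \<in> carrier G" and c: "c \<in> commutant"
  define c' where "c' = (\<lambda>x. \<rho> g (c (\<rho> (inv g) x)))"
  have cE: "endo c" using c by (simp add: commutant_def)
  have "c' (r x) = r (c' x)" if r: "r \<in> R" and x: "x \<in> V" for r x
  proof -
    obtain r' where r': "r' \<in> R" "\<And>x. x \<in> V \<Longrightarrow> r' (\<rho> (inv g) x) = \<rho> (inv g) (r x)"
      using stable'[OF inv_closed[OF g] r] by blast
    have y: "\<rho> (inv g) x \<in> V" using g x by (simp add: act_in)
    have "c' (r x) = \<rho> g (c (r' (\<rho> (inv g) x)))" using r' x by (simp add: c'_def)
    also have "\<dots> = \<rho> g (r' (c (\<rho> (inv g) x)))" using c r' y by (simp add: commutant_def)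
    also have "\<dots> = \<rho> g (r' (\<rho> (inv g) (c' x)))" using g y cE by (simp add: c'_def endo_in)
    also have "\<dots> = \<rho> g (\<rho> (inv g) (r (c' x)))"
      using r'(2)[of "c' x"] g y cE by (simp add: c'_def endo_in act_in)
    also have "\<dots> = r (c' x)" using g y cE R_endo[OF r] by (simp add: c'_def endo_in act_in)
    finally show ?thesis .
  qed
  moreover have "endo c'"
    using cE g by (simp add: c'_def endo_def act_in act_add)
  ultimately have "c' \<in> commutant" by (simp add: commutant_def)
  then show "\<exists>r'\<in>commutant. \<forall>x\<in>V. r' x = \<rho> g (c (\<rho> (inv g) x))"
    by (intro bexI[of _ c']) (auto simp: c'_def)
qed

text \<open>If both \<open>R\<close> and its commutant moved \<open>v0\<close>, then every \<open>v\<close> in the second socle layer would be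
  \<open>c v0\<close> for some \<open>c\<close> in the commutant acting on the simple module \<open>R v0\<close>. There \<open>c\<^sup>2 + c = 1\<close>,
  because the left-hand side is fixed by \<open>P\<close>, and this is impossible for three independent
  \<open>c\<close> modulo scalars.\<close>

lemma commutant_scalar:
  assumes S2W: "S2 \<subseteq> cyc v0" and c: "c \<in> commutant"
  shows "(\<forall>x\<in>V. c x = 0) \<or> (\<forall>x\<in>V. c x = x)"
proof (rule ccontr)
  assume not: "\<not> ?thesis"
  interpret C: stable_algebra G V \<rho> P T \<Phi> v0 k Z commutant by (rule commutant_algebra)
  define W where "W = cyc v0"
  have "S2 \<subseteq> C.cyc v0" using C.scalar_or_socle not c by blast
  then have "\<forall>v\<in>S2. \<exists>c\<in>commutant. c v0 = v" unfolding C.cyc_def by blast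
  then obtain \<gamma> where \<gamma>: "\<And>v. v \<in> S2 \<Longrightarrow> \<gamma> v \<in> commutant" "\<And>v. v \<in> S2 \<Longrightarrow> \<gamma> v v0 = v" by metis
  have W: "rsimple W" unfolding W_def by (rule rsimple_cyc)
  have Wsub: "rsub W" using W by (rule rsimple_rsub)
  have WV: "x \<in> V" if "x \<in> W" for x using that rsub_V'[OF Wsub] by blast
  have S2W': "S2 \<subseteq> W" using S2W by (simp add: W_def)
  have S2V: "x \<in> V" if "x \<in> S2" for x using that S2W' WV by blast
  have v0W: "v0 \<in> W" unfolding W_def by (rule cyc_self)
  \<comment> \<open>On W = R v0 an operator commuting with \<open>R\<close> is determined by its
    value at \<open>v0\<close>.\<close>
  have agree: "a x = b x" if ab: "a \<in> commutant" "b \<in> commutant" "a v0 = b v0" "x \<in> W" for a b x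
  proof -
    obtain r where "r \<in> R" "x = r v0" using ab(4) by (auto simp: W_def cyc_def)
    then show ?thesis using ab v0 by (simp add: commutant_def)
  qed
  have maps: "a x \<in> W" if a: "a \<in> commutant" "a v0 \<in> W" and x: "x \<in> W" for a x
  proof -
    obtain r where r: "r \<in> R" "x = r v0" using x by (auto simp: W_def cyc_def)
    then have "a x = r (a v0)" using a v0 by (simp add: commutant_def)
    then show ?thesis using rsub_act[OF Wsub r(1) a(2)] by simp
  qed
  have inj: "inj_on a W" if a: "a \<in> commutant" "a v0 \<in> W" "a v0 \<noteq> 0" for a
  proof -
    have "rhom W a" using a WV C.R_endo[OF a(1)] by (auto simp: rhom_def commutant_def endo_def)
    then show ?thesis using rhom_simple_cases[OF W] a v0W by blast
  qed
  have key: "\<gamma> v v = v + v0" if v: "v \<in> S2" "v \<notin> {0, v0}" for v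
  proof -
    let ?c = "\<gamma> v"
    have cC: "?c \<in> commutant" and cv: "?c v0 = v" and vW: "v \<in> W" using \<gamma> v S2W' by blast+
    have cE: "endo ?c" using cC by (simp add: commutant_def)
    have vV: "v \<in> V" using WV vW .
    \<comment> \<open>This vector is c^2 v0 + c v0. Conjugation by s in \<open>P\<close> sends the
      value v at \<open>v0\<close> to v or v + v0, hence c on W to c or c + 1, and c^2 + c is the
      same for both.\<close>
    have "?c v + v \<in> {0, v0}"
    proof (rule fixed)
      show "?c v + v \<in> V" using cE vV by (simp add: endo_in)
      fix s assume s: "s \<in> P"
      have sG: "s \<in> carrier G" using P_in s .
      obtain c' where c': "c' \<in> commutant" "\<And>x. x \<in> V \<Longrightarrow> c' (\<rho> s x) = \<rho> s (?c x)"
        using C.stable'[OF sG cC] by blast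
      have c'v0: "c' v0 = \<rho> s v" using c'(2)[OF v0(1)] v0_fixed[of s] s cv by simp
      have eq: "\<rho> s (?c v + v) = c' (\<rho> s v) + \<rho> s v" using c'(2)[OF vV] sG cE vV by (simp add: act_add endo_in)
      have "\<rho> s v = v \<or> \<rho> s v = v + v0" using S2_act[OF s v(1)] by blast
      then show "\<rho> s (?c v + v) = ?c v + v"
      proof
        assume sv: "\<rho> s v = v"
        then have "c' v = ?c v" using agree[OF c'(1) cC _ vW] c'v0 cv by simp
        then show ?thesis using eq sv by simp
      next
        assume sv: "\<rho> s v = v + v0"
        have cC1: "(\<lambda>x. ?c x + x) \<in> commutant" using C.R_add[OF cC C.R_id] .
        have *: "c' x = ?c x + x" if "x \<in> W" for x
          using agree[OF c'(1) cC1 _ that] c'v0 cv sv by simp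
        have "v + v0 \<in> W" using vW v0W subsp_add[OF rsub_subsp[OF Wsub]] by blast
        then have "c' (v + v0) = (?c v + v) + (v + v0)" using * cE vV v0 cv by (simp add: endo_add)
        then show ?thesis using eq sv by (simp add: add.assoc)
      qed
    qed
    \<comment> \<open>Otherwise c v = v = c v0, and c is injective on W.\<close>
    moreover have "?c v + v \<noteq> 0"
    proof
      assume "?c v + v = 0"
      then have "?c v = ?c v0" using cv by (simp add: add_eq_0_iff2)
      then have "v = v0" using inj_onD[OF inj[OF cC] _ vW v0W] cv vW v by simp
      then show False using v by simp
    qed
    ultimately have "?c v + v = v0" by blast
    then show ?thesis by (metis add.commute cancel2)
  qed
  have lin: "\<gamma> (u + v) x = \<gamma> u x + \<gamma> v x" if "u \<in> S2" "v \<in> S2" "x \<in> W" for u v x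
    using agree[OF \<gamma>(1)[OF subsp_add[OF subsp_S2 that(1,2)]] C.R_add[OF \<gamma>(1)[OF that(1)] \<gamma>(1)[OF that(2)]] _ that(3)]
      \<gamma>(2) that subsp_add[OF subsp_S2] by simp
  \<comment> \<open>Polarization of \<open>key\<close>: comparing u, v and u + v leaves the mixed
    terms, which are c_u c_v + c_v c_u applied to \<open>v0\<close>.\<close>
  have comm: "\<gamma> u v + \<gamma> v u = v0"
    if uv: "u \<in> S2" "v \<in> S2" "u \<notin> {0, v0}" "v \<notin> {0, v0}" "u + v \<notin> {0, v0}" for u v
  proof -
    have in2: "u + v \<in> S2" using uv subsp_add[OF subsp_S2] by blast
    have uvW: "u \<in> W" "v \<in> W" using uv S2W' by blast+
    have E: "endo (\<gamma> u)" "endo (\<gamma> v)" using \<gamma> uv by (auto simp: commutant_def)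
    have "u + v + v0 = \<gamma> (u + v) (u + v)" using key[OF in2 uv(5)] by simp
    also have "\<dots> = \<gamma> u (u + v) + \<gamma> v (u + v)"
      using lin[OF uv(1,2)] in2 S2W' by blast
    also have "\<dots> = \<gamma> u u + \<gamma> u v + (\<gamma> v u + \<gamma> v v)" using E uvW WV by (simp add: endo_add)
    also have "\<dots> = (u + v0) + \<gamma> u v + (\<gamma> v u + (v + v0))" using key uv by simp
    also have "\<dots> = (\<gamma> u v + \<gamma> v u) + (u + v) + (v0 + v0)" by (simp only: ac_simps)
    finally have "(u + v) + v0 = (u + v) + (\<gamma> u v + \<gamma> v u)" by (simp add: ac_simps)
    then show ?thesis by (simp only: add_left_cancel)
  qed
  obtain v1 where v1: "v1 \<in> S2" "v1 \<notin> {0, v0}"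
  proof -
    have "\<not> S2 \<subseteq> {0, v0}"
    proof
      assume "S2 \<subseteq> {0, v0}"
      then have "card S2 \<le> card {0, v0}" by (intro card_mono) auto
      then show False using card_S2_ge v0 by simp
    qed
    then show ?thesis using that by blast
  qed
  obtain v2 where v2: "v2 \<in> S2" "v2 \<notin> set [0, v0, v1, v1 + v0]"
  proof -
    have "\<not> S2 \<subseteq> set [0, v0, v1, v1 + v0]"
    proof
      assume "S2 \<subseteq> set [0, v0, v1, v1 + v0]"
      then have "card S2 \<le> card (set [0, v0, v1, v1 + v0])" by (intro card_mono) auto
      then show False using card_S2_ge card_length[of "[0, v0, v1, v1 + v0]"] by simp
    qed
    then show ?thesis using that by blast
  qed
  \<comment> \<open>The span of v0, v1 and v2. It has at most eight elements, while
    \<open>S2\<close> has at least sixteen.\<close>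
  define L where "L = [0, v0, v1, v1 + v0, v2, v2 + v0, v1 + v2, (v1 + v2) + v0]"
  obtain v3 where v3: "v3 \<in> S2" "v3 \<notin> set L"
  proof -
    have "\<not> S2 \<subseteq> set L"
    proof
      assume "S2 \<subseteq> set L"
      then have "card S2 \<le> card (set L)" by (intro card_mono) auto
      then show False using card_S2_ge card_length[of L] by (simp add: L_def)
    qed
    then show ?thesis using that by blast
  qed
  have move: "a + b = c' \<longleftrightarrow> b = a + c'" for a b c' :: 'v by (metis cancel2)
  have ind: "v1 + v2 \<notin> {0, v0}" "v1 + v3 \<notin> {0, v0}" "v2 + v3 \<notin> {0, v0}" "(v1 + v2) + v3 \<notin> {0, v0}"
    using v2 v3 unfolding move L_def insert_iff empty_iff by (auto simp: move)
  have n3: "v3 \<notin> {0, v0}" and n2: "v2 \<notin> {0, v0}" using v2 v3 by (auto simp: L_def)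
  have v12: "v1 + v2 \<in> S2" using v1 v2 subsp_add[OF subsp_S2] by blast
  have v3W: "v3 \<in> W" using v3 S2W' by blast
  have E3: "endo (\<gamma> v3)" using \<gamma>(1)[OF v3(1)] by (simp add: commutant_def)
  \<comment> \<open>The mixed term is additive in its first argument, so for v1 + v2 against v3 it
    is both 1 and 1 + 1 = 0, evaluated at \<open>v0\<close>.\<close>
  have "v0 = \<gamma> (v1 + v2) v3 + \<gamma> v3 (v1 + v2)" using comm[OF v12 v3(1) ind(1) n3 ind(4)] by simp
  also have "\<dots> = (\<gamma> v1 v3 + \<gamma> v3 v1) + (\<gamma> v2 v3 + \<gamma> v3 v2)"
    using lin[OF v1(1) v2(1) v3W] E3 S2V v1 v2 by (simp add: endo_add ac_simps)
  also have "\<dots> = v0 + v0"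
    using comm[OF v1(1) v3(1) v1(2) n3 ind(2)] comm[OF v2(1) v3(1) n2 n3 ind(3)] by simp
  finally show False using v0 by simp
qed

text \<open>The translates of W = R v0 are simple and span \<open>V\<close>, so a submodule M
  maximal among those meeting W trivially is a complement of W. The projection to W along M commutes
  with \<open>R\<close> and fixes \<open>v0\<close>, so by hypothesis it is the identity.\<close>

lemma simple_V:
  assumes C: "\<And>c. c \<in> commutant \<Longrightarrow> (\<forall>x\<in>V. c x = 0) \<or> (\<forall>x\<in>V. c x = x)"
  shows "rsimple V"
proof -
  define W where "W = cyc v0"
  have W: "rsimple W" unfolding W_def by (rule rsimple_cyc)
  have Wsub: "rsub W" using W by (rule rsimple_rsub)
  have v0W: "v0 \<in> W" unfolding W_def by (rule cyc_self)
  define \<M> where "\<M> = {M. rsub M \<and> M \<inter> W = {0}}"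
  have "finite \<M>" using finite_rsubs by (auto simp: \<M>_def)
  moreover have "{0} \<in> \<M>" using subsp_0[OF rsub_subsp[OF Wsub]] by (auto simp: \<M>_def)
  ultimately obtain M where M: "M \<in> \<M>" "\<And>M'. M' \<in> \<M> \<Longrightarrow> M \<subseteq> M' \<Longrightarrow> M = M'"
    by (metis finite_has_maximal empty_iff)
  have Msub: "rsub M" and MW: "M \<inter> W = {0}" using M(1) by (auto simp: \<M>_def)
  have Ssub: "rsub (setsum W M)" using Wsub Msub by (rule rsub_setsum)
  have "setsum W M = V"
  proof (rule span)
    show "subsp (setsum W M)" using Ssub by (rule rsub_subsp)
    fix g assume g: "g \<in> carrier G"
    show "\<rho> g v0 \<in> setsum W M"
    proof (rule ccontr)
      assume n: "\<rho> g v0 \<notin> setsum W M"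
      let ?Y = "\<rho> g ` W"
      have Y: "rsimple ?Y" using rsimple_act_image[OF W g] .
      then have Ysub: "rsub ?Y" by (rule rsimple_rsub)
      have YS: "?Y \<inter> setsum W M = {0}" using rsimple_Int[OF Y Ssub] n v0W by blast
      have "M \<inter> W = {0}" by (rule MW)
      \<comment> \<open>The translate meets W + M trivially, so adding it to M creates no
        intersection with W; maximality of M then puts the translate inside M.\<close>
      have "setsum M ?Y \<inter> W \<subseteq> {0}"
      proof
        fix x assume x: "x \<in> setsum M ?Y \<inter> W"
        then obtain m y where my: "x = m + y" "m \<in> M" "y \<in> ?Y" unfolding setsum_def by blast
        then have "y = x + m" by (metis add.commute cancel2)
        then have "y \<in> setsum W M" using x my unfolding setsum_def by blast
        then have "y = 0" using YS my by blast
        then have "x \<in> M \<inter> W" using my x by simp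
        then show "x \<in> {0}" using MW by blast
      qed
      moreover have r: "rsub (setsum M ?Y)" using Msub Ysub by (rule rsub_setsum)
      ultimately have "setsum M ?Y \<in> \<M>"
        using subsp_0[OF rsub_subsp[OF r]] subsp_0[OF rsub_subsp[OF Wsub]] by (auto simp: \<M>_def)
      then have "M = setsum M ?Y" using M(2) setsum_upper(1)[OF rsub_subsp[OF Msub] rsub_subsp[OF Ysub]] by blast
      then have "\<rho> g v0 \<in> M"
        using setsum_upper(2)[OF rsub_subsp[OF Msub] rsub_subsp[OF Ysub]] v0W by blast
      then show False using n setsum_upper(2)[OF rsub_subsp[OF Wsub] rsub_subsp[OF Msub]] by blast
    qed
  qed
  then have "\<forall>x\<in>V. \<exists>w m. w \<in> W \<and> m \<in> M \<and> x = w + m" unfolding setsum_def by blast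
  then obtain p q where pq: "\<And>x. x \<in> V \<Longrightarrow> p x \<in> W" "\<And>x. x \<in> V \<Longrightarrow> q x \<in> M" "\<And>x. x \<in> V \<Longrightarrow> x = p x + q x"
    by metis
  have p_eq: "p (w + m) = w" if wm: "w \<in> W" "m \<in> M" for w m
  proof -
    have V: "w + m \<in> V" using wm rsub_V' Wsub Msub by (intro add_in) blast+
    have "p (w + m) + w = q (w + m) + m"
      using pq(3)[OF V] by (metis add.assoc add.commute cancel2)
    moreover have "p (w + m) + w \<in> W" using pq(1)[OF V] wm subsp_add[OF rsub_subsp[OF Wsub]] by blast
    moreover have "q (w + m) + m \<in> M" using pq(2)[OF V] wm subsp_add[OF rsub_subsp[OF Msub]] by blast
    ultimately have "p (w + m) + w = 0" using MW by auto
    then show ?thesis by (simp add: add_eq_0_iff2)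
  qed
  have "p \<in> commutant"
    unfolding commutant_def endo_def
  proof (intro CollectI conjI ballI)
    fix x assume x: "x \<in> V"
    show "p x \<in> V" using pq(1)[OF x] rsub_V'[OF Wsub] by blast
  next
    fix x y assume xy: "x \<in> V" "y \<in> V"
    have "x + y = (p x + p y) + (q x + q y)"
      using pq(3)[OF xy(1)] pq(3)[OF xy(2)] by (metis add.assoc add.commute)
    then show "p (x + y) = p x + p y"
      using p_eq[of "p x + p y" "q x + q y"] pq xy subsp_add[OF rsub_subsp[OF Wsub]] subsp_add[OF rsub_subsp[OF Msub]]
      by simp
  next
    fix r x assume r: "r \<in> R" and x: "x \<in> V"
    have "p x \<in> V" "q x \<in> V" using pq(1,2)[OF x] rsub_V' Wsub Msub by blast+
    then have "r x = r (p x) + r (q x)"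
      using pq(3)[OF x] endo_add[OF R_endo[OF r]] by metis
    then show "p (r x) = r (p x)"
      using p_eq[OF rsub_act[OF Wsub r] rsub_act[OF Msub r]] pq x by simp
  qed
  then have "(\<forall>x\<in>V. p x = 0) \<or> (\<forall>x\<in>V. p x = x)" by (rule C)
  moreover have "p v0 = v0" using p_eq[OF v0W subsp_0[OF rsub_subsp[OF Msub]]] by simp
  ultimately have "\<forall>x\<in>V. p x = x" using v0 by metis
  then have "V \<subseteq> W" using pq(1) by (metis subsetI)
  then have "V = W" using rsub_V'[OF Wsub] by blast
  then show ?thesis using W by simp
qed

theorem very_simple_dichotomy:
  "(\<forall>r\<in>R. (\<forall>x\<in>V. r x = 0) \<or> (\<forall>x\<in>V. r x = x)) \<or> (\<forall>f. endo f \<longrightarrow> (\<exists>r\<in>R. \<forall>x\<in>V. r x = f x))"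
proof (cases "\<forall>r\<in>R. (\<forall>x\<in>V. r x = 0) \<or> (\<forall>x\<in>V. r x = x)")
  case False
  then have S2W: "S2 \<subseteq> cyc v0" using scalar_or_socle by blast
  then show ?thesis using density[OF simple_V] commutant_scalar by blast
qed blast

end

section \<open>Permutation modules\<close>

text \<open>By the sizes of \<open>P\<close> and B, \<open>free\<close> makes \<open>P\<close>
  regular on the points other than \<open>p0\<close>. The conditions on \<open>\<Phi>\<close>,
  \<open>Z\<close> and normal subgroups are passed on unchanged to the linear setting.\<close>

locale regular_setting = group G for G :: "('a, 'c) monoid_scheme" (structure) +
  fixes B :: "'b set" and \<alpha> :: "'a \<Rightarrow> 'b \<Rightarrow> 'b" and P T \<Phi> Z :: "'a set" and k :: nat and p0 :: 'b
  assumes fin_B: "finite B" and card_B: "card B = 2 ^ k + 1" and p0: "p0 \<in> B"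
    and perm_in: "\<And>g b. g \<in> carrier G \<Longrightarrow> b \<in> B \<Longrightarrow> \<alpha> g b \<in> B"
    and perm_one: "\<And>b. b \<in> B \<Longrightarrow> \<alpha> \<one> b = b"
    and perm_mult: "\<And>g h b. g \<in> carrier G \<Longrightarrow> h \<in> carrier G \<Longrightarrow> b \<in> B \<Longrightarrow> \<alpha> (g \<otimes> h) b = \<alpha> g (\<alpha> h b)"
    and P: "subgroup P G" and card_P: "card P = 2 ^ k"
    and T: "subgroup T G" and T_norm: "\<And>t s. t \<in> T \<Longrightarrow> s \<in> P \<Longrightarrow> t \<otimes> s \<otimes> inv t \<in> P"
    and p0_fixed: "\<And>s. s \<in> P \<union> T \<Longrightarrow> \<alpha> s p0 = p0"
    and free: "\<And>s b. s \<in> P \<Longrightarrow> b \<in> B \<Longrightarrow> b \<noteq> p0 \<Longrightarrow> \<alpha> s b = b \<Longrightarrow> s = \<one>"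
    and transitive: "\<And>b. b \<in> B \<Longrightarrow> \<exists>g\<in>carrier G. \<alpha> g p0 = b"
    and Frattini: "\<And>Q. subgroup Q G \<Longrightarrow> Q \<subseteq> P \<Longrightarrow> Q \<noteq> P \<Longrightarrow> (\<And>s. s \<in> P \<Longrightarrow> s \<otimes> s \<in> Q) \<Longrightarrow>
      (\<And>t s. t \<in> T \<Longrightarrow> s \<in> Q \<Longrightarrow> t \<otimes> s \<otimes> inv t \<in> Q) \<Longrightarrow> Q = \<Phi>"
    and card_Phi: "card \<Phi> > 0" "8 * card \<Phi> \<le> card P"
    and Z_central: "\<And>z s. z \<in> Z \<Longrightarrow> s \<in> P \<Longrightarrow> z \<otimes> s = s \<otimes> z"
    and small: "\<And>Q. subgroup Q G \<Longrightarrow> Q \<subseteq> P \<Longrightarrow> Q \<inter> Z = {\<one>} \<Longrightarrow> Q = {\<one>}"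
    and normal_cases: "\<And>N. N \<lhd> G \<Longrightarrow> N \<inter> Z = {\<one>} \<or> P \<subseteq> N"
begin

definition V :: "('b \<Rightarrow> bit) set"
  where "V = {h. (\<forall>b. b \<notin> B \<longrightarrow> h b = 0) \<and> sum h B = 0}"

definition act :: "'a \<Rightarrow> ('b \<Rightarrow> bit) \<Rightarrow> 'b \<Rightarrow> bit"
  where "act g h = (\<lambda>b. if b \<in> B then h (\<alpha> (inv g) b) else 0)"

text \<open>The all-one function plus the indicator of a. For a in B its support is even because B
  has odd size, and the stabilizer of a fixes it.\<close>

definition ev :: "'b \<Rightarrow> 'b \<Rightarrow> bit"
  where "ev a = (\<lambda>b. if b \<in> B \<and> b \<noteq> a then 1 else 0)"

lemma bit_cases: "x = 0 \<or> x = (1 :: bit)"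
  by (cases x) auto

lemma bit_sum_one: "finite A \<Longrightarrow> (\<Sum>b\<in>A. (1 :: bit)) = (if odd (card A) then 1 else 0)"
  by (induction A rule: finite_induct) auto

lemma bit_sum: "finite A \<Longrightarrow> sum h A = (if odd (card {b \<in> A. h b = (1 :: bit)}) then 1 else 0)"
proof -
  assume A: "finite A"
  have "sum h A = sum h {b \<in> A. h b = 1}"
    using A bit_cases by (intro sum.mono_neutral_right) auto
  also have "\<dots> = (\<Sum>b\<in>{b \<in> A. h b = 1}. 1)" by (intro sum.cong) auto
  finally show ?thesis using A bit_sum_one[of "{b \<in> A. h b = 1}"] by simp
qed

lemma perm_inv:
  assumes "g \<in> carrier G" "b \<in> B"
  shows "\<alpha> g (\<alpha> (inv g) b) = b" "\<alpha> (inv g) (\<alpha> g b) = b"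
  using assms by (simp_all add: perm_mult[symmetric] perm_one)

lemma k_ge: "3 \<le> k"
proof -
  have "2 ^ 3 \<le> (2 :: nat) ^ k" using card_Phi card_P by simp
  then show ?thesis by (simp only: power_increasing_iff[of 2 3 k])
qed

lemma P_in: "s \<in> P \<Longrightarrow> s \<in> carrier G"
  using subgroup.subset[OF P] by blast

lemma char2_V: "char2_space V"
proof
  have "V \<subseteq> (\<lambda>A b. if b \<in> A then 1 else 0) ` Pow B"
  proof
    fix h assume h: "h \<in> V"
    have "h = (\<lambda>b. if b \<in> {b \<in> B. h b = 1} then 1 else 0)"
      using h bit_cases by (fastforce simp: V_def fun_eq_iff)
    then show "h \<in> (\<lambda>A b. if b \<in> A then 1 else 0) ` Pow B" by blast
  qed
  then show "finite V" using fin_B finite_subset by blast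
  show "0 \<in> V" by (simp add: V_def)
  show "x + y \<in> V" if "x \<in> V" "y \<in> V" for x y
  proof -
    have "sum (x + y) B = sum x B + sum y B" unfolding plus_fun_def by (rule sum.distrib)
    then show ?thesis using that by (simp add: V_def)
  qed
  show "x + x = 0" for x :: "'b \<Rightarrow> bit" by (simp add: fun_eq_iff)
qed

sublocale char2_space V by (rule char2_V)

lemma ev_in: "a \<in> B \<Longrightarrow> ev a \<in> V"
proof -
  assume a: "a \<in> B"
  have "{b \<in> B. ev a b = 1} = B - {a}" by (auto simp: ev_def)
  then have "sum (ev a) B = 0" using bit_sum[OF fin_B, of "ev a"] a fin_B card_B k_ge by simp
  then show ?thesis by (simp add: V_def ev_def)
qed

lemma act_ev:
  assumes g: "g \<in> carrier G" and a: "a \<in> B"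
  shows "act g (ev a) = ev (\<alpha> g a)"
proof
  fix b
  have "\<alpha> (inv g) b = a \<longleftrightarrow> b = \<alpha> g a" if "b \<in> B" using perm_inv g a that by metis
  then show "act g (ev a) b = ev (\<alpha> g a) b"
    using perm_in[of "inv g" b] g by (auto simp: act_def ev_def)
qed

lemma sum_ev:
  assumes Y: "Y \<subseteq> B"
  shows "sum ev Y c = (if c \<in> B \<and> odd (card (Y - {c})) then 1 else 0)"
proof -
  have fY: "finite Y" using Y fin_B finite_subset by blast
  have "sum ev Y c = (\<Sum>a\<in>Y. ev a c)" using fY by (induction Y rule: finite_induct) auto
  also have "\<dots> = (if odd (card {a \<in> Y. ev a c = 1}) then 1 else 0)" by (rule bit_sum[OF fY])
  also have "{a \<in> Y. ev a c = 1} = (if c \<in> B then Y - {c} else {})" by (auto simp: ev_def)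
  finally show ?thesis by auto
qed

text \<open>The support of h is even, so the all-one parts cancel and the indicator of the support
  remains.\<close>

lemma V_eq_sum_ev:
  assumes h: "h \<in> V"
  shows "h = sum ev {b \<in> B. h b = 1}"
proof
  fix c
  let ?Y = "{b \<in> B. h b = 1}"
  have even: "even (card ?Y)" using h bit_sum[OF fin_B, of h] by (auto simp: V_def split: if_splits)
  have fY: "finite ?Y" using fin_B by simp
  show "h c = sum ev ?Y c"
  proof (cases "c \<in> ?Y")
    case True
    then have "card ?Y = Suc (card (?Y - {c}))" using fY by (simp only: card.remove[OF fY True])
    then show ?thesis using sum_ev[of ?Y c] even True by auto
  next
    case False
    then have "h c = 0" using h bit_cases by (auto simp: V_def)
    moreover have "?Y - {c} = ?Y" using False by blast
    ultimately show ?thesis using sum_ev[of ?Y c] even by auto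
  qed
qed

lemma span_ev:
  assumes U: "subsp U" and ev: "\<And>b. b \<in> B \<Longrightarrow> ev b \<in> U"
  shows "U = V"
proof
  show "U \<subseteq> V" using U by (simp add: subsp_def)
  show "V \<subseteq> U"
  proof
    fix h assume "h \<in> V"
    then have "h = sum ev {b \<in> B. h b = 1}" by (rule V_eq_sum_ev)
    moreover have "sum ev {b \<in> B. h b = 1} \<in> U" using ev by (intro subsp_sum[OF U]) auto
    ultimately show "h \<in> U" by simp
  qed
qed

text \<open>The sum of all \<open>ev b\<close> is 0. Applying f leaves the sum over those b for
  which f fixes \<open>ev b\<close>, and such a partial sum can vanish only over the empty set or
  over B.\<close>

lemma scalar_ev:
  assumes f: "endo f" and ev: "\<And>b. b \<in> B \<Longrightarrow> f (ev b) \<in> {0, ev b}"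
  shows "(\<forall>x\<in>V. f x = 0) \<or> (\<forall>x\<in>V. f x = x)"
proof -
  define Y where "Y = {b \<in> B. f (ev b) = ev b}"
  have fY: "finite Y" using fin_B by (simp add: Y_def)
  have "sum ev B = 0"
  proof
    fix c show "sum ev B c = 0 c" using sum_ev[of B c] fin_B card_B k_ge by simp
  qed
  then have "0 = f (sum ev B)" using endo_0[OF f] by simp
  also have "\<dots> = (\<Sum>b\<in>B. f (ev b))" using ev_in by (intro endo_sum[OF f])
  also have "\<dots> = (\<Sum>b\<in>Y. f (ev b))"
    using ev fin_B by (intro sum.mono_neutral_right) (auto simp: Y_def)
  also have "\<dots> = sum ev Y" by (intro sum.cong) (auto simp: Y_def)
  finally have "sum ev Y c = 0" for c by (metis zero_fun_apply)
  \<comment> \<open>At c the partial sum counts the elements of Y other than c. One point inside Y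
    and one outside would give the size of Y both parities.\<close>
  then have even: "even (card (Y - {c}))" if "c \<in> B" for c
    using sum_ev[of Y c] that by (auto simp: Y_def split: if_splits)
  have "Y = {} \<or> Y = B"
  proof (rule ccontr)
    assume "\<not> ?thesis"
    then obtain c d where cd: "c \<in> Y" "d \<in> B" "d \<notin> Y" by (auto simp: Y_def)
    have "c \<in> B" using cd by (simp add: Y_def)
    then have "even (card (Y - {c}))" by (rule even)
    moreover have "card Y = Suc (card (Y - {c}))" using card.remove[OF fY cd(1)] by blast
    ultimately have odd: "odd (card Y)" by simp
    have "Y - {d} = Y" using cd by blast
    then have "even (card Y)" using even[OF cd(2)] by simp
    then show False using odd by blast
  qed
  then show ?thesis
  proof
    assume "Y = {}"
    have "{x \<in> V. f x = 0} = V"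
    proof (rule span_ev)
      show "subsp {x \<in> V. f x = 0}" using f by (auto simp: subsp_def endo_0 endo_add)
      fix b assume "b \<in> B"
      then show "ev b \<in> {x \<in> V. f x = 0}" using ev[of b] \<open>Y = {}\<close> ev_in by (auto simp: Y_def)
    qed
    then show ?thesis by blast
  next
    assume "Y = B"
    have "{x \<in> V. f x = x} = V"
    proof (rule span_ev)
      show "subsp {x \<in> V. f x = x}" using f by (auto simp: subsp_def endo_0 endo_add)
      fix b assume "b \<in> B"
      then show "ev b \<in> {x \<in> V. f x = x}" using \<open>Y = B\<close> ev_in by (auto simp: Y_def)
    qed
    then show ?thesis by blast
  qed
qed

text \<open>A free orbit of \<open>P\<close> has \<open>2 ^ k\<close> points, which exhausts B
  without p0.\<close>

lemma regular:
  assumes "b \<in> B - {p0}" "b' \<in> B - {p0}"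
  shows "\<exists>s\<in>P. \<alpha> s b = b'"
proof -
  have P0: "\<alpha> s c \<in> B - {p0}" if s: "s \<in> P" and c: "c \<in> B - {p0}" for s c
  proof -
    have "\<alpha> s c \<noteq> p0"
    proof
      assume "\<alpha> s c = p0"
      then have "c = \<alpha> (inv s) p0" using perm_inv(2)[OF P_in[OF s], of c] c by simp
      also have "\<dots> = p0" using p0_fixed subgroup.m_inv_closed[OF P s] by blast
      finally show False using c by simp
    qed
    then show ?thesis using perm_in P_in s c by blast
  qed
  have "inj_on (\<lambda>s. \<alpha> s b) P"
  proof (rule inj_onI)
    fix s t assume st: "s \<in> P" "t \<in> P" "\<alpha> s b = \<alpha> t b"
    have "\<alpha> (inv t \<otimes> s) b = b" using st assms P_in perm_inv(2) by (simp add: perm_mult)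
    then have "inv t \<otimes> s = \<one>" using st assms P
      by (intro free[of _ b]) (auto simp: subgroup.m_closed subgroup.m_inv_closed)
    then show "s = t" using st P_in by (metis inv_closed inv_equality inv_inv)
  qed
  then have "card ((\<lambda>s. \<alpha> s b) ` P) = card (B - {p0})"
    using card_image card_P card_B p0 fin_B by fastforce
  moreover have "(\<lambda>s. \<alpha> s b) ` P \<subseteq> B - {p0}" using P0 assms by blast
  ultimately have "(\<lambda>s. \<alpha> s b) ` P = B - {p0}" using fin_B by (intro card_subset_eq) auto
  then show ?thesis using assms by (metis imageE)
qed

text \<open>By \<open>regular\<close>, h is constant away from p0. The number of those points is
  even, so the sum condition reduces to h p0 = 0.\<close>

lemma fixed_V:
  assumes h: "h \<in> V" and inv: "\<And>s. s \<in> P \<Longrightarrow> act s h = h"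
  shows "h \<in> {0, ev p0}"
proof -
  have const: "h b = h b'" if "b \<in> B - {p0}" "b' \<in> B - {p0}" for b b'
  proof -
    obtain s where s: "s \<in> P" "\<alpha> s b = b'" using regular \<open>b \<in> _\<close> \<open>b' \<in> _\<close> by blast
    have "h b' = act s h b'" using inv[OF s(1)] by simp
    also have "\<dots> = h (\<alpha> (inv s) b')" using that by (simp add: act_def)
    also have "\<alpha> (inv s) b' = b" using perm_inv(2)[OF P_in[OF s(1)], of b] s that by simp
    finally show ?thesis by simp
  qed
  obtain c where c: "\<And>b. b \<in> B - {p0} \<Longrightarrow> h b = c"
  proof (cases "B - {p0} = {}")
    case False
    then obtain a where "a \<in> B - {p0}" by blast
    then show ?thesis using that[of "h a"] const by blast
  qed (use that in blast)
  have "sum h (B - {p0}) = (\<Sum>b\<in>B - {p0}. c)" using c by (intro sum.cong) auto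
  also have "\<dots> = 0"
  proof -
    have "card (B - {p0}) = 2 ^ k" using card_B p0 fin_B by simp
    then show ?thesis using bit_sum_one[of "B - {p0}"] bit_cases[of c] k_ge fin_B by auto
  qed
  finally have "h p0 = 0" using sum.remove[OF fin_B p0, of h] h by (simp add: V_def)
  then have eq: "h b = (if b \<in> B \<and> b \<noteq> p0 then c else 0)" for b using c h by (auto simp: V_def)
  show ?thesis using bit_cases[of c] eq by (auto simp: ev_def fun_eq_iff)
qed

lemma ev_inj: "a \<in> B \<Longrightarrow> b \<in> B \<Longrightarrow> ev a = ev b \<Longrightarrow> a = b"
  by (metis ev_def zero_neq_one)

lemma ev_ne_0: "ev a \<noteq> 0"
proof
  assume 0: "ev a = 0"
  have "B \<subseteq> {a}"
  proof
    fix b assume "b \<in> B"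
    then show "b \<in> {a}" using fun_cong[OF 0, of b] by (auto simp: ev_def split: if_splits)
  qed
  then have "card B \<le> card {a}" by (intro card_mono) auto
  then show False using card_B by simp
qed

lemma ex_other: "\<exists>b\<in>B. b \<noteq> p0"
proof (rule ccontr)
  assume "\<not> ?thesis"
  then have "card B \<le> card {p0}" by (intro card_mono) auto
  then show False using card_B by simp
qed

lemma clifford: "clifford_setting G V act P T \<Phi> (ev p0) k Z"
proof (intro clifford_setting.intro char2_rep.intro clifford_setting_axioms.intro
    char2_rep_axioms.intro is_group char2_V)
  show "subgroup P G" "subgroup T G" by (rule P, rule T)
next
  fix g x assume g: "g \<in> carrier G" and x: "x \<in> V"
  have "sum (act g x) B = (\<Sum>b\<in>B. x (\<alpha> (inv g) b))" by (intro sum.cong) (auto simp: act_def)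
  also have "\<dots> = sum x B"
    by (rule sum.reindex_bij_witness[of _ "\<alpha> g" "\<alpha> (inv g)"]) (use g perm_inv perm_in in auto)
  finally show "act g x \<in> V" using x by (simp add: V_def act_def)
next
  fix g x y show "act g (x + y) = act g x + act g y" by (simp add: act_def fun_eq_iff)
next
  fix x assume "x \<in> V"
  then show "act \<one> x = x" by (auto simp: act_def V_def perm_one)
next
  fix g h x assume "g \<in> carrier G" "h \<in> carrier G"
  then show "act (g \<otimes> h) x = act g (act h x)"
    by (auto simp: act_def fun_eq_iff inv_mult_group perm_mult perm_in)
next
  fix s assume s: "s \<in> P \<union> T"
  then have "s \<in> carrier G" using subgroup.subset[OF P] subgroup.subset[OF T] by blast
  then show "act s (ev p0) = ev p0" using act_ev p0 p0_fixed[OF s] by simp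
next
  fix x assume "x \<in> V" "\<And>s. s \<in> P \<Longrightarrow> act s x = x"
  then show "x \<in> {0, ev p0}" by (rule fixed_V)
next
  obtain b where b: "b \<in> B" "b \<noteq> p0" using ex_other by blast
  show "\<not> V \<subseteq> {0, ev p0}" using ev_in[OF b(1)] ev_ne_0[of b] ev_inj[OF b(1) p0] b by blast
  obtain g where g: "g \<in> carrier G" "\<alpha> g p0 = b" using transitive[OF b(1)] by blast
  then show "\<exists>g\<in>carrier G. act g (ev p0) \<noteq> ev p0"
    using act_ev[OF g(1) p0] ev_inj[OF b(1) p0] b by (intro bexI[of _ g]) auto
next
  fix U assume U: "subsp U" "\<And>g. g \<in> carrier G \<Longrightarrow> act g (ev p0) \<in> U"
  show "U = V"
  proof (rule span_ev[OF U(1)])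
    fix b assume "b \<in> B"
    then obtain g where "g \<in> carrier G" "\<alpha> g p0 = b" using transitive by blast
    then show "ev b \<in> U" using U(2)[of g] act_ev p0 by simp
  qed
next
  fix f assume f: "endo f" "\<And>g. g \<in> carrier G \<Longrightarrow> f (act g (ev p0)) \<in> {0, act g (ev p0)}"
  show "(\<forall>x\<in>V. f x = 0) \<or> (\<forall>x\<in>V. f x = x)"
  proof (rule scalar_ev[OF f(1)])
    fix b assume "b \<in> B"
    then obtain g where "g \<in> carrier G" "\<alpha> g p0 = b" using transitive by blast
    then show "f (ev b) \<in> {0, ev b}" using f(2)[of g] act_ev p0 by simp
  qed
qed (use card_P T_norm ev_in p0 ev_ne_0 Frattini card_Phi Z_central small normal_cases in auto)

end

section \<open>Split Zassenhaus groups and their small subgroups\<close>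

lemma card_le_fibers:
  assumes "finite A" "finite B" "f ` A \<subseteq> B" "\<And>b. b \<in> B \<Longrightarrow> card {a \<in> A. f a = b} \<le> c"
  shows "card A \<le> card B * c"
proof -
  have "A = (\<Union>b\<in>B. {a \<in> A. f a = b})" using assms(3) by blast
  then have "card A \<le> (\<Sum>b\<in>B. card {a \<in> A. f a = b})" using card_UN_le[OF assms(2)] by metis
  also have "\<dots> \<le> card B * c" using sum_bounded_above[OF assms(4), of B "\<lambda>b. b"] by simp
  finally show ?thesis .
qed

context group
begin

lemma cancel_inv [simp]:
  "x \<in> carrier G \<Longrightarrow> y \<in> carrier G \<Longrightarrow> inv x \<otimes> (x \<otimes> y) = y"
  "x \<in> carrier G \<Longrightarrow> y \<in> carrier G \<Longrightarrow> x \<otimes> (inv x \<otimes> y) = y"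
  by (simp_all add: m_assoc[symmetric])

text \<open>The subgroup inv g M g, written as a preimage.\<close>

definition conj_sub :: "'a set \<Rightarrow> 'a \<Rightarrow> 'a set"
  where "conj_sub M g = {x \<in> carrier G. g \<otimes> x \<otimes> inv g \<in> M}"

lemma subgroup_conj_sub:
  assumes M: "subgroup M G" and g: "g \<in> carrier G"
  shows "subgroup (conj_sub M g) G"
proof (rule subgroupI)
  show "conj_sub M g \<subseteq> carrier G" by (auto simp: conj_sub_def)
  show "conj_sub M g \<noteq> {}" using g subgroup.one_closed[OF M] by (auto simp: conj_sub_def intro!: exI[of _ \<one>])
  show "inv a \<in> conj_sub M g" if "a \<in> conj_sub M g" for a
  proof -
    have a: "a \<in> carrier G" "g \<otimes> a \<otimes> inv g \<in> M" using that by (auto simp: conj_sub_def)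
    have "inv (g \<otimes> a \<otimes> inv g) = g \<otimes> inv a \<otimes> inv g" using a(1) g by (simp add: inv_mult_group m_assoc)
    then show ?thesis using subgroup.m_inv_closed[OF M a(2)] a(1) by (simp add: conj_sub_def)
  qed
  show "a \<otimes> b \<in> conj_sub M g" if "a \<in> conj_sub M g" "b \<in> conj_sub M g" for a b
  proof -
    have ab: "a \<in> carrier G" "b \<in> carrier G" "g \<otimes> a \<otimes> inv g \<in> M" "g \<otimes> b \<otimes> inv g \<in> M"
      using that by (auto simp: conj_sub_def)
    have "(g \<otimes> a \<otimes> inv g) \<otimes> (g \<otimes> b \<otimes> inv g) = g \<otimes> (a \<otimes> b) \<otimes> inv g"
      using ab(1,2) g by (simp add: m_assoc)
    then show ?thesis using subgroup.m_closed[OF M ab(3,4)] ab(1,2) by (simp add: conj_sub_def)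
  qed
qed

lemma conj_sub_conj_sub:
  "g \<in> carrier G \<Longrightarrow> h \<in> carrier G \<Longrightarrow> conj_sub (conj_sub M g) h = conj_sub M (g \<otimes> h)"
  by (auto simp: conj_sub_def inv_mult_group m_assoc)

lemma card_conj_sub:
  assumes "M \<subseteq> carrier G" and g: "g \<in> carrier G"
  shows "card (conj_sub M g) = card M"
proof (rule bij_betw_same_card[of "\<lambda>x. g \<otimes> x \<otimes> inv g"])
  show "bij_betw (\<lambda>x. g \<otimes> x \<otimes> inv g) (conj_sub M g) M"
    by (rule bij_betw_byWitness[of _ "\<lambda>x. inv g \<otimes> x \<otimes> g"])
       (use assms in \<open>auto simp: conj_sub_def m_assoc subset_iff\<close>)
qed

text \<open>Counting the conjugating elements instead of the conjugates gives a class function and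
  keeps centralizers out of the double counts.\<close>

definition conj_count :: "'a set \<Rightarrow> 'a \<Rightarrow> nat"
  where "conj_count M a = card {g \<in> carrier G. g \<otimes> a \<otimes> inv g \<in> M}"

lemma conj_count_conj:
  assumes "a \<in> carrier G" "x \<in> carrier G"
  shows "conj_count M (x \<otimes> a \<otimes> inv x) = conj_count M a"
  unfolding conj_count_def
proof (rule bij_betw_same_card[of "\<lambda>g. g \<otimes> x"])
  show "bij_betw (\<lambda>g. g \<otimes> x) {g \<in> carrier G. g \<otimes> (x \<otimes> a \<otimes> inv x) \<otimes> inv g \<in> M}
      {g \<in> carrier G. g \<otimes> a \<otimes> inv g \<in> M}"
    by (rule bij_betw_byWitness[of _ "\<lambda>g. g \<otimes> inv x"])
       (use assms in \<open>auto simp: m_assoc inv_mult_group\<close>)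
qed

lemma sum_conj_count:
  assumes "finite (carrier G)" "finite A" "A \<subseteq> carrier G"
  shows "(\<Sum>a\<in>A. conj_count M a) = (\<Sum>g\<in>carrier G. card (conj_sub M g \<inter> A))"
proof -
  have "(\<Sum>a\<in>A. conj_count M a) = (\<Sum>a\<in>A. \<Sum>g\<in>carrier G. if g \<otimes> a \<otimes> inv g \<in> M then 1 else 0)"
    using assms(1) by (simp add: conj_count_def sum.If_cases Int_def)
  also have "\<dots> = (\<Sum>g\<in>carrier G. \<Sum>a\<in>A. if g \<otimes> a \<otimes> inv g \<in> M then 1 else 0)"
    by (rule sum.swap)
  also have "\<dots> = (\<Sum>g\<in>carrier G. card (conj_sub M g \<inter> A))"
  proof (rule sum.cong)
    fix g assume "g \<in> carrier G"
    have "conj_sub M g \<inter> A = {a \<in> A. g \<otimes> a \<otimes> inv g \<in> M}" using assms by (auto simp: conj_sub_def)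
    then show "(\<Sum>a\<in>A. if g \<otimes> a \<otimes> inv g \<in> M then 1 else 0) = card (conj_sub M g \<inter> A)"
      using assms(2) by (simp add: sum.If_cases Int_def)
  qed simp
  finally show ?thesis .
qed

text \<open>Two pairs (m, h) with the same product m g h have second components that differ by an
  element of H which g conjugates into M; this bounds the fibres of the product map.\<close>

lemma card_double_coset:
  assumes fin: "finite (carrier G)" and M: "subgroup M G" and H: "subgroup H G" and g: "g \<in> carrier G"
  shows "card M * card H \<le> card {m \<otimes> g \<otimes> h | m h. m \<in> M \<and> h \<in> H} * card (conj_sub M g \<inter> H)"
proof -
  let ?D = "{m \<otimes> g \<otimes> h | m h. m \<in> M \<and> h \<in> H}"
  have Mc: "m \<in> carrier G" if "m \<in> M" for m using that subgroup.subset[OF M] by blast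
  have Hc: "h \<in> carrier G" if "h \<in> H" for h using that subgroup.subset[OF H] by blast
  have finM: "finite M" "finite H" using fin subgroup.subset[OF M] subgroup.subset[OF H] finite_subset by blast+
  have DG: "?D \<subseteq> carrier G" using Mc Hc g by auto
  have "card (M \<times> H) \<le> card ?D * card (conj_sub M g \<inter> H)"
  proof (rule card_le_fibers[where f = "\<lambda>(m, h). m \<otimes> g \<otimes> h"])
    show "finite (M \<times> H)" using finM by simp
    show "finite ?D" using DG fin finite_subset by blast
    show "(\<lambda>(m, h). m \<otimes> g \<otimes> h) ` (M \<times> H) \<subseteq> ?D" by auto
    fix b assume "b \<in> ?D"
    then obtain m0 h0 where mh0: "m0 \<in> M" "h0 \<in> H" "b = m0 \<otimes> g \<otimes> h0" by blast
    have eq: "g \<otimes> (h0 \<otimes> inv h) \<otimes> inv g = inv m0 \<otimes> m"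
      if mh: "m \<in> M" "h \<in> H" "m \<otimes> g \<otimes> h = b" for m h
    proof -
      have "g \<otimes> (h0 \<otimes> inv h) \<otimes> inv g = inv m0 \<otimes> (m0 \<otimes> g \<otimes> h0) \<otimes> inv h \<otimes> inv g"
        using mh0(1,2) mh(1,2) Mc Hc g by (simp add: m_assoc)
      also have "\<dots> = inv m0 \<otimes> (m \<otimes> g \<otimes> h) \<otimes> inv h \<otimes> inv g" using mh(3) mh0(3) by simp
      also have "\<dots> = inv m0 \<otimes> m" using mh0(1,2) mh(1,2) Mc Hc g by (simp add: m_assoc)
      finally show ?thesis .
    qed
    show "card {a \<in> M \<times> H. (case a of (m, h) \<Rightarrow> m \<otimes> g \<otimes> h) = b} \<le> card (conj_sub M g \<inter> H)"
    proof (rule card_inj_on_le[of "\<lambda>(m, h). h0 \<otimes> inv h"])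
      show "finite (conj_sub M g \<inter> H)" using finM by simp
      show "(\<lambda>(m, h). h0 \<otimes> inv h) ` {a \<in> M \<times> H. (case a of (m, h) \<Rightarrow> m \<otimes> g \<otimes> h) = b} \<subseteq> conj_sub M g \<inter> H"
      proof clarify
        fix m h assume *: "m \<in> M" "h \<in> H" "b = m \<otimes> g \<otimes> h"
        have "h0 \<otimes> inv h \<in> H" using * mh0 H by (simp add: subgroup.m_closed subgroup.m_inv_closed)
        moreover have "inv m0 \<otimes> m \<in> M" using * mh0 M by (simp add: subgroup.m_closed subgroup.m_inv_closed)
        ultimately show "h0 \<otimes> inv h \<in> conj_sub M g \<inter> H"
          using eq[OF *(1,2)] *(3) Hc by (simp add: conj_sub_def)
      qed
      show "inj_on (\<lambda>(m, h). h0 \<otimes> inv h) {a \<in> M \<times> H. (case a of (m, h) \<Rightarrow> m \<otimes> g \<otimes> h) = b}"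
      proof (rule inj_onI, clarify)
        fix m h m' h' assume *: "m \<in> M" "h \<in> H" "m' \<in> M" "h' \<in> H"
          "b = m \<otimes> g \<otimes> h" "m' \<otimes> g \<otimes> h' = m \<otimes> g \<otimes> h" "h0 \<otimes> inv h = h0 \<otimes> inv h'"
        have "inv h = inv h'" using *(2,4,7) Hc mh0 by simp
        then have "h = h'" using *(2,4) Hc by (metis inv_inv)
        moreover from this have "m' = m" using * Mc Hc g by (metis m_closed r_cancel)
        ultimately show "m = m' \<and> h = h'" by simp
      qed
    qed
  qed
  then show ?thesis by (simp add: card_cartesian_product)
qed

end

text \<open>
  For \<open>SL\<^sub>2\<close> take \<open>P = Z\<close>; for the Suzuki group \<open>Z\<close> is the center of \<open>P\<close>. In both cases the
  squares of elements of \<open>P\<close> form its Frattini subgroup, and \<open>w_s1\<close> makes \<open>w\<close> a conjugate of \<open>z1\<close>.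
\<close>

locale zassenhaus_type = group G for G (structure) +
  fixes P Z T :: "'a set" and w s1 z1 :: 'a and k :: nat
  assumes fin: "finite (carrier G)"
    and P: "subgroup P G" and Z: "subgroup Z G" and T: "subgroup T G"
    and ZP: "Z \<subseteq> P" and Z_central: "\<And>z s. z \<in> Z \<Longrightarrow> s \<in> P \<Longrightarrow> z \<otimes> s = s \<otimes> z"
    and card_P: "card P = 2 ^ k" and card_Z: "card Z = card T + 1" "8 \<le> card Z"
    and T_P: "\<And>t s. t \<in> T \<Longrightarrow> s \<in> P \<Longrightarrow> t \<otimes> s \<otimes> inv t \<in> P"
    and T_Z: "\<And>t s. t \<in> T \<Longrightarrow> s \<in> Z \<Longrightarrow> t \<otimes> s \<otimes> inv t \<in> Z"
    and T_free: "\<And>t s. t \<in> T \<Longrightarrow> s \<in> P \<Longrightarrow> t \<otimes> s = s \<otimes> t \<Longrightarrow> t = \<one> \<or> s = \<one>"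
    and T_comm: "\<And>t t'. t \<in> T \<Longrightarrow> t' \<in> T \<Longrightarrow> t \<otimes> t' = t' \<otimes> t"
    and sq_Z: "\<And>s. s \<in> P \<Longrightarrow> s \<otimes> s \<in> Z"
    and sq_inj: "\<And>s s'. s \<in> P \<Longrightarrow> s' \<in> P \<Longrightarrow> s \<otimes> s = s' \<otimes> s' \<Longrightarrow> inv s \<otimes> s' \<in> Z"
    and w: "w \<in> carrier G" "w \<otimes> w = \<one>" "\<And>t. t \<in> T \<Longrightarrow> w \<otimes> t \<otimes> w = inv t"
    and s1: "s1 \<in> P" and z1: "z1 \<in> Z" and w_s1: "w \<otimes> s1 = s1 \<otimes> w \<otimes> z1 \<otimes> w"
    and Bruhat: "\<And>g. g \<in> carrier G \<Longrightarrow> (\<exists>s\<in>P. \<exists>t\<in>T. g = s \<otimes> t) \<or>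
      (\<exists>s\<in>P. \<exists>t\<in>T. \<exists>s'\<in>P. g = s \<otimes> w \<otimes> t \<otimes> s')"
    and opposite: "\<And>s s' t. s \<in> P \<Longrightarrow> s' \<in> P \<Longrightarrow> t \<in> T \<Longrightarrow> w \<otimes> s \<otimes> w = s' \<otimes> t \<Longrightarrow> s = \<one>"
    and w_notin: "\<And>s t. s \<in> P \<Longrightarrow> t \<in> T \<Longrightarrow> w \<noteq> s \<otimes> t"
    and squares: "subgroup ((\<lambda>s. s \<otimes> s) ` P) G" "card P = card Z * card ((\<lambda>s. s \<otimes> s) ` P)"
    and squares_free: "\<And>t s. t \<in> T \<Longrightarrow> s \<in> P \<Longrightarrow> t \<otimes> s \<otimes> inv t \<otimes> inv s \<in> (\<lambda>s. s \<otimes> s) ` P \<Longrightarrow>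
      t = \<one> \<or> s \<in> (\<lambda>s. s \<otimes> s) ` P"
begin

text \<open>The Borel subgroup, which will turn out to be a point stabilizer.\<close>

definition H :: "'a set"
  where "H = {s \<otimes> t | s t. s \<in> P \<and> t \<in> T}"

lemma in_carrier [simp]:
  "x \<in> P \<Longrightarrow> x \<in> carrier G" "w \<in> carrier G" "x \<in> T \<Longrightarrow> x \<in> carrier G" "x \<in> Z \<Longrightarrow> x \<in> carrier G"
  "z1 \<in> carrier G" "s1 \<in> carrier G"
  using subgroup.subset[OF P] subgroup.subset[OF Z] subgroup.subset[OF T] w s1 z1 by blast+

lemma closed [simp]:
  "\<one> \<in> P" "\<one> \<in> T" "\<one> \<in> Z"
  "x \<in> P \<Longrightarrow> inv x \<in> P" "x \<in> T \<Longrightarrow> inv x \<in> T" "x \<in> Z \<Longrightarrow> inv x \<in> Z"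
  "x \<in> P \<Longrightarrow> y \<in> P \<Longrightarrow> x \<otimes> y \<in> P" "x \<in> T \<Longrightarrow> y \<in> T \<Longrightarrow> x \<otimes> y \<in> T" "x \<in> Z \<Longrightarrow> y \<in> Z \<Longrightarrow> x \<otimes> y \<in> Z"
  using P Z T by (simp_all add: subgroup.one_closed subgroup.m_inv_closed subgroup.m_closed)

lemma finite_sub [simp]: "finite P" "finite T" "finite Z"
  using fin finite_subset subgroup.subset[OF P] subgroup.subset[OF Z] subgroup.subset[OF T] by blast+

lemma w_w [simp]: "x \<in> carrier G \<Longrightarrow> w \<otimes> (w \<otimes> x) = x" "w \<otimes> w = \<one>" "inv w = w"
  using w(2) by (simp_all add: m_assoc[symmetric] inv_equality)

lemma w_T: "t \<in> T \<Longrightarrow> w \<otimes> t = inv t \<otimes> w"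
proof -
  assume t: "t \<in> T"
  have "w \<otimes> t = w \<otimes> t \<otimes> w \<otimes> w" using t by (simp add: m_assoc)
  then show ?thesis using w(3)[OF t] by simp
qed

lemma P_T: "P \<inter> T = {\<one>}"
proof -
  have "s = \<one>" if "s \<in> P" "s \<in> T" for s using T_free[OF that(2,1)] by simp
  then show ?thesis by auto
qed

lemma T_P': "t \<in> T \<Longrightarrow> s \<in> P \<Longrightarrow> \<exists>s'\<in>P. t \<otimes> s = s' \<otimes> t"
  by (rule bexI[OF _ T_P]) (simp_all add: m_assoc)

lemma P_T_unique:
  assumes "s \<in> P" "s' \<in> P" "t \<in> T" "t' \<in> T" "s \<otimes> t = s' \<otimes> t'"
  shows "s = s'" "t = t'"
proof -
  have "inv s' \<otimes> s = inv s' \<otimes> (s \<otimes> t) \<otimes> inv t" using assms(1-4) by (simp add: m_assoc)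
  also have "\<dots> = t' \<otimes> inv t" unfolding assms(5) using assms(1-4) by (simp add: m_assoc)
  finally have "inv s' \<otimes> s = t' \<otimes> inv t" .
  moreover have "inv s' \<otimes> s \<in> P" "t' \<otimes> inv t \<in> T" using assms by simp_all
  ultimately have "inv s' \<otimes> s = \<one>" using P_T by (metis IntI singletonD)
  then show "s = s'" using assms(1,2) by (metis in_carrier(1) inv_closed inv_equality inv_inv)
  then show "t = t'" using assms by simp
qed

lemma H_I: "s \<in> P \<Longrightarrow> t \<in> T \<Longrightarrow> s \<otimes> t \<in> H"
  by (auto simp: H_def)

lemma H_subgroup: "subgroup H G"
proof (rule subgroupI)
  show "H \<subseteq> carrier G" by (auto simp: H_def)
  show "H \<noteq> {}" using H_I[OF closed(1,2)] by blast
  show "inv a \<in> H" if a: "a \<in> H" for a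
  proof -
    obtain s t where st: "s \<in> P" "t \<in> T" "a = s \<otimes> t" using a by (auto simp: H_def)
    then have "inv a = inv t \<otimes> inv s" by (simp add: inv_mult_group)
    moreover obtain s' where "s' \<in> P" "inv t \<otimes> inv s = s' \<otimes> inv t" using T_P'[of "inv t" "inv s"] st by auto
    ultimately show ?thesis using st H_I by simp
  qed
  show "a \<otimes> b \<in> H" if ab: "a \<in> H" "b \<in> H" for a b
  proof -
    obtain s t where st: "s \<in> P" "t \<in> T" "a = s \<otimes> t" using ab by (auto simp: H_def)
    obtain s' t' where st': "s' \<in> P" "t' \<in> T" "b = s' \<otimes> t'" using ab by (auto simp: H_def)
    obtain s'' where s'': "s'' \<in> P" "t \<otimes> s' = s'' \<otimes> t" using T_P'[of t s'] st st' by auto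
    have "a \<otimes> b = s \<otimes> (t \<otimes> s') \<otimes> t'" using st st' by (simp add: m_assoc)
    also have "\<dots> = (s \<otimes> s'') \<otimes> (t \<otimes> t')" using st st' s'' by (simp add: m_assoc)
    finally show ?thesis using st(1,2) st'(1,2) s''(1) H_I by simp
  qed
qed

lemma H_carrier [simp]: "x \<in> H \<Longrightarrow> x \<in> carrier G"
  using subgroup.subset[OF H_subgroup] by blast

lemma H_closed [simp]: "\<one> \<in> H" "x \<in> H \<Longrightarrow> inv x \<in> H" "x \<in> H \<Longrightarrow> y \<in> H \<Longrightarrow> x \<otimes> y \<in> H"
  using H_subgroup by (simp_all add: subgroup.one_closed subgroup.m_inv_closed subgroup.m_closed)

lemma finite_H [simp]: "finite H"
  using fin finite_subset subgroup.subset[OF H_subgroup] by blast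

lemma P_H: "s \<in> P \<Longrightarrow> s \<in> H" and T_H: "t \<in> T \<Longrightarrow> t \<in> H"
  unfolding H_def by (force intro: exI[of _ \<one>])+

lemma card_H: "card H = card P * card T"
proof -
  have "bij_betw (\<lambda>(s, t). s \<otimes> t) (P \<times> T) H"
    using P_T_unique by (auto simp: bij_betw_def inj_on_def H_def image_def)
  then show ?thesis using bij_betw_same_card card_cartesian_product by metis
qed

lemma w_notin_H: "w \<notin> H"
  using w_notin by (auto simp: H_def)

lemma opposite_H: "s \<in> P \<Longrightarrow> w \<otimes> s \<otimes> w \<in> H \<Longrightarrow> s = \<one>"
  using opposite by (auto simp: H_def)

lemma Bruhat_H: "g \<in> carrier G \<Longrightarrow> g \<in> H \<or> (\<exists>s\<in>P. \<exists>h\<in>H. g = s \<otimes> w \<otimes> h)"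
proof -
  assume "g \<in> carrier G"
  then consider s t where "s \<in> P" "t \<in> T" "g = s \<otimes> t" | s t s' where "s \<in> P" "t \<in> T" "s' \<in> P" "g = s \<otimes> w \<otimes> t \<otimes> s'"
    using Bruhat by blast
  then show ?thesis
  proof cases
    case 1
    then show ?thesis by (auto simp: H_def)
  next
    case (2 s t s')
    then have "g = s \<otimes> w \<otimes> (t \<otimes> s')" by (simp add: m_assoc)
    moreover have "t \<otimes> s' \<in> H" using 2 T_H P_H by simp
    ultimately show ?thesis using 2(1) by blast
  qed
qed

text \<open>\<open>G\<close> is the disjoint union of \<open>H\<close> and the big cell. The
  products s w h are pairwise distinct because w conjugates no element of \<open>P\<close> except
  the identity into \<open>H\<close>.\<close>

lemma card_G: "card (carrier G) = (card P + 1) * card H"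
proof -
  let ?C = "(\<lambda>(s, h). s \<otimes> w \<otimes> h) ` (P \<times> H)"
  have "carrier G = H \<union> ?C" using Bruhat_H by force
  moreover have "H \<inter> ?C = {}"
  proof -
    have False if "s \<in> P" "h \<in> H" "s \<otimes> w \<otimes> h \<in> H" for s h
    proof -
      have "inv s \<otimes> (s \<otimes> w \<otimes> h) \<otimes> inv h \<in> H" 
        using H_closed(3)[OF H_closed(3)[OF H_closed(2)[OF P_H[OF that(1)]] that(3)] H_closed(2)[OF that(2)]] .
      moreover have "inv s \<otimes> (s \<otimes> w \<otimes> h) \<otimes> inv h = w" using that(1,2) w(1) by (simp add: m_assoc)
      ultimately show False using w_notin_H by simp
    qed
    then show ?thesis by auto
  qed
  ultimately have "card (carrier G) = card H + card ?C" by (simp add: card_Un_disjoint)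
  moreover have "inj_on (\<lambda>(s, h). s \<otimes> w \<otimes> h) (P \<times> H)"
  proof (rule inj_onI, clarify)
    fix s h s' h' assume *: "s \<in> P" "h \<in> H" "s' \<in> P" "h' \<in> H" "s \<otimes> w \<otimes> h = s' \<otimes> w \<otimes> h'"
    have "w \<otimes> (inv s' \<otimes> s) \<otimes> w = w \<otimes> inv s' \<otimes> (s \<otimes> w \<otimes> h) \<otimes> inv h"
      using *(1-4) by (simp add: m_assoc)
    also have "\<dots> = h' \<otimes> inv h" unfolding *(5) using *(1-4) by (simp add: m_assoc)
    finally have "w \<otimes> (inv s' \<otimes> s) \<otimes> w \<in> H" using * by simp
    then have "inv s' \<otimes> s = \<one>" using * by (intro opposite_H) auto
    then have ss: "s = s'" using * by (metis in_carrier(1) inv_closed inv_equality inv_inv)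
    have "h = w \<otimes> inv s \<otimes> (s \<otimes> w \<otimes> h)" using *(1-4) by (simp add: m_assoc)
    also have "\<dots> = h'" unfolding *(5) using *(1-4) ss by (simp add: m_assoc)
    finally show "s = s' \<and> h = h'" using ss by simp
  qed
  ultimately show ?thesis by (simp add: card_image card_cartesian_product)
qed

text \<open>Since t centralizes only the identity of \<open>P\<close>, the commutator map of t on
  \<open>P\<close> is injective, and surjective by finiteness.\<close>

lemma commutator_surj:
  assumes t: "t \<in> T" "t \<noteq> \<one>" and s: "s \<in> P"
  shows "\<exists>s'\<in>P. s = s' \<otimes> (t \<otimes> inv s' \<otimes> inv t)"
proof -
  let ?f = "\<lambda>s'. s' \<otimes> (t \<otimes> inv s' \<otimes> inv t)"
  have "inj_on ?f P"
  proof (rule inj_onI)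
    fix a b assume ab: "a \<in> P" "b \<in> P" "?f a = ?f b"
    have "a \<otimes> t \<otimes> inv a = ?f a \<otimes> t" using ab(1) t by (simp add: m_assoc)
    also have "\<dots> = b \<otimes> t \<otimes> inv b" unfolding ab(3) using ab(2) t by (simp add: m_assoc)
    finally have e: "a \<otimes> t \<otimes> inv a = b \<otimes> t \<otimes> inv b" .
    have "t \<otimes> (inv b \<otimes> a) = inv b \<otimes> (b \<otimes> t \<otimes> inv b) \<otimes> a" using ab(1,2) t by (simp add: m_assoc)
    also have "\<dots> = inv b \<otimes> a \<otimes> t" unfolding e[symmetric] using ab(1,2) t by (simp add: m_assoc)
    finally have "inv b \<otimes> a = \<one>" using T_free[of t "inv b \<otimes> a"] t ab by simp
    then show "a = b" using ab by (metis in_carrier(1) inv_closed inv_equality inv_inv)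
  qed
  then have "card (?f ` P) = card P" by (rule card_image)
  moreover have "?f ` P \<subseteq> P" using T_P t by auto
  ultimately have "?f ` P = P" by (intro card_subset_eq) auto
  then have "s \<in> ?f ` P" using s by (simp only:)
  then show ?thesis by (simp only: image_iff)
qed

lemma H_conj_T:
  assumes h: "h \<in> H" "h \<notin> P"
  obtains s t where "s \<in> P" "t \<in> T" "t \<noteq> \<one>" "h = s \<otimes> t \<otimes> inv s"
proof -
  obtain s t where st: "s \<in> P" "t \<in> T" "h = s \<otimes> t" using h by (auto simp: H_def)
  have t1: "t \<noteq> \<one>" using st h by auto
  obtain s' where s': "s' \<in> P" "s = s' \<otimes> (t \<otimes> inv s' \<otimes> inv t)" using commutator_surj[OF st(2) t1 st(1)] by blast
  have "h = s' \<otimes> t \<otimes> inv s'" unfolding st(3) s'(2) using s'(1) st(1,2) by (simp add: m_assoc)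
  then show ?thesis using that s' st t1 by blast
qed

lemma card_P_ge: "card Z \<le> card P"
  using ZP by (intro card_mono) auto

lemma z1_ne: "z1 \<noteq> \<one>"
proof
  assume "z1 = \<one>"
  then have "w \<otimes> s1 = s1" using w_s1 by (simp add: m_assoc)
  then have "w = \<one>" by (simp add: r_cancel_one[of s1 w])
  then show False using w_notin_H by simp
qed

lemma w_conj: "w = (s1 \<otimes> w) \<otimes> z1 \<otimes> inv (s1 \<otimes> w)"
proof -
  have "(s1 \<otimes> w) \<otimes> z1 \<otimes> inv (s1 \<otimes> w) = (s1 \<otimes> w \<otimes> z1 \<otimes> w) \<otimes> inv s1"
    by (simp add: inv_mult_group m_assoc)
  also have "\<dots> = w \<otimes> s1 \<otimes> inv s1" by (simp add: w_s1)
  also have "\<dots> = w" by (simp add: m_assoc)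
  finally show ?thesis by simp
qed

text \<open>Conjugation by \<open>T\<close> is free on the nonidentity elements of \<open>Z\<close>,
  and there are exactly card T of them.\<close>

lemma T_transitive_Z:
  assumes "z \<in> Z" "z \<noteq> \<one>" "z' \<in> Z" "z' \<noteq> \<one>"
  obtains t where "t \<in> T" "z' = t \<otimes> z \<otimes> inv t"
proof -
  let ?f = "\<lambda>t. t \<otimes> z \<otimes> inv t"
  have zP: "z \<in> P" using assms ZP by blast
  have "inj_on ?f T"
  proof (rule inj_onI)
    fix a b assume ab: "a \<in> T" "b \<in> T" "?f a = ?f b"
    have "(inv b \<otimes> a) \<otimes> z = inv b \<otimes> ?f a \<otimes> a" using ab(1,2) assms(1) by (simp add: m_assoc)
    also have "\<dots> = z \<otimes> (inv b \<otimes> a)" unfolding ab(3) using ab(1,2) assms(1) by (simp add: m_assoc)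
    finally have "inv b \<otimes> a = \<one>" using T_free[of "inv b \<otimes> a" z] ab zP assms by simp
    then show "a = b" using ab by (metis in_carrier(3) inv_closed inv_equality inv_inv)
  qed
  then have "card (?f ` T) = card T" by (rule card_image)
  moreover have "?f ` T \<subseteq> Z - {\<one>}"
  proof
    fix x assume "x \<in> ?f ` T"
    then obtain t where t: "t \<in> T" "x = ?f t" by blast
    have "z = inv t \<otimes> x \<otimes> t" using t assms by (simp add: m_assoc)
    then have "x \<noteq> \<one>" using t assms by auto
    then show "x \<in> Z - {\<one>}" using t T_Z assms by simp
  qed
  ultimately have "?f ` T = Z - {\<one>}" using card_Z(1) by (intro card_subset_eq) auto
  then have "z' \<in> ?f ` T" using assms by simp
  then show ?thesis using that by (elim imageE)
qed

lemma odd_card_T: "odd (card T)"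
proof -
  have "subgroup Z (G\<lparr>carrier := P\<rparr>)"
    using subgroup_incl[OF Z P ZP] .
  from group.lagrange[OF subgroup_imp_group[OF P] this] have "card Z dvd card P"
    by (simp add: Coset.order_def dvd_def) (metis mult.commute)
  then obtain j where j: "card Z = 2 ^ j" using card_P by (auto simp: divides_primepow_nat)
  then have "j \<noteq> 0" using card_Z by (intro notI) simp
  then have "even (card Z)" using j by simp
  then show ?thesis using card_Z(1) by simp
qed

text \<open>As \<open>T\<close> has odd order, r is the power of t with exponent (card T + 1) /
  2.\<close>

lemma T_square:
  assumes t: "t \<in> T"
  obtains r where "r \<in> T" "t = r \<otimes> r"
proof -
  interpret GT: group "G\<lparr>carrier := T\<rparr>" by (rule subgroup_imp_group[OF T])
  obtain d where d: "card T + 1 = 2 * d" using odd_card_T by (metis even_plus_one_iff evenE)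
  have pow: "t [^]\<^bsub>G\<lparr>carrier := T\<rparr>\<^esub> (card T) = \<one>"
    using GT.pow_order_eq_1[of t] t by (simp add: Coset.order_def)
  have eq: "x [^]\<^bsub>G\<lparr>carrier := T\<rparr>\<^esub> (i :: nat) = x [^] i" for x i
    by (simp add: nat_pow_def)
  have "t [^] (card T + 1) = t" using pow t by (simp add: eq)
  then have "t = t [^] d \<otimes> t [^] d" unfolding d using t by (simp add: nat_pow_mult mult_2)
  moreover have "t [^] d \<in> T"
    using GT.nat_pow_closed[of t d] t by (simp add: eq)
  ultimately show ?thesis using that by blast
qed

lemma conj_count_Z_T:
  assumes M: "subgroup M G"
  shows "(\<Sum>z\<in>Z - {\<one>}. conj_count M z) \<le> (\<Sum>t\<in>T. conj_count M t)"
proof -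
  have cw: "conj_count M w = conj_count M z1"
    using conj_count_conj[of z1 "s1 \<otimes> w" M] w_conj by simp
  have cz: "conj_count M z = conj_count M z1" if z: "z \<in> Z" "z \<noteq> \<one>" for z
  proof -
    obtain t where t: "t \<in> T" "z = t \<otimes> z1 \<otimes> inv t" using T_transitive_Z[OF z1 z1_ne z] .
    then show ?thesis using conj_count_conj[of z1 t M] by simp
  qed
  \<comment> \<open>With t = r r and w inverting r, the product w t equals inv r w r.\<close>
  have cwt: "conj_count M (w \<otimes> t) = conj_count M w" if t: "t \<in> T" for t
  proof -
    obtain r where r: "r \<in> T" "t = r \<otimes> r" using T_square[OF t] .
    have "w \<otimes> t = (w \<otimes> r) \<otimes> r" using r by (simp add: m_assoc)
    also have "\<dots> = inv r \<otimes> w \<otimes> inv (inv r)" using r w_T by simp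
    finally show ?thesis using conj_count_conj[of w "inv r" M] r by simp
  qed
  \<comment> \<open>A nonempty part of the coset w T inside a subgroup is carried into the
    corresponding part of \<open>T\<close> by dividing by one of its elements.\<close>
  have le: "card (conj_sub M g \<inter> (\<lambda>t. w \<otimes> t) ` T) \<le> card (conj_sub M g \<inter> T)" if g: "g \<in> carrier G" for g
  proof (cases "conj_sub M g \<inter> (\<lambda>t. w \<otimes> t) ` T = {}")
    case False
    then obtain t0 where t0: "t0 \<in> T" "w \<otimes> t0 \<in> conj_sub M g" by blast
    have N: "subgroup (conj_sub M g) G" using subgroup_conj_sub[OF M g] .
    show ?thesis
    proof (rule card_inj_on_le[of "\<lambda>x. inv (w \<otimes> t0) \<otimes> x"])
      show "inj_on (\<lambda>x. inv (w \<otimes> t0) \<otimes> x) (conj_sub M g \<inter> (\<lambda>t. w \<otimes> t) ` T)"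
        using t0 by (auto simp: inj_on_def)
      show "finite (conj_sub M g \<inter> T)" by simp
      show "(\<lambda>x. inv (w \<otimes> t0) \<otimes> x) ` (conj_sub M g \<inter> (\<lambda>t. w \<otimes> t) ` T) \<subseteq> conj_sub M g \<inter> T"
      proof
        fix y assume "y \<in> (\<lambda>x. inv (w \<otimes> t0) \<otimes> x) ` (conj_sub M g \<inter> (\<lambda>t. w \<otimes> t) ` T)"
        then obtain t where t: "t \<in> T" "w \<otimes> t \<in> conj_sub M g" "y = inv (w \<otimes> t0) \<otimes> (w \<otimes> t)" by blast
        have "y \<in> conj_sub M g"
          using t t0 subgroup.m_closed[OF N] subgroup.m_inv_closed[OF N] by simp
        moreover have "y = inv t0 \<otimes> t" using t t0 by (simp add: inv_mult_group m_assoc)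
        ultimately show "y \<in> conj_sub M g \<inter> T" using t t0 by simp
      qed
    qed
  qed simp
  have "(\<Sum>z\<in>Z - {\<one>}. conj_count M z) = card T * conj_count M w"
    using cz cw card_Z(1) by simp
  also have "\<dots> = (\<Sum>t\<in>T. conj_count M (w \<otimes> t))" using cwt by simp
  also have "\<dots> = (\<Sum>x\<in>(\<lambda>t. w \<otimes> t) ` T. conj_count M x)"
    by (subst sum.reindex) (auto simp: inj_on_def)
  also have "\<dots> = (\<Sum>g\<in>carrier G. card (conj_sub M g \<inter> (\<lambda>t. w \<otimes> t) ` T))"
    by (intro sum_conj_count fin) auto
  also have "\<dots> \<le> (\<Sum>g\<in>carrier G. card (conj_sub M g \<inter> T))" using le by (intro sum_mono)
  also have "\<dots> = (\<Sum>t\<in>T. conj_count M t)" by (intro sum_conj_count[symmetric] fin) auto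
  finally show ?thesis .
qed

text \<open>For s in \<open>P\<close> and t \<noteq> 1 in \<open>T\<close> the elements s t inv s
  are distinct, lie in \<open>H\<close> outside \<open>P\<close>, and have the same count as
  t.\<close>

lemma conj_count_T_H:
  "card P * (\<Sum>t\<in>T - {\<one>}. conj_count M t) \<le> (\<Sum>h\<in>H - P. conj_count M h)"
proof -
  let ?f = "\<lambda>(s, t). s \<otimes> t \<otimes> inv s"
  let ?A = "P \<times> (T - {\<one>})"
  have dec: "s \<otimes> t \<otimes> inv s = (s \<otimes> (t \<otimes> inv s \<otimes> inv t)) \<otimes> t" if "s \<in> P" "t \<in> T" for s t
    using that by (simp add: m_assoc)
  have decP: "s \<otimes> (t \<otimes> inv s \<otimes> inv t) \<in> P" if "s \<in> P" "t \<in> T" for s t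
    using that T_P by simp
  have inj: "inj_on ?f ?A"
  proof (rule inj_onI)
    fix x y assume xy: "x \<in> ?A" "y \<in> ?A" "?f x = ?f y"
    obtain s t where x: "x = (s, t)" by (cases x)
    obtain s' t' where y: "y = (s', t')" by (cases y)
    have *: "s \<in> P" "t \<in> T" "t \<noteq> \<one>" "s' \<in> P" "t' \<in> T"
      and e: "s \<otimes> t \<otimes> inv s = s' \<otimes> t' \<otimes> inv s'"
      using xy x y by auto
    have t: "t = t'"
      using P_T_unique(2)[OF decP[OF *(1,2)] decP[OF *(4,5)] *(2,5)] e dec * by simp
    have "t \<otimes> (inv s' \<otimes> s) = inv s' \<otimes> (s' \<otimes> t' \<otimes> inv s') \<otimes> s"
      using * t by (simp add: m_assoc)
    also have "\<dots> = inv s' \<otimes> s \<otimes> t" unfolding e[symmetric] using *(1,2,4) by (simp add: m_assoc)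
    finally have "inv s' \<otimes> s = \<one>" using T_free[of t "inv s' \<otimes> s"] * by simp
    then have "s = s'" using *(1,4) by (metis in_carrier(1) inv_closed inv_equality inv_inv)
    then show "x = y" using t x y by simp
  qed
  have sub: "?f ` ?A \<subseteq> H - P"
  proof
    fix x assume "x \<in> ?f ` ?A"
    then obtain s t where *: "s \<in> P" "t \<in> T" "t \<noteq> \<one>" and x: "x = s \<otimes> t \<otimes> inv s" by auto
    have "s \<otimes> t \<otimes> inv s \<notin> P"
    proof
      assume c: "s \<otimes> t \<otimes> inv s \<in> P"
      have "inv s \<otimes> (s \<otimes> t \<otimes> inv s) \<otimes> s \<in> P"
        using closed(7)[OF closed(7)[OF closed(4)[OF *(1)] c] *(1)] .
      moreover have "inv s \<otimes> (s \<otimes> t \<otimes> inv s) \<otimes> s = t" using * by (simp add: m_assoc)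
      ultimately have "t \<in> P \<inter> T" using * by simp
      then show False using P_T * by simp
    qed
    then show "x \<in> H - P" using * x P_H T_H by simp
  qed
  have "card P * (\<Sum>t\<in>T - {\<one>}. conj_count M t) = (\<Sum>s\<in>P. \<Sum>t\<in>T - {\<one>}. conj_count M t)" by simp
  also have "\<dots> = (\<Sum>s\<in>P. \<Sum>t\<in>T - {\<one>}. conj_count M (s \<otimes> t \<otimes> inv s))"
    using conj_count_conj by (intro sum.cong) auto
  also have "\<dots> = (\<Sum>x\<in>?A. conj_count M (?f x))"
    by (simp add: sum.cartesian_product case_prod_unfold)
  also have "\<dots> = (\<Sum>h\<in>?f ` ?A. conj_count M h)" using inj by (simp add: sum.reindex)
  also have "\<dots> \<le> (\<Sum>h\<in>H - P. conj_count M h)" using sub by (intro sum_mono2) auto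
  finally show ?thesis .
qed

text \<open>
  Both \<open>Z - {\<one>}\<close> and \<open>w T\<close> consist of conjugates of \<open>z1\<close>, but a subgroup contains at most as many
  elements of a coset of \<open>T\<close> as of \<open>T\<close> itself.
\<close>

lemma counting:
  assumes M: "subgroup M G"
  shows "(\<Sum>g\<in>carrier G. card P * card (conj_sub M g \<inter> (Z - {\<one>}))) \<le>
    (\<Sum>g\<in>carrier G. card P + card (conj_sub M g \<inter> (H - P)))"
proof -
  have one: "conj_count M \<one> = card (carrier G)"
    using subgroup.one_closed[OF M] unfolding conj_count_def
    by (intro arg_cong[of _ _ card]) auto
  have "(\<Sum>g\<in>carrier G. card P * card (conj_sub M g \<inter> (Z - {\<one>}))) = card P * (\<Sum>z\<in>Z - {\<one>}. conj_count M z)"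
    by (subst sum_conj_count[OF fin]) (auto simp: sum_distrib_left)
  also have "\<dots> \<le> card P * (\<Sum>t\<in>T. conj_count M t)" using conj_count_Z_T[OF M] by simp
  \<comment> \<open>The identity of \<open>T\<close> counts every g once; this is the source of the
    term \<open>card P\<close> on the right.\<close>
  also have "(\<Sum>t\<in>T. conj_count M t) = card (carrier G) + (\<Sum>t\<in>T - {\<one>}. conj_count M t)"
    using one by (subst sum.remove[of _ \<one>]) auto
  also have "card P * \<dots> \<le> card P * card (carrier G) + (\<Sum>h\<in>H - P. conj_count M h)"
    using conj_count_T_H[of M] by (simp add: distrib_left)
  also have "(\<Sum>h\<in>H - P. conj_count M h) = (\<Sum>g\<in>carrier G. card (conj_sub M g \<inter> (H - P)))"
    by (intro sum_conj_count fin) auto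
  also have "card P * card (carrier G) + \<dots> = (\<Sum>g\<in>carrier G. card P + card (conj_sub M g \<inter> (H - P)))"
    by (simp add: sum.distrib)
  finally show ?thesis .
qed

text \<open>Squaring maps N \<inter> P to N \<inter> Z with fibres inside cosets of N \<inter> Z,
  and a proper subgroup of \<open>P\<close> has index at least 2. Elements of N \<inter> H conjugate
  a nonidentity z in N \<inter> Z within N \<inter> Z, and the centralizer of z in \<open>H\<close>
  lies in \<open>P\<close>. If N \<inter> Z is trivial, elements of N \<inter> P have square 1 and
  lie in \<open>Z\<close> by \<open>sq_inj\<close>. If N \<inter> P is trivial, the T-component is
  injective on N \<inter> H.\<close>

lemma local_bounds:
  assumes N: "subgroup N G"
  shows "card (N \<inter> P) \<le> card (N \<inter> Z) * card (N \<inter> Z)"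
    and "\<not> P \<subseteq> N \<Longrightarrow> 2 * card (N \<inter> P) \<le> card P"
    and "N \<inter> Z \<noteq> {\<one>} \<Longrightarrow> card (N \<inter> H) \<le> card (N \<inter> P) * card (N \<inter> (Z - {\<one>}))"
    and "N \<inter> Z = {\<one>} \<Longrightarrow> N \<inter> P = {\<one>}"
    and "N \<inter> P = {\<one>} \<Longrightarrow> card (N \<inter> H) \<le> card T"
proof -
  note Ncl = subgroup.one_closed[OF N] subgroup.m_inv_closed[OF N] subgroup.m_closed[OF N]
  show "card (N \<inter> P) \<le> card (N \<inter> Z) * card (N \<inter> Z)"
  proof (rule card_le_fibers[where f = "\<lambda>s. s \<otimes> s"])
    show "(\<lambda>s. s \<otimes> s) ` (N \<inter> P) \<subseteq> N \<inter> Z" using Ncl sq_Z by blast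
    fix b assume "b \<in> N \<inter> Z"
    show "card {a \<in> N \<inter> P. a \<otimes> a = b} \<le> card (N \<inter> Z)"
    proof (cases "{a \<in> N \<inter> P. a \<otimes> a = b} = {}")
      case False
      then obtain a0 where a0: "a0 \<in> N" "a0 \<in> P" "a0 \<otimes> a0 = b" by blast
      show ?thesis
      proof (rule card_inj_on_le[of "\<lambda>a. inv a0 \<otimes> a"])
        show "inj_on (\<lambda>a. inv a0 \<otimes> a) {a \<in> N \<inter> P. a \<otimes> a = b}" using a0 by (auto simp: inj_on_def)
        show "(\<lambda>a. inv a0 \<otimes> a) ` {a \<in> N \<inter> P. a \<otimes> a = b} \<subseteq> N \<inter> Z" using a0 Ncl sq_inj by auto
      qed simp
    next
      case True
      then show ?thesis by (simp only: card.empty)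
    qed
  qed simp_all
  show "2 * card (N \<inter> P) \<le> card P" if nP: "\<not> P \<subseteq> N"
  proof -
    obtain s where s: "s \<in> P" "s \<notin> N" using nP by blast
    have "(\<lambda>x. s \<otimes> x) ` (N \<inter> P) \<inter> (N \<inter> P) = {}"
    proof -
      have False if x: "x \<in> N" "x \<in> P" "s \<otimes> x \<in> N" for x
      proof -
        have "(s \<otimes> x) \<otimes> inv x \<in> N" using x Ncl by blast
        then show False using s x by (simp add: m_assoc)
      qed
      then show ?thesis by blast
    qed
    then have "card ((\<lambda>x. s \<otimes> x) ` (N \<inter> P) \<union> (N \<inter> P)) = card ((\<lambda>x. s \<otimes> x) ` (N \<inter> P)) + card (N \<inter> P)"
      by (intro card_Un_disjoint) auto
    moreover have "card ((\<lambda>x. s \<otimes> x) ` (N \<inter> P)) = card (N \<inter> P)"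
      using s by (intro card_image) (auto simp: inj_on_def)
    moreover have "card ((\<lambda>x. s \<otimes> x) ` (N \<inter> P) \<union> (N \<inter> P)) \<le> card P"
      using s by (intro card_mono) auto
    ultimately show ?thesis by simp
  qed
  show "card (N \<inter> H) \<le> card (N \<inter> P) * card (N \<inter> (Z - {\<one>}))" if ne: "N \<inter> Z \<noteq> {\<one>}"
  proof -
    obtain z where z: "z \<in> N" "z \<in> Z" "z \<noteq> \<one>" using ne Ncl(1) closed(3) by blast
    have zP: "z \<in> P" using z ZP by blast
    have commP: "h \<in> P" if h: "h \<in> H" "h \<otimes> z = z \<otimes> h" for h
    proof -
      obtain s t where st: "s \<in> P" "t \<in> T" "h = s \<otimes> t" using h(1) by (auto simp: H_def)
      have "t \<otimes> z = inv s \<otimes> (h \<otimes> z)" using st z by (simp add: m_assoc)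
      also have "\<dots> = inv s \<otimes> (z \<otimes> s) \<otimes> t" unfolding h(2) using st z by (simp add: m_assoc)
      also have "\<dots> = z \<otimes> t" using st z Z_central[of z s] by (simp add: m_assoc)
      finally have "t = \<one>" using T_free[OF st(2) zP] z by simp
      then show ?thesis using st by simp
    qed
    have "card (N \<inter> H) \<le> card (N \<inter> (Z - {\<one>})) * card (N \<inter> P)"
    proof (rule card_le_fibers[where f = "\<lambda>h. h \<otimes> z \<otimes> inv h"])
      show "(\<lambda>h. h \<otimes> z \<otimes> inv h) ` (N \<inter> H) \<subseteq> N \<inter> (Z - {\<one>})"
      proof
        fix y assume "y \<in> (\<lambda>h. h \<otimes> z \<otimes> inv h) ` (N \<inter> H)"
        then obtain h where h: "h \<in> N" "h \<in> H" "y = h \<otimes> z \<otimes> inv h" by blast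
        obtain s t where st: "s \<in> P" "t \<in> T" "h = s \<otimes> t" using h(2) by (auto simp: H_def)
        let ?z' = "t \<otimes> z \<otimes> inv t"
        have z': "?z' \<in> Z" using T_Z st z by blast
        have "y = s \<otimes> ?z' \<otimes> inv s" unfolding h(3) st(3) using st(1,2) z by (simp add: inv_mult_group m_assoc)
        also have "\<dots> = ?z' \<otimes> s \<otimes> inv s" using Z_central[OF z' st(1)] by (simp only:)
        also have "\<dots> = ?z'" using in_carrier(4)[OF z'] st(1) by (simp only: m_assoc in_carrier(1) inv_closed r_inv r_one)
        finally have y: "y \<in> Z" using z' by simp
        have "y \<noteq> \<one>"
        proof
          assume "y = \<one>"
          have "z = inv h \<otimes> y \<otimes> h" unfolding h(3) using h(2) z by (simp add: m_assoc)
          then show False using \<open>y = \<one>\<close> h(2) z by simp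
        qed
        moreover have "y \<in> N" using h z Ncl by simp
        ultimately show "y \<in> N \<inter> (Z - {\<one>})" using y by simp
      qed
      fix b assume "b \<in> N \<inter> (Z - {\<one>})"
      show "card {h \<in> N \<inter> H. h \<otimes> z \<otimes> inv h = b} \<le> card (N \<inter> P)"
      proof (cases "{h \<in> N \<inter> H. h \<otimes> z \<otimes> inv h = b} = {}")
        case False
        then obtain h0 where h0: "h0 \<in> N" "h0 \<in> H" "h0 \<otimes> z \<otimes> inv h0 = b" by blast
        show ?thesis
        proof (rule card_inj_on_le[of "\<lambda>h. inv h0 \<otimes> h"])
          show "inj_on (\<lambda>h. inv h0 \<otimes> h) {h \<in> N \<inter> H. h \<otimes> z \<otimes> inv h = b}" using h0 by (auto simp: inj_on_def)
          show "(\<lambda>h. inv h0 \<otimes> h) ` {h \<in> N \<inter> H. h \<otimes> z \<otimes> inv h = b} \<subseteq> N \<inter> P"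
          proof
            fix x assume "x \<in> (\<lambda>h. inv h0 \<otimes> h) ` {h \<in> N \<inter> H. h \<otimes> z \<otimes> inv h = b}"
            then obtain h where h: "h \<in> N" "h \<in> H" "h \<otimes> z \<otimes> inv h = b" "x = inv h0 \<otimes> h" by blast
            have "x \<otimes> z = inv h0 \<otimes> (h \<otimes> z \<otimes> inv h) \<otimes> h" unfolding h(4) using h(2) h0(2) z by (simp add: m_assoc)
            also have "\<dots> = inv h0 \<otimes> (h0 \<otimes> z \<otimes> inv h0) \<otimes> h" using h(3) h0(3) by simp
            also have "\<dots> = z \<otimes> x" unfolding h(4) using h(2) h0(2) z by (simp add: m_assoc)
            finally have "x \<in> P" using h h0 by (intro commP) auto
            moreover have "x \<in> N" using h h0 Ncl by simp
            ultimately show "x \<in> N \<inter> P" by simp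
          qed
        qed simp
      next
        case True
        then show ?thesis by (simp only: card.empty)
      qed
    qed simp_all
    then show ?thesis by (simp add: mult.commute)
  qed
  show "N \<inter> P = {\<one>}" if NZ: "N \<inter> Z = {\<one>}"
  proof -
    have "s = \<one>" if s: "s \<in> N" "s \<in> P" for s
    proof -
      have "s \<otimes> s \<in> N \<inter> Z" using s Ncl sq_Z by simp
      then have "\<one> \<otimes> \<one> = s \<otimes> s" using NZ by simp
      then have "inv \<one> \<otimes> s \<in> Z" using s by (intro sq_inj) auto
      then have "s \<in> N \<inter> Z" using s by simp
      then show ?thesis using NZ by simp
    qed
    then have "N \<inter> P \<subseteq> {\<one>}" by blast
    moreover have "\<one> \<in> N \<inter> P" using Ncl(1) closed(1) by (rule IntI)
    ultimately show ?thesis by blast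
  qed
  show "card (N \<inter> H) \<le> card T" if NP: "N \<inter> P = {\<one>}"
  proof -
    have "card (N \<inter> H) \<le> card T * 1"
    \<comment> \<open>The function reads off the T-component of h.\<close>
    proof (rule card_le_fibers[where f = "\<lambda>h. SOME t. t \<in> T \<and> (\<exists>s\<in>P. h = s \<otimes> t)"])
      have *: "(SOME t. t \<in> T \<and> (\<exists>s\<in>P. h = s \<otimes> t)) \<in> T \<and> (\<exists>s\<in>P. h = s \<otimes> (SOME t. t \<in> T \<and> (\<exists>s\<in>P. h = s \<otimes> t)))"
        if "h \<in> H" for h
        by (rule someI_ex) (use that in \<open>auto simp: H_def\<close>)
      then show "(\<lambda>h. SOME t. t \<in> T \<and> (\<exists>s\<in>P. h = s \<otimes> t)) ` (N \<inter> H) \<subseteq> T" by blast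
      fix t assume t: "t \<in> T"
      have "a = b" if ab: "a \<in> N" "a \<in> H" "b \<in> N" "b \<in> H"
        "(SOME t. t \<in> T \<and> (\<exists>s\<in>P. a = s \<otimes> t)) = t" "(SOME t. t \<in> T \<and> (\<exists>s\<in>P. b = s \<otimes> t)) = t" for a b
      proof -
        obtain s s' where ss: "s \<in> P" "s' \<in> P" "a = s \<otimes> t" "b = s' \<otimes> t"
          using *[OF ab(2)] *[OF ab(4)] ab(5,6) by metis
        have "a \<otimes> inv b = s \<otimes> inv s'" unfolding ss(3,4) using ss(1,2) t by (simp add: inv_mult_group m_assoc)
        then have "s \<otimes> inv s' \<in> N \<inter> P" using ss(1,2) ab Ncl by (metis IntI closed(4) closed(7))
        then have "s \<otimes> inv s' = \<one>" using NP by simp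
        then have "s = s'" using ss by (metis in_carrier(1) inv_closed inv_equality inv_inv)
        then show ?thesis using ss by simp
      qed
      then have "card {h \<in> N \<inter> H. (SOME t. t \<in> T \<and> (\<exists>s\<in>P. h = s \<otimes> t)) = t} \<le> Suc 0"
        by (subst card_le_Suc0_iff_eq) auto
      then show "card {h \<in> N \<inter> H. (SOME t. t \<in> T \<and> (\<exists>s\<in>P. h = s \<otimes> t)) = t} \<le> 1" by simp
    qed simp_all
    then show ?thesis by simp
  qed
qed

text \<open>Let y, u and p be the sizes of N \<inter> (Z - {1}), N \<inter> P and P. The left side
  is at most p + u (y - 1), and 2 u \<le> p makes this smaller than p y as soon as y \<ge>
  2.\<close>

lemma local_strict:
  assumes N: "subgroup N G" and nP: "\<not> P \<subseteq> N" and NZ: "N \<inter> Z \<noteq> {\<one>}" and h: "card T \<le> card (N \<inter> H)"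
  shows "card P + card (N \<inter> (H - P)) < card P * card (N \<inter> (Z - {\<one>}))"
proof -
  let ?y = "card (N \<inter> (Z - {\<one>}))" and ?u = "card (N \<inter> P)" and ?h = "card (N \<inter> H)"
  have "N \<inter> Z = insert \<one> (N \<inter> (Z - {\<one>}))" using subgroup.one_closed[OF N] closed(3) by blast
  then have y: "card (N \<inter> Z) = ?y + 1" by simp
  have "N \<inter> (H - P) = (N \<inter> H) - (N \<inter> P)" by blast
  moreover have "N \<inter> P \<subseteq> N \<inter> H" using P_H by blast
  ultimately have d: "card (N \<inter> (H - P)) = ?h - ?u" by (simp add: card_Diff_subset)
  have b1: "?u \<le> (?y + 1) * (?y + 1)" using local_bounds(1)[OF N] y by simp
  have b2: "2 * ?u \<le> card P" using local_bounds(2)[OF N nP] .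
  have b3: "?h \<le> ?u * ?y" using local_bounds(3)[OF N NZ] .
  have "?y \<noteq> 0" using b3 h card_Z by (intro notI) simp
  \<comment> \<open>For y = 1 the bounds give at most 4 elements in N \<inter> H, but
    \<open>T\<close> has at least 7.\<close>
  moreover have "?y \<noteq> 1"
  proof
    assume "?y = 1"
    then have "?h \<le> 4" using b1 b3 by simp
    then show False using h card_Z by simp
  qed
  ultimately have y2: "2 \<le> ?y" by linarith
  then obtain v where v: "?y = v + 2" by (metis le_add_diff_inverse2)
  have arith: "p + (h - u) < p * (v + 2)"
    if "h \<le> u * (v + 2)" "2 * u \<le> p" "p > 0" for p h u :: nat
  proof -
    have "2 * (h - u) \<le> (2 * u) * (v + 1)" using that(1) by (simp add: algebra_simps)
    also have "\<dots> \<le> p * (v + 1)" using that(2) by (rule mult_right_mono) simp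
    finally have "2 * (h - u) \<le> p * v + p" by (simp add: algebra_simps)
    then show ?thesis using that(3) by (simp add: algebra_simps)
  qed
  show ?thesis unfolding d v using b3 b2 v card_P by (intro arith) auto
qed

text \<open>Let c be the size of the intersection with \<open>H\<close>. The double coset N g H has
  at most (card P + 1) card H elements, so N has at most (card P + 1) c, and at least card H = card
  P card T. Since card T < card P, this excludes c < card T.\<close>

lemma big_subgroup_H:
  assumes N: "subgroup N G" and big: "card (carrier G) \<le> card N * (card P + 1)" and g: "g \<in> carrier G"
  shows "card T \<le> card (conj_sub N g \<inter> H)" "card H \<le> card N"
proof -
  have pos: "0 < card H" using H_closed(1) finite_H by (metis card_gt_0_iff empty_iff)
  have "card H * (card P + 1) \<le> card N * (card P + 1)" using big card_G by (simp add: mult.commute)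
  then show NH: "card H \<le> card N" by (simp only: mult_le_cancel2)
  let ?D = "{m \<otimes> g \<otimes> h | m h. m \<in> N \<and> h \<in> H}" and ?c = "card (conj_sub N g \<inter> H)"
  have "card ?D \<le> card (carrier G)"
    using fin subgroup.subset[OF N] g by (intro card_mono) auto
  then have "card N * card H \<le> card (carrier G) * ?c"
    using card_double_coset[OF fin N H_subgroup g] by (meson le_trans mult_le_mono1)
  then have "card N * card H \<le> ((card P + 1) * ?c) * card H" using card_G by (simp only: ac_simps)
  then have "card N \<le> (card P + 1) * ?c" using pos by (simp only: mult_le_cancel2)
  then have le: "card P * card T \<le> (card P + 1) * ?c" using NH card_H by simp
  show "card T \<le> ?c"
  proof (rule ccontr)
    assume "\<not> ?thesis"
    then have "?c + 1 \<le> card T" by simp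
    then obtain d where d: "card T = ?c + 1 + d" by (metis le_Suc_ex)
    have "card P * (?c + 1) \<le> card P * card T" using d by simp
    then have "card P \<le> ?c" using le by (simp add: algebra_simps)
    then show False using d card_Z(1) card_P_ge by simp
  qed
qed

text \<open>By the Bruhat decomposition an element outside \<open>H\<close> puts some w inv t into
  N, and hence w P w. Then w lies in N by \<open>w_conj\<close>, and conjugates of w under
  \<open>T\<close> multiplied by w give the squares in \<open>T\<close>, which are all of
  \<open>T\<close>.\<close>

lemma contains_P_H:
  assumes N: "subgroup N G" and PN: "P \<subseteq> N" and proper: "N \<noteq> carrier G"
  shows "N \<subseteq> H"
proof (rule ccontr)
  note Ncl = subgroup.one_closed[OF N] subgroup.m_inv_closed[OF N] subgroup.m_closed[OF N]
  assume "\<not> N \<subseteq> H"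
  then obtain g where g: "g \<in> N" "g \<notin> H" by blast
  have "g \<in> carrier G" using g subgroup.subset[OF N] by blast
  then obtain s h where sh: "s \<in> P" "h \<in> H" "g = s \<otimes> w \<otimes> h" using Bruhat_H g(2) by blast
  obtain s' t where st: "s' \<in> P" "t \<in> T" "inv h = s' \<otimes> t" using H_closed(2)[OF sh(2)] by (auto simp: H_def)
  have "h = inv (s' \<otimes> t)" using inv_inv[OF H_carrier[OF sh(2)]] by (simp only: st(3))
  then have hi: "h = inv t \<otimes> inv s'" using st(1,2) by (simp add: inv_mult_group)
  have PN': "x \<in> N" if "x \<in> P" for x using PN that by blast
  have "inv s \<otimes> g \<otimes> s' \<in> N" using Ncl(3)[OF Ncl(3)[OF Ncl(2)[OF PN'[OF sh(1)]] g(1)] PN'[OF st(1)]] .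
  moreover have "inv s \<otimes> g \<otimes> s' = w \<otimes> inv t" unfolding sh(3) hi using sh(1) st by (simp add: m_assoc)
  ultimately have wt: "w \<otimes> inv t \<in> N" by simp
  have wPw: "w \<otimes> x \<otimes> w \<in> N" if x: "x \<in> P" for x
  proof -
    have "t \<otimes> x \<otimes> inv t \<in> N" by (rule PN'[OF T_P[OF st(2) x]])
    then have "(w \<otimes> inv t) \<otimes> (t \<otimes> x \<otimes> inv t) \<otimes> inv (w \<otimes> inv t) \<in> N" using wt Ncl by simp
    moreover have "(w \<otimes> inv t) \<otimes> (t \<otimes> x \<otimes> inv t) \<otimes> inv (w \<otimes> inv t) = w \<otimes> x \<otimes> w"
      using st x by (simp add: inv_mult_group m_assoc)
    ultimately show ?thesis by simp
  qed
  have z1P: "z1 \<in> P" using z1 ZP by blast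
  have s1N: "s1 \<in> N" using s1 PN by blast
  have "s1 \<otimes> (w \<otimes> z1 \<otimes> w) \<otimes> inv s1 \<in> N" using wPw[OF z1P] s1N Ncl by simp
  moreover have "s1 \<otimes> (w \<otimes> z1 \<otimes> w) \<otimes> inv s1 = w" using w_conj by (simp add: inv_mult_group m_assoc)
  ultimately have wN: "w \<in> N" by simp
  have TN: "r \<in> N" if r: "r \<in> T" for r
  proof -
    obtain a where a: "a \<in> T" "r = a \<otimes> a" using T_square[OF r] .
    \<comment> \<open>It is not yet known that a lies in N, so the conjugate of w by a is assembled
      from elements of \<open>P\<close> and of w P w, as in \<open>w_conj\<close>. Multiplying it by
      w gives a a = r.\<close>
    define x where "x = a \<otimes> s1 \<otimes> inv a"
    define y where "y = inv a \<otimes> z1 \<otimes> a"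
    have x: "x \<in> P" using T_P[OF a(1) s1] by (simp add: x_def)
    have y: "y \<in> P" using T_P[of "inv a" z1] a z1P by (simp add: y_def)
    have "x \<otimes> (w \<otimes> y \<otimes> w) \<otimes> inv x \<otimes> w \<in> N" using PN'[OF x] wPw[OF y] wN Ncl by simp
    moreover have "x \<otimes> (w \<otimes> y \<otimes> w) \<otimes> inv x \<otimes> w = r"
    proof -
      have "w \<otimes> y \<otimes> w = (w \<otimes> inv a) \<otimes> z1 \<otimes> (a \<otimes> w)" using a(1) by (simp add: y_def m_assoc)
      also have "\<dots> = a \<otimes> (w \<otimes> z1 \<otimes> w) \<otimes> inv a"
      proof -
        have "w \<otimes> inv a = a \<otimes> w" using w_T[of "inv a"] a(1) by simp
        then have e: "a \<otimes> w = w \<otimes> inv a" ..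
        have "(w \<otimes> inv a) \<otimes> z1 \<otimes> (a \<otimes> w) = (a \<otimes> w) \<otimes> z1 \<otimes> (w \<otimes> inv a)"
          by (simp only: e)
        then show ?thesis using a(1) by (simp add: m_assoc)
      qed
      finally have "x \<otimes> (w \<otimes> y \<otimes> w) \<otimes> inv x = a \<otimes> (s1 \<otimes> (w \<otimes> z1 \<otimes> w) \<otimes> inv s1) \<otimes> inv a"
        using a(1) by (simp add: x_def inv_mult_group m_assoc)
      also have "\<dots> = a \<otimes> w \<otimes> inv a" using \<open>s1 \<otimes> (w \<otimes> z1 \<otimes> w) \<otimes> inv s1 = w\<close> by simp
      also have "\<dots> = a \<otimes> (w \<otimes> inv a)" using a(1) by (simp add: m_assoc)
      also have "\<dots> = a \<otimes> (a \<otimes> w)" using w_T[of "inv a"] a(1) by simp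
      finally show ?thesis using a by (simp add: m_assoc)
    qed
    ultimately show ?thesis by simp
  qed
  have "carrier G \<subseteq> N"
  proof
    fix g assume "g \<in> carrier G"
    then consider s t where "s \<in> P" "t \<in> T" "g = s \<otimes> t" | s t s' where "s \<in> P" "t \<in> T" "s' \<in> P" "g = s \<otimes> w \<otimes> t \<otimes> s'"
      using Bruhat by blast
    then show "g \<in> N"
    proof cases
      case 1
      then show ?thesis using PN' TN Ncl by simp
    next
      case 2
      then show ?thesis using PN' TN wN Ncl by simp
    qed
  qed
  then show False using proper subgroup.subset[OF N] by blast
qed

text \<open>The conjugate w of z1 lies in N, then the products of its T-conjugates with w, which are
  the squares in \<open>T\<close>, and finally the commutators of \<open>P\<close> with one t
  \<noteq> 1, which fill \<open>P\<close>.\<close>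

lemma normal_contains_P:
  assumes N: "N \<lhd> G" and ZN: "Z \<subseteq> N"
  shows "P \<subseteq> N"
proof
  interpret N: normal N G by (rule N)
  have conj: "g \<otimes> x \<otimes> inv g \<in> N" if "g \<in> carrier G" "x \<in> N" for g x
    using N.inv_op_closed2[OF that] .
  have z1N: "z1 \<in> N" using z1 ZN by blast
  have wN: "w \<in> N"
  proof -
    have "(s1 \<otimes> w) \<otimes> z1 \<otimes> inv (s1 \<otimes> w) \<in> N" by (rule conj) (use z1N in auto)
    then show ?thesis using w_conj by simp
  qed
  have TN: "t \<in> N" if t: "t \<in> T" for t
  proof -
    obtain r where r: "r \<in> T" "t = r \<otimes> r" using T_square[OF t] .
    have "(r \<otimes> w \<otimes> inv r) \<otimes> w \<in> N" using conj wN r by simp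
    moreover have "(r \<otimes> w \<otimes> inv r) \<otimes> w = r \<otimes> (w \<otimes> inv r \<otimes> w)" using r by (simp add: m_assoc)
    moreover have "w \<otimes> inv r \<otimes> w = r" using w(3)[of "inv r"] r by simp
    ultimately show ?thesis using r by simp
  qed
  have "card T \<noteq> 1" using card_Z by simp
  then have "T \<noteq> {\<one>}" by auto
  then obtain t where t: "t \<in> T" "t \<noteq> \<one>" using closed(2) by blast
  fix s assume s: "s \<in> P"
  obtain s' where s': "s' \<in> P" "s = s' \<otimes> (t \<otimes> inv s' \<otimes> inv t)" using commutator_surj[OF t s] by blast
  have "(s' \<otimes> t \<otimes> inv s') \<otimes> inv t \<in> N" using conj TN t s' by simp
  moreover have "s = (s' \<otimes> t \<otimes> inv s') \<otimes> inv t" unfolding s'(2) using s'(1) t by (simp add: m_assoc)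
  ultimately show "s \<in> N" by simp
qed

text \<open>Here N H is all of \<open>G\<close>, so every conjugate of N meets \<open>P\<close>
  trivially. A conjugate that contains \<open>T\<close> is shown to contain w, which is conjugate to
  z1 in \<open>P\<close>.\<close>

lemma complement_case:
  assumes N: "subgroup N G" and big: "card (carrier G) \<le> card N * (card P + 1)"
    and NZ: "N \<inter> Z = {\<one>}" and noP: "\<And>g. g \<in> carrier G \<Longrightarrow> \<not> P \<subseteq> conj_sub N g"
  shows False
proof -
  have Nc: "x \<in> carrier G" if "x \<in> N" for x using that subgroup.subset[OF N] by blast
  have conj1: "conj_sub N \<one> = N" using Nc by (auto simp: conj_sub_def)
  have NP: "N \<inter> P = {\<one>}" using local_bounds(4)[OF N NZ] .
  have cardNH: "card (N \<inter> H) = card T"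
    using big_subgroup_H(1)[OF N big one_closed] local_bounds(5)[OF N NP] conj1 by simp
  have HN: "card H \<le> card N" using big_subgroup_H(2)[OF N big one_closed] .
  have T_pos: "0 < card T" using card_Z by simp
  have H_pos: "0 < card H" using H_closed(1) finite_H by (metis card_gt_0_iff empty_iff)
  let ?D = "\<lambda>g. {m \<otimes> g \<otimes> h | m h. m \<in> N \<and> h \<in> H}"
  have DG: "?D g \<subseteq> carrier G" if "g \<in> carrier G" for g using that Nc by auto
  \<comment> \<open>The double coset N H fills all of \<open>G\<close> except for at most card H
    elements.\<close>
  have D1: "card P * card H \<le> card (?D \<one>)"
  proof -
    have "card H * card H \<le> card N * card H" using HN by simp
    also have "\<dots> \<le> card (?D \<one>) * card T"
      using card_double_coset[OF fin N H_subgroup one_closed] conj1 cardNH by simp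
    finally have "(card P * card H) * card T \<le> card (?D \<one>) * card T" using card_H by (simp only: ac_simps)
    then show ?thesis using T_pos by (simp only: mult_le_cancel2)
  qed
  \<comment> \<open>A second double coset would be so small that a conjugate of N contains
    \<open>H\<close>, and with it \<open>P\<close>.\<close>
  have NH: "\<exists>n\<in>N. \<exists>h\<in>H. x = n \<otimes> h" if x: "x \<in> carrier G" for x
  proof (rule ccontr)
    assume no: "\<not> ?thesis"
    have "?D \<one> \<inter> ?D x = {}"
    proof -
      have False if "n \<in> N" "h \<in> H" "n' \<in> N" "h' \<in> H" "n \<otimes> \<one> \<otimes> h = n' \<otimes> x \<otimes> h'" for n h n' h'
      proof -
        have "x = inv n' \<otimes> (n' \<otimes> x \<otimes> h') \<otimes> inv h'" using that(3,4) Nc x by (simp add: m_assoc)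
        also have "\<dots> = (inv n' \<otimes> n) \<otimes> (h \<otimes> inv h')" unfolding that(5)[symmetric] using that(1-4) Nc by (simp add: m_assoc)
        finally have "x = (inv n' \<otimes> n) \<otimes> (h \<otimes> inv h')" .
        moreover have "inv n' \<otimes> n \<in> N" "h \<otimes> inv h' \<in> H"
          using that(1-4) N by (auto simp: subgroup.m_closed subgroup.m_inv_closed)
        ultimately show False using no by blast
      qed
      then show ?thesis by blast
    qed
    then have "card (?D \<one>) + card (?D x) \<le> card (carrier G)"
      using DG[OF one_closed] DG[OF x] fin
      by (metis (no_types, lifting) card_Un_disjoint card_mono finite_subset le_sup_iff)
    then have Dx: "card (?D x) \<le> card H" using D1 card_G by simp
    let ?K = "conj_sub N x \<inter> H"
    have "card N * card H \<le> card (?D x) * card ?K" using card_double_coset[OF fin N H_subgroup x] .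
    also have "\<dots> \<le> card H * card ?K" using Dx by simp
    finally have "card H * card N \<le> card H * card ?K" by (simp only: ac_simps)
    then have "card N \<le> card ?K" using H_pos by (simp only: mult_le_cancel1)
    then have "card H \<le> card ?K" using HN by simp
    then have "?K = H" by (intro card_subset_eq card_seteq) auto
    then have "P \<subseteq> conj_sub N x" using P_H by blast
    then show False using noP x by blast
  qed
  \<comment> \<open>In g = n h the factor n is absorbed by N, while h normalizes
    \<open>P\<close>.\<close>
  have noconj: "conj_sub N g \<inter> P = {\<one>}" if g: "g \<in> carrier G" for g
  proof -
    obtain n h where nh: "n \<in> N" "h \<in> H" "g = n \<otimes> h" using NH[OF g] by blast
    obtain s t where st: "s \<in> P" "t \<in> T" "h = s \<otimes> t" using nh(2) by (auto simp: H_def)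
    have "x = \<one>" if x: "x \<in> conj_sub N g" "x \<in> P" for x
    proof -
      have "inv n \<otimes> (g \<otimes> x \<otimes> inv g) \<otimes> n \<in> N"
        using x(1) nh(1) N by (simp add: conj_sub_def subgroup.m_closed subgroup.m_inv_closed)
      moreover have "inv n \<otimes> (g \<otimes> x \<otimes> inv g) \<otimes> n = s \<otimes> (t \<otimes> x \<otimes> inv t) \<otimes> inv s"
        unfolding nh(3) st(3) using st(1,2) x(2) Nc[OF nh(1)] by (simp add: inv_mult_group m_assoc)
      moreover have "s \<otimes> (t \<otimes> x \<otimes> inv t) \<otimes> inv s \<in> P" using T_P[OF st(2) x(2)] st(1) by simp
      ultimately have "s \<otimes> (t \<otimes> x \<otimes> inv t) \<otimes> inv s \<in> N \<inter> P" by simp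
      then have e: "s \<otimes> (t \<otimes> x \<otimes> inv t) \<otimes> inv s = \<one>" using NP by blast
      have "x = inv t \<otimes> (inv s \<otimes> (s \<otimes> (t \<otimes> x \<otimes> inv t) \<otimes> inv s) \<otimes> s) \<otimes> t"
        using st(1,2) x(2) by (simp add: m_assoc)
      then show ?thesis unfolding e using st(1,2) by simp
    qed
    then have "conj_sub N g \<inter> P \<subseteq> {\<one>}" by blast
    moreover have "\<one> \<in> conj_sub N g \<inter> P" using subgroup.one_closed[OF subgroup_conj_sub[OF N g]] closed(1) by blast
    ultimately show ?thesis by blast
  qed
  \<comment> \<open>A nonidentity element of N \<inter> H lies outside \<open>P\<close>, so
    \<open>H_conj_T\<close> moves it into \<open>T\<close>; the same conjugation turns N into
    M.\<close>
  have "card (N \<inter> H) \<noteq> 1" using cardNH card_Z by simp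
  then have "N \<inter> H \<noteq> {\<one>}" by auto
  then obtain a where a: "a \<in> N" "a \<in> H" "a \<noteq> \<one>" using subgroup.one_closed[OF N] H_closed(1) by blast
  then have "a \<notin> P" using NP by blast
  then obtain s t where st: "s \<in> P" "t \<in> T" "t \<noteq> \<one>" "a = s \<otimes> t \<otimes> inv s" using H_conj_T[OF a(2)] by metis
  define M where "M = conj_sub N s"
  have M: "subgroup M G" unfolding M_def using subgroup_conj_sub[OF N] st by simp
  have Mc: "x \<in> carrier G" if "x \<in> M" for x using that subgroup.subset[OF M] by blast
  note Mcl = subgroup.one_closed[OF M] subgroup.m_inv_closed[OF M] subgroup.m_closed[OF M]
  have tM: "t \<in> M" using st a by (simp add: M_def conj_sub_def)
  have MP: "M \<inter> P = {\<one>}" unfolding M_def using noconj st by simp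
  have Mnoconj: "x = \<one>" if "g \<in> carrier G" "g \<otimes> x \<otimes> inv g \<in> M" "x \<in> P" for g x
  proof -
    have "x \<in> conj_sub M g" using that by (simp add: conj_sub_def)
    then have "x \<in> conj_sub N (s \<otimes> g) \<inter> P" using conj_sub_conj_sub[of s g N] st that by (simp add: M_def)
    moreover have "s \<otimes> g \<in> carrier G" using st that by simp
    ultimately show ?thesis using noconj[of "s \<otimes> g"] by simp
  qed
  have MH_T: "M \<inter> H \<subseteq> T"
  proof
    fix x assume x: "x \<in> M \<inter> H"
    then obtain s' t' where st': "s' \<in> P" "t' \<in> T" "x = s' \<otimes> t'" by (auto simp: H_def)
    \<comment> \<open>As \<open>T\<close> is abelian, this commutator lies in \<open>P\<close>, and
      in M as well, so it is trivial. The P-part of x then commutes with t.\<close>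
    let ?c = "x \<otimes> t \<otimes> inv x \<otimes> inv t"
    have "?c \<in> M" using x tM Mcl by simp
    moreover have "?c = s' \<otimes> (t \<otimes> inv s' \<otimes> inv t)"
    proof -
      have "?c = s' \<otimes> (t' \<otimes> t) \<otimes> inv t' \<otimes> inv s' \<otimes> inv t"
        unfolding st'(3) using st' st by (simp add: inv_mult_group m_assoc)
      also have "\<dots> = s' \<otimes> (t \<otimes> t') \<otimes> inv t' \<otimes> inv s' \<otimes> inv t"
        using T_comm[OF st'(2) st(2)] by simp
      also have "\<dots> = s' \<otimes> (t \<otimes> inv s' \<otimes> inv t)" using st' st by (simp add: m_assoc)
      finally show ?thesis .
    qed
    moreover have "s' \<otimes> (t \<otimes> inv s' \<otimes> inv t) \<in> P" using T_P st st' by simp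
    ultimately have "s' \<otimes> (t \<otimes> inv s' \<otimes> inv t) \<in> M \<inter> P" by simp
    then have e: "s' \<otimes> (t \<otimes> inv s' \<otimes> inv t) = \<one>" using MP by blast
    have "t \<otimes> s' = (s' \<otimes> (t \<otimes> inv s' \<otimes> inv t)) \<otimes> (t \<otimes> s')" unfolding e using st st' by simp
    also have "\<dots> = s' \<otimes> t" using st st' by (simp add: m_assoc)
    finally have "s' = \<one>" using T_free[OF st(2) st'(1)] st(3) by blast
    then show "x \<in> T" using st' by simp
  qed
  have cardM: "card M = card N" unfolding M_def using card_conj_sub[OF subgroup.subset[OF N]] st by simp
  have "card (carrier G) \<le> card M * (card P + 1)" using big cardM by simp
  moreover have "conj_sub M \<one> = M" using Mc by (auto simp: conj_sub_def)
  ultimately have "card T \<le> card (M \<inter> H)" using big_subgroup_H(1)[OF M _ one_closed] by simp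
  then have MH: "M \<inter> H = T" using MH_T by (intro card_seteq) auto
  then have TM: "T \<subseteq> M" by blast
  obtain n h where nh: "n \<in> M" "h \<in> H" "w = n \<otimes> h"
  proof -
    \<comment> \<open>Decomposing s w s instead of w: stripping s from both sides turns the factor
      in N into one in M and leaves the other in \<open>H\<close>.\<close>
    have "s \<otimes> w \<otimes> s \<in> carrier G" using st by simp
    then obtain n'' h'' where nh'': "n'' \<in> N" "h'' \<in> H" "s \<otimes> w \<otimes> s = n'' \<otimes> h''" using NH by blast
    have "inv s \<otimes> n'' \<otimes> s \<in> M" using st nh''(1) Nc by (simp add: M_def conj_sub_def m_assoc)
    moreover have "inv s \<otimes> h'' \<otimes> inv s \<in> H" using st nh''(2) P_H by simp
    moreover have "(inv s \<otimes> n'' \<otimes> s) \<otimes> (inv s \<otimes> h'' \<otimes> inv s) = inv s \<otimes> (n'' \<otimes> h'') \<otimes> inv s"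
      using st(1) nh''(1,2) Nc by (simp add: m_assoc)
    moreover have "inv s \<otimes> (n'' \<otimes> h'') \<otimes> inv s = w" unfolding nh''(3)[symmetric] using st(1) by (simp add: m_assoc)
    ultimately show ?thesis using that by metis
  qed
  have nc: "n \<in> carrier G" using Mc nh by blast
  have n_eq: "n = w \<otimes> inv h" unfolding nh(3) using nh(2) nc by (simp add: m_assoc)
  \<comment> \<open>As w normalizes \<open>T\<close>, n conjugates h r inv h into \<open>T\<close>,
    so this element lies in M \<inter> H = \<open>T\<close>. The P-part of h will then commute with
    t and be trivial.\<close>
  have hT: "h \<otimes> r \<otimes> inv h \<in> T" if r: "r \<in> T" for r
  proof -
    have "n \<otimes> (h \<otimes> r \<otimes> inv h) \<otimes> inv n = w \<otimes> r \<otimes> w"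
      unfolding n_eq using nh(2) r by (simp add: inv_mult_group m_assoc)
    then have e: "n \<otimes> (h \<otimes> r \<otimes> inv h) \<otimes> inv n \<in> T" using w(3)[OF r] r by simp
    have "inv n \<otimes> (n \<otimes> (h \<otimes> r \<otimes> inv h) \<otimes> inv n) \<otimes> n \<in> M"
      using Mcl(3)[OF Mcl(3)[OF Mcl(2)[OF nh(1)] subsetD[OF TM e]] nh(1)] .
    moreover have "inv n \<otimes> (n \<otimes> (h \<otimes> r \<otimes> inv h) \<otimes> inv n) \<otimes> n = h \<otimes> r \<otimes> inv h"
      using nc nh(2) r by (simp add: m_assoc)
    moreover have "h \<otimes> r \<otimes> inv h \<in> H" using nh(2) r T_H by simp
    ultimately have "h \<otimes> r \<otimes> inv h \<in> M \<inter> H" by simp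
    then show ?thesis by (simp only: MH)
  qed
  obtain s' t' where st': "s' \<in> P" "t' \<in> T" "h = s' \<otimes> t'" using nh(2) by (auto simp: H_def)
  have "s' = \<one>"
  proof -
    let ?r = "inv t' \<otimes> t \<otimes> t'"
    have rT: "?r \<in> T" using st' st by simp
    have e: "h \<otimes> ?r \<otimes> inv h = s' \<otimes> t \<otimes> inv s'"
      unfolding st'(3) using st'(1,2) st(2) by (simp add: inv_mult_group m_assoc)
    then have "s' \<otimes> t \<otimes> inv s' \<in> T" using hT[OF rT] by simp
    then have "(s' \<otimes> t \<otimes> inv s') \<otimes> inv t \<in> T" using st by simp
    moreover have d: "(s' \<otimes> t \<otimes> inv s') \<otimes> inv t = s' \<otimes> (t \<otimes> inv s' \<otimes> inv t)" using st st' by (simp add: m_assoc)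
    moreover have "s' \<otimes> (t \<otimes> inv s' \<otimes> inv t) \<in> P" using T_P st st' by simp
    ultimately have "s' \<otimes> (t \<otimes> inv s' \<otimes> inv t) \<in> P \<inter> T" by simp
    then have e: "s' \<otimes> (t \<otimes> inv s' \<otimes> inv t) = \<one>" using P_T by blast
    have "t \<otimes> s' = (s' \<otimes> (t \<otimes> inv s' \<otimes> inv t)) \<otimes> (t \<otimes> s')" unfolding e using st st' by simp
    also have "\<dots> = s' \<otimes> t" using st st' by (simp add: m_assoc)
    finally show ?thesis using T_free[OF st(2) st'(1)] st(3) by blast
  qed
  then have "h \<in> M" using st' TM by auto
  then have "w \<in> M" unfolding nh(3) using Mcl(3)[OF nh(1)] by blast
  then have "(s1 \<otimes> w) \<otimes> z1 \<otimes> inv (s1 \<otimes> w) \<in> M" using w_conj by simp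
  then have "z1 = \<one>" using ZP z1 by (intro Mnoconj[of "s1 \<otimes> w"]) auto
  then show False using z1_ne by simp
qed

text \<open>
  If no conjugate of \<open>M\<close> contains \<open>P\<close>, then some conjugate meets \<open>Z\<close> trivially, since otherwise
  summing \<open>local_strict\<close> over all conjugates would contradict \<open>counting\<close>.
\<close>

theorem big_subgroup:
  assumes M: "subgroup M G" and proper: "M \<noteq> carrier G" and big: "card (carrier G) \<le> card M * (card P + 1)"
  shows "\<exists>g\<in>carrier G. conj_sub M g = H"
proof (cases "\<exists>g\<in>carrier G. P \<subseteq> conj_sub M g")
  case True
  then obtain g where g: "g \<in> carrier G" "P \<subseteq> conj_sub M g" by blast
  let ?N = "conj_sub M g"
  have N: "subgroup ?N G" using subgroup_conj_sub[OF M g(1)] .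
  have card: "card ?N = card M" using card_conj_sub[OF subgroup.subset[OF M] g(1)] .
  have "?N \<noteq> carrier G"
  proof
    assume "?N = carrier G"
    then have "card M = card (carrier G)" using card by simp
    then show False using proper subgroup.subset[OF M] fin by (simp add: card_subset_eq)
  qed
  then have "?N \<subseteq> H" using contains_P_H[OF N g(2)] by blast
  moreover have "card H \<le> card ?N" using big_subgroup_H(2)[OF M big one_closed] card by simp
  ultimately have "?N = H" by (intro card_seteq) auto
  then show ?thesis using g by blast
next
  case False
  then have noP: "\<not> P \<subseteq> conj_sub M g" if "g \<in> carrier G" for g using that by blast
  have nZ: "conj_sub M g \<inter> Z \<noteq> {\<one>}" if g: "g \<in> carrier G" for g
  proof
    assume Z1: "conj_sub M g \<inter> Z = {\<one>}"
    show False
    proof (rule complement_case[OF subgroup_conj_sub[OF M g] _ Z1])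
      show "card (carrier G) \<le> card (conj_sub M g) * (card P + 1)"
        using big card_conj_sub[OF subgroup.subset[OF M] g] by simp
      show "\<not> P \<subseteq> conj_sub (conj_sub M g) h" if "h \<in> carrier G" for h
        using noP[of "g \<otimes> h"] conj_sub_conj_sub[OF g that] g that by simp
    qed
  qed
  have "(\<Sum>g\<in>carrier G. card P + card (conj_sub M g \<inter> (H - P))) <
      (\<Sum>g\<in>carrier G. card P * card (conj_sub M g \<inter> (Z - {\<one>})))"
    using fin one_closed
    by (intro sum_strict_mono local_strict subgroup_conj_sub[OF M] noP nZ big_subgroup_H(1)[OF M big]) auto
  then show ?thesis using counting[OF M] by simp
qed

section \<open>Frattini quotient and actions on card P + 1 points\<close>

abbreviation Phi :: "'a set"
  where "Phi \<equiv> (\<lambda>s. s \<otimes> s) ` P"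

lemma Phi_conj:
  assumes "x \<in> carrier G" "\<And>s. s \<in> P \<Longrightarrow> x \<otimes> s \<otimes> inv x \<in> P" "f \<in> Phi"
  shows "x \<otimes> f \<otimes> inv x \<in> Phi"
proof -
  obtain s where s: "s \<in> P" "f = s \<otimes> s" using assms(3) by blast
  have "x \<otimes> f \<otimes> inv x = (x \<otimes> s \<otimes> inv x) \<otimes> (x \<otimes> s \<otimes> inv x)"
    unfolding s(2) using s(1) assms(1) by (simp add: m_assoc)
  then show ?thesis using assms(2)[OF s(1)] by blast
qed

text \<open>\<open>T\<close> acts freely on the nontrivial cosets of \<open>Phi\<close> in
  \<open>P\<close>, and there are card Z - 1 = card T of them. An invariant Q with an element
  outside \<open>Phi\<close> therefore contains them all.\<close>

lemma Frattini:
  assumes Q: "subgroup Q G" "Q \<subseteq> P" "Q \<noteq> P" and sq: "\<And>s. s \<in> P \<Longrightarrow> s \<otimes> s \<in> Q"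
    and T_inv: "\<And>t s. t \<in> T \<Longrightarrow> s \<in> Q \<Longrightarrow> t \<otimes> s \<otimes> inv t \<in> Q"
  shows "Q = Phi"
proof (rule ccontr)
  assume "Q \<noteq> Phi"
  moreover have PhiQ: "Phi \<subseteq> Q" using sq by blast
  ultimately obtain s where s: "s \<in> Q" "s \<notin> Phi" by blast
  have sP: "s \<in> P" using s Q by blast
  have PhiP: "f \<in> P" if "f \<in> Phi" for f using that by auto
  note Pcl = subgroup.m_closed[OF squares(1)] subgroup.m_inv_closed[OF squares(1)]
  let ?f = "\<lambda>(t, f). (t \<otimes> s \<otimes> inv t) \<otimes> f"
  have inj: "inj_on ?f (T \<times> Phi)"
  proof (rule inj_onI)
    fix a b assume ab: "a \<in> T \<times> Phi" "b \<in> T \<times> Phi" "?f a = ?f b"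
    obtain t f where a: "a = (t, f)" by (cases a)
    obtain t' f' where b: "b = (t', f')" by (cases b)
    have *: "t \<in> T" "t' \<in> T" "f \<in> Phi" "f' \<in> Phi" "f \<in> P" "f' \<in> P"
      using ab a b PhiP by auto
    have e: "(t \<otimes> s \<otimes> inv t) \<otimes> f = (t' \<otimes> s \<otimes> inv t') \<otimes> f'" using ab(3) a b by simp
    have e': "inv (t' \<otimes> s \<otimes> inv t') \<otimes> (t \<otimes> s \<otimes> inv t) = f' \<otimes> inv f"
    proof -
      have "inv (t' \<otimes> s \<otimes> inv t') \<otimes> (t \<otimes> s \<otimes> inv t)
          = inv (t' \<otimes> s \<otimes> inv t') \<otimes> ((t \<otimes> s \<otimes> inv t) \<otimes> f) \<otimes> inv f"
        using *(1,2,5) sP by (simp add: m_assoc)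
      also have "\<dots> = f' \<otimes> inv f" unfolding e using *(1,2,5,6) sP by (simp add: m_assoc inv_mult_group)
      finally show ?thesis .
    qed
    define r where "r = inv t' \<otimes> t"
    have r: "r \<in> T" using * by (simp add: r_def)
    have "inv t' \<otimes> (f' \<otimes> inv f) \<otimes> inv (inv t') \<in> Phi"
      by (rule Phi_conj[OF _ T_P[OF closed(5)[OF *(2)]]]) (use *(1-4) Pcl in simp_all)
    then have "s \<otimes> (inv t' \<otimes> (f' \<otimes> inv f) \<otimes> inv (inv t')) \<otimes> inv s \<in> Phi"
      by (rule Phi_conj[rotated 2]) (use sP in simp_all)
    moreover have "s \<otimes> (inv t' \<otimes> (f' \<otimes> inv f) \<otimes> inv (inv t')) \<otimes> inv s = r \<otimes> s \<otimes> inv r \<otimes> inv s"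
      unfolding e'[symmetric] r_def using *(1,2) sP by (simp add: m_assoc inv_mult_group)
    ultimately have "r = \<one>" using squares_free[OF r sP] s by auto
    then have "t' \<otimes> (inv t' \<otimes> t) = t'" using *(2) by (simp add: r_def)
    then have "t = t'" using *(1,2) by simp
    moreover from this have "f = f'" using e * sP by simp
    ultimately show "a = b" using a b by simp
  qed
  have sub: "?f ` (T \<times> Phi) \<subseteq> Q - Phi"
  proof
    fix x assume "x \<in> ?f ` (T \<times> Phi)"
    then obtain t f where tf: "t \<in> T" "f \<in> Phi" "x = (t \<otimes> s \<otimes> inv t) \<otimes> f" by auto
    have fP: "f \<in> P" using tf PhiP by blast
    have "x \<in> Q" using tf PhiQ T_inv s subgroup.m_closed[OF Q(1)] by blast
    moreover have "x \<notin> Phi"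
    proof
      assume "x \<in> Phi"
      then have "x \<otimes> inv f \<in> Phi" using Pcl tf(2) by simp
      then have m: "t \<otimes> s \<otimes> inv t \<in> Phi" unfolding tf(3) using tf(1) fP sP by (simp add: m_assoc)
      have "inv t \<otimes> (t \<otimes> s \<otimes> inv t) \<otimes> inv (inv t) \<in> Phi"
        by (rule Phi_conj[OF inv_closed[OF in_carrier(3)[OF tf(1)]] T_P[OF closed(5)[OF tf(1)]] m])
      then show False using s tf(1) sP by (simp add: m_assoc)
    qed
    ultimately show "x \<in> Q - Phi" by blast
  qed
  have finQ: "finite Q" using finite_subset[OF Q(2)] by simp
  have "card P = card (T \<times> Phi) + card Phi" using squares(2) card_Z(1) by (simp add: card_cartesian_product)
  also have "card (T \<times> Phi) = card (?f ` (T \<times> Phi))" using inj by (simp only: card_image)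
  also have "\<dots> \<le> card (Q - Phi)" using sub finQ by (intro card_mono) auto
  also have "card (Q - Phi) + card Phi = card Q"
    using PhiQ finQ by (simp add: card_Diff_subset card_mono)
  finally have "card P \<le> card Q" by simp
  then have "Q = P" using Q(2) by (intro card_seteq) auto
  then show False using Q(3) by blast
qed

text \<open>The stabilizer of a moved point is proper and of index at most card P + 1, so
  \<open>big_subgroup\<close> makes it conjugate to \<open>H\<close>. The point p0 is the translate
  whose stabilizer is \<open>H\<close> itself, and its orbit is large enough to be B.\<close>

theorem action_regular:
  assumes fin_B: "finite B" and card_B: "card B = card P + 1"
    and perm_in: "\<And>g b. g \<in> carrier G \<Longrightarrow> b \<in> B \<Longrightarrow> \<alpha> g b \<in> B"
    and perm_one: "\<And>b. b \<in> B \<Longrightarrow> \<alpha> \<one> b = b"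
    and perm_mult: "\<And>g h b. g \<in> carrier G \<Longrightarrow> h \<in> carrier G \<Longrightarrow> b \<in> B \<Longrightarrow> \<alpha> (g \<otimes> h) b = \<alpha> g (\<alpha> h b)"
    and nontrivial: "g1 \<in> carrier G" "b1 \<in> B" "\<alpha> g1 b1 \<noteq> b1"
  shows "\<exists>p0. regular_setting G B \<alpha> P T Phi Z k p0"
proof -
  have perm_inv: "\<alpha> g (\<alpha> (inv g) b) = b" "\<alpha> (inv g) (\<alpha> g b) = b" if "g \<in> carrier G" "b \<in> B" for g b
    using that by (simp_all add: perm_mult[symmetric] perm_one)
  define stab where "stab b = {g \<in> carrier G. \<alpha> g b = b}" for b
  have stab: "subgroup (stab b) G" if b: "b \<in> B" for b
  proof (rule subgroupI)
    show "stab b \<subseteq> carrier G" by (auto simp: stab_def)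
    show "stab b \<noteq> {}" using perm_one[OF b] by (auto simp: stab_def)
    show "inv a \<in> stab b" if "a \<in> stab b" for a using perm_inv(2)[of a b] that b by (simp add: stab_def)
    show "a \<otimes> c \<in> stab b" if "a \<in> stab b" "c \<in> stab b" for a c using that b by (simp add: stab_def perm_mult)
  qed
  have orbit: "card (carrier G) \<le> card ((\<lambda>g. \<alpha> g b) ` carrier G) * card (stab b)" if b: "b \<in> B" for b
  proof (rule card_le_fibers[OF fin _ order_refl])
    show "finite ((\<lambda>g. \<alpha> g b) ` carrier G)" using fin by simp
    fix c assume "c \<in> (\<lambda>g. \<alpha> g b) ` carrier G"
    then obtain g0 where g0: "g0 \<in> carrier G" "\<alpha> g0 b = c" by blast
    show "card {g \<in> carrier G. \<alpha> g b = c} \<le> card (stab b)"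
    proof (rule card_inj_on_le[of "\<lambda>g. inv g0 \<otimes> g"])
      show "inj_on (\<lambda>g. inv g0 \<otimes> g) {g \<in> carrier G. \<alpha> g b = c}" using g0 by (auto simp: inj_on_def)
      show "finite (stab b)" using fin by (simp add: stab_def)
      show "(\<lambda>g. inv g0 \<otimes> g) ` {g \<in> carrier G. \<alpha> g b = c} \<subseteq> stab b"
        using g0 b perm_inv(2)[of g0 b] by (auto simp: stab_def perm_mult)
    qed
  qed
  have "card ((\<lambda>g. \<alpha> g b1) ` carrier G) \<le> card P + 1"
    using perm_in nontrivial(2) fin_B unfolding card_B[symmetric] by (intro card_mono) auto
  then have big: "card (carrier G) \<le> card (stab b1) * (card P + 1)"
    using orbit[OF nontrivial(2)] by (metis mult.commute mult_le_mono1 le_trans)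
  have "stab b1 \<noteq> carrier G" using nontrivial by (auto simp: stab_def)
  then obtain g where g: "g \<in> carrier G" "conj_sub (stab b1) g = H"
    using big_subgroup[OF stab[OF nontrivial(2)] _ big] by blast
  define p0 where "p0 = \<alpha> (inv g) b1"
  have p0: "p0 \<in> B" using perm_in g nontrivial by (simp add: p0_def)
  have stab_p0: "stab p0 = H"
  proof -
    have "\<alpha> x p0 = p0 \<longleftrightarrow> \<alpha> (g \<otimes> x \<otimes> inv g) b1 = b1" if x: "x \<in> carrier G" for x
    proof -
      have e: "\<alpha> (g \<otimes> x \<otimes> inv g) b1 = \<alpha> g (\<alpha> x p0)"
        using x g(1) nontrivial(2) perm_in by (simp add: perm_mult p0_def)
      have "\<alpha> g p0 = b1" using perm_inv(1)[OF g(1) nontrivial(2)] by (simp add: p0_def)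
      then show ?thesis unfolding e using perm_inv(2)[OF g(1)] perm_in[OF x p0] p0 by metis
    qed
    then have "stab p0 = conj_sub (stab b1) g" using g(1) by (auto simp: stab_def conj_sub_def)
    then show ?thesis using g(2) by simp
  qed
  have orb_p0: "(\<lambda>g. \<alpha> g p0) ` carrier G = B"
  proof -
    have "(card P + 1) * card H \<le> card ((\<lambda>g. \<alpha> g p0) ` carrier G) * card H"
      using orbit[OF p0] stab_p0 card_G by simp
    moreover have "0 < card H" using H_closed(1) finite_H by (metis card_gt_0_iff empty_iff)
    ultimately have "card B \<le> card ((\<lambda>g. \<alpha> g p0) ` carrier G)"
      unfolding card_B by (simp only: mult_le_cancel2)
    then show ?thesis using perm_in p0 fin_B by (intro card_seteq) auto
  qed
  have "regular_setting G B \<alpha> P T Phi Z k p0"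
  proof (intro regular_setting.intro regular_setting_axioms.intro is_group fin_B p0 P T)
    show "card B = 2 ^ k + 1" using card_B card_P by simp
    show "card P = 2 ^ k" by (rule card_P)
    show "\<alpha> s p0 = p0" if "s \<in> P \<union> T" for s
    proof -
      have "s \<in> stab p0" using that P_H T_H stab_p0 by blast
      then show ?thesis by (simp add: stab_def)
    qed
    show "\<exists>g\<in>carrier G. \<alpha> g p0 = b" if "b \<in> B" for b using that orb_p0 by force
    \<comment> \<open>The point b is reached from p0 through the big cell. Pulling s back to the
      stabilizer of p0 gives an element w x w of \<open>H\<close> with x conjugate to s in
      \<open>P\<close>.\<close>
    show "s = \<one>" if s: "s \<in> P" and b: "b \<in> B" "b \<noteq> p0" "\<alpha> s b = b" for s b
    proof -
      obtain h where h: "h \<in> carrier G" "\<alpha> h p0 = b" using b orb_p0 by force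
      have "h \<notin> H" using h b stab_p0 by (auto simp: stab_def)
      then obtain s' h' where sh: "s' \<in> P" "h' \<in> H" "h = s' \<otimes> w \<otimes> h'" using Bruhat_H[OF h(1)] by blast
      have "\<alpha> (inv h \<otimes> s \<otimes> h) p0 = p0"
        using h s b p0 perm_in perm_inv(2)[OF h(1) p0] by (simp add: perm_mult)
      then have "inv h \<otimes> s \<otimes> h \<in> H" using h s unfolding stab_p0[symmetric] by (simp add: stab_def)
      then have "h' \<otimes> (inv h \<otimes> s \<otimes> h) \<otimes> inv h' \<in> H" using sh by simp
      moreover have "h' \<otimes> (inv h \<otimes> s \<otimes> h) \<otimes> inv h' = w \<otimes> (inv s' \<otimes> s \<otimes> s') \<otimes> w"
        unfolding sh(3) using sh(1,2) s by (simp add: m_assoc inv_mult_group)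
      ultimately have e: "inv s' \<otimes> s \<otimes> s' = \<one>" using sh s by (intro opposite_H) auto
      have "s = s' \<otimes> (inv s' \<otimes> s \<otimes> s') \<otimes> inv s'" using sh s by (simp add: m_assoc)
      then show ?thesis unfolding e using sh by simp
    qed
    show "0 < card Phi" using closed(1) unfolding card_gt_0_iff by (metis empty_iff finite_imageI finite_sub(1) image_is_empty)
    show "8 * card Phi \<le> card P" using squares(2) card_Z(2) by simp
    show "Q = {\<one>}" if "subgroup Q G" "Q \<subseteq> P" "Q \<inter> Z = {\<one>}" for Q
      using local_bounds(4)[OF that(1,3)] that(2) by (simp add: Int_absorb2)
    \<comment> \<open>By transitivity of \<open>T\<close>, one nonidentity element of
      \<open>Z\<close> in N brings in all of \<open>Z\<close>.\<close>
    show "N \<inter> Z = {\<one>} \<or> P \<subseteq> N" if N: "N \<lhd> G" for N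
    proof (rule disjCI)
      assume nP: "\<not> P \<subseteq> N"
      interpret N: normal N G by (rule N)
      show "N \<inter> Z = {\<one>}"
      proof (rule ccontr)
        assume "N \<inter> Z \<noteq> {\<one>}"
        then obtain z where z: "z \<in> N" "z \<in> Z" "z \<noteq> \<one>" using N.one_closed closed(3) by blast
        have "z' \<in> N" if z': "z' \<in> Z" for z'
        proof (cases "z' = \<one>")
          case False
          obtain t where t: "t \<in> T" "z' = t \<otimes> z \<otimes> inv t" using T_transitive_Z[OF z(2,3) z' False] .
          then show ?thesis using N.inv_op_closed2[OF _ z(1)] by simp
        qed simp
        then show False using normal_contains_P[OF N] nP by blast
      qed
    qed
  qed (use perm_in perm_one perm_mult T_P Frattini Z_central in auto)
  then show ?thesis by blast
qed

end

section \<open>Matrix groups in characteristic two\<close>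

lemma alg_closure_two: "(2 :: bit alg_closure) = 0"
  by (metis CHAR_alg_closure bit_2_eq_0 to_ac_0 to_ac_numeral)

text \<open>The finite field is a subset of an ambient field, as \<open>GF q\<close> is inside the
  algebraic closure. Closure under negation follows from - x = x.\<close>

locale char2_field =
  fixes K :: "'a :: field set" and q :: nat
  assumes two: "(2 :: 'a) = 0"
    and K_1: "1 \<in> K" and K_add: "\<And>x y. x \<in> K \<Longrightarrow> y \<in> K \<Longrightarrow> x + y \<in> K"
    and K_mult: "\<And>x y. x \<in> K \<Longrightarrow> y \<in> K \<Longrightarrow> x * y \<in> K"
    and K_inverse: "\<And>x. x \<in> K \<Longrightarrow> inverse x \<in> K"
    and card_K: "card K = q" and q_ge: "8 \<le> q"
begin

lemma dbl: "x + x = (0 :: 'a)"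
  using two by (metis mult_2 mult_zero_left)

lemma dbl': "x + (x + y) = (y :: 'a)"
  using dbl by (metis add.assoc add_0)

lemma minus_eq: "- x = (x :: 'a)"
  using dbl by (metis add_eq_0_iff)

lemma diff_eq: "x - y = x + (y :: 'a)"
  using minus_eq by (metis diff_conv_add_uminus)

lemma add_eq_0: "x + y = 0 \<longleftrightarrow> x = (y :: 'a)"
  using diff_eq by (metis eq_iff_diff_eq_0)

lemma fin_K: "finite K"
  using card_K q_ge by (intro card_ge_0_finite) simp

lemma K_0: "0 \<in> K"
  using K_add[OF K_1 K_1] dbl by simp

lemma K_div: "x \<in> K \<Longrightarrow> y \<in> K \<Longrightarrow> x / y \<in> K"
  by (simp add: divide_inverse K_mult K_inverse)

lemma K_power: "x \<in> K \<Longrightarrow> x ^ n \<in> K"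
  by (induction n) (auto simp: K_1 K_mult)

end

lemma power_2_power_add:
  fixes x y :: "'a :: field"
  assumes "(2 :: 'a) = 0"
  shows "(x + y) ^ 2 ^ n = x ^ 2 ^ n + y ^ 2 ^ n"
proof (induction n)
  case (Suc n)
  have p: "z ^ 2 ^ Suc n = (z ^ 2 ^ n)\<^sup>2" for z :: 'a by (simp only: power_Suc2 power_mult)
  have "(x + y) ^ 2 ^ Suc n = ((x + y) ^ 2 ^ n)\<^sup>2" by (rule p)
  also have "\<dots> = (x ^ 2 ^ n)\<^sup>2 + (y ^ 2 ^ n)\<^sup>2" using assms by (simp add: Suc power2_sum)
  finally show ?case by (simp only: p)
qed simp

text \<open>The polynomial X^q - X splits over the algebraic closure, and its derivative is the
  constant -1, so it has q distinct roots.\<close>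

lemma card_GF:
  assumes "m > 0"
  shows "card (GF (2 ^ m)) = 2 ^ m"
proof -
  define q where "q = (2 :: nat) ^ m"
  have q: "q \<ge> 2" using assms self_le_power[of "2 :: nat" m] by (simp add: q_def)
  define p :: "bit alg_closure poly" where "p = monom 1 q - monom 1 1"
  have roots: "poly p x = x ^ q - x" for x by (simp add: p_def poly_monom)
  have coeffq: "coeff p q = 1" using q by (simp add: p_def)
  have "degree p \<le> q" unfolding p_def using q by (intro degree_diff_le) (auto intro: degree_monom_le[THEN order_trans])
  moreover have "q \<le> degree p" using coeffq by (intro le_degree) simp
  ultimately have deg: "degree p = q" by simp
  have p0: "p \<noteq> 0" using coeffq by auto
  have "of_nat q = (0 :: bit alg_closure)" using assms alg_closure_two by (simp add: q_def)
  then have dp: "poly (pderiv p) x = - 1" for x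
    by (simp add: p_def pderiv_diff pderiv_monom poly_monom)
  obtain A where A: "size A = degree p" "p = smult (lead_coeff p) (\<Prod>x\<in>#A. [:-x, 1:])"
    using alg_closed_imp_factorization[OF p0] by blast
  have lc: "lead_coeff p = 1" using coeffq deg by simp
  have pA: "p = (\<Prod>x\<in>#A. [:-x, 1:])" using A(2) lc by simp
  have "poly p x = 0 \<longleftrightarrow> x \<in># A" for x
    unfolding pA by (induction A) auto
  then have set: "GF q = set_mset A" using roots by (auto simp: GF_def)
  have "count A a \<le> 1" for a
  proof (rule ccontr)
    assume "\<not> ?thesis"
    then have c: "count A a \<ge> 2" by simp
    then have "a \<in># A" by (metis count_eq_zero_iff not_numeral_le_zero)
    then obtain A' where A': "A = add_mset a A'" by (metis insert_DiffM)
    then have "a \<in># A'" using c by (metis Suc_le_mono count_add_mset count_eq_zero_iff numeral_2_eq_2 not_less_eq_eq zero_le)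
    then obtain A'' where A'': "A' = add_mset a A''" by (metis insert_DiffM)
    have "p = [:-a, 1:] * ([:-a, 1:] * (\<Prod>x\<in>#A''. [:-x, 1:]))" unfolding pA A' A'' by simp
    then have "poly (pderiv p) a = 0" by (simp only: pderiv_mult poly_add poly_mult) simp
    then show False using dp by simp
  qed
  then have "size A = card (set_mset A)"
    unfolding size_multiset_overloaded_eq
    by (metis card_eq_sum count_greater_eq_one_iff le_antisym sum.cong)
  then show ?thesis using set A(1) deg by (simp add: q_def)
qed

lemma char2_field_GF:
  assumes "m \<ge> 3"
  shows "char2_field (GF (2 ^ m)) (2 ^ m)"
proof
  show "(2 :: bit alg_closure) = 0" by (rule alg_closure_two)
  show "1 \<in> GF (2 ^ m)" by (simp add: GF_def)
  show "x + y \<in> GF (2 ^ m)" if "x \<in> GF (2 ^ m)" "y \<in> GF (2 ^ m)" for x y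
    using that by (simp add: GF_def power_2_power_add alg_closure_two)
  show "x * y \<in> GF (2 ^ m)" if "x \<in> GF (2 ^ m)" "y \<in> GF (2 ^ m)" for x y
    using that by (simp add: GF_def power_mult_distrib)
  show "inverse x \<in> GF (2 ^ m)" if "x \<in> GF (2 ^ m)" for x
    using that by (simp add: GF_def power_inverse)
  show "card (GF (2 ^ m)) = 2 ^ m" using assms by (simp add: card_GF)
  have "2 ^ 3 \<le> (2 :: nat) ^ m" using assms by (rule power_increasing) simp
  then show "8 \<le> (2 :: nat) ^ m" by simp
qed

section \<open>Explicit matrices of size two and four\<close>

lemma sum_lessThan_2: "(\<Sum>i\<in>{0..<2 :: nat}. f i) = f 0 + f 1"
  by (simp add: numeral_2_eq_2)

lemma sum_lessThan_4: "(\<Sum>i\<in>{0..<4 :: nat}. f i) = f 0 + f 1 + f 2 + f 3"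
  by (simp add: eval_nat_numeral)

lemma less_2_cases: "i < 2 \<Longrightarrow> i = 0 \<or> i = (1 :: nat)" by auto
lemma less_4_cases: "i < 4 \<Longrightarrow> i = 0 \<or> i = 1 \<or> i = 2 \<or> i = (3 :: nat)" by auto

lemma mat_of_rows_list_2: "mat_of_rows_list 2 [r1, r2] = mat 2 2 (\<lambda>(i, j). [r1, r2] ! i ! j)"
  by (simp add: mat_of_rows_list_def numeral_2_eq_2)

lemma mat_of_rows_list_4:
  "mat_of_rows_list 4 [r1, r2, r3, r4] = mat 4 4 (\<lambda>(i, j). [r1, r2, r3, r4] ! i ! j)"
proof -
  have "length [r1, r2, r3, r4] = 4" by simp
  then show ?thesis unfolding mat_of_rows_list_def by (simp only:)
qed

lemma mult_mat_2:
  "mat_of_rows_list 2 [[a11, a12], [a21, a22]] * mat_of_rows_list 2 [[b11, b12], [b21, b22]]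
   = mat_of_rows_list 2
      [[a11 * b11 + a12 * b21, a11 * b12 + a12 * b22],
       [a21 * b11 + a22 * b21, a21 * b12 + a22 * b22]]"
  by (rule eq_matI)
     (auto simp: mat_of_rows_list_2 scalar_prod_def sum_lessThan_2 dest!: less_2_cases)

lemma mult_mat_4:
  "mat_of_rows_list 4 [[a11, a12, a13, a14], [a21, a22, a23, a24], [a31, a32, a33, a34], [a41, a42, a43, a44]] *
   mat_of_rows_list 4 [[b11, b12, b13, b14], [b21, b22, b23, b24], [b31, b32, b33, b34], [b41, b42, b43, b44]]
   = mat_of_rows_list 4
      [[a11 * b11 + a12 * b21 + a13 * b31 + a14 * b41, a11 * b12 + a12 * b22 + a13 * b32 + a14 * b42,
        a11 * b13 + a12 * b23 + a13 * b33 + a14 * b43, a11 * b14 + a12 * b24 + a13 * b34 + a14 * b44],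
       [a21 * b11 + a22 * b21 + a23 * b31 + a24 * b41, a21 * b12 + a22 * b22 + a23 * b32 + a24 * b42,
        a21 * b13 + a22 * b23 + a23 * b33 + a24 * b43, a21 * b14 + a22 * b24 + a23 * b34 + a24 * b44],
       [a31 * b11 + a32 * b21 + a33 * b31 + a34 * b41, a31 * b12 + a32 * b22 + a33 * b32 + a34 * b42,
        a31 * b13 + a32 * b23 + a33 * b33 + a34 * b43, a31 * b14 + a32 * b24 + a33 * b34 + a34 * b44],
       [a41 * b11 + a42 * b21 + a43 * b31 + a44 * b41, a41 * b12 + a42 * b22 + a43 * b32 + a44 * b42,
        a41 * b13 + a42 * b23 + a43 * b33 + a44 * b43, a41 * b14 + a42 * b24 + a43 * b34 + a44 * b44]]"
  by (rule eq_matI)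
     (auto simp: mat_of_rows_list_4 scalar_prod_def sum_lessThan_4 dest!: less_4_cases)

lemma mat_4_eq_iff:
  "mat_of_rows_list 4 [[a11, a12, a13, a14], [a21, a22, a23, a24], [a31, a32, a33, a34], [a41, a42, a43, a44]] =
   mat_of_rows_list 4 [[b11, b12, b13, b14], [b21, b22, b23, b24], [b31, b32, b33, b34], [b41, b42, b43, b44]]
   \<longleftrightarrow> [[a11, a12, a13, a14], [a21, a22, a23, a24], [a31, a32, a33, a34], [a41, a42, a43, a44]] =
     [[b11, b12, b13, b14], [b21, b22, b23, b24], [b31, b32, b33, b34], [b41, b42, b43, b44]]"
    (is "mat_of_rows_list 4 ?a = mat_of_rows_list 4 ?b \<longleftrightarrow> _")
proof
  assume e: "mat_of_rows_list 4 ?a = mat_of_rows_list 4 ?b"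
  have *: "?a ! i ! j = ?b ! i ! j" if "i < 4" "j < 4" for i j
    using arg_cong[OF e, of "\<lambda>A. A $$ (i, j)"] that by (simp add: mat_of_rows_list_def)
  show "?a = ?b"
    using *[of 0 0] *[of 0 1] *[of 0 2] *[of 0 3] *[of 1 0] *[of 1 1] *[of 1 2] *[of 1 3]
      *[of 2 0] *[of 2 1] *[of 2 2] *[of 2 3] *[of 3 0] *[of 3 1] *[of 3 2] *[of 3 3] by simp
qed simp

lemma mat_2_eq_iff:
  "mat_of_rows_list 2 [[a11, a12], [a21, a22]] = mat_of_rows_list 2 [[b11, b12], [b21, b22]]
   \<longleftrightarrow> [[a11, a12], [a21, a22]] = [[b11, b12], [b21, b22]]"
    (is "mat_of_rows_list 2 ?a = mat_of_rows_list 2 ?b \<longleftrightarrow> _")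
proof
  assume e: "mat_of_rows_list 2 ?a = mat_of_rows_list 2 ?b"
  have *: "?a ! i ! j = ?b ! i ! j" if "i < 2" "j < 2" for i j
    using arg_cong[OF e, of "\<lambda>A. A $$ (i, j)"] that by (simp add: mat_of_rows_list_def)
  show "?a = ?b" using *[of 0 0] *[of 0 1] *[of 1 0] *[of 1 1] by simp
qed simp

lemma one_mat_2: "1\<^sub>m 2 = mat_of_rows_list 2 [[1, 0], [0, 1]]"
  by (rule eq_matI) (auto simp: mat_of_rows_list_2 dest!: less_2_cases)

lemma one_mat_4:
  "1\<^sub>m 4 = mat_of_rows_list 4 [[1, 0, 0, 0], [0, 1, 0, 0], [0, 0, 1, 0], [0, 0, 0, 1]]"
  by (rule eq_matI) (auto simp: mat_of_rows_list_4 dest!: less_4_cases)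

lemma carrier_mat_2: "mat_of_rows_list 2 [[a, b], [c, d]] \<in> carrier_mat 2 2"
  by (simp add: mat_of_rows_list_2)

lemma carrier_mat_4:
  "mat_of_rows_list 4 [[a11, a12, a13, a14], [a21, a22, a23, a24], [a31, a32, a33, a34], [a41, a42, a43, a44]] \<in> carrier_mat 4 4"
  by (simp add: mat_of_rows_list_4)

lemma group_GL: "group (GL n)"
proof -
  interpret ring "ring_mat TYPE('a) n ()" by (rule ring_mat)
  show ?thesis unfolding GL_def by (rule units_group)
qed

lemma GL_simps: "A \<otimes>\<^bsub>GL n\<^esub> B = A * B" "\<one>\<^bsub>GL n\<^esub> = 1\<^sub>m n"
  by (simp_all add: GL_def units_of_def ring_mat_simps)

lemma carrier_GL_I:
  "A \<in> carrier_mat n n \<Longrightarrow> B \<in> carrier_mat n n \<Longrightarrow> A * B = 1\<^sub>m n \<Longrightarrow> B * A = 1\<^sub>m n \<Longrightarrow> A \<in> carrier (GL n)"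
  by (auto simp: GL_def units_of_def Units_def ring_mat_simps)

lemma det_2: "det (mat_of_rows_list 2 [[a, b], [c, d :: 'a :: comm_ring_1]]) = a * d - b * c"
proof -
  let ?A = "mat_of_rows_list 2 [[a, b], [c, d]]"
  have "det ?A = (\<Sum>j<2. ?A $$ (0, j) * cofactor ?A 0 j)"
    by (rule laplace_expansion_row[OF carrier_mat_2]) simp
  also have "\<dots> = ?A $$ (0, 0) * cofactor ?A 0 0 + ?A $$ (0, 1) * cofactor ?A 0 1"
    by (simp add: numeral_2_eq_2)
  finally have e: "det ?A = ?A $$ (0, 0) * cofactor ?A 0 0 + ?A $$ (0, 1) * cofactor ?A 0 1" .
  have "mat_delete ?A 0 0 = mat 1 1 (\<lambda>_. d)" "mat_delete ?A 0 1 = mat 1 1 (\<lambda>_. c)"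
    by (auto simp: mat_delete_def mat_of_rows_list_2)
  then have "cofactor ?A 0 0 = d" "cofactor ?A 0 1 = - c"
    unfolding cofactor_def by (simp_all add: det_single)
  then show ?thesis unfolding e by (simp add: mat_of_rows_list_2)
qed

lemma mat_2_cases:
  assumes "A \<in> carrier_mat 2 2"
  shows "A = mat_of_rows_list 2 [[A $$ (0, 0), A $$ (0, 1)], [A $$ (1, 0), A $$ (1, 1)]]"
  using assms by (intro eq_matI) (auto simp: mat_of_rows_list_2 dest!: less_2_cases)

section \<open>Verifying the axioms for matrix groups\<close>

context group
begin

text \<open>Inverses enter by existence and conjugation by exchange equations, so that for matrices
  every condition becomes an identity between products.\<close>

lemma zassenhaus_typeI:
  fixes P Z T :: "'a set"
  assumes fin: "finite (carrier G)"
    and sub: "P \<subseteq> carrier G" "Z \<subseteq> P" "T \<subseteq> carrier G"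
    and one: "\<one> \<in> Z" "\<one> \<in> T"
    and cl: "\<And>x y. x \<in> P \<Longrightarrow> y \<in> P \<Longrightarrow> x \<otimes> y \<in> P" "\<And>x y. x \<in> Z \<Longrightarrow> y \<in> Z \<Longrightarrow> x \<otimes> y \<in> Z"
      "\<And>x y. x \<in> T \<Longrightarrow> y \<in> T \<Longrightarrow> x \<otimes> y \<in> T"
    and inv_ex: "\<And>x. x \<in> P \<Longrightarrow> \<exists>y\<in>P. y \<otimes> x = \<one>" "\<And>x. x \<in> Z \<Longrightarrow> \<exists>y\<in>Z. y \<otimes> x = \<one>"
      "\<And>x. x \<in> T \<Longrightarrow> \<exists>y\<in>T. y \<otimes> x = \<one>"
    and Z_central: "\<And>z s. z \<in> Z \<Longrightarrow> s \<in> P \<Longrightarrow> z \<otimes> s = s \<otimes> z"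
    and card: "card P = 2 ^ k" "card Z = card T + 1" "8 \<le> card Z"
    and T_P: "\<And>t s. t \<in> T \<Longrightarrow> s \<in> P \<Longrightarrow> \<exists>s'\<in>P. t \<otimes> s = s' \<otimes> t"
    and T_Z: "\<And>t s. t \<in> T \<Longrightarrow> s \<in> Z \<Longrightarrow> \<exists>s'\<in>Z. t \<otimes> s = s' \<otimes> t"
    and T_free: "\<And>t s. t \<in> T \<Longrightarrow> s \<in> P \<Longrightarrow> t \<otimes> s = s \<otimes> t \<Longrightarrow> t = \<one> \<or> s = \<one>"
    and T_comm: "\<And>t t'. t \<in> T \<Longrightarrow> t' \<in> T \<Longrightarrow> t \<otimes> t' = t' \<otimes> t"
    and sq_Z: "\<And>s. s \<in> P \<Longrightarrow> s \<otimes> s \<in> Z"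
    and sq_inj: "\<And>s s'. s \<in> P \<Longrightarrow> s' \<in> P \<Longrightarrow> s \<otimes> s = s' \<otimes> s' \<Longrightarrow> \<exists>z\<in>Z. s' = s \<otimes> z"
    and w: "w \<in> carrier G" "w \<otimes> w = \<one>" "\<And>t. t \<in> T \<Longrightarrow> (w \<otimes> t \<otimes> w) \<otimes> t = \<one>"
    and s1: "s1 \<in> P" and z1: "z1 \<in> Z" and w_s1: "w \<otimes> s1 = s1 \<otimes> w \<otimes> z1 \<otimes> w"
    and Bruhat: "\<And>g. g \<in> carrier G \<Longrightarrow> (\<exists>s\<in>P. \<exists>t\<in>T. g = s \<otimes> t) \<or>
      (\<exists>s\<in>P. \<exists>t\<in>T. \<exists>s'\<in>P. g = s \<otimes> w \<otimes> t \<otimes> s')"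
    and opposite: "\<And>s s' t. s \<in> P \<Longrightarrow> s' \<in> P \<Longrightarrow> t \<in> T \<Longrightarrow> w \<otimes> s \<otimes> w = s' \<otimes> t \<Longrightarrow> s = \<one>"
    and w_notin: "\<And>s t. s \<in> P \<Longrightarrow> t \<in> T \<Longrightarrow> w \<noteq> s \<otimes> t"
    and squares: "(\<lambda>s. s \<otimes> s) ` P = {\<one>} \<or> (\<lambda>s. s \<otimes> s) ` P = Z" "card P = card Z * card ((\<lambda>s. s \<otimes> s) ` P)"
    and squares_free: "\<And>t s f. t \<in> T \<Longrightarrow> s \<in> P \<Longrightarrow> f \<in> (\<lambda>s. s \<otimes> s) ` P \<Longrightarrow> t \<otimes> s = f \<otimes> (s \<otimes> t) \<Longrightarrow>
      t = \<one> \<or> s \<in> (\<lambda>s. s \<otimes> s) ` P"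
  shows "zassenhaus_type G P Z T w s1 z1 k"
proof -
  have subgr: "subgroup A G"
    if A: "A \<subseteq> carrier G" "\<one> \<in> A" "\<And>x y. x \<in> A \<Longrightarrow> y \<in> A \<Longrightarrow> x \<otimes> y \<in> A" "\<And>x. x \<in> A \<Longrightarrow> \<exists>y\<in>A. y \<otimes> x = \<one>" for A
  proof (rule subgroupI)
    show "inv a \<in> A" if a: "a \<in> A" for a
    proof -
      obtain y where "y \<in> A" "y \<otimes> a = \<one>" using A(4)[OF a] by blast
      then show ?thesis using inv_equality[of y a] a A(1) by auto
    qed
  qed (use A in auto)
  have P: "subgroup P G" by (rule subgr) (use sub one cl(1) inv_ex(1) in auto)
  have Z: "subgroup Z G" by (rule subgr) (use sub one cl(2) inv_ex(2) in auto)
  have T: "subgroup T G" by (rule subgr) (use sub one cl(3) inv_ex(3) in auto)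
  have c: "x \<in> P \<Longrightarrow> x \<in> carrier G" "x \<in> T \<Longrightarrow> x \<in> carrier G" "x \<in> Z \<Longrightarrow> x \<in> carrier G" for x
    using sub by blast+
  show ?thesis
  proof (intro zassenhaus_type.intro zassenhaus_type_axioms.intro is_group fin P Z T)
    show "t \<otimes> s \<otimes> inv t \<in> P" if ts: "t \<in> T" "s \<in> P" for t s
    proof -
      obtain s' where "s' \<in> P" "t \<otimes> s = s' \<otimes> t" using T_P[OF ts] by blast
      then show ?thesis using ts c by (simp add: m_assoc)
    qed
    show "t \<otimes> s \<otimes> inv t \<in> Z" if ts: "t \<in> T" "s \<in> Z" for t s
    proof -
      obtain s' where "s' \<in> Z" "t \<otimes> s = s' \<otimes> t" using T_Z[OF ts] by blast
      then show ?thesis using ts c by (simp add: m_assoc)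
    qed
    show "inv s \<otimes> s' \<in> Z" if s: "s \<in> P" "s' \<in> P" "s \<otimes> s = s' \<otimes> s'" for s s'
    proof -
      obtain z where "z \<in> Z" "s' = s \<otimes> z" using sq_inj[OF s] by blast
      then show ?thesis using s c by simp
    qed
    show "w \<otimes> t \<otimes> w = inv t" if t: "t \<in> T" for t
      using inv_equality[OF w(3)[OF t]] t c w(1) by simp
    show "subgroup ((\<lambda>s. s \<otimes> s) ` P) G"
      using squares(1) Z triv_subgroup by auto
    show "t = \<one> \<or> s \<in> (\<lambda>s. s \<otimes> s) ` P"
      if ts: "t \<in> T" "s \<in> P" "t \<otimes> s \<otimes> inv t \<otimes> inv s \<in> (\<lambda>s. s \<otimes> s) ` P" for t s
    proof (rule squares_free[OF ts])
      show "t \<otimes> s = t \<otimes> s \<otimes> inv t \<otimes> inv s \<otimes> (s \<otimes> t)" using ts(1,2) c by (simp add: m_assoc)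
    qed
  qed (fact assms)+
qed

text \<open>The set of normal forms is closed under left multiplication by \<open>P\<close>,
  \<open>T\<close> and w. The essential case is w times s w t s' with s \<noteq> 1, where
  \<open>wPw\<close> rewrites w s w.\<close>

lemma generate_Bruhat:
  assumes P: "subgroup P G" and T: "subgroup T G" and w: "w \<in> carrier G" "w \<otimes> w = \<one>"
    and wT: "\<And>t. t \<in> T \<Longrightarrow> w \<otimes> t \<otimes> w \<in> T"
    and T_P: "\<And>t s. t \<in> T \<Longrightarrow> s \<in> P \<Longrightarrow> \<exists>s'\<in>P. t \<otimes> s = s' \<otimes> t"
    and wPw: "\<And>s. s \<in> P \<Longrightarrow> s \<noteq> \<one> \<Longrightarrow> \<exists>s1\<in>P. \<exists>t\<in>T. \<exists>s2\<in>P. w \<otimes> s \<otimes> w = s1 \<otimes> w \<otimes> t \<otimes> s2"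
    and gens: "S \<subseteq> P \<union> T \<union> {w}" and g: "g \<in> generate G S"
  shows "(\<exists>s\<in>P. \<exists>t\<in>T. g = s \<otimes> t) \<or> (\<exists>s\<in>P. \<exists>t\<in>T. \<exists>s'\<in>P. g = s \<otimes> w \<otimes> t \<otimes> s')"
proof -
  define C where "C = {s \<otimes> t | s t. s \<in> P \<and> t \<in> T} \<union> {s \<otimes> w \<otimes> t \<otimes> s' | s t s'. s \<in> P \<and> t \<in> T \<and> s' \<in> P}"
  have c: "x \<in> P \<Longrightarrow> x \<in> carrier G" "x \<in> T \<Longrightarrow> x \<in> carrier G" for x
    using subgroup.subset[OF P] subgroup.subset[OF T] by blast+
  note Pc = subgroup.one_closed[OF P] subgroup.m_inv_closed[OF P] subgroup.m_closed[OF P]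
  note Tc = subgroup.one_closed[OF T] subgroup.m_inv_closed[OF T] subgroup.m_closed[OF T]
  have C1: "s \<otimes> t \<in> C" if "s \<in> P" "t \<in> T" for s t using that unfolding C_def by blast
  have C2: "s \<otimes> w \<otimes> t \<otimes> s' \<in> C" if "s \<in> P" "t \<in> T" "s' \<in> P" for s t s' using that unfolding C_def by blast
  have CG: "x \<in> carrier G" if "x \<in> C" for x using that c w unfolding C_def by auto
  have T_P': "\<exists>s'\<in>P. s \<otimes> t = t \<otimes> s'" if ts: "t \<in> T" "s \<in> P" for t s
  proof -
    obtain s' where s': "s' \<in> P" "inv t \<otimes> s = s' \<otimes> inv t" using T_P[OF Tc(2)[OF ts(1)] ts(2)] by blast
    have "s \<otimes> t = t \<otimes> (inv t \<otimes> s) \<otimes> t" using ts c by (simp add: m_assoc)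
    also have "\<dots> = t \<otimes> s'" unfolding s'(2) using ts s' c by (simp add: m_assoc)
    finally show ?thesis using s' by blast
  qed
  have ww: "w \<otimes> (w \<otimes> x) = x" if "x \<in> carrier G" for x using w that by (simp add: m_assoc[symmetric])
  have cases: "(\<exists>s t. s \<in> P \<and> t \<in> T \<and> x = s \<otimes> t) \<or> (\<exists>s t s'. s \<in> P \<and> t \<in> T \<and> s' \<in> P \<and> x = s \<otimes> w \<otimes> t \<otimes> s')"
    if "x \<in> C" for x using that unfolding C_def by blast
  have leftP: "p \<otimes> x \<in> C" if p: "p \<in> P" and x: "x \<in> C" for p x
    using cases[OF x]
  proof (elim disjE exE conjE)
    fix s t assume *: "s \<in> P" "t \<in> T" "x = s \<otimes> t"
    then have "p \<otimes> x = (p \<otimes> s) \<otimes> t" using p c by (simp add: m_assoc)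
    then show ?thesis using C1[of "p \<otimes> s" t] p * Pc by simp
  next
    fix s t s' assume *: "s \<in> P" "t \<in> T" "s' \<in> P" "x = s \<otimes> w \<otimes> t \<otimes> s'"
    then have "p \<otimes> x = (p \<otimes> s) \<otimes> w \<otimes> t \<otimes> s'" using p c w by (simp add: m_assoc)
    then show ?thesis using C2[of "p \<otimes> s" t s'] p * Pc by simp
  qed
  have leftT: "r \<otimes> x \<in> C" if r: "r \<in> T" and x: "x \<in> C" for r x
    using cases[OF x]
  proof (elim disjE exE conjE)
    fix s t assume *: "s \<in> P" "t \<in> T" "x = s \<otimes> t"
    obtain s' where s': "s' \<in> P" "r \<otimes> s = s' \<otimes> r" using T_P[OF r *(1)] by blast
    have "r \<otimes> x = (r \<otimes> s) \<otimes> t" unfolding *(3) using *(1,2) r c by (simp add: m_assoc)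
    also have "\<dots> = s' \<otimes> (r \<otimes> t)" unfolding s'(2) using *(1,2) s'(1) r c by (simp add: m_assoc)
    finally show ?thesis using C1[of s' "r \<otimes> t"] s' * r Tc by simp
  next
    fix s t s' assume *: "s \<in> P" "t \<in> T" "s' \<in> P" "x = s \<otimes> w \<otimes> t \<otimes> s'"
    obtain s'' where s'': "s'' \<in> P" "r \<otimes> s = s'' \<otimes> r" using T_P[OF r *(1)] by blast
    have "r \<otimes> x = (r \<otimes> s) \<otimes> w \<otimes> t \<otimes> s'" unfolding *(4) using *(1-3) r c w by (simp add: m_assoc)
    also have "\<dots> = s'' \<otimes> w \<otimes> ((w \<otimes> r \<otimes> w) \<otimes> t) \<otimes> s'" unfolding s''(2)
      using *(1-3) s''(1) r c w ww by (simp add: m_assoc)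
    finally show ?thesis using C2[of s'' "(w \<otimes> r \<otimes> w) \<otimes> t" s'] s'' * wT[OF r] Tc by simp
  qed
  have leftw: "w \<otimes> x \<in> C" if x: "x \<in> C" for x
    using cases[OF x]
  proof (elim disjE exE conjE)
    fix s t assume *: "s \<in> P" "t \<in> T" "x = s \<otimes> t"
    obtain s' where s': "s' \<in> P" "s \<otimes> t = t \<otimes> s'" using T_P'[OF *(2,1)] by blast
    have "w \<otimes> x = \<one> \<otimes> w \<otimes> t \<otimes> s'" unfolding *(3) s'(2) using * s' c w by (simp add: m_assoc)
    then show ?thesis using C2[of \<one> t s'] * s' Pc by simp
  next
    fix s t s' assume *: "s \<in> P" "t \<in> T" "s' \<in> P" "x = s \<otimes> w \<otimes> t \<otimes> s'"
    show ?thesis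
    proof (cases "s = \<one>")
      case True
      obtain s'' where s'': "s'' \<in> P" "t \<otimes> s' = s'' \<otimes> t" using T_P[OF *(2,3)] by blast
      have "w \<otimes> x = t \<otimes> s'" unfolding *(4) True using * c w ww by (simp add: m_assoc)
      then show ?thesis using C1[of s'' t] s'' * by simp
    next
      case False
      obtain p1 r p2 where p: "p1 \<in> P" "r \<in> T" "p2 \<in> P" "w \<otimes> s \<otimes> w = p1 \<otimes> w \<otimes> r \<otimes> p2"
        using wPw[OF *(1) False] by blast
      obtain p3 where p3: "p3 \<in> P" "p2 \<otimes> t = t \<otimes> p3" using T_P'[OF *(2) p(3)] by blast
      have "w \<otimes> x = (w \<otimes> s \<otimes> w) \<otimes> t \<otimes> s'" unfolding *(4) using * c w by (simp add: m_assoc)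
      also have "\<dots> = p1 \<otimes> w \<otimes> r \<otimes> (p2 \<otimes> t) \<otimes> s'" unfolding p(4) using *(1-3) p(1-3) c w by (simp add: m_assoc)
      also have "\<dots> = p1 \<otimes> w \<otimes> (r \<otimes> t) \<otimes> (p3 \<otimes> s')" unfolding p3(2) using *(1-3) p(1-3) p3(1) c w by (simp add: m_assoc)
      finally show ?thesis using C2[of p1 "r \<otimes> t" "p3 \<otimes> s'"] p p3 * Pc Tc by simp
    qed
  qed
  have "S \<subseteq> carrier G" using gens c w by blast
  from g have "g \<otimes> x \<in> C" if "x \<in> C" for x
    using that
  proof (induction arbitrary: x rule: generate.induct)
    case one
    then show ?case using CG by simp
  next
    case (incl h)
    then show ?case using gens leftP leftT leftw by blast
  next
    case (inv h)
    then consider "h \<in> P" | "h \<in> T" | "h = w" using gens by blast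
    then show ?case
    proof cases
      case 3
      then have "inv h = w" using w by (simp add: inv_equality)
      then show ?thesis using leftw inv by simp
    qed (use leftP leftT Pc Tc inv in auto)
  next
    case (eng h1 h2)
    have "h1 \<in> carrier G" "h2 \<in> carrier G"
      using eng generate_in_carrier[OF \<open>S \<subseteq> carrier G\<close>] by blast+
    then show ?case using eng CG by (simp add: m_assoc)
  qed
  moreover have "\<one> \<in> C" using C1[OF Pc(1) Tc(1)] by simp
  ultimately have "g \<otimes> \<one> \<in> C" by blast
  then have "g \<in> C" using generate_in_carrier[OF \<open>S \<subseteq> carrier G\<close> g] by simp
  then show ?thesis using cases by blast
qed

end

section \<open>The group SL2\<close>

context char2_field
begin

definition lower2 :: "'a \<Rightarrow> 'a mat"
  where "lower2 x = mat_of_rows_list 2 [[1, 0], [x, 1]]"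

definition diag2 :: "'a \<Rightarrow> 'a mat"
  where "diag2 l = mat_of_rows_list 2 [[l, 0], [0, inverse l]]"

definition flip2 :: "'a mat"
  where "flip2 = mat_of_rows_list 2 [[0, 1], [1, 0]]"

lemmas mat2_simps = lower2_def diag2_def flip2_def mult_mat_2 one_mat_2 mat_2_eq_iff

lemma carrier_SL2:
  "A \<in> carrier (SL2 K) \<longleftrightarrow> (\<exists>a\<in>K. \<exists>b\<in>K. \<exists>c\<in>K. \<exists>d\<in>K.
    A = mat_of_rows_list 2 [[a, b], [c, d]] \<and> a * d + b * c = 1)"
proof -
  have el: "elements_mat (mat_of_rows_list 2 [[a, b], [c, d]]) \<subseteq> K \<longleftrightarrow> a \<in> K \<and> b \<in> K \<and> c \<in> K \<and> d \<in> K" for a b c d :: 'a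
  proof -
    have "elements_mat (mat_of_rows_list 2 [[a, b], [c, d]]) = {a, b, c, d}"
    proof (rule equalityI; rule subsetI)
      fix x assume "x \<in> elements_mat (mat_of_rows_list 2 [[a, b], [c, d]])"
      then obtain i j where "i < 2" "j < 2" "x = mat_of_rows_list 2 [[a, b], [c, d]] $$ (i, j)"
        by (auto simp: mat_of_rows_list_2)
      then show "x \<in> {a, b, c, d}" by (auto simp: mat_of_rows_list_2 dest!: less_2_cases)
    next
      fix x assume x: "x \<in> {a, b, c, d}"
      have "a \<in> elements_mat (mat_of_rows_list 2 [[a, b], [c, d]])"
        by (rule elements_matI[OF carrier_mat_2, of 0 0]) (simp_all add: mat_of_rows_list_2)
      moreover have "b \<in> elements_mat (mat_of_rows_list 2 [[a, b], [c, d]])"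
        by (rule elements_matI[OF carrier_mat_2, of 0 1]) (simp_all add: mat_of_rows_list_2)
      moreover have "c \<in> elements_mat (mat_of_rows_list 2 [[a, b], [c, d]])"
        by (rule elements_matI[OF carrier_mat_2, of 1 0]) (simp_all add: mat_of_rows_list_2)
      moreover have "d \<in> elements_mat (mat_of_rows_list 2 [[a, b], [c, d]])"
        by (rule elements_matI[OF carrier_mat_2, of 1 1]) (simp_all add: mat_of_rows_list_2)
      ultimately show "x \<in> elements_mat (mat_of_rows_list 2 [[a, b], [c, d]])" using x by blast
    qed
    then show ?thesis by auto
  qed
  have "A \<in> carrier (SL2 K) \<longleftrightarrow> A \<in> carrier_mat 2 2 \<and> elements_mat A \<subseteq> K \<and> det A = 1"
    by (simp add: SL2_def)
  also have "\<dots> \<longleftrightarrow> (\<exists>a\<in>K. \<exists>b\<in>K. \<exists>c\<in>K. \<exists>d\<in>K.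
    A = mat_of_rows_list 2 [[a, b], [c, d]] \<and> a * d + b * c = 1)"
  proof
    assume A: "A \<in> carrier_mat 2 2 \<and> elements_mat A \<subseteq> K \<and> det A = 1"
    then obtain a b c d where e: "A = mat_of_rows_list 2 [[a, b], [c, d]]" using mat_2_cases by blast
    then show "\<exists>a\<in>K. \<exists>b\<in>K. \<exists>c\<in>K. \<exists>d\<in>K. A = mat_of_rows_list 2 [[a, b], [c, d]] \<and> a * d + b * c = 1"
      using A el[of a b c d] det_2[of a b c d] diff_eq[of "a * d" "b * c"] by auto
  next
    assume "\<exists>a\<in>K. \<exists>b\<in>K. \<exists>c\<in>K. \<exists>d\<in>K. A = mat_of_rows_list 2 [[a, b], [c, d]] \<and> a * d + b * c = 1"
    then obtain a b c d where "a \<in> K" "b \<in> K" "c \<in> K" "d \<in> K" "A = mat_of_rows_list 2 [[a, b], [c, d]]" "a * d + b * c = 1"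
      by blast
    then show "A \<in> carrier_mat 2 2 \<and> elements_mat A \<subseteq> K \<and> det A = 1"
      using el[of a b c d] det_2[of a b c d] diff_eq[of "a * d" "b * c"] carrier_mat_2[of a b c d] by (simp only:)
  qed
  finally show ?thesis .
qed

lemma SL2_simps: "A \<otimes>\<^bsub>SL2 K\<^esub> B = A * B" "\<one>\<^bsub>SL2 K\<^esub> = 1\<^sub>m 2"
  by (simp_all add: SL2_def GL_simps)

lemma carrier_SL2_I:
  "a \<in> K \<Longrightarrow> b \<in> K \<Longrightarrow> c \<in> K \<Longrightarrow> d \<in> K \<Longrightarrow> a * d + b * c = 1 \<Longrightarrow>
    mat_of_rows_list 2 [[a, b], [c, d]] \<in> carrier (SL2 K)"
  unfolding carrier_SL2 by blast

lemma carrier_SL2_E: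
  assumes "A \<in> carrier (SL2 K)"
  obtains a b c d where "a \<in> K" "b \<in> K" "c \<in> K" "d \<in> K" "A = mat_of_rows_list 2 [[a, b], [c, d]]" "a * d + b * c = 1"
  using assms unfolding carrier_SL2 by blast

lemma group_SL2: "group (SL2 K)"
proof (rule groupI)
  fix A B assume "A \<in> carrier (SL2 K)" "B \<in> carrier (SL2 K)"
  then obtain a b c d a' b' c' d' where *: "a \<in> K" "b \<in> K" "c \<in> K" "d \<in> K" "a' \<in> K" "b' \<in> K" "c' \<in> K" "d' \<in> K"
    "A = mat_of_rows_list 2 [[a, b], [c, d]]" "B = mat_of_rows_list 2 [[a', b'], [c', d']]"
    "a * d + b * c = 1" "a' * d' + b' * c' = 1"
    by (elim carrier_SL2_E)
  \<comment> \<open>The determinant of the product is the product of the determinants, up to terms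
    that occur twice.\<close>
  have "(a * a' + b * c') * (c * b' + d * d') + (a * b' + b * d') * (c * a' + d * c')
      = (a * d + b * c) * (a' * d' + b' * c') + ((a * a' * b' * c + a * a' * b' * c) + (b * c' * d * d' + b * c' * d * d'))"
    by (simp add: algebra_simps)
  also have "\<dots> = 1" using *(11,12) by (simp add: two)
  finally show "A \<otimes>\<^bsub>SL2 K\<^esub> B \<in> carrier (SL2 K)"
    unfolding *(9,10) SL2_simps mult_mat_2 by (intro carrier_SL2_I K_add K_mult *(1-8))
next
  show "\<one>\<^bsub>SL2 K\<^esub> \<in> carrier (SL2 K)"
    unfolding SL2_simps one_mat_2 by (intro carrier_SL2_I) (auto simp: K_0 K_1)
next
  fix A B C assume "A \<in> carrier (SL2 K)" "B \<in> carrier (SL2 K)" "C \<in> carrier (SL2 K)"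
  then have "A \<in> carrier_mat 2 2" "B \<in> carrier_mat 2 2" "C \<in> carrier_mat 2 2" by (simp_all add: SL2_def)
  then show "A \<otimes>\<^bsub>SL2 K\<^esub> B \<otimes>\<^bsub>SL2 K\<^esub> C = A \<otimes>\<^bsub>SL2 K\<^esub> (B \<otimes>\<^bsub>SL2 K\<^esub> C)"
    unfolding SL2_simps by (rule assoc_mult_mat)
next
  fix A assume "A \<in> carrier (SL2 K)"
  then have "A \<in> carrier_mat 2 2" by (simp add: SL2_def)
  then show "\<one>\<^bsub>SL2 K\<^esub> \<otimes>\<^bsub>SL2 K\<^esub> A = A" unfolding SL2_simps by (rule left_mult_one_mat)
next
  fix A assume "A \<in> carrier (SL2 K)"
  then obtain a b c d where *: "a \<in> K" "b \<in> K" "c \<in> K" "d \<in> K" "A = mat_of_rows_list 2 [[a, b], [c, d]]" "a * d + b * c = 1"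
    by (rule carrier_SL2_E)
  \<comment> \<open>The adjugate matrix, in which characteristic two removes the signs.\<close>
  have "mat_of_rows_list 2 [[d, b], [c, a]] \<in> carrier (SL2 K)"
    using * by (intro carrier_SL2_I) (auto simp: ac_simps)
  moreover have "mat_of_rows_list 2 [[d, b], [c, a]] \<otimes>\<^bsub>SL2 K\<^esub> A = \<one>\<^bsub>SL2 K\<^esub>"
    unfolding SL2_simps *(5) mult_mat_2 one_mat_2 mat_2_eq_iff using *(6) dbl by (simp add: ac_simps)
  ultimately show "\<exists>B\<in>carrier (SL2 K). B \<otimes>\<^bsub>SL2 K\<^esub> A = \<one>\<^bsub>SL2 K\<^esub>" by blast
qed

lemma square_eq_1: "x * x = 1 \<Longrightarrow> x = (1 :: 'a)"
proof -
  assume "x * x = 1"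
  then have "(x + 1) * (x + 1) = 1 + 1 + (x + x)" by (simp add: algebra_simps)
  then have "x + 1 = 0" using dbl by simp
  then show ?thesis by (simp only: add_eq_0)
qed

text \<open>The unitriangular group is elementary abelian in characteristic two, so it serves both
  as \<open>P\<close> and as \<open>Z\<close>, and all squares are trivial. The element L =
  \<open>lower2 1\<close> satisfies w L = L w L w and so plays both s1 and z1.\<close>

lemma zassenhaus_SL2:
  assumes q: "q = 2 ^ m"
  shows "zassenhaus_type (SL2 K) (lower2 ` K) (lower2 ` K) (diag2 ` (K - {0})) flip2 (lower2 1) (lower2 1) m"
proof -
  interpret G: group "SL2 K" by (rule group_SL2)
  have inj_l: "inj lower2" by (auto simp: inj_def mat2_simps)
  have inj_d: "inj diag2" by (auto simp: inj_def mat2_simps)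
  have ll: "lower2 x * lower2 y = lower2 (x + y)" for x y by (simp add: mat2_simps)
  have dd: "diag2 x * diag2 y = diag2 (x * y)" for x y by (simp add: mat2_simps)
  have l0: "lower2 0 = 1\<^sub>m 2" and d1: "diag2 1 = 1\<^sub>m 2" by (simp_all add: mat2_simps)
  have dl: "diag2 l * lower2 x = lower2 (x / (l * l)) * diag2 l" if "l \<noteq> 0" for l x
    using that by (simp add: mat2_simps field_simps)
  have sq: "(\<lambda>s. s \<otimes>\<^bsub>SL2 K\<^esub> s) ` lower2 ` K = {1\<^sub>m 2}"
    using K_0 unfolding SL2_simps image_image ll dbl l0 by auto
  have lc: "lower2 x \<in> carrier (SL2 K)" if "x \<in> K" for x
    unfolding lower2_def using that by (intro carrier_SL2_I) (auto simp: K_0 K_1)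
  have dc: "diag2 x \<in> carrier (SL2 K)" if "x \<in> K - {0}" for x
    unfolding diag2_def using that by (intro carrier_SL2_I) (auto simp: K_0 K_1 K_inverse)
  show ?thesis
  proof (rule G.zassenhaus_typeI)
    have "carrier (SL2 K) \<subseteq> (\<lambda>(a, b, c, d). mat_of_rows_list 2 [[a, b], [c, d]]) ` (K \<times> K \<times> K \<times> K)"
    proof
      fix A assume "A \<in> carrier (SL2 K)"
      then obtain a b c d where "a \<in> K" "b \<in> K" "c \<in> K" "d \<in> K" "A = mat_of_rows_list 2 [[a, b], [c, d]]"
        by (rule carrier_SL2_E)
      then show "A \<in> (\<lambda>(a, b, c, d). mat_of_rows_list 2 [[a, b], [c, d]]) ` (K \<times> K \<times> K \<times> K)"
        by (intro image_eqI[of _ _ "(a, b, c, d)"]) auto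
    qed
    then show "finite (carrier (SL2 K))" by (rule finite_subset) (simp add: fin_K)
    show "lower2 ` K \<subseteq> carrier (SL2 K)" "diag2 ` (K - {0}) \<subseteq> carrier (SL2 K)" using lc dc by blast+
    show "lower2 ` K \<subseteq> lower2 ` K" by simp
    show "\<one>\<^bsub>SL2 K\<^esub> \<in> lower2 ` K" "\<one>\<^bsub>SL2 K\<^esub> \<in> diag2 ` (K - {0})"
      unfolding SL2_simps using imageI[OF K_0, of lower2] imageI[of 1 "K - {0}" diag2] K_1 by (simp_all add: l0 d1)
    show cl: "x \<otimes>\<^bsub>SL2 K\<^esub> y \<in> lower2 ` K" if "x \<in> lower2 ` K" "y \<in> lower2 ` K" for x y
      using that by (auto simp: SL2_simps ll K_add)
    show "x \<otimes>\<^bsub>SL2 K\<^esub> y \<in> lower2 ` K" if "x \<in> lower2 ` K" "y \<in> lower2 ` K" for x y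
      using cl[OF that] .
    show "x \<otimes>\<^bsub>SL2 K\<^esub> y \<in> diag2 ` (K - {0})" if "x \<in> diag2 ` (K - {0})" "y \<in> diag2 ` (K - {0})" for x y
      using that by (auto simp: SL2_simps dd K_mult)
    show inv: "\<exists>y\<in>lower2 ` K. y \<otimes>\<^bsub>SL2 K\<^esub> x = \<one>\<^bsub>SL2 K\<^esub>" if x: "x \<in> lower2 ` K" for x
    proof -
      obtain y where y: "y \<in> K" "x = lower2 y" using x by blast
      then have "x \<otimes>\<^bsub>SL2 K\<^esub> x = \<one>\<^bsub>SL2 K\<^esub>" by (simp only: SL2_simps ll l0 dbl)
      then show ?thesis using x by blast
    qed
    show "\<exists>y\<in>lower2 ` K. y \<otimes>\<^bsub>SL2 K\<^esub> x = \<one>\<^bsub>SL2 K\<^esub>" if "x \<in> lower2 ` K" for x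
      using inv[OF that] .
    show "\<exists>y\<in>diag2 ` (K - {0}). y \<otimes>\<^bsub>SL2 K\<^esub> x = \<one>\<^bsub>SL2 K\<^esub>" if x: "x \<in> diag2 ` (K - {0})" for x
    proof -
      obtain l where l: "l \<in> K" "l \<noteq> 0" "x = diag2 l" using x by blast
      then have "diag2 (inverse l) \<otimes>\<^bsub>SL2 K\<^esub> x = \<one>\<^bsub>SL2 K\<^esub>" by (simp add: SL2_simps dd d1)
      moreover have "diag2 (inverse l) \<in> diag2 ` (K - {0})" using l K_inverse by simp
      ultimately show ?thesis by (rule bexI)
    qed
    show "z \<otimes>\<^bsub>SL2 K\<^esub> s = s \<otimes>\<^bsub>SL2 K\<^esub> z" if "z \<in> lower2 ` K" "s \<in> lower2 ` K" for z s
      using that by (auto simp: SL2_simps ll add.commute)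
    have cP: "card (lower2 ` K) = q" using inj_l card_K by (metis card_image inj_on_subset subset_UNIV)
    then show "card (lower2 ` K) = 2 ^ m" "8 \<le> card (lower2 ` K)" using q q_ge by simp_all
    have "card (diag2 ` (K - {0})) = card (K - {0})" using inj_d by (metis card_image inj_on_subset subset_UNIV)
    then show "card (lower2 ` K) = card (diag2 ` (K - {0})) + 1" using cP card_K K_0 fin_K q_ge by simp
    show TP: "\<exists>s'\<in>lower2 ` K. t \<otimes>\<^bsub>SL2 K\<^esub> s = s' \<otimes>\<^bsub>SL2 K\<^esub> t"
      if "t \<in> diag2 ` (K - {0})" "s \<in> lower2 ` K" for t s
      using that by (auto simp: SL2_simps dl K_div K_mult)
    show "\<exists>s'\<in>lower2 ` K. t \<otimes>\<^bsub>SL2 K\<^esub> s = s' \<otimes>\<^bsub>SL2 K\<^esub> t"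
      if "t \<in> diag2 ` (K - {0})" "s \<in> lower2 ` K" for t s
      using TP[OF that] .
    have free: "t = \<one>\<^bsub>SL2 K\<^esub> \<or> s = \<one>\<^bsub>SL2 K\<^esub>"
      if ts: "t \<in> diag2 ` (K - {0})" "s \<in> lower2 ` K" "t * s = s * t" for t s
    proof -
      obtain l x where lx: "l \<in> K" "l \<noteq> 0" "t = diag2 l" "x \<in> K" "s = lower2 x" using ts by blast
      have "inverse l * x = x * l" using ts(3) unfolding lx by (simp add: mat2_simps)
      then have "x * (l * l) = x" using lx(2) by (simp add: field_simps)
      then have "x = 0 \<or> l * l = 1" by simp
      then have "x = 0 \<or> l = 1" using square_eq_1[of l] by blast
      then show ?thesis unfolding SL2_simps lx(3,5) using l0 d1 by blast
    qed
    show "t = \<one>\<^bsub>SL2 K\<^esub> \<or> s = \<one>\<^bsub>SL2 K\<^esub>"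
      if "t \<in> diag2 ` (K - {0})" "s \<in> lower2 ` K" "t \<otimes>\<^bsub>SL2 K\<^esub> s = s \<otimes>\<^bsub>SL2 K\<^esub> t" for t s
      using free that by (simp add: SL2_simps)
    show "t \<otimes>\<^bsub>SL2 K\<^esub> t' = t' \<otimes>\<^bsub>SL2 K\<^esub> t" if "t \<in> diag2 ` (K - {0})" "t' \<in> diag2 ` (K - {0})" for t t'
      using that by (auto simp: SL2_simps dd mult.commute)
    show "s \<otimes>\<^bsub>SL2 K\<^esub> s \<in> lower2 ` K" if "s \<in> lower2 ` K" for s
      using cl[OF that that] .
    show "\<exists>z\<in>lower2 ` K. s' = s \<otimes>\<^bsub>SL2 K\<^esub> z" if s: "s \<in> lower2 ` K" "s' \<in> lower2 ` K" for s s'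
    proof -
      obtain x y where xy: "x \<in> K" "y \<in> K" "s = lower2 x" "s' = lower2 y" using s by blast
      then have "s' = s \<otimes>\<^bsub>SL2 K\<^esub> lower2 (x + y)" by (simp add: SL2_simps ll dbl')
      then show ?thesis using imageI[OF K_add[OF xy(1,2)], of lower2] by (rule bexI)
    qed
    show "flip2 \<in> carrier (SL2 K)"
      unfolding flip2_def by (intro carrier_SL2_I) (auto simp: K_0 K_1)
    show "flip2 \<otimes>\<^bsub>SL2 K\<^esub> flip2 = \<one>\<^bsub>SL2 K\<^esub>" by (simp add: SL2_simps mat2_simps)
    show "flip2 \<otimes>\<^bsub>SL2 K\<^esub> t \<otimes>\<^bsub>SL2 K\<^esub> flip2 \<otimes>\<^bsub>SL2 K\<^esub> t = \<one>\<^bsub>SL2 K\<^esub>" if "t \<in> diag2 ` (K - {0})" for t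
      using that by (auto simp: SL2_simps mat2_simps)
    show "lower2 1 \<in> lower2 ` K" "lower2 1 \<in> lower2 ` K" using K_1 by auto
    show "flip2 \<otimes>\<^bsub>SL2 K\<^esub> lower2 1 = lower2 1 \<otimes>\<^bsub>SL2 K\<^esub> flip2 \<otimes>\<^bsub>SL2 K\<^esub> lower2 1 \<otimes>\<^bsub>SL2 K\<^esub> flip2"
      using dbl[of 1] by (simp add: SL2_simps mat2_simps)
    show "(\<exists>s\<in>lower2 ` K. \<exists>t\<in>diag2 ` (K - {0}). A = s \<otimes>\<^bsub>SL2 K\<^esub> t) \<or>
      (\<exists>s\<in>lower2 ` K. \<exists>t\<in>diag2 ` (K - {0}). \<exists>s'\<in>lower2 ` K. A = s \<otimes>\<^bsub>SL2 K\<^esub> flip2 \<otimes>\<^bsub>SL2 K\<^esub> t \<otimes>\<^bsub>SL2 K\<^esub> s')"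
      if A: "A \<in> carrier (SL2 K)" for A
    proof -
      obtain a b c d where *: "a \<in> K" "b \<in> K" "c \<in> K" "d \<in> K" "A = mat_of_rows_list 2 [[a, b], [c, d]]" "a * d + b * c = 1"
        using A by (rule carrier_SL2_E)
      show ?thesis
      proof (cases "b = 0")
        case True
        then have ad: "a * d = 1" using *(6) by simp
        then have a0: "a \<noteq> 0" by auto
        have "d = inverse a" using ad by (metis inverse_unique)
        then have "A = lower2 (c / a) \<otimes>\<^bsub>SL2 K\<^esub> diag2 a"
          unfolding *(5) SL2_simps using True a0 by (simp add: mat2_simps)
        moreover have "lower2 (c / a) \<in> lower2 ` K" "diag2 a \<in> diag2 ` (K - {0})" using * a0 K_div by simp_all
        ultimately show ?thesis by blast
      next
        case False
        \<comment> \<open>The determinant condition solves for c; the three factors of the big cell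
          can then be read off from a, b and d.\<close>
        have "c = (1 + a * d) / b" using *(6) False dbl' by (simp add: field_simps) (metis add.commute dbl')
        then have "A = lower2 (d / b) \<otimes>\<^bsub>SL2 K\<^esub> flip2 \<otimes>\<^bsub>SL2 K\<^esub> diag2 (inverse b) \<otimes>\<^bsub>SL2 K\<^esub> lower2 (a / b)"
          unfolding *(5) SL2_simps using False by (simp add: mat2_simps field_simps)
        moreover have "lower2 (d / b) \<in> lower2 ` K" "diag2 (inverse b) \<in> diag2 ` (K - {0})" "lower2 (a / b) \<in> lower2 ` K"
          using * False K_inverse K_div by simp_all
        ultimately show ?thesis by blast
      qed
    qed
    show "s = \<one>\<^bsub>SL2 K\<^esub>"
      if "s \<in> lower2 ` K" "s' \<in> lower2 ` K" "t \<in> diag2 ` (K - {0})" "flip2 \<otimes>\<^bsub>SL2 K\<^esub> s \<otimes>\<^bsub>SL2 K\<^esub> flip2 = s' \<otimes>\<^bsub>SL2 K\<^esub> t" for s s' t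
      using that by (auto simp: SL2_simps mat2_simps)
    show "flip2 \<noteq> s \<otimes>\<^bsub>SL2 K\<^esub> t" if "s \<in> lower2 ` K" "t \<in> diag2 ` (K - {0})" for s t
      using that by (auto simp: SL2_simps mat2_simps)
    show "(\<lambda>s. s \<otimes>\<^bsub>SL2 K\<^esub> s) ` lower2 ` K = {\<one>\<^bsub>SL2 K\<^esub>} \<or> (\<lambda>s. s \<otimes>\<^bsub>SL2 K\<^esub> s) ` lower2 ` K = lower2 ` K"
      unfolding sq SL2_simps(2) by simp
    show "card (lower2 ` K) = card (lower2 ` K) * card ((\<lambda>s. s \<otimes>\<^bsub>SL2 K\<^esub> s) ` lower2 ` K)"
      unfolding sq by simp
    show "t = \<one>\<^bsub>SL2 K\<^esub> \<or> s \<in> (\<lambda>s. s \<otimes>\<^bsub>SL2 K\<^esub> s) ` lower2 ` K"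
      if ts: "t \<in> diag2 ` (K - {0})" "s \<in> lower2 ` K" "f \<in> (\<lambda>s. s \<otimes>\<^bsub>SL2 K\<^esub> s) ` lower2 ` K"
        "t \<otimes>\<^bsub>SL2 K\<^esub> s = f \<otimes>\<^bsub>SL2 K\<^esub> (s \<otimes>\<^bsub>SL2 K\<^esub> t)" for t s f
    proof -
      have "f = \<one>\<^bsub>SL2 K\<^esub>" using ts(3) unfolding sq SL2_simps(2) by simp
      moreover have "s \<in> carrier (SL2 K)" "t \<in> carrier (SL2 K)" using ts lc dc by blast+
      ultimately have "t \<otimes>\<^bsub>SL2 K\<^esub> s = s \<otimes>\<^bsub>SL2 K\<^esub> t" using ts(4) by simp
      then show ?thesis using free[OF ts(1,2)] unfolding sq SL2_simps(2) by (simp add: SL2_simps)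
    qed
  qed
qed

end

section \<open>The Suzuki groups\<close>

text \<open>On K the map \<open>\<theta>\<close> is a square root of the Frobenius map. Additivity
  and multiplicativity are assumed on the whole type, where a power of the Frobenius map has
  them.\<close>

locale suzuki_field = char2_field K q for K :: "'a :: field set" and q :: nat +
  fixes \<theta> :: "'a \<Rightarrow> 'a"
  assumes th_add: "\<And>x y. \<theta> (x + y) = \<theta> x + \<theta> y"
    and th_mult: "\<And>x y. \<theta> (x * y) = \<theta> x * \<theta> y"
    and th_in: "\<And>x. x \<in> K \<Longrightarrow> \<theta> x \<in> K"
    and th_th: "\<And>x. x \<in> K \<Longrightarrow> \<theta> (\<theta> x) = x * x"
begin

lemma th_0: "\<theta> 0 = 0"
  by (metis add_0 dbl th_add)

lemma numeral_char2: "numeral (Num.Bit0 m) = (0 :: 'a)" "numeral (Num.Bit1 m) = (1 :: 'a)"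
  by (simp_all only: numeral_Bit0 numeral_Bit1 dbl add_0)

lemmas char2_simps = algebra_simps dbl dbl' numeral_char2

lemma th_eq_0: "x \<in> K \<Longrightarrow> \<theta> x = 0 \<longleftrightarrow> x = 0"
  using th_th[of x] th_0 by auto

lemma th_1: "\<theta> 1 = 1"
  using th_mult[of 1 1] th_eq_0[OF K_1] by simp

lemma th_eq_1: "x \<in> K \<Longrightarrow> \<theta> x = 1 \<longleftrightarrow> x = 1"
  using th_th[of x] th_1 square_eq_1[of x] by auto

lemma th_inverse: "x \<in> K \<Longrightarrow> \<theta> (inverse x) = inverse (\<theta> x)"
proof (cases "x = 0")
  case False
  then have "\<theta> x * \<theta> (inverse x) = 1" using th_mult[of x "inverse x"] th_1 by simp
  then show ?thesis by (simp add: inverse_unique)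
qed (simp add: th_0)

lemma th_divide: "x \<in> K \<Longrightarrow> \<theta> (y / x) = \<theta> y / \<theta> x"
  by (simp add: divide_inverse th_mult th_inverse)

definition sS :: "'a \<Rightarrow> 'a \<Rightarrow> 'a mat"
  where "sS a b = mat_of_rows_list 4
    [[1, 0, 0, 0], [a, 1, 0, 0], [b, \<theta> a, 1, 0], [a * a * \<theta> a + a * b + \<theta> b, a * \<theta> a + b, a, 1]]"

text \<open>The parameter is the second diagonal entry n, with l = \<theta> n for the usual
  parameter l; in this form all entries are expressed by n and \<theta> n.\<close>

definition sD :: "'a \<Rightarrow> 'a mat"
  where "sD n = mat_of_rows_list 4
    [[n * \<theta> n, 0, 0, 0], [0, n, 0, 0], [0, 0, inverse n, 0], [0, 0, 0, inverse (n * \<theta> n)]]"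

definition sW :: "'a mat"
  where "sW = mat_of_rows_list 4 [[0, 0, 0, 1], [0, 0, 1, 0], [0, 1, 0, 0], [1, 0, 0, 0]]"

lemmas mat4_simps = sS_def sD_def sW_def mult_mat_4 one_mat_4 mat_4_eq_iff

lemma sS_eq: "sS a b = sS c d \<longleftrightarrow> a = c \<and> b = d"
  unfolding mat4_simps by auto

lemma SS: "a \<in> K \<Longrightarrow> sS a b * sS c d = sS (a + c) (b + d + \<theta> a * c)"
  unfolding mat4_simps by (simp add: th_add th_mult th_th algebra_simps dbl dbl' two)

lemma DD: "n \<in> K \<Longrightarrow> n' \<in> K \<Longrightarrow> sD n * sD n' = sD (n * n')"
  unfolding mat4_simps by (simp add: th_mult algebra_simps)

lemma sD_eq: "sD n = sD n' \<longleftrightarrow> n = n'"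
  unfolding mat4_simps by auto

lemma S_0: "sS 0 0 = 1\<^sub>m 4" and D_1: "sD 1 = 1\<^sub>m 4"
  unfolding mat4_simps by (simp_all add: th_0 th_1)

lemma DS:
  assumes n: "n \<in> K" "n \<noteq> 0" and a: "a \<in> K"
  shows "sD n * sS a b = sS (a / \<theta> n) (b / (n * n * \<theta> n)) * sD n"
proof -
  have n': "\<theta> n \<noteq> 0" using th_eq_0 n by simp
  have d: "\<theta> (a / \<theta> n) = \<theta> a / (n * n)" "\<theta> (b / (n * n * \<theta> n)) = \<theta> b / (\<theta> n * \<theta> n * (n * n))"
    using n th_in[OF n(1)] by (simp_all add: th_divide th_th th_mult K_mult)
  show ?thesis
    unfolding mat4_simps d using n n' by (simp add: field_simps)
qed

lemma WW: "sW * sW = 1\<^sub>m 4"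
  unfolding mat4_simps by simp

lemma WDWD: "n \<in> K - {0} \<Longrightarrow> sW * sD n * sW * sD n = 1\<^sub>m 4"
  unfolding mat4_simps using th_eq_0[of n] by (simp add: field_simps)

lemma WS1: "sW * sS 1 1 = sS 1 1 * sW * sS 0 1 * sW"
  unfolding mat4_simps by (simp add: th_1 th_0 dbl dbl' two)

text \<open>For a \<noteq> 0 the substitution b = a \<theta>(a) c turns a zero into \<theta>(c) = 1
  + c. Applying \<open>\<theta>\<close> again gives c c = c, but neither 0 nor 1 solves the
  equation.\<close>

lemma f_ne_0:
  assumes ab: "a \<in> K" "b \<in> K" "\<not> (a = 0 \<and> b = 0)"
  shows "a * a * \<theta> a + a * b + \<theta> b \<noteq> 0"
proof
  assume f: "a * a * \<theta> a + a * b + \<theta> b = 0"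
  show False
  proof (cases "a = 0")
    case True
    then show False using f th_0 th_eq_0[OF ab(2)] ab(3) by simp
  next
    case False
    have a': "\<theta> a \<noteq> 0" using th_eq_0 ab False by simp
    define c where "c = b / (a * \<theta> a)"
    have cK: "c \<in> K" unfolding c_def using ab th_in by (intro K_div K_mult) auto
    have b: "b = a * \<theta> a * c" using False a' by (simp add: c_def)
    have "a * a * \<theta> a * (1 + c + \<theta> c) = 0"
      using f unfolding b by (simp add: th_mult th_th[OF ab(1)] algebra_simps)
    then have "1 + c + \<theta> c = 0" using False a' by simp
    then have th: "\<theta> c = 1 + c" by (simp add: add_eq_0)
    have "c * c = 1 + \<theta> c" using th_th[OF cK] th th_add[of 1 c] th_1 by simp
    also have "\<dots> = c" unfolding th by (simp add: dbl')
    finally have "c = 0 \<or> c = 1" by simp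
    then show False using th th_0 th_1 dbl[of 1] by auto
  qed
qed

text \<open>This is the rewriting rule required by \<open>generate_Bruhat\<close>. The lower left
  entry f of \<open>sS a b\<close> occurs in the denominators and is nonzero by
  \<open>f_ne_0\<close>.\<close>

lemma WSW:
  assumes ab: "a \<in> K" "b \<in> K" "\<not> (a = 0 \<and> b = 0)"
  obtains a1 b1 n a2 b2 where "a1 \<in> K" "b1 \<in> K" "n \<in> K - {0}" "a2 \<in> K" "b2 \<in> K"
    "sW * sS a b * sW = sS a1 b1 * sW * sD n * sS a2 b2"
proof -
  \<comment> \<open>Naming the images of a, b and f removes \<open>\<theta>\<close>: on the six
    elements its values are listed in \<open>th\<close>, and polynomial identities in characteristic
    two remain.\<close>
  define A B f F where "A = \<theta> a" and "B = \<theta> b" and "f = a * a * \<theta> a + a * b + \<theta> b" and "F = \<theta> f"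
  have f0: "f \<noteq> 0" unfolding f_def using f_ne_0[OF ab] .
  have K: "A \<in> K" "B \<in> K" "f \<in> K" "F \<in> K"
    unfolding A_def B_def F_def f_def using ab by (auto intro!: K_add K_mult th_in)
  have F0: "F \<noteq> 0" unfolding F_def using th_eq_0 K f0 by simp
  have f: "f = a * a * A + a * b + B" by (simp add: f_def A_def B_def)
  have th: "\<theta> a = A" "\<theta> b = B" "\<theta> f = F" "\<theta> A = a * a" "\<theta> B = b * b" "\<theta> F = f * f"
    by (simp_all add: A_def B_def F_def th_th ab(1,2) K(3))
  have F: "F = A * A * (a * a) + A * B + b * b"
    unfolding th(3)[symmetric] f th_add th_mult th by (simp add: algebra_simps)
  have key: "b * B + a * F = (a * A + b) * f" "(a * A + b) * (A * (a * a) + B) = b * f + a * F"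
    "f * f = B * (A * (a * a) + B) + a * a * F" "F + b * (a * A + b) = A * f"
    unfolding f F by (simp_all add: char2_simps)
  \<comment> \<open>The first row of w S(a, b) w forces n \<theta>(n) = 1 / f, solved by n = f / F,
    then a2 = (a A + b) / f, and b2 from a2 \<theta>(a2) + b2 = a / f. The last column forces a1 = b
    / f and b1 = a / f.\<close>
  define n where "n = f / F"
  define a2 where "a2 = (a * A + b) / f"
  define b2 where "b2 = b / F"
  have invn: "inverse n = F / f" by (simp add: n_def)
  have thn: "\<theta> n = F / (f * f)" unfolding n_def th_divide[OF K(4)] th ..
  have nn: "n * \<theta> n = inverse f" unfolding thn unfolding n_def using f0 F0 by (simp add: field_simps)
  have tha2: "\<theta> a2 = (A * (a * a) + B) / F"
    unfolding a2_def th_divide[OF K(3)] th_add th_mult th ..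
  have tha1: "\<theta> (b / f) = B / F" and thb1: "\<theta> (a / f) = A / F" and thb2: "\<theta> b2 = B / (f * f)"
    unfolding b2_def th_divide[OF K(3)] th_divide[OF K(4)] th by simp_all
  have f1: "b / f * (b / f) * (B / F) + b / f * (a / f) + A / F = 1 / f"
  proof -
    have "b * b * B + b * a * F + A * (f * f) = f * F"
      unfolding f F by (simp add: char2_simps)
    then have "(b * b * B + b * a * F + A * (f * f)) / (f * f * F) = (f * F) / (f * f * F)" by simp
    then show ?thesis using f0 F0 by (simp add: field_simps)
  qed
  have a2b2: "a2 * \<theta> a2 + b2 = a / f"
  proof -
    have "a2 * \<theta> a2 + b2 = ((a * A + b) * (A * (a * a) + B)) / (f * F) + b * f / (f * F)"
      unfolding tha2 unfolding a2_def b2_def using f0 F0 by (simp add: field_simps)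
    also have "\<dots> = (a * F) / (f * F)" unfolding key(2) add_divide_distrib[symmetric] by (simp add: char2_simps)
    finally show ?thesis using F0 by simp
  qed
  have f2: "a2 * a2 * \<theta> a2 + a2 * b2 + \<theta> b2 = 1 / f"
  proof -
    have "a2 * a2 * \<theta> a2 + a2 * b2 + \<theta> b2 = a2 * (a2 * \<theta> a2 + b2) + \<theta> b2" by (simp add: algebra_simps)
    also have "\<dots> = (a * A + b) * a / (f * f) + B / (f * f)" unfolding a2b2 thb2 unfolding a2_def by simp
    also have "\<dots> = f / (f * f)" unfolding add_divide_distrib[symmetric] unfolding f by (simp add: algebra_simps)
    finally show ?thesis using f0 by simp
  qed
  have L: "sW * sS a b * sW = mat_of_rows_list 4
      [[1, a, a * A + b, f], [0, 1, A, b], [0, 0, 1, a], [0, 0, 0, 1]]"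
    unfolding mat4_simps by (simp add: A_def f_def)
  have R1: "sS (b / f) (a / f) * sW = mat_of_rows_list 4
      [[0, 0, 0, 1], [0, 0, 1, b / f], [0, 1, B / F, a / f], [1, b / f, b / f * (B / F) + a / f, 1 / f]]"
    unfolding mat4_simps tha1 thb1 f1 by simp
  have R2: "sD n * sS a2 b2 = mat_of_rows_list 4
      [[1 / f, 0, 0, 0], [(a * A + b) / F, f / F, 0, 0], [b / f, (A * (a * a) + B) / f, F / f, 0],
       [1, a, a * A + b, f]]"
    unfolding mat4_simps nn f2 a2b2 unfolding tha2 invn using f0 F0 by (simp add: n_def a2_def b2_def inverse_eq_divide)
  have n0: "n \<noteq> 0" using f0 F0 by (simp add: n_def)
  have r4: "b / f * (B / F) + a / f = (a * A + b) / F"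
  proof -
    have "b / f * (B / F) + a / f = (b * B + a * F) / (f * F)" using F0 by (simp add: add_divide_distrib)
    then show ?thesis unfolding key(1) using f0 by simp
  qed
  have e22: "(A * (a * a) + B) / f + b / f * a = 1"
    unfolding times_divide_eq_left add_divide_distrib[symmetric] using f0 f by (simp add: algebra_simps)
  have e23: "F / f + b / f * (a * A + b) = A"
    unfolding times_divide_eq_left add_divide_distrib[symmetric] key(4) using f0 by simp
  have e31: "(a * A + b) / F + B / F * (b / f) + a / f = 0"
    using r4 by (simp add: add.assoc mult.commute dbl)
  have e32: "f / F + B / F * ((A * (a * a) + B) / f) + a / f * a = 0"
  proof -
    have "f / F + B / F * ((A * (a * a) + B) / f) + a / f * a
        = (f * f + (B * (A * (a * a) + B) + a * a * F)) / (f * F)"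
      using f0 F0 by (simp add: field_simps)
    then show ?thesis unfolding key(3)[symmetric] dbl by simp
  qed
  have e33: "B / F * (F / f) + a / f * (a * A + b) = 1"
  proof -
    have "B / F * (F / f) + a / f * (a * A + b) = (B + a * (a * A + b)) / f"
      using F0 by (simp add: add_divide_distrib)
    then show ?thesis using f0 f by (simp add: algebra_simps)
  qed
  have e42: "b / f * (f / F) + (a * A + b) / F * ((A * (a * a) + B) / f) + 1 / f * a = 0"
  proof -
    have "b / f * (f / F) + (a * A + b) / F * ((A * (a * a) + B) / f) + 1 / f * a
        = (b * f + (a * A + b) * (A * (a * a) + B) + a * F) / (f * F)"
      using f0 F0 by (simp add: field_simps)
    then show ?thesis unfolding key(2) by (simp add: char2_simps)
  qed
  \<comment> \<open>The first row and the last column agree by the choice of the parameters; the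
    facts \<open>e22\<close> to \<open>e42\<close> are other entries, named by position.\<close>
  have e: "sS (b / f) (a / f) * sW * (sD n * sS a2 b2) = sW * sS a b * sW"
    unfolding L R1 R2 r4 mult_mat_4 mat_4_eq_iff
    using e22 e23 e31 e32 e33 e42 f0 F0 by (simp add: dbl dbl' ac_simps)
  have c4: "sS x y \<in> carrier_mat 4 4" "sW \<in> carrier_mat 4 4" "sD x \<in> carrier_mat 4 4" for x y
    by (simp_all add: sS_def sW_def sD_def carrier_mat_4)
  have "sS (b / f) (a / f) * sW * sD n * sS a2 b2 = sS (b / f) (a / f) * sW * (sD n * sS a2 b2)"
    by (rule assoc_mult_mat[OF mult_carrier_mat[OF c4(1,2)] c4(3,1)])
  moreover have "b / f \<in> K" "a / f \<in> K" "n \<in> K - {0}" "a2 \<in> K"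
    using ab K n0 by (auto simp: n_def a2_def intro!: K_div K_add K_mult)
  moreover have "b2 \<in> K" unfolding b2_def using ab K by (intro K_div)
  ultimately show ?thesis using that e by metis
qed

lemma carrier_mat_s: "sS x y \<in> carrier_mat 4 4" "sW \<in> carrier_mat 4 4" "sD x \<in> carrier_mat 4 4"
  by (simp_all add: sS_def sW_def sD_def carrier_mat_4)

definition PS :: "'a mat set" where "PS = {sS a b | a b. a \<in> K \<and> b \<in> K}"
definition ZS :: "'a mat set" where "ZS = sS 0 ` K"
definition TS :: "'a mat set" where "TS = sD ` (K - {0})"
definition GS :: "'a mat monoid" where "GS = subgroup_generated (GL 4) (PS \<union> TS \<union> {sW})"

lemma PS_I: "a \<in> K \<Longrightarrow> b \<in> K \<Longrightarrow> sS a b \<in> PS"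
  unfolding PS_def by blast

lemma PS_E:
  assumes "s \<in> PS"
  obtains a b where "a \<in> K" "b \<in> K" "s = sS a b"
  using assms unfolding PS_def by blast

lemma TS_E:
  assumes "t \<in> TS"
  obtains n where "n \<in> K" "n \<noteq> 0" "t = sD n"
  using assms unfolding TS_def by blast

lemma ZS_E:
  assumes "z \<in> ZS"
  obtains b where "b \<in> K" "z = sS 0 b"
  using assms unfolding ZS_def by blast

lemma TS_I: "n \<in> K \<Longrightarrow> n \<noteq> 0 \<Longrightarrow> sD n \<in> TS"
  unfolding TS_def by blast

lemma ZS_I: "b \<in> K \<Longrightarrow> sS 0 b \<in> ZS"
  unfolding ZS_def by blast

lemma S_inverse: "a \<in> K \<Longrightarrow> sS a (b + a * \<theta> a) * sS a b = 1\<^sub>m 4"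
  unfolding SS S_0[symmetric] sS_eq by (simp add: char2_simps)

lemma S_inverse': "a \<in> K \<Longrightarrow> sS a b * sS a (b + a * \<theta> a) = 1\<^sub>m 4"
  unfolding SS S_0[symmetric] sS_eq by (simp add: char2_simps)

lemma D_inverse: "n \<in> K \<Longrightarrow> n \<noteq> 0 \<Longrightarrow> sD (inverse n) * sD n = 1\<^sub>m 4" "n \<in> K \<Longrightarrow> n \<noteq> 0 \<Longrightarrow> sD n * sD (inverse n) = 1\<^sub>m 4"
  by (simp_all add: DD K_inverse D_1)

lemma gens_GL: "PS \<union> TS \<union> {sW} \<subseteq> carrier (GL 4)"
proof -
  have "sS a b \<in> carrier (GL 4)" if "a \<in> K" for a b
    by (rule carrier_GL_I[OF carrier_mat_s(1) carrier_mat_s(1) S_inverse'[OF that] S_inverse[OF that]])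
  moreover have "sD n \<in> carrier (GL 4)" if "n \<in> K" "n \<noteq> 0" for n
    by (rule carrier_GL_I[OF carrier_mat_s(3) carrier_mat_s(3) D_inverse(2)[OF that] D_inverse(1)[OF that]])
  moreover have "sW \<in> carrier (GL 4)"
    by (rule carrier_GL_I[OF carrier_mat_s(2) carrier_mat_s(2) WW WW])
  ultimately show ?thesis unfolding PS_def TS_def by blast
qed

lemma carrier_GS: "carrier GS = generate (GL 4) (PS \<union> TS \<union> {sW})"
  using gens_GL by (simp add: GS_def carrier_subgroup_generated Int_absorb1)

lemma GS_simps: "A \<otimes>\<^bsub>GS\<^esub> B = A * B" "\<one>\<^bsub>GS\<^esub> = 1\<^sub>m 4"
  by (simp_all add: GS_def subgroup_generated_def GL_simps)

lemma group_GS: "group GS"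
  unfolding GS_def by (rule group.group_subgroup_generated[OF group_GL])

lemma gens_GS: "PS \<union> TS \<union> {sW} \<subseteq> carrier GS"
  unfolding carrier_GS by (rule subsetI) (rule generate.incl)

lemma PS_mult: "s \<in> PS \<Longrightarrow> s' \<in> PS \<Longrightarrow> s * s' \<in> PS"
  by (elim PS_E) (auto simp only: SS intro!: PS_I K_add K_mult th_in)

lemma TS_mult: "s \<in> TS \<Longrightarrow> s' \<in> TS \<Longrightarrow> s * s' \<in> TS"
  by (elim TS_E) (simp add: DD TS_I K_mult)

lemma ZS_mult: "s \<in> ZS \<Longrightarrow> s' \<in> ZS \<Longrightarrow> s * s' \<in> ZS"
  by (elim ZS_E) (simp add: SS K_0 th_0 ZS_I K_add)

lemma PS_inverse: "s \<in> PS \<Longrightarrow> \<exists>y\<in>PS. y * s = 1\<^sub>m 4"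
proof (elim PS_E)
  fix a b assume *: "a \<in> K" "b \<in> K" "s = sS a b"
  have "sS a (b + a * \<theta> a) \<in> PS" using * by (intro PS_I K_add K_mult th_in)
  then show ?thesis using S_inverse[OF *(1)] * by blast
qed

lemma TS_inverse: "s \<in> TS \<Longrightarrow> \<exists>y\<in>TS. y * s = 1\<^sub>m 4"
proof (elim TS_E)
  fix n assume *: "n \<in> K" "n \<noteq> 0" "s = sD n"
  have "sD (inverse n) \<in> TS" using * by (intro TS_I K_inverse) auto
  then show ?thesis using D_inverse(1)[OF *(1,2)] * by blast
qed

lemma DS_PS:
  assumes "t \<in> TS" "s \<in> PS"
  shows "\<exists>s'\<in>PS. t * s = s' * t"
proof -
  obtain n where n: "n \<in> K" "n \<noteq> 0" "t = sD n" using assms(1) by (rule TS_E)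
  obtain a b where ab: "a \<in> K" "b \<in> K" "s = sS a b" using assms(2) by (rule PS_E)
  have "sS (a / \<theta> n) (b / (n * n * \<theta> n)) \<in> PS" using n ab by (intro PS_I K_div K_mult th_in)
  then show ?thesis using DS[OF n(1,2) ab(1)] n ab by blast
qed

lemma DS_ZS:
  assumes "t \<in> TS" "s \<in> ZS"
  shows "\<exists>s'\<in>ZS. t * s = s' * t"
proof -
  obtain n where n: "n \<in> K" "n \<noteq> 0" "t = sD n" using assms(1) by (rule TS_E)
  obtain b where b: "b \<in> K" "s = sS 0 b" using assms(2) by (rule ZS_E)
  have "sS 0 (b / (n * n * \<theta> n)) \<in> ZS" using n b by (intro ZS_I K_div K_mult th_in)
  then show ?thesis using DS[OF n(1,2) K_0, of b] n b by auto
qed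

lemma GS_Bruhat:
  assumes g: "g \<in> carrier GS"
  shows "(\<exists>s\<in>PS. \<exists>t\<in>TS. g = s * t) \<or> (\<exists>s\<in>PS. \<exists>t\<in>TS. \<exists>s'\<in>PS. g = s * sW * t * s')"
proof -
  interpret GL: group "GL 4 :: 'a mat monoid" by (rule group_GL)
  have sub: "subgroup A (GL 4)" if A: "A \<subseteq> carrier (GL 4)" "A \<noteq> {}" "\<And>x y. x \<in> A \<Longrightarrow> y \<in> A \<Longrightarrow> x * y \<in> A"
    "\<And>x. x \<in> A \<Longrightarrow> \<exists>y\<in>A. y * x = 1\<^sub>m 4" for A :: "'a mat set"
  proof (rule GL.subgroupI)
    fix x assume x: "x \<in> A"
    obtain y where y: "y \<in> A" "y * x = 1\<^sub>m 4" using A(4)[OF x] by blast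
    then have "inv\<^bsub>GL 4\<^esub> x = y" using x A(1) by (intro GL.inv_equality) (auto simp: GL_simps)
    then show "inv\<^bsub>GL 4\<^esub> x \<in> A" using y by simp
  qed (use A in \<open>auto simp: GL_simps\<close>)
  have P: "subgroup PS (GL 4)"
    using gens_GL PS_I[OF K_0 K_0] by (intro sub PS_mult PS_inverse) auto
  have T: "subgroup TS (GL 4)"
    using gens_GL TS_I[OF K_1] by (intro sub TS_mult TS_inverse) auto
  show ?thesis
  proof (rule GL.generate_Bruhat[OF P T, of sW "PS \<union> TS \<union> {sW}" g, unfolded GL_simps])
    show "sW \<in> carrier (GL 4)" using gens_GL by blast
    show "sW * sW = 1\<^sub>m 4" by (rule WW)
    show "sW * t * sW \<in> TS" if "t \<in> TS" for t
    proof -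
      obtain n where n: "n \<in> K" "n \<noteq> 0" "t = sD n" using \<open>t \<in> TS\<close> by (rule TS_E)
      have "sW * sD n * sW = sD (inverse n)"
        unfolding mat4_simps th_inverse[OF n(1)] by simp
      then show ?thesis using n K_inverse by (simp add: TS_I)
    qed
    show "\<exists>s'\<in>PS. t * s = s' * t" if "t \<in> TS" "s \<in> PS" for t s using DS_PS[OF that] .
    show "\<exists>s1\<in>PS. \<exists>t\<in>TS. \<exists>s2\<in>PS. sW * s * sW = s1 * sW * t * s2" if s: "s \<in> PS" "s \<noteq> 1\<^sub>m 4" for s
    proof -
      obtain a b where ab: "a \<in> K" "b \<in> K" "s = sS a b" using s(1) by (rule PS_E)
      have "\<not> (a = 0 \<and> b = 0)" using s(2) ab S_0 by auto
      from WSW[OF ab(1,2) this] obtain a1 b1 n a2 b2 where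
        "a1 \<in> K" "b1 \<in> K" "n \<in> K - {0}" "a2 \<in> K" "b2 \<in> K" "sW * sS a b * sW = sS a1 b1 * sW * sD n * sS a2 b2" .
      then show ?thesis unfolding ab(3) using PS_I TS_I by blast
    qed
    show "PS \<union> TS \<union> {sW} \<subseteq> PS \<union> TS \<union> {sW}" by simp
    show "g \<in> generate (GL 4) (PS \<union> TS \<union> {sW})" using g by (simp only: carrier_GS)
  qed
qed

text \<open>For c = \<theta>(x) x one has \<theta>(c) = x c, which recovers x unless c = 0, and then
  x = 0. Since \<open>sS x y\<close> has square \<open>sS 0 c\<close>, this determines the squares
  in \<open>PS\<close> and the fibres of squaring.\<close>

lemma sq_map: "inj_on (\<lambda>a. \<theta> a * a) K"
proof (rule inj_onI)
  fix x y assume *: "x \<in> K" "y \<in> K" "\<theta> x * x = \<theta> y * y"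
  have th: "\<theta> (\<theta> z * z) = z * (\<theta> z * z)" if "z \<in> K" for z using that by (simp add: th_mult th_th ac_simps)
  have "x * (\<theta> x * x) = \<theta> (\<theta> x * x)" by (rule th[OF *(1), symmetric])
  also have "\<dots> = y * (\<theta> y * y)" unfolding *(3) by (rule th[OF *(2)])
  finally have "x * (\<theta> x * x) = y * (\<theta> x * x)" by (simp only: *(3))
  then consider "x = y" | "\<theta> x * x = 0" by (metis mult_cancel_right)
  then show "x = y"
  proof cases
    case 2
    then have "\<theta> y * y = 0" using *(3) by simp
    then show ?thesis using 2 th_eq_0[OF *(1)] th_eq_0[OF *(2)] by auto
  qed
qed

lemma card_PS: "card PS = q * q"
proof -
  have "PS = (\<lambda>(a, b). sS a b) ` (K \<times> K)" unfolding PS_def by auto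
  moreover have "inj_on (\<lambda>(a, b). sS a b) (K \<times> K)" by (auto simp: inj_on_def sS_eq)
  ultimately show ?thesis using card_K by (simp add: card_image card_cartesian_product)
qed

lemma card_ZS: "card ZS = q"
  unfolding ZS_def using card_K by (subst card_image) (auto simp: inj_on_def sS_eq)

lemma card_TS: "card TS = q - 1"
  unfolding TS_def using card_K K_0 fin_K by (subst card_image) (auto simp: inj_on_def sD_eq)

lemma squares_PS: "(\<lambda>s. s * s) ` PS = ZS"
proof -
  have eq: "sS a b * sS a b = sS 0 (\<theta> a * a)" if "a \<in> K" for a b
    unfolding SS[OF that] sS_eq by (simp add: dbl)
  have "(\<lambda>a. \<theta> a * a) ` K \<subseteq> K" using K_mult th_in by auto
  then have surj: "(\<lambda>a. \<theta> a * a) ` K = K"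
    using card_image[OF sq_map] fin_K by (intro card_subset_eq) auto
  show ?thesis
  proof (rule equalityI; rule subsetI)
    fix x assume "x \<in> (\<lambda>s. s * s) ` PS"
    then obtain s where "s \<in> PS" "x = s * s" by blast
    then obtain a b where "a \<in> K" "x = sS a b * sS a b" by (metis PS_E)
    then show "x \<in> ZS" using eq[of a b] ZS_I K_mult th_in by simp
  next
    fix x assume "x \<in> ZS"
    then obtain c where c: "c \<in> K" "x = sS 0 c" by (rule ZS_E)
    then obtain a where a: "a \<in> K" "c = \<theta> a * a" using surj by blast
    then show "x \<in> (\<lambda>s. s * s) ` PS" using eq[OF a(1), of 0] PS_I[OF a(1) K_0] c by (metis image_eqI)
  qed
qed

text \<open>Both sides become some \<open>sS\<close> times \<open>sD n\<close>, so the torus factor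
  cancels and parameters can be compared. The case d = 0 describes commuting with the torus, general
  d commuting modulo squares.\<close>

lemma lower_T:
  assumes "n \<in> K" "n \<noteq> 0" "a \<in> K" "sD n * sS a b = sS c d * (sS a b * sD n)" "c = 0"
  shows "a / \<theta> n = a" "d = 0 \<Longrightarrow> b / (n * n * \<theta> n) = b"
proof -
  have "sD n * sS a b = (sS c d * sS a b) * sD n"
    using assms(4) assoc_mult_mat[OF carrier_mat_s(1) carrier_mat_s(1) carrier_mat_s(3)] by simp
  then have "sS (a / \<theta> n) (b / (n * n * \<theta> n)) * sD n = sS a (b + d) * sD n"
    using DS[OF assms(1-3)] assms(5) SS[OF K_0, of d a b] by (simp add: th_0 add.commute)
  then have "(sS (a / \<theta> n) (b / (n * n * \<theta> n)) * sD n) * sD (inverse n) = (sS a (b + d) * sD n) * sD (inverse n)" by simp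
  then have "sS (a / \<theta> n) (b / (n * n * \<theta> n)) * (sD n * sD (inverse n)) = sS a (b + d) * (sD n * sD (inverse n))"
    using assoc_mult_mat[OF carrier_mat_s(1) carrier_mat_s(3) carrier_mat_s(3)] by simp
  then have "sS (a / \<theta> n) (b / (n * n * \<theta> n)) = sS a (b + d)"
    unfolding D_inverse(2)[OF assms(1,2)] using right_mult_one_mat[OF carrier_mat_s(1)] by simp
  then show "a / \<theta> n = a" "d = 0 \<Longrightarrow> b / (n * n * \<theta> n) = b" unfolding sS_eq by simp_all
qed

lemma scale_cases:
  assumes "n \<in> K" "n \<noteq> 0" "a \<in> K" "a / \<theta> n = a"
  shows "n = 1 \<or> a = 0"
  using assms th_eq_0[OF assms(1)] th_eq_1[OF assms(1)] by (auto simp: field_simps)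

text \<open>For b \<noteq> 0 the scaling factor n n \<theta>(n) is 1. Applying
  \<open>\<theta>\<close> multiplies this factor by \<theta>(n), so \<theta>(n) = 1.\<close>

lemma scale_cases':
  assumes n: "n \<in> K" "n \<noteq> 0" and b: "b / (n * n * \<theta> n) = b"
  shows "n = 1 \<or> b = 0"
proof (cases "b = 0")
  case False
  have tn: "\<theta> n \<noteq> 0" using n th_eq_0 by simp
  have e: "n * n * \<theta> n = 1" using b False n tn by (simp add: field_simps)
  then have "\<theta> (n * n * \<theta> n) = 1" using th_1 by simp
  then have "\<theta> n * (n * n * \<theta> n) = 1" using th_th[OF n(1)] by (simp add: th_mult ac_simps)
  then have "\<theta> n = 1" unfolding e by simp
  then show ?thesis using th_eq_1[OF n(1)] by simp
qed simp

text \<open>The exponent is doubled because \<open>PS\<close> has q q elements. All of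
  \<open>ZS\<close> consists of squares, so freeness modulo squares concerns only the first
  parameter of \<open>sS\<close>.\<close>

theorem zassenhaus_GS:
  assumes q: "q = 2 ^ m"
  shows "zassenhaus_type GS PS ZS TS sW (sS 1 1) (sS 0 1) (2 * m)"
proof -
  interpret G: group GS by (rule group_GS)
  show ?thesis
  proof (rule G.zassenhaus_typeI; (unfold GS_simps)?)
    show "finite (carrier GS)"
    proof (rule finite_subset)
      have fP: "finite PS" using card_PS q_ge by (intro card_ge_0_finite) simp
      have fT: "finite TS" unfolding TS_def using fin_K by simp
      show "finite ((\<lambda>(s, t). s * t) ` (PS \<times> TS) \<union> (\<lambda>(s, t, s'). s * sW * t * s') ` (PS \<times> TS \<times> PS))"
        using fP fT by simp
      show "carrier GS \<subseteq> (\<lambda>(s, t). s * t) ` (PS \<times> TS) \<union> (\<lambda>(s, t, s'). s * sW * t * s') ` (PS \<times> TS \<times> PS)"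
      proof
        fix g assume "g \<in> carrier GS"
        from GS_Bruhat[OF this]
        show "g \<in> (\<lambda>(s, t). s * t) ` (PS \<times> TS) \<union> (\<lambda>(s, t, s'). s * sW * t * s') ` (PS \<times> TS \<times> PS)"
        proof
          assume "\<exists>s\<in>PS. \<exists>t\<in>TS. g = s * t"
          then obtain s t where "s \<in> PS" "t \<in> TS" "g = s * t" by blast
          then have "(s, t) \<in> PS \<times> TS" "g = (\<lambda>(s, t). s * t) (s, t)" by simp_all
          then show ?thesis by (intro UnI1 image_eqI)
        next
          assume "\<exists>s\<in>PS. \<exists>t\<in>TS. \<exists>s'\<in>PS. g = s * sW * t * s'"
          then obtain s t s' where "s \<in> PS" "t \<in> TS" "s' \<in> PS" "g = s * sW * t * s'" by blast
          then have "(s, t, s') \<in> PS \<times> TS \<times> PS" "g = (\<lambda>(s, t, s'). s * sW * t * s') (s, t, s')" by simp_all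
          then show ?thesis by (intro UnI2 image_eqI)
        qed
      qed
    qed
    show "PS \<subseteq> carrier GS" "TS \<subseteq> carrier GS" "sW \<in> carrier GS"
      using gens_GS by (simp_all only: Un_subset_iff insert_subset)
    show ZP: "ZS \<subseteq> PS" by (rule subsetI, elim ZS_E) (simp only: PS_I K_0)
    show "1\<^sub>m 4 \<in> ZS" "1\<^sub>m 4 \<in> TS" using ZS_I[OF K_0] TS_I[OF K_1] S_0 D_1 by simp_all
    show "\<exists>y\<in>ZS. y * x = 1\<^sub>m 4" if "x \<in> ZS" for x
    proof -
      obtain b where b: "b \<in> K" "x = sS 0 b" using \<open>x \<in> ZS\<close> by (rule ZS_E)
      then show ?thesis using S_inverse[OF K_0, of b] ZS_I[OF b(1)] by (intro bexI[of _ x]) simp_all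
    qed
    show "z * s = s * z" if "z \<in> ZS" "s \<in> PS" for z s
      using that by (elim ZS_E PS_E) (simp add: SS K_0 th_0 add.commute)
    show "card PS = 2 ^ (2 * m)" using card_PS q by (simp add: power_add mult_2)
    show "card ZS = card TS + 1" "8 \<le> card ZS" using card_ZS card_TS q_ge by simp_all
    show "t = 1\<^sub>m 4 \<or> s = 1\<^sub>m 4" if ts: "t \<in> TS" "s \<in> PS" "t * s = s * t" for t s
    proof -
      obtain n where n: "n \<in> K" "n \<noteq> 0" "t = sD n" using ts(1) by (rule TS_E)
      obtain a b where ab: "a \<in> K" "b \<in> K" "s = sS a b" using ts(2) by (rule PS_E)
      have "sS a b * sD n \<in> carrier_mat 4 4" by (rule mult_carrier_mat[OF carrier_mat_s(1,3)])
      then have "sD n * sS a b = sS 0 0 * (sS a b * sD n)"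
        unfolding S_0 using ts(3) n(3) ab(3) by (subst left_mult_one_mat) simp_all
      note l = lower_T[OF n(1,2) ab(1) this refl]
      have "n = 1 \<or> a = 0" "n = 1 \<or> b = 0"
        using scale_cases[OF n(1,2) ab(1) l(1)] scale_cases'[OF n(1,2) l(2)[OF refl]] by auto
      then show ?thesis using n(3) ab(3) S_0 D_1 by (cases "n = 1") simp_all
    qed
    show "t * t' = t' * t" if "t \<in> TS" "t' \<in> TS" for t t'
      using that by (elim TS_E) (simp add: DD mult.commute)
    show "s * s \<in> ZS" if "s \<in> PS" for s using imageI[OF that, of "\<lambda>s. s * s"] by (simp only: squares_PS)
    show "\<exists>z\<in>ZS. s' = s * z" if s: "s \<in> PS" "s' \<in> PS" "s * s = s' * s'" for s s'
    proof -
      obtain a b where ab: "a \<in> K" "b \<in> K" "s = sS a b" using s(1) by (rule PS_E)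
      obtain c d where cd: "c \<in> K" "d \<in> K" "s' = sS c d" using s(2) by (rule PS_E)
      have "\<theta> a * a = \<theta> c * c" using s(3) ab cd by (simp add: SS sS_eq dbl two)
      then have "a = c" using sq_map ab cd by (auto dest: inj_onD)
      then have "s' = s * sS 0 (b + d)" using ab cd by (simp add: SS dbl')
      then show ?thesis using ZS_I[OF K_add[OF ab(2) cd(2)]] by blast
    qed
    show "sW * t * sW * t = 1\<^sub>m 4" if "t \<in> TS" for t using that WDWD by (elim TS_E) simp
    show "sS 1 1 \<in> PS" "sS 0 1 \<in> ZS" using PS_I ZS_I K_1 by auto
    show "s = 1\<^sub>m 4" if s: "s \<in> PS" "s' \<in> PS" "t \<in> TS" "sW * s * sW = s' * t" for s s' t
    proof -
      obtain a b where ab: "a \<in> K" "b \<in> K" "s = sS a b" using s(1) by (rule PS_E)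
      obtain c d where cd: "c \<in> K" "d \<in> K" "s' = sS c d" using s(2) by (rule PS_E)
      obtain n where n: "n \<in> K" "n \<noteq> 0" "t = sD n" using s(3) by (rule TS_E)
      have "a = 0 \<and> b = 0" using s(4) unfolding ab cd n mat4_simps by (auto simp: th_0)
      then show ?thesis using ab S_0 by simp
    qed
    show "sW \<noteq> s * t" if s: "s \<in> PS" "t \<in> TS" for s t
    proof
      obtain c d where cd: "c \<in> K" "d \<in> K" "s = sS c d" using s(1) by (rule PS_E)
      obtain n where n: "n \<in> K" "n \<noteq> 0" "t = sD n" using s(2) by (rule TS_E)
      assume "sW = s * t"
      then show False unfolding cd n mat4_simps by auto
    qed
    show "(\<lambda>s. s * s) ` PS = {1\<^sub>m 4} \<or> (\<lambda>s. s * s) ` PS = ZS" using squares_PS by (rule disjI2)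
    show "card PS = card ZS * card ((\<lambda>s. s * s) ` PS)" unfolding squares_PS card_PS card_ZS ..
    show "t = 1\<^sub>m 4 \<or> s \<in> (\<lambda>s. s * s) ` PS"
      if ts: "t \<in> TS" "s \<in> PS" "f \<in> (\<lambda>s. s * s) ` PS" "t * s = f * (s * t)" for t s f
    proof -
      obtain n where n: "n \<in> K" "n \<noteq> 0" "t = sD n" using ts(1) by (rule TS_E)
      obtain a b where ab: "a \<in> K" "b \<in> K" "s = sS a b" using ts(2) by (rule PS_E)
      obtain d where d: "d \<in> K" "f = sS 0 d" using ts(3) unfolding squares_PS by (rule ZS_E)
      have "sD n * sS a b = sS 0 d * (sS a b * sD n)" using ts(4) n ab d by simp
      then have "a / \<theta> n = a" using lower_T(1)[OF n(1,2) ab(1)] by blast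
      then have "n = 1 \<or> a = 0" by (rule scale_cases[OF n(1,2) ab(1)])
      then show ?thesis
      proof
        assume "n = 1" then show ?thesis using n(3) D_1 by simp
      next
        assume "a = 0" then show ?thesis unfolding squares_PS using ab(3) ZS_I[OF ab(2)] by simp
      qed
    qed
    show "x * y \<in> PS" if "x \<in> PS" "y \<in> PS" for x y using that by (rule PS_mult)
    show "x * y \<in> ZS" if "x \<in> ZS" "y \<in> ZS" for x y using that by (rule ZS_mult)
    show "x * y \<in> TS" if "x \<in> TS" "y \<in> TS" for x y using that by (rule TS_mult)
    show "\<exists>y\<in>PS. y * x = 1\<^sub>m 4" if "x \<in> PS" for x using that by (rule PS_inverse)
    show "\<exists>y\<in>TS. y * x = 1\<^sub>m 4" if "x \<in> TS" for x using that by (rule TS_inverse)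
    show "\<exists>s'\<in>PS. t * s = s' * t" if "t \<in> TS" "s \<in> PS" for t s using that by (rule DS_PS)
    show "\<exists>s'\<in>ZS. t * s = s' * t" if "t \<in> TS" "s \<in> ZS" for t s using that by (rule DS_ZS)
    show "sW * sW = 1\<^sub>m 4" by (rule WW)
    show "sW * sS 1 1 = sS 1 1 * sW * sS 0 1 * sW" by (rule WS1)
    show "(\<exists>s\<in>PS. \<exists>t\<in>TS. g = s * t) \<or> (\<exists>s\<in>PS. \<exists>t\<in>TS. \<exists>s'\<in>PS. g = s * sW * t * s')"
      if "g \<in> carrier GS" for g using that by (rule GS_Bruhat)
  qed
qed

end

section \<open>Very simple modules\<close>

lemma Q_module_simps:
  "carrier (Q_module B) = {h \<in> B \<rightarrow>\<^sub>E UNIV. (\<Sum>b\<in>B. h b) = 0}"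
  "x \<oplus>\<^bsub>Q_module B\<^esub> y = (\<lambda>b\<in>B. x b + y b)"
  "\<zero>\<^bsub>Q_module B\<^esub> = (\<lambda>b\<in>B. 0)"
  "a \<odot>\<^bsub>Q_module B\<^esub> x = (\<lambda>b\<in>B. a * x b)"
  by (simp_all add: Q_module_def)

lemma F2_simps:
  "carrier (F2) = UNIV" "x \<oplus>\<^bsub>F2\<^esub> y = x + y" "x \<otimes>\<^bsub>F2\<^esub> y = x * y" "\<one>\<^bsub>F2\<^esub> = 1" "\<zero>\<^bsub>F2\<^esub> = 0"
  by (simp_all add: ring_of_type_algebra_def)

lemma End_algebra_simps:
  "f \<otimes>\<^bsub>End_algebra F M\<^esub> g = compose (carrier M) f g"
  "\<one>\<^bsub>End_algebra F M\<^esub> = (\<lambda>x\<in>carrier M. x)"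
  "f \<oplus>\<^bsub>End_algebra F M\<^esub> g = (\<lambda>x\<in>carrier M. f x \<oplus>\<^bsub>M\<^esub> g x)"
  "a \<odot>\<^bsub>End_algebra F M\<^esub> f = (\<lambda>x\<in>carrier M. a \<odot>\<^bsub>M\<^esub> f x)"
  by (simp_all add: End_algebra_def)

lemma Q_memD:
  assumes "h \<in> carrier (Q_module B)"
  shows "h \<in> extensional B" "sum h B = 0"
  using assms by (auto simp: Q_module_simps PiE_def)

lemma Q_memI: "h \<in> extensional B \<Longrightarrow> sum h B = 0 \<Longrightarrow> h \<in> carrier (Q_module B)"
  by (auto simp: Q_module_simps PiE_def)

lemma Q_eqI:
  assumes "x \<in> carrier (Q_module B)" "y \<in> carrier (Q_module B)" "\<And>b. b \<in> B \<Longrightarrow> x b = y b"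
  shows "x = y"
  using extensionalityI[OF Q_memD(1)[OF assms(1)] Q_memD(1)[OF assms(2)] assms(3)] .

lemma Q_add_closed:
  assumes "x \<in> carrier (Q_module B)" "y \<in> carrier (Q_module B)"
  shows "x \<oplus>\<^bsub>Q_module B\<^esub> y \<in> carrier (Q_module B)"
proof (rule Q_memI)
  have "sum (x \<oplus>\<^bsub>Q_module B\<^esub> y) B = (\<Sum>b\<in>B. x b + y b)"
    by (rule sum.cong) (simp_all only: Q_module_simps(2) restrict_apply' refl)
  also have "\<dots> = sum x B + sum y B" by (rule sum.distrib)
  finally show "sum (x \<oplus>\<^bsub>Q_module B\<^esub> y) B = 0"
    using Q_memD(2)[OF assms(1)] Q_memD(2)[OF assms(2)] by simp
qed (simp only: Q_module_simps(2) restrict_extensional)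

lemma Q_zero_closed: "\<zero>\<^bsub>Q_module B\<^esub> \<in> carrier (Q_module B)"
  by (rule Q_memI) (simp_all add: Q_module_simps(3) cong: sum.cong)

lemma module_Q: "module F2 (Q_module B)"
proof (rule moduleI)
  show "cring F2" by (rule cring_from_type_algebra)
  show "abelian_group (Q_module B)"
  proof (rule abelian_groupI)
    show "\<exists>y\<in>carrier (Q_module B). y \<oplus>\<^bsub>Q_module B\<^esub> x = \<zero>\<^bsub>Q_module B\<^esub>" if "x \<in> carrier (Q_module B)" for x
      using that by (intro bexI[of _ x]) (simp_all add: Q_module_simps(2,3))
    show "\<zero>\<^bsub>Q_module B\<^esub> \<oplus>\<^bsub>Q_module B\<^esub> x = x" if "x \<in> carrier (Q_module B)" for x
      by (rule Q_eqI[OF Q_add_closed[OF Q_zero_closed that] that]) (simp add: Q_module_simps(2,3))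
    show "x \<oplus>\<^bsub>Q_module B\<^esub> y = y \<oplus>\<^bsub>Q_module B\<^esub> x" for x y
      unfolding Q_module_simps(2) by (rule restrict_ext) (rule add.commute)
    show "x \<oplus>\<^bsub>Q_module B\<^esub> y \<oplus>\<^bsub>Q_module B\<^esub> z = x \<oplus>\<^bsub>Q_module B\<^esub> (y \<oplus>\<^bsub>Q_module B\<^esub> z)" for x y z
      unfolding Q_module_simps(2) by (rule restrict_ext) (simp only: restrict_apply' add.assoc)
  qed (rule Q_add_closed Q_zero_closed; assumption?)+
  have cl: "a \<odot>\<^bsub>Q_module B\<^esub> x \<in> carrier (Q_module B)" if "x \<in> carrier (Q_module B)" for a x
  proof (rule Q_memI)
    have "sum (a \<odot>\<^bsub>Q_module B\<^esub> x) B = (\<Sum>b\<in>B. a * x b)"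
      by (rule sum.cong) (simp_all only: Q_module_simps(4) restrict_apply' refl)
    also have "\<dots> = a * sum x B" by (rule sum_distrib_left[symmetric])
    finally show "sum (a \<odot>\<^bsub>Q_module B\<^esub> x) B = 0" using Q_memD(2)[OF \<open>x \<in> _\<close>] by simp
  qed (simp only: Q_module_simps(4) restrict_extensional)
  then show "a \<odot>\<^bsub>Q_module B\<^esub> x \<in> carrier (Q_module B)" if "x \<in> carrier (Q_module B)" for a x
    using that by blast
  show "\<one>\<^bsub>F2\<^esub> \<odot>\<^bsub>Q_module B\<^esub> x = x" if "x \<in> carrier (Q_module B)" for x
    by (rule Q_eqI[OF cl[OF that] that]) (simp add: Q_module_simps(4) F2_simps)
  show "(a \<oplus>\<^bsub>F2\<^esub> b) \<odot>\<^bsub>Q_module B\<^esub> x = a \<odot>\<^bsub>Q_module B\<^esub> x \<oplus>\<^bsub>Q_module B\<^esub> b \<odot>\<^bsub>Q_module B\<^esub> x" for a b x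
    unfolding Q_module_simps(2,4) F2_simps by (rule restrict_ext) (simp only: restrict_apply' distrib_right)
  show "a \<odot>\<^bsub>Q_module B\<^esub> (x \<oplus>\<^bsub>Q_module B\<^esub> y) = a \<odot>\<^bsub>Q_module B\<^esub> x \<oplus>\<^bsub>Q_module B\<^esub> a \<odot>\<^bsub>Q_module B\<^esub> y" for a x y
    unfolding Q_module_simps(2,4) by (rule restrict_ext) (simp only: restrict_apply' distrib_left)
  show "(a \<otimes>\<^bsub>F2\<^esub> b) \<odot>\<^bsub>Q_module B\<^esub> x = a \<odot>\<^bsub>Q_module B\<^esub> (b \<odot>\<^bsub>Q_module B\<^esub> x)" for a b x
    unfolding Q_module_simps(4) F2_simps by (rule restrict_ext) (simp only: restrict_apply' mult.assoc)
qed

text \<open>Over the field with two elements additive maps are linear: the scalar 0 only asks that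
  the zero vector be preserved.\<close>

lemma carrier_End_Q:
  "u \<in> carrier (End_algebra F2 (Q_module B)) \<longleftrightarrow>
    u \<in> carrier (Q_module B) \<rightarrow>\<^sub>E carrier (Q_module B) \<and>
    (\<forall>x\<in>carrier (Q_module B). \<forall>y\<in>carrier (Q_module B). u (x \<oplus>\<^bsub>Q_module B\<^esub> y) = u x \<oplus>\<^bsub>Q_module B\<^esub> u y)"
    (is "?l \<longleftrightarrow> ?r")
proof
  assume r: ?r
  interpret module F2 "Q_module B" by (rule module_Q)
  have u0: "u \<zero>\<^bsub>Q_module B\<^esub> = \<zero>\<^bsub>Q_module B\<^esub>"
  proof -
    have u: "u \<zero>\<^bsub>Q_module B\<^esub> \<in> carrier (Q_module B)" using r Q_zero_closed by blast
    have "u \<zero>\<^bsub>Q_module B\<^esub> \<oplus>\<^bsub>Q_module B\<^esub> u \<zero>\<^bsub>Q_module B\<^esub> = u \<zero>\<^bsub>Q_module B\<^esub>"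
      using r Q_zero_closed M.l_zero[OF Q_zero_closed] by metis
    then have "u \<zero>\<^bsub>Q_module B\<^esub> \<oplus>\<^bsub>Q_module B\<^esub> u \<zero>\<^bsub>Q_module B\<^esub> = u \<zero>\<^bsub>Q_module B\<^esub> \<oplus>\<^bsub>Q_module B\<^esub> \<zero>\<^bsub>Q_module B\<^esub>"
      using u by simp
    then show ?thesis by (rule M.add.l_cancel[OF _ u Q_zero_closed u])
  qed
  have "u (a \<odot>\<^bsub>Q_module B\<^esub> x) = a \<odot>\<^bsub>Q_module B\<^esub> u x" if x: "x \<in> carrier (Q_module B)" for a x
  proof -
    have ux: "u x \<in> carrier (Q_module B)" using r x by blast
    consider "a = \<zero>\<^bsub>F2\<^esub>" | "a = \<one>\<^bsub>F2\<^esub>" unfolding F2_simps by (cases a) auto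
    then show ?thesis by cases (use x ux u0 in simp_all)
  qed
  then show ?l using r by (auto simp: End_algebra_def)
qed (auto simp: End_algebra_def)

lemma monoid_End_Q: "monoid (End_algebra F2 (Q_module B))"
proof (rule monoidI; (unfold End_algebra_simps)?)
  interpret module F2 "Q_module B" by (rule module_Q)
  fix u v assume "u \<in> carrier (End_algebra F2 (Q_module B))" "v \<in> carrier (End_algebra F2 (Q_module B))"
  then have u: "u \<in> carrier (Q_module B) \<rightarrow>\<^sub>E carrier (Q_module B)" "v \<in> carrier (Q_module B) \<rightarrow>\<^sub>E carrier (Q_module B)"
    and a: "\<And>x y. x \<in> carrier (Q_module B) \<Longrightarrow> y \<in> carrier (Q_module B) \<Longrightarrow> u (x \<oplus>\<^bsub>Q_module B\<^esub> y) = u x \<oplus>\<^bsub>Q_module B\<^esub> u y"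
      "\<And>x y. x \<in> carrier (Q_module B) \<Longrightarrow> y \<in> carrier (Q_module B) \<Longrightarrow> v (x \<oplus>\<^bsub>Q_module B\<^esub> y) = v x \<oplus>\<^bsub>Q_module B\<^esub> v y"
    unfolding carrier_End_Q by blast+
  have f: "u x \<in> carrier (Q_module B)" "v x \<in> carrier (Q_module B)" if "x \<in> carrier (Q_module B)" for x
    using u that by blast+
  show "compose (carrier (Q_module B)) u v \<in> carrier (End_algebra F2 (Q_module B))"
    unfolding carrier_End_Q using f a by (auto simp: compose_def)
next
  interpret module F2 "Q_module B" by (rule module_Q)
  show "(\<lambda>x\<in>carrier (Q_module B). x) \<in> carrier (End_algebra F2 (Q_module B))"
    unfolding carrier_End_Q by auto
qed (auto simp: carrier_End_Q PiE_def compose_def intro!: extensionalityI[of _ "carrier (Q_module B)"])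

lemma Q_action_apply:
  "h \<in> carrier (Q_module B) \<Longrightarrow> b \<in> B \<Longrightarrow> Q_action B s h b = h ((inv\<^bsub>BijGroup B\<^esub> s) b)"
  by (simp add: Q_action_def)

lemma BijGroup_simps:
  "carrier (BijGroup B) = Bij B" "\<one>\<^bsub>BijGroup B\<^esub> = (\<lambda>b\<in>B. b)"
  "s \<in> Bij B \<Longrightarrow> t \<in> Bij B \<Longrightarrow> s \<otimes>\<^bsub>BijGroup B\<^esub> t = compose B s t"
  by (simp_all add: BijGroup_def)

lemma Q_action_closed:
  assumes s: "s \<in> Bij B" and h: "h \<in> carrier (Q_module B)"
  shows "Q_action B s h \<in> carrier (Q_module B)"
proof (rule Q_memI)
  let ?t = "inv\<^bsub>BijGroup B\<^esub> s"
  have "?t \<in> Bij B" using group.inv_closed[OF group_BijGroup, of s B] s by (simp add: BijGroup_simps)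
  then have t: "bij_betw ?t B B" by (simp add: Bij_def)
  have "sum (Q_action B s h) B = (\<Sum>b\<in>B. h (?t b))"
    using h by (intro sum.cong) (simp_all add: Q_action_apply)
  also have "\<dots> = sum h B" by (rule sum.reindex_bij_betw[OF t])
  finally show "sum (Q_action B s h) B = 0" using Q_memD[OF h] by simp
  show "Q_action B s h \<in> extensional B" using h by (simp add: Q_action_def)
qed

lemma Q_action_End:
  assumes s: "s \<in> Bij B"
  shows "Q_action B s \<in> carrier (End_algebra F2 (Q_module B))"
proof -
  have t: "(inv\<^bsub>BijGroup B\<^esub> s) b \<in> B" if "b \<in> B" for b
  proof -
    have "inv\<^bsub>BijGroup B\<^esub> s \<in> Bij B" using group.inv_closed[OF group_BijGroup, of s B] s by (simp add: BijGroup_simps)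
    from Bij_imp_funcset[OF this] that show ?thesis by blast
  qed
  have "Q_action B s (x \<oplus>\<^bsub>Q_module B\<^esub> y) = Q_action B s x \<oplus>\<^bsub>Q_module B\<^esub> Q_action B s y"
    if x: "x \<in> carrier (Q_module B)" "y \<in> carrier (Q_module B)" for x y
  proof (rule Q_eqI)
    fix b assume b: "b \<in> B"
    show "Q_action B s (x \<oplus>\<^bsub>Q_module B\<^esub> y) b = (Q_action B s x \<oplus>\<^bsub>Q_module B\<^esub> Q_action B s y) b"
      using Q_action_apply[OF Q_add_closed[OF x] b, of s] Q_action_apply[OF x(1) b, of s] Q_action_apply[OF x(2) b, of s] b t[OF b]
      by (simp add: Q_module_simps(2))
  qed (intro Q_action_closed Q_add_closed s x)+
  moreover have "Q_action B s \<in> extensional (carrier (Q_module B))" by (simp add: Q_action_def)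
  moreover have "Q_action B s \<in> carrier (Q_module B) \<rightarrow> carrier (Q_module B)"
    using Q_action_closed[OF s] by (rule Pi_I)
  ultimately show ?thesis unfolding carrier_End_Q PiE_def by blast
qed

lemma Q_action_mult:
  assumes s: "s \<in> Bij B" "t \<in> Bij B"
  shows "Q_action B (s \<otimes>\<^bsub>BijGroup B\<^esub> t) = Q_action B s \<otimes>\<^bsub>End_algebra F2 (Q_module B)\<^esub> Q_action B t"
proof -
  interpret Bij: group "BijGroup B" by (rule group_BijGroup)
  have c: "x \<in> Bij B \<longleftrightarrow> x \<in> carrier (BijGroup B)" for x by (simp add: BijGroup_simps)
  have st: "inv\<^bsub>BijGroup B\<^esub> s \<in> Bij B" "inv\<^bsub>BijGroup B\<^esub> t \<in> Bij B" "s \<otimes>\<^bsub>BijGroup B\<^esub> t \<in> Bij B"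
    using s unfolding c by simp_all
  have e: "inv\<^bsub>BijGroup B\<^esub> (s \<otimes>\<^bsub>BijGroup B\<^esub> t) = compose B (inv\<^bsub>BijGroup B\<^esub> t) (inv\<^bsub>BijGroup B\<^esub> s)"
    using Bij.inv_mult_group[of s t] s st by (simp add: BijGroup_simps)
  show ?thesis
  proof (rule extensionalityI[of _ "carrier (Q_module B)"])
    fix h assume h: "h \<in> carrier (Q_module B)"
    have th: "Q_action B t h \<in> carrier (Q_module B)" by (rule Q_action_closed[OF s(2) h])
    show "Q_action B (s \<otimes>\<^bsub>BijGroup B\<^esub> t) h = (Q_action B s \<otimes>\<^bsub>End_algebra F2 (Q_module B)\<^esub> Q_action B t) h"
      unfolding End_algebra_simps compose_eq[OF h]
    proof (rule Q_eqI)
      fix b assume b: "b \<in> B"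
      have "(inv\<^bsub>BijGroup B\<^esub> s) b \<in> B" using Bij_imp_funcset[OF st(1)] b by blast
      then show "Q_action B (s \<otimes>\<^bsub>BijGroup B\<^esub> t) h b = Q_action B s (Q_action B t h) b"
        by (simp add: Q_action_apply h b th e compose_eq)
    qed (intro Q_action_closed s st th h)+
  qed (simp_all add: Q_action_def End_algebra_simps compose_def)
qed

lemma Q_action_one: "Q_action B \<one>\<^bsub>BijGroup B\<^esub> = \<one>\<^bsub>End_algebra F2 (Q_module B)\<^esub>"
proof -
  interpret Bij: group "BijGroup B" by (rule group_BijGroup)
  have one: "\<one>\<^bsub>BijGroup B\<^esub> \<in> Bij B" using Bij.one_closed by (simp only: BijGroup_simps)
  show ?thesis
  proof (rule extensionalityI[of _ "carrier (Q_module B)"])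
    fix h assume h: "h \<in> carrier (Q_module B)"
    have "Q_action B \<one>\<^bsub>BijGroup B\<^esub> h = h"
    proof (rule Q_eqI[OF Q_action_closed[OF one h] h])
      fix b assume b: "b \<in> B"
      show "Q_action B \<one>\<^bsub>BijGroup B\<^esub> h b = h b"
        unfolding Q_action_apply[OF h b] Bij.inv_one using b by (simp add: BijGroup_simps)
    qed
    then show "Q_action B \<one>\<^bsub>BijGroup B\<^esub> h = \<one>\<^bsub>End_algebra F2 (Q_module B)\<^esub> h"
      using h by (simp add: End_algebra_simps)
  qed (simp_all add: Q_action_def End_algebra_simps)
qed

lemma Q_action_inv:
  assumes s: "s \<in> Bij B"
  shows "Q_action B s \<otimes>\<^bsub>End_algebra F2 (Q_module B)\<^esub> Q_action B (inv\<^bsub>BijGroup B\<^esub> s) = \<one>\<^bsub>End_algebra F2 (Q_module B)\<^esub>"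
    "Q_action B (inv\<^bsub>BijGroup B\<^esub> s) \<otimes>\<^bsub>End_algebra F2 (Q_module B)\<^esub> Q_action B s = \<one>\<^bsub>End_algebra F2 (Q_module B)\<^esub>"
proof -
  interpret Bij: group "BijGroup B" by (rule group_BijGroup)
  have s': "s \<in> carrier (BijGroup B)" using s by (simp only: BijGroup_simps)
  have i: "inv\<^bsub>BijGroup B\<^esub> s \<in> Bij B" using Bij.inv_closed[OF s'] by (simp only: BijGroup_simps)
  show "Q_action B s \<otimes>\<^bsub>End_algebra F2 (Q_module B)\<^esub> Q_action B (inv\<^bsub>BijGroup B\<^esub> s) = \<one>\<^bsub>End_algebra F2 (Q_module B)\<^esub>"
    unfolding Q_action_mult[OF s i, symmetric] Bij.r_inv[OF s'] by (rule Q_action_one)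
  show "Q_action B (inv\<^bsub>BijGroup B\<^esub> s) \<otimes>\<^bsub>End_algebra F2 (Q_module B)\<^esub> Q_action B s = \<one>\<^bsub>End_algebra F2 (Q_module B)\<^esub>"
    unfolding Q_action_mult[OF i s, symmetric] Bij.l_inv[OF s'] by (rule Q_action_one)
qed

text \<open>Stability of a subalgebra is stated with the inverse in \<open>End_algebra\<close>,
  while the permutations supply the action of the inverse; inverses in a monoid are unique.\<close>

lemma Q_action_inv_End:
  assumes s: "s \<in> Bij B"
  shows "inv\<^bsub>End_algebra F2 (Q_module B)\<^esub> (Q_action B s) = Q_action B (inv\<^bsub>BijGroup B\<^esub> s)"
proof -
  have i: "inv\<^bsub>BijGroup B\<^esub> s \<in> Bij B"
    using group.inv_closed[OF group_BijGroup, of s B] s by (simp add: BijGroup_simps)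
  show ?thesis
    by (rule monoid.inv_char[OF monoid_End_Q Q_action_End[OF s] Q_action_End[OF i] Q_action_inv[OF s]])
qed

lemma linear_representation_Q:
  assumes H: "subgroup H (BijGroup B)"
  shows "linear_representation F2 (Q_module B) ((BijGroup B)\<lparr>carrier := H\<rparr>) (Q_action B)"
proof (intro linear_representation.intro linear_representation_axioms.intro)
  show "field F2" by (rule field_from_type_algebra)
  show "module F2 (Q_module B)" by (rule module_Q)
  show "group ((BijGroup B)\<lparr>carrier := H\<rparr>)" by (rule subgroup.subgroup_is_group[OF H group_BijGroup])
  have sub: "s \<in> Bij B" if "s \<in> H" for s using subgroup.subset[OF H] that by (auto simp: BijGroup_simps)
  show "Q_action B \<in> hom ((BijGroup B)\<lparr>carrier := H\<rparr>) (Aut_group F2 (Q_module B))"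
  proof (rule homI)
    fix s assume "s \<in> carrier ((BijGroup B)\<lparr>carrier := H\<rparr>)"
    then have s: "s \<in> Bij B" using sub by simp
    then have "inv\<^bsub>BijGroup B\<^esub> s \<in> Bij B"
      using group.inv_closed[OF group_BijGroup, of s B] by (simp add: BijGroup_simps)
    then show "Q_action B s \<in> carrier (Aut_group F2 (Q_module B))"
      using Q_action_inv[OF s] Q_action_End[OF s] Q_action_End by (auto simp: units_of_def Units_def)
  next
    fix s t assume "s \<in> carrier ((BijGroup B)\<lparr>carrier := H\<rparr>)" "t \<in> carrier ((BijGroup B)\<lparr>carrier := H\<rparr>)"
    then show "Q_action B (s \<otimes>\<^bsub>(BijGroup B)\<lparr>carrier := H\<rparr>\<^esub> t)
        = Q_action B s \<otimes>\<^bsub>Aut_group F2 (Q_module B)\<^esub> Q_action B t"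
      using Q_action_mult[of s B t] sub by (simp add: units_of_def)
  qed
qed

text \<open>
  Elements of \<open>Q_module B\<close> are undefined outside \<open>B\<close>; extending them by 0 instead turns addition
  into the pointwise addition of functions.
\<close>

definition zext :: "'b set \<Rightarrow> ('b \<Rightarrow> bit) \<Rightarrow> 'b \<Rightarrow> bit"
  where "zext B h = (\<lambda>b. if b \<in> B then h b else 0)"

lemma restrict_zext: "h \<in> carrier (Q_module B) \<Longrightarrow> restrict (zext B h) B = h"
  by (rule extensionalityI[OF restrict_extensional Q_memD(1)]) (simp_all add: zext_def)

section \<open>Transport between extensional and zero-extended functions\<close>

context regular_setting
begin

text \<open>Together with \<open>restrict_op\<close> this translates operators in both directions.
  \<open>restrict_op\<close> ignores values outside \<open>V\<close>, in accordance with comparing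
  operators on \<open>V\<close> only.\<close>

definition extend_op :: "(('b \<Rightarrow> bit) \<Rightarrow> 'b \<Rightarrow> bit) \<Rightarrow> ('b \<Rightarrow> bit) \<Rightarrow> 'b \<Rightarrow> bit"
  where "extend_op u = (\<lambda>x. zext B (u (restrict x B)))"

definition restrict_op :: "(('b \<Rightarrow> bit) \<Rightarrow> 'b \<Rightarrow> bit) \<Rightarrow> ('b \<Rightarrow> bit) \<Rightarrow> 'b \<Rightarrow> bit"
  where "restrict_op f = (\<lambda>h\<in>carrier (Q_module B). restrict (f (zext B h)) B)"

lemma zext_in: "h \<in> carrier (Q_module B) \<Longrightarrow> zext B h \<in> V"
  using Q_memD(2)[of h B] by (simp add: V_def zext_def cong: sum.cong)

lemma restrict_in: "x \<in> V \<Longrightarrow> restrict x B \<in> carrier (Q_module B)"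
  by (rule Q_memI) (simp_all add: V_def cong: sum.cong)

lemma zext_restrict: "x \<in> V \<Longrightarrow> zext B (restrict x B) = x"
  by (auto simp: V_def zext_def)

lemma restrict_add: "restrict (x + y) B = restrict x B \<oplus>\<^bsub>Q_module B\<^esub> restrict y B"
  unfolding Q_module_simps(2) by (rule restrict_ext) (simp only: restrict_apply' plus_fun_apply)

lemma zext_add: "zext B (x \<oplus>\<^bsub>Q_module B\<^esub> y) = zext B x + zext B y"
proof
  fix b show "zext B (x \<oplus>\<^bsub>Q_module B\<^esub> y) b = (zext B x + zext B y) b"
    unfolding zext_def Q_module_simps(2) by (cases "b \<in> B") (simp_all only: plus_fun_apply restrict_apply' if_True if_False add_0)
qed

lemma restrict_op_in:
  assumes f: "endo f"
  shows "restrict_op f \<in> carrier (End_algebra F2 (Q_module B))"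
proof -
  have "restrict_op f \<in> carrier (Q_module B) \<rightarrow>\<^sub>E carrier (Q_module B)"
    unfolding restrict_op_def using endo_in[OF f zext_in] restrict_in by (simp add: restrict_PiE_iff)
  moreover have "restrict_op f (x \<oplus>\<^bsub>Q_module B\<^esub> y) = restrict_op f x \<oplus>\<^bsub>Q_module B\<^esub> restrict_op f y"
    if x: "x \<in> carrier (Q_module B)" "y \<in> carrier (Q_module B)" for x y
  proof -
    have "f (zext B (x \<oplus>\<^bsub>Q_module B\<^esub> y)) = f (zext B x) + f (zext B y)"
      unfolding zext_add using f zext_in[OF x(1)] zext_in[OF x(2)] by (simp only: endo_def)
    then show ?thesis unfolding restrict_op_def using x Q_add_closed[OF x] by (simp only: restrict_apply' restrict_add)
  qed
  ultimately show ?thesis unfolding carrier_End_Q by blast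
qed

lemma restrict_op_cong: "(\<And>x. x \<in> V \<Longrightarrow> f x = g x) \<Longrightarrow> restrict_op f = restrict_op g"
  unfolding restrict_op_def by (rule restrict_ext) (simp only: zext_in)

lemma restrict_op_id: "restrict_op (\<lambda>x. x) = \<one>\<^bsub>End_algebra F2 (Q_module B)\<^esub>"
  unfolding restrict_op_def End_algebra_simps by (rule restrict_ext) (rule restrict_zext)

lemma restrict_op_add: "restrict_op (\<lambda>x. f x + g x) = restrict_op f \<oplus>\<^bsub>End_algebra F2 (Q_module B)\<^esub> restrict_op g"
  unfolding restrict_op_def End_algebra_simps by (rule restrict_ext) (simp only: restrict_apply' restrict_add)

text \<open>The inner operator must preserve \<open>V\<close>, so that its value is recovered after
  truncation to B.\<close>

lemma restrict_op_comp:
  assumes f: "endo g"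
  shows "restrict_op (\<lambda>x. f (g x)) = restrict_op f \<otimes>\<^bsub>End_algebra F2 (Q_module B)\<^esub> restrict_op g"
  unfolding restrict_op_def End_algebra_simps compose_def
proof (rule restrict_ext)
  fix h assume h: "h \<in> carrier (Q_module B)"
  have g: "g (zext B h) \<in> V" by (rule endo_in[OF f zext_in[OF h]])
  show "restrict (f (g (zext B h))) B =
    (\<lambda>h\<in>carrier (Q_module B). restrict (f (zext B h)) B) ((\<lambda>h\<in>carrier (Q_module B). restrict (g (zext B h)) B) h)"
    unfolding restrict_apply'[OF h] restrict_apply'[OF restrict_in[OF g]] zext_restrict[OF g] ..
qed

lemma endo_extend_op:
  assumes u: "u \<in> carrier (End_algebra F2 (Q_module B))"
  shows "endo (extend_op u)"
  unfolding endo_def extend_op_def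
proof (intro conjI ballI)
  have u': "u h \<in> carrier (Q_module B)" if "h \<in> carrier (Q_module B)" for h
    using u that unfolding carrier_End_Q by blast
  show "zext B (u (restrict x B)) \<in> V" if "x \<in> V" for x
    by (rule zext_in[OF u'[OF restrict_in[OF that]]])
  show "zext B (u (restrict (x + y) B)) = zext B (u (restrict x B)) + zext B (u (restrict y B))"
    if "x \<in> V" "y \<in> V" for x y
  proof -
    have "u (restrict (x + y) B) = u (restrict x B) \<oplus>\<^bsub>Q_module B\<^esub> u (restrict y B)"
      unfolding restrict_add using u restrict_in[OF that(1)] restrict_in[OF that(2)] unfolding carrier_End_Q by blast
    then show ?thesis by (simp only: zext_add)
  qed
qed

lemma restrict_extend_op:
  assumes u: "u \<in> carrier (End_algebra F2 (Q_module B))"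
  shows "restrict_op (extend_op u) = u"
proof (rule extensionalityI[of _ "carrier (Q_module B)"])
  fix h assume h: "h \<in> carrier (Q_module B)"
  then have uh: "u h \<in> carrier (Q_module B)" using u unfolding carrier_End_Q by blast
  show "restrict_op (extend_op u) h = u h"
    unfolding restrict_op_def extend_op_def restrict_apply'[OF h] restrict_zext[OF h] by (rule restrict_zext[OF uh])
next
  show "u \<in> extensional (carrier (Q_module B))" using u unfolding carrier_End_Q PiE_def by blast
qed (simp add: restrict_op_def)

lemma restrict_op_act:
  assumes g: "g \<in> carrier G" and s: "s \<in> Bij B" and sg: "\<And>b. b \<in> B \<Longrightarrow> (inv\<^bsub>BijGroup B\<^esub> s) b = \<alpha> (inv g) b"
  shows "restrict_op (act g) = Q_action B s"
proof (rule extensionalityI[of _ "carrier (Q_module B)"])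
  fix h assume h: "h \<in> carrier (Q_module B)"
  show "restrict_op (act g) h = Q_action B s h"
    unfolding restrict_op_def restrict_apply'[OF h] unfolding Q_action_def restrict_apply'[OF h]
  proof (rule restrict_ext)
    fix b assume b: "b \<in> B"
    have "\<alpha> (inv g) b \<in> B" using perm_in g b by simp
    then show "act g (zext B h) b = h ((inv\<^bsub>BijGroup B\<^esub> s) b)" using b by (simp add: act_def zext_def sg)
  qed
qed (simp_all add: restrict_op_def Q_action_def)

text \<open>The zero-extended operators whose restriction lies in A form a
  \<open>stable_algebra\<close>, and its dichotomy is carried back by \<open>restrict_op\<close>.
  The map \<iota> turns the action \<alpha> into extensional permutations of B.\<close>

lemma subalgebra_cases:
  assumes A: "unital_subalgebra A F2 (Q_module B)"
    and \<iota>: "\<And>g. g \<in> carrier G \<Longrightarrow> \<iota> g \<in> Bij B" "\<And>g b. g \<in> carrier G \<Longrightarrow> b \<in> B \<Longrightarrow> \<iota> g b = \<alpha> g b"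
      "\<And>g. g \<in> carrier G \<Longrightarrow> inv\<^bsub>BijGroup B\<^esub> (\<iota> g) = \<iota> (inv g)"
    and stable: "\<And>g u. g \<in> carrier G \<Longrightarrow> u \<in> A \<Longrightarrow>
      Q_action B (\<iota> g) \<otimes>\<^bsub>End_algebra F2 (Q_module B)\<^esub> u \<otimes>\<^bsub>End_algebra F2 (Q_module B)\<^esub>
        inv\<^bsub>End_algebra F2 (Q_module B)\<^esub> (Q_action B (\<iota> g)) \<in> A"
  shows "A = {a \<odot>\<^bsub>End_algebra F2 (Q_module B)\<^esub> \<one>\<^bsub>End_algebra F2 (Q_module B)\<^esub> | a. a \<in> carrier F2} \<or>
    A = carrier (End_algebra F2 (Q_module B))"
proof -
  let ?E = "End_algebra F2 (Q_module B)"
  have sub: "subring A ?E" using A unfolding unital_subalgebra_def by (rule conjunct1)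
  have smult: "a \<odot>\<^bsub>?E\<^esub> u \<in> A" if "u \<in> A" for a u
    using A that by (simp add: unital_subalgebra_def F2_simps)
  have one_A: "\<one>\<^bsub>?E\<^esub> \<in> A" and A_sub: "A \<subseteq> carrier ?E"
    and A_mult: "u \<in> A \<Longrightarrow> v \<in> A \<Longrightarrow> u \<otimes>\<^bsub>?E\<^esub> v \<in> A" and A_add: "u \<in> A \<Longrightarrow> v \<in> A \<Longrightarrow> u \<oplus>\<^bsub>?E\<^esub> v \<in> A" for u v
    using subring.axioms[OF sub] subgroup.subset[of A "add_monoid ?E"] submonoid.one_closed[of A ?E]
      submonoid.m_closed[of A ?E u v] subgroup.m_closed[of A "add_monoid ?E" u v] by simp_all
  interpret clifford_setting G V act P T \<Phi> "ev p0" k Z by (rule clifford)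
  have endo_act: "endo (act g)" if "g \<in> carrier G" for g
    unfolding endo_def using act_in[OF that] act_add[OF that] by blast
  have restrict_op_act': "restrict_op (act g) = Q_action B (\<iota> g)" if g: "g \<in> carrier G" for g
    using \<iota> g by (intro restrict_op_act) simp_all
  define R where "R = {f. endo f \<and> restrict_op f \<in> A}"
  have R: "stable_algebra G V act P T \<Phi> (ev p0) k Z R"
  proof (intro stable_algebra.intro clifford char2_algebra.intro char2_V char2_algebra_axioms.intro stable_algebra_axioms.intro)
    show "endo r" if "r \<in> R" for r using that by (simp add: R_def)
    show "(\<lambda>x. x) \<in> R" using one_A by (simp add: R_def endo_def restrict_op_id)
    show "(\<lambda>x. r x + s x) \<in> R" if "r \<in> R" "s \<in> R" for r s
    proof -
      have e: "endo r" "endo s" using that by (simp_all add: R_def)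
      have "endo (\<lambda>x. r x + s x)"
        unfolding endo_def using e endo_in[OF e(1)] endo_in[OF e(2)] by (simp add: endo_def add_in ac_simps)
      then show ?thesis using that A_add by (simp add: R_def restrict_op_add)
    qed
    show "(\<lambda>x. r (s x)) \<in> R" if "r \<in> R" "s \<in> R" for r s
    proof -
      have e: "endo r" "endo s" using that by (simp_all add: R_def)
      have "endo (\<lambda>x. r (s x))" using e by (simp add: endo_def)
      then show ?thesis using that A_mult by (simp add: R_def restrict_op_comp)
    qed
    show "\<exists>r'\<in>R. \<forall>x\<in>V. r' x = act g (r (act (inv g) x))" if g: "g \<in> carrier G" and r: "r \<in> R" for g r
    proof -
      have ig: "inv g \<in> carrier G" using g by simp
      have er: "endo r" and rA: "restrict_op r \<in> A" using r by (simp_all add: R_def)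
      note e = endo_act[OF g] endo_act[OF ig] er
      have e1: "endo (\<lambda>x. r (act (inv g) x))" using e(2,3) unfolding endo_def by simp
      then have "endo (\<lambda>x. act g (r (act (inv g) x)))" using e(1) unfolding endo_def by simp
      moreover have "restrict_op (\<lambda>x. act g (r (act (inv g) x))) \<in> A"
      proof -
        have "restrict_op (\<lambda>x. act g (r (act (inv g) x)))
            = Q_action B (\<iota> g) \<otimes>\<^bsub>?E\<^esub> (restrict_op r \<otimes>\<^bsub>?E\<^esub> Q_action B (\<iota> (inv g)))"
          unfolding restrict_op_comp[OF e1] restrict_op_comp[OF e(2)] restrict_op_act'[OF g] restrict_op_act'[OF ig] ..
        also have "\<dots> = Q_action B (\<iota> g) \<otimes>\<^bsub>?E\<^esub> restrict_op r \<otimes>\<^bsub>?E\<^esub> Q_action B (\<iota> (inv g))"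
          by (rule monoid.m_assoc[OF monoid_End_Q Q_action_End[OF \<iota>(1)[OF g]] restrict_op_in[OF er] Q_action_End[OF \<iota>(1)[OF ig]], symmetric])
        finally show ?thesis using stable[OF g rA] Q_action_inv_End[OF \<iota>(1)[OF g]] \<iota>(3)[OF g] by simp
      qed
      ultimately have "(\<lambda>x. act g (r (act (inv g) x))) \<in> R" unfolding R_def by (intro CollectI conjI)
      then show ?thesis by (rule bexI[rotated]) simp
    qed
  qed
  have extend_op_R: "extend_op u \<in> R" if u: "u \<in> A" for u
  proof -
    have uE: "u \<in> carrier ?E" by (rule subsetD[OF A_sub u])
    show ?thesis using endo_extend_op[OF uE] restrict_extend_op[OF uE] u by (simp add: R_def)
  qed
  from stable_algebra.very_simple_dichotomy[OF R] show ?thesis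
  proof
    assume triv: "\<forall>r\<in>R. (\<forall>x\<in>V. r x = 0) \<or> (\<forall>x\<in>V. r x = x)"
    interpret module F2 "Q_module B" by (rule module_Q)
    have s1: "1 \<odot>\<^bsub>?E\<^esub> \<one>\<^bsub>?E\<^esub> = \<one>\<^bsub>?E\<^esub>"
      unfolding End_algebra_simps by (rule restrict_ext) (use smult_one in \<open>simp add: F2_simps\<close>)
    have s0: "0 \<odot>\<^bsub>?E\<^esub> \<one>\<^bsub>?E\<^esub> = restrict_op (\<lambda>x. 0)"
      unfolding End_algebra_simps restrict_op_def by (rule restrict_ext) (simp add: Q_module_simps(4) restrict_def fun_eq_iff)
    have "u \<in> {a \<odot>\<^bsub>?E\<^esub> \<one>\<^bsub>?E\<^esub> | a. a \<in> carrier F2}" if u: "u \<in> A" for u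
    proof -
      have uE: "u \<in> carrier ?E" by (rule subsetD[OF A_sub u])
      from triv extend_op_R[OF u] consider "\<forall>x\<in>V. extend_op u x = 0" | "\<forall>x\<in>V. extend_op u x = x" by blast
      then have "u = 0 \<odot>\<^bsub>?E\<^esub> \<one>\<^bsub>?E\<^esub> \<or> u = 1 \<odot>\<^bsub>?E\<^esub> \<one>\<^bsub>?E\<^esub>"
      proof cases
        case 1
        then have "restrict_op (extend_op u) = restrict_op (\<lambda>x. 0)" by (intro restrict_op_cong) simp
        then show ?thesis using s0 restrict_extend_op[OF uE] by simp
      next
        case 2
        then have "restrict_op (extend_op u) = restrict_op (\<lambda>x. x)" by (intro restrict_op_cong) simp
        then show ?thesis using s1 restrict_op_id restrict_extend_op[OF uE] by simp
      qed
      then show ?thesis unfolding F2_simps by (elim disjE) (rule CollectI, intro exI conjI UNIV_I, assumption)+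
    qed
    moreover have "{a \<odot>\<^bsub>?E\<^esub> \<one>\<^bsub>?E\<^esub> | a. a \<in> carrier F2} \<subseteq> A"
      by (rule subsetI, elim CollectE exE conjE) (simp only: smult[OF one_A])
    ultimately show ?thesis by (intro disjI1 equalityI subsetI) (simp_all only: subsetD)
  next
    assume full: "\<forall>f. endo f \<longrightarrow> (\<exists>r\<in>R. \<forall>x\<in>V. r x = f x)"
    have "u \<in> A" if u: "u \<in> carrier ?E" for u
    proof -
      obtain r where r: "r \<in> R" "\<forall>x\<in>V. r x = extend_op u x" using full endo_extend_op[OF u] by blast
      have "restrict_op r = restrict_op (extend_op u)" using r(2) by (intro restrict_op_cong) simp
      then show ?thesis using r(1) restrict_extend_op[OF u] by (simp add: R_def)
    qed
    then show ?thesis by (intro disjI2 equalityI A_sub subsetI)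
  qed
qed

end

text \<open>Stability under L includes stability under the image of \<open>G\<close>, so the
  conclusion passes to the larger group. A nontrivial homomorphism in place of an embedding lets a
  quotient of \<open>G\<close>, such as PSL2, be the group that sits in L.\<close>

theorem (in zassenhaus_type) very_simple_Q:
  assumes B: "finite B" "card B = card P + 1" and L: "subgroup L (BijGroup B)"
    and \<iota>: "\<iota> \<in> hom G ((BijGroup B)\<lparr>carrier := L\<rparr>)" and g1: "g1 \<in> carrier G" "\<iota> g1 \<noteq> \<one>\<^bsub>BijGroup B\<^esub>"
  shows "very_simple_module F2 (Q_module B) ((BijGroup B)\<lparr>carrier := L\<rparr>) (Q_action B)"
proof -
  interpret Bij: group "BijGroup B" by (rule group_BijGroup)
  have H_sub: "L \<subseteq> Bij B" using subgroup.subset[OF L] by (simp add: BijGroup_simps)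
  have \<iota>L: "\<iota> g \<in> L" if "g \<in> carrier G" for g using hom_in_carrier[OF \<iota> that] by simp
  have \<iota>B: "\<iota> g \<in> Bij B" if "g \<in> carrier G" for g using \<iota>L[OF that] H_sub by blast
  have "\<iota> \<in> hom G (BijGroup B)"
    using \<iota> H_sub unfolding hom_def by (auto simp: BijGroup_simps)
  then interpret \<iota>: group_hom G "BijGroup B" \<iota>
    by (intro group_hom.intro group_hom_axioms.intro is_group group_BijGroup)
  have one: "\<iota> \<one> b = b" if "b \<in> B" for b using \<iota>.hom_one that by (simp add: BijGroup_simps)
  have mult: "\<iota> (g \<otimes> h) b = \<iota> g (\<iota> h b)" if "g \<in> carrier G" "h \<in> carrier G" "b \<in> B" for g h b
    using \<iota>.hom_mult[OF that(1,2)] that \<iota>B by (simp add: BijGroup_simps compose_eq)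
  have perm: "\<iota> g b \<in> B" if "g \<in> carrier G" "b \<in> B" for g b
    using Bij_imp_funcset[OF \<iota>B[OF that(1)]] that(2) by blast
  obtain b1 where b1: "b1 \<in> B" "\<iota> g1 b1 \<noteq> b1"
  proof (rule ccontr)
    assume n: "\<not> thesis"
    have "\<iota> g1 = (\<lambda>b\<in>B. b)"
    proof (rule extensionalityI[OF Bij_imp_extensional[OF \<iota>B[OF g1(1)]] restrict_extensional])
      show "\<iota> g1 x = (\<lambda>b\<in>B. b) x" if "x \<in> B" for x using n \<open>\<And>b1. b1 \<in> B \<Longrightarrow> _ b1 \<Longrightarrow> thesis\<close> \<open>x \<in> B\<close> by auto
    qed
    then show False using g1(2) by (simp add: BijGroup_simps)
  qed
  obtain p0 where p0: "regular_setting G B \<iota> P T Phi Z k p0"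
    using action_regular[OF B perm one mult g1(1) b1] by blast
  interpret R: regular_setting G B \<iota> P T Phi Z k p0 by (rule p0)
  show ?thesis
  proof (intro very_simple_module.intro very_simple_module_axioms.intro linear_representation_Q L)
    fix A assume A: "unital_subalgebra A F2 (Q_module B)"
      and st: "\<And>\<sigma> u. \<sigma> \<in> carrier ((BijGroup B)\<lparr>carrier := L\<rparr>) \<Longrightarrow> u \<in> A \<Longrightarrow>
        Q_action B \<sigma> \<otimes>\<^bsub>End_algebra F2 (Q_module B)\<^esub> u \<otimes>\<^bsub>End_algebra F2 (Q_module B)\<^esub>
          inv\<^bsub>End_algebra F2 (Q_module B)\<^esub> (Q_action B \<sigma>) \<in> A"
    show "A = {a \<odot>\<^bsub>End_algebra F2 (Q_module B)\<^esub> \<one>\<^bsub>End_algebra F2 (Q_module B)\<^esub> | a. a \<in> carrier F2} \<or>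
      A = carrier (End_algebra F2 (Q_module B))"
    proof (rule R.subalgebra_cases[OF A \<iota>B refl])
      show "inv\<^bsub>BijGroup B\<^esub> \<iota> g = \<iota> (inv g)" if "g \<in> carrier G" for g using \<iota>.hom_inv[OF that] by simp
      show "Q_action B (\<iota> g) \<otimes>\<^bsub>End_algebra F2 (Q_module B)\<^esub> u \<otimes>\<^bsub>End_algebra F2 (Q_module B)\<^esub>
          inv\<^bsub>End_algebra F2 (Q_module B)\<^esub> (Q_action B (\<iota> g)) \<in> A" if "g \<in> carrier G" "u \<in> A" for g u
        by (rule st[OF _ that(2)]) (simp add: \<iota>L that(1))
    qed
  qed
qed

lemma suzuki_field_GF:
  assumes "k > 0"
  shows "suzuki_field (GF (2 ^ (2 * k + 1))) (2 ^ (2 * k + 1)) (\<lambda>x. x ^ 2 ^ (k + 1))"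
proof (rule suzuki_field.intro[OF char2_field_GF], unfold_locales)
  show "3 \<le> 2 * k + 1" using assms by simp
  show "(x + y) ^ 2 ^ (k + 1) = x ^ 2 ^ (k + 1) + y ^ 2 ^ (k + 1)" for x y :: "bit alg_closure"
    by (rule power_2_power_add[OF alg_closure_two])
  show "(x * y) ^ 2 ^ (k + 1) = x ^ 2 ^ (k + 1) * y ^ 2 ^ (k + 1)" for x y :: "bit alg_closure"
    by (rule power_mult_distrib)
  show "x ^ 2 ^ (k + 1) \<in> GF (2 ^ (2 * k + 1))" if "x \<in> GF (2 ^ (2 * k + 1))" for x
  proof -
    have "(x ^ 2 ^ (k + 1)) ^ 2 ^ (2 * k + 1) = (x ^ 2 ^ (2 * k + 1)) ^ 2 ^ (k + 1)"
      by (simp only: power_mult[symmetric] mult.commute)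
    then show ?thesis using that by (simp only: GF_def mem_Collect_eq)
  qed
  show "(x ^ 2 ^ (k + 1)) ^ 2 ^ (k + 1) = x * x" if "x \<in> GF (2 ^ (2 * k + 1))" for x
  proof -
    \<comment> \<open>Applying the power map twice raises x to twice the field size, and x to the
      field size is x.\<close>
    have e: "(2 :: nat) ^ (k + 1) * 2 ^ (k + 1) = 2 ^ (2 * k + 1) * 2"
      unfolding power_add[symmetric] power_Suc2[symmetric] by (rule arg_cong[where f = "power 2"]) simp
    have "(x ^ 2 ^ (k + 1)) ^ 2 ^ (k + 1) = (x ^ 2 ^ (2 * k + 1)) ^ 2"
      by (simp only: power_mult[symmetric] e)
    then show ?thesis using that by (simp only: GF_def mem_Collect_eq power2_eq_square)
  qed
qed

text \<open>The diagonal generators match because \<open>n = l ^ 2 ^ k\<close> is inverse to \<open>l = \<theta> n\<close>.\<close>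

lemma Suzuki_eq:
  assumes k: "k > 0"
  shows "Suzuki k = suzuki_field.GS (GF (2 ^ (2 * k + 1))) (\<lambda>x. x ^ 2 ^ (k + 1))"
proof -
  let ?q = "2 ^ (2 * k + 1) :: nat"
  define th :: "bit alg_closure \<Rightarrow> bit alg_closure" where "th = (\<lambda>x. x ^ 2 ^ (k + 1))"
  interpret suzuki_field "GF ?q" ?q th unfolding th_def by (rule suzuki_field_GF[OF k])
  have S: "Sz_S k a b = sS a b" for a b
    unfolding Sz_S_def sS_def Let_def power2_eq_square unfolding th_def ..
  have thk: "th (l ^ 2 ^ k) = l" if "l \<in> GF ?q" for l
  proof -
    have e: "(2 :: nat) ^ k * 2 ^ (k + 1) = ?q" unfolding power_add[symmetric] by (simp add: mult_2)
    have "th (l ^ 2 ^ k) = l ^ ?q" unfolding th_def power_mult[symmetric] e ..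
    then show ?thesis using that by (simp only: GF_def mem_Collect_eq)
  qed
  have M: "Sz_M k l = sD (l ^ 2 ^ k)" if l: "l \<in> GF ?q" for l
    unfolding Sz_M_def sD_def thk[OF l] by (simp add: power_add power_inverse ac_simps)
  have "{Sz_M k l | l. l \<in> GF ?q - {0}} = TS"
  proof (intro equalityI subsetI)
    fix x assume "x \<in> {Sz_M k l | l. l \<in> GF ?q - {0}}"
    then obtain l where l: "l \<in> GF ?q" "l \<noteq> 0" "x = Sz_M k l" by blast
    show "x \<in> TS" unfolding l(3) M[OF l(1)] by (rule TS_I[OF K_power[OF l(1)]]) (use l(2) in simp)
  next
    fix x assume "x \<in> TS"
    then obtain n where n: "n \<in> GF ?q" "n \<noteq> 0" "x = sD n" by (rule TS_E)
    have "(th n) ^ 2 ^ k = th (n ^ 2 ^ k)" unfolding th_def by (simp only: power_mult[symmetric] mult.commute)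
    then have "x = Sz_M k (th n)" unfolding M[OF th_in[OF n(1)]] using thk[OF n(1)] n(3) by simp
    moreover have "th n \<in> GF ?q - {0}" using th_in[OF n(1)] th_eq_0[OF n(1)] n(2) by simp
    ultimately show "x \<in> {Sz_M k l | l. l \<in> GF ?q - {0}}" by blast
  qed
  moreover have "{Sz_S k a b | a b. a \<in> GF ?q \<and> b \<in> GF ?q} = PS" unfolding S PS_def ..
  moreover have "Sz_T = sW" unfolding Sz_T_def sW_def ..
  ultimately have "Suzuki k = GS" unfolding Suzuki_def Let_def GS_def by (simp only:)
  then show ?thesis by (simp only: th_def)
qed

text \<open>The isomorphism is reversed, so that the concrete matrix group acts on B through an
  embedding.\<close>

lemma contains_copyE:
  assumes "contains_copy ((BijGroup B)\<lparr>carrier := H\<rparr>) K" and H: "subgroup H (BijGroup B)" and K: "group K"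
  obtains \<iota> where "\<iota> \<in> hom K ((BijGroup B)\<lparr>carrier := H\<rparr>)" "inj_on \<iota> (carrier K)"
proof -
  have gH: "group ((BijGroup B)\<lparr>carrier := H\<rparr>)" by (rule subgroup.subgroup_is_group[OF H group_BijGroup])
  obtain S where S: "subgroup S ((BijGroup B)\<lparr>carrier := H\<rparr>)" "(BijGroup B)\<lparr>carrier := H\<rparr>\<lparr>carrier := S\<rparr> \<cong> K"
    using assms(1) unfolding contains_copy_def by blast
  have "K \<cong> (BijGroup B)\<lparr>carrier := H\<rparr>\<lparr>carrier := S\<rparr>"
    by (rule group.iso_sym[OF subgroup.subgroup_is_group[OF S(1) gH] S(2)])
  then obtain \<iota> where \<iota>: "\<iota> \<in> iso K ((BijGroup B)\<lparr>carrier := S\<rparr>)" unfolding is_iso_def by auto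
  have "S \<subseteq> H" using subgroup.subset[OF S(1)] by simp
  then have "\<iota> \<in> hom K ((BijGroup B)\<lparr>carrier := H\<rparr>)" using \<iota> unfolding iso_def hom_def by auto
  moreover have "inj_on \<iota> (carrier K)" using \<iota> unfolding iso_def bij_betw_def by blast
  ultimately show ?thesis by (rule that)
qed

lemma (in group) group_center_normal:
  "group_center G \<lhd> G"
proof -
  have sub: "subgroup (group_center G) G"
  proof (rule subgroupI)
    fix a assume a: "a \<in> group_center G"
    then have aG: "a \<in> carrier G" by (simp add: group_center_def)
    have "inv a \<otimes> x = x \<otimes> inv a" if x: "x \<in> carrier G" for x
    proof -
      have "a \<otimes> inv x = inv x \<otimes> a" using a x by (simp add: group_center_def)
      then have "inv (a \<otimes> inv x) = inv (inv x \<otimes> a)" by simp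
      then show ?thesis using aG x by (simp add: inv_mult_group)
    qed
    then show "inv a \<in> group_center G" using aG by (simp add: group_center_def)
  next
    fix a b assume ab: "a \<in> group_center G" "b \<in> group_center G"
    then have c: "a \<in> carrier G" "b \<in> carrier G" by (simp_all add: group_center_def)
    have "a \<otimes> b \<otimes> x = x \<otimes> (a \<otimes> b)" if x: "x \<in> carrier G" for x
    proof -
      have e: "a \<otimes> x = x \<otimes> a" "b \<otimes> x = x \<otimes> b" using ab x by (simp_all add: group_center_def)
      have "a \<otimes> b \<otimes> x = a \<otimes> (x \<otimes> b)" unfolding m_assoc[OF c x] e(2) ..
      also have "\<dots> = x \<otimes> a \<otimes> b" unfolding m_assoc[OF c(1) x c(2), symmetric] e(1) ..
      also have "\<dots> = x \<otimes> (a \<otimes> b)" by (rule m_assoc[OF x c])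
      finally show ?thesis .
    qed
    then show "a \<otimes> b \<in> group_center G" using c by (simp add: group_center_def)
  qed (auto simp: group_center_def)
  show ?thesis
  proof (rule normal_invI[OF sub])
    fix x h assume *: "x \<in> carrier G" "h \<in> group_center G"
    then have h: "h \<in> carrier G" "h \<otimes> x = x \<otimes> h" by (simp_all add: group_center_def)
    have "x \<otimes> h \<otimes> inv x = h" unfolding h(2)[symmetric] using h(1) *(1) by (simp add: m_assoc)
    then show "x \<otimes> h \<otimes> inv x \<in> group_center G" using * by simp
  qed
qed

theorem theorem5p4:
  fixes n :: nat and B :: "'b set" and H :: "('b \<Rightarrow> 'b) set"
  assumes "n > 0" and "finite B" and "card B = n"
    and "subgroup H (BijGroup B)"
    and "(\<exists>m::nat. n = 2 ^ m + 1 \<and> n \<ge> 9 \<and>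
            contains_copy ((BijGroup B)\<lparr>carrier := H\<rparr>) (PSL2 (GF (2 ^ m)))) \<or>
         (\<exists>k::nat. k > 0 \<and> n = 2 ^ (2 * (2 * k + 1)) + 1 \<and>
            contains_copy ((BijGroup B)\<lparr>carrier := H\<rparr>) (Suzuki k))"
  shows "very_simple_module F2 (Q_module B) ((BijGroup B)\<lparr>carrier := H\<rparr>) (Q_action B)"
  using assms(5)
proof (elim disjE exE conjE)
  fix m assume n: "n = 2 ^ m + 1" "n \<ge> 9" and c: "contains_copy ((BijGroup B)\<lparr>carrier := H\<rparr>) (PSL2 (GF (2 ^ m)))"
  \<comment> \<open>The bound n \<ge> 9 amounts to a field with at least eight elements.\<close>
  have m: "3 \<le> m"
  proof (rule ccontr)
    assume "\<not> 3 \<le> m"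
    then have "m \<le> 2" by simp
    then have "(2 :: nat) ^ m \<le> 2 ^ 2" by (rule power_increasing) simp
    then show False using n by simp
  qed
  interpret char2_field "GF (2 ^ m)" "2 ^ m" by (rule char2_field_GF[OF m])
  let ?G = "SL2 (GF (2 ^ m)) :: bit alg_closure mat monoid"
  let ?C = "group_center ?G"
  interpret Z: zassenhaus_type ?G "lower2 ` GF (2 ^ m)" "lower2 ` GF (2 ^ m)" "diag2 ` (GF (2 ^ m) - {0})"
    flip2 "lower2 1" "lower2 1" m by (rule zassenhaus_SL2[OF refl])
  interpret N: normal ?C ?G by (rule group.group_center_normal[OF group_SL2])
  obtain \<iota> where \<iota>: "\<iota> \<in> hom (?G Mod ?C) ((BijGroup B)\<lparr>carrier := H\<rparr>)" "inj_on \<iota> (carrier (?G Mod ?C))"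
    using contains_copyE[OF c[unfolded PSL2_def] assms(4) N.factorgroup_is_group] by blast
  \<comment> \<open>The action of the quotient is pulled back to SL2, where the subgroups
    \<open>P\<close> and \<open>T\<close> are matrices.\<close>
  have hom: "(\<lambda>g. \<iota> (?C #>\<^bsub>?G\<^esub> g)) \<in> hom ?G ((BijGroup B)\<lparr>carrier := H\<rparr>)"
    using hom_compose[OF N.r_coset_hom_Mod \<iota>(1)] by (simp add: comp_def)
  interpret \<iota>: group_hom "?G Mod ?C" "(BijGroup B)\<lparr>carrier := H\<rparr>" \<iota>
    by (intro group_hom.intro group_hom_axioms.intro \<iota>(1) N.factorgroup_is_group
        subgroup.subgroup_is_group[OF assms(4) group_BijGroup])
  have f: "flip2 \<in> carrier ?G" by (rule Z.w(1))
  have l: "lower2 1 \<in> carrier ?G" using Z.P subgroup.subset K_1 by blast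
  \<comment> \<open>One noncommuting pair shows that \<open>flip2\<close> survives in the quotient
    by the centre, which makes the action nontrivial.\<close>
  have "flip2 * lower2 1 \<noteq> lower2 1 * (flip2 :: bit alg_closure mat)" unfolding mat2_simps by simp
  then have "flip2 \<notin> ?C"
    unfolding group_center_def SL2_simps using l by (intro notI) (elim CollectE conjE, drule (1) bspec, simp only: not_True_eq_False simp_thms)
  then have "?C #>\<^bsub>?G\<^esub> flip2 \<noteq> ?C" using Z.coset_join1[OF _ f N.subgroup_axioms] by (rule contrapos_nn)
  then have ne: "?C #>\<^bsub>?G\<^esub> flip2 \<noteq> \<one>\<^bsub>?G Mod ?C\<^esub>" by (simp only: FactGroup_def monoid.simps not_False_eq_True)
  have *: "?C #>\<^bsub>?G\<^esub> flip2 \<in> carrier (?G Mod ?C)"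
    unfolding FactGroup_def partial_object.simps using Z.rcosetsI[OF N.subset f] .
  have "\<iota> (?C #>\<^bsub>?G\<^esub> flip2) \<noteq> \<one>\<^bsub>(BijGroup B)\<lparr>carrier := H\<rparr>\<^esub>"
    unfolding \<iota>.hom_one[symmetric] using ne by (rule contrapos_nn) (rule inj_onD[OF \<iota>(2) _ * \<iota>.G.one_closed])
  then have nt: "\<iota> (?C #>\<^bsub>?G\<^esub> flip2) \<noteq> \<one>\<^bsub>BijGroup B\<^esub>" by simp
  have "card B = card (lower2 ` GF (2 ^ m) :: bit alg_closure mat set) + 1"
    using assms(3) n(1) Z.card_P by simp
  from Z.very_simple_Q[OF assms(2) this assms(4) hom f nt] show ?thesis .
next
  fix k assume k: "k > 0" and n: "n = 2 ^ (2 * (2 * k + 1)) + 1" and c: "contains_copy ((BijGroup B)\<lparr>carrier := H\<rparr>) (Suzuki k)"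
  interpret suzuki_field "GF (2 ^ (2 * k + 1))" "2 ^ (2 * k + 1)" "\<lambda>x. x ^ 2 ^ (k + 1)"
    by (rule suzuki_field_GF[OF k])
  interpret Z: zassenhaus_type GS PS ZS TS sW "sS 1 1" "sS 0 1" "2 * (2 * k + 1)"
    by (rule zassenhaus_GS[OF refl])
  obtain \<iota> where \<iota>: "\<iota> \<in> hom GS ((BijGroup B)\<lparr>carrier := H\<rparr>)" "inj_on \<iota> (carrier GS)"
    using contains_copyE[OF c[unfolded Suzuki_eq[OF k]] assms(4) group_GS] by blast
  interpret \<iota>: group_hom GS "(BijGroup B)\<lparr>carrier := H\<rparr>" \<iota>
    by (intro group_hom.intro group_hom_axioms.intro \<iota>(1) group_GS
        subgroup.subgroup_is_group[OF assms(4) group_BijGroup])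
  have f: "sW \<in> carrier GS" by (rule Z.w(1))
  have "sW \<noteq> \<one>\<^bsub>GS\<^esub>" unfolding GS_simps mat4_simps by simp
  then have "\<iota> sW \<noteq> \<one>\<^bsub>(BijGroup B)\<lparr>carrier := H\<rparr>\<^esub>"
    unfolding \<iota>.hom_one[symmetric] by (rule contrapos_nn) (rule inj_onD[OF \<iota>(2) _ f Z.one_closed])
  then have nt: "\<iota> sW \<noteq> \<one>\<^bsub>BijGroup B\<^esub>" by simp
  have "card B = card PS + 1" using assms(3) n Z.card_P by simp
  from Z.very_simple_Q[OF assms(2) this assms(4) \<iota>(1) f nt] show ?thesis .
qed

end
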